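(* Let $\mathcal P_0(S_n')$ be the set of subsets $I\subset S_n'$ with $I=\langle I\rangle\cap S_n'$. Then $\Sigma'(W_n)=\bigoplus_{I\in\mathcal P_0(S_n')}\mathbb Z x_I$ is a subalgebra of $\mathbb Z W_n$, and the $\mathbb Z$-linear map $\theta_n:\Sigma'(W_n)\to\mathbb Z\,\mathrm{Irr}\,W_n$, $x_I\mapsto \mathrm{Ind}_{W_I}^{W_n}1$, is a surjective morphism of algebras. Moreover, $\ker\theta_n=\sum_{I\equiv I'}\mathbb Z(x_I-x_{I'})$, and $\mathbb Q\otimes_{\mathbb Z}\ker\theta_n$ is the radical of the $\mathbb Q$-algebra $\mathbb Q\otimes_{\mathbb Z}\Sigma'(W_n)$.
   Context: Let $(W_n,S_n)$ be the Coxeter system of type $C_n$, $S_n=\{t,s_1,\dots,s_{n-1}\}$, with Dynkin diagram $t = s_1 - s_2 - \cdots - s_{n-1}$ (double bond between $t$ and $s_1$), and let $\ell$ be its length function. Put $t_1=t$, $t_i=s_{i-1}t_{i-1}s_{i-1}$ for $2\le i\le n$, and $S_n'=S_n\cup\{t_1,\dots,t_n\}$. For $I\in\mathcal P_0(S_n')$ let $W_I=\langle I\rangle$ be the subgroup generated by $I$, $X_I=\{w\in W_n : \forall s\in I,\ \ell(ws)>\ell(w)\}$, and $x_I=\sum_{w\in X_I}w\in\mathbb Z W_n$. $\mathbb Z\,\mathrm{Irr}\,W_n$ is the ring of virtual (complex) characters of $W_n$ with pointwise product. For $I,I'\in\mathcal P_0(S_n')$, $I\equiv I'$ means that there is $w\in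 W_n$ with $I'=wIw^{-1}$ (i.e. $W_I$ and $W_{I'}$ are conjugate in $W_n$). *)

theory Defs
  imports "HOL-Algebra.Subrings" "HOL-Algebra.Generated_Groups" "Jordan_Normal_Form.VS_Connect"
begin

section \<open>Coxeter systems\<close>

definition word_prod :: "('a, 'm) monoid_scheme \<Rightarrow> ('i \<Rightarrow> 'a) \<Rightarrow> 'i list \<Rightarrow> 'a" where
  "word_prod G s us = foldr (\<lambda>i x. s i \<otimes>\<^bsub>G\<^esub> x) us \<one>\<^bsub>G\<^esub>"

text \<open>The monoid congruence on words over \<open>J\<close> generated by \<open>(i j)\<^sup>m\<^sup>i\<^sup>j = 1\<close>. When \<open>m i i = 1\<close>
  the letters are involutions modulo the congruence, so that the monoid of classes is the group
  presented by these relations. An entry \<open>m i j = 0\<close> imposes no relation (order \<open>\<infinity>\<close>).\<close>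

inductive coxeter_cong :: "'i set \<Rightarrow> ('i \<Rightarrow> 'i \<Rightarrow> nat) \<Rightarrow> 'i list \<Rightarrow> 'i list \<Rightarrow> bool"
  for J :: "'i set" and m :: "'i \<Rightarrow> 'i \<Rightarrow> nat" where
  rel: "i \<in> J \<Longrightarrow> j \<in> J \<Longrightarrow> us \<in> lists J \<Longrightarrow> vs \<in> lists J \<Longrightarrow>
      coxeter_cong J m (us @ concat (replicate (m i j) [i, j]) @ vs) (us @ vs)"
| refl: "us \<in> lists J \<Longrightarrow> coxeter_cong J m us us"
| sym: "coxeter_cong J m us vs \<Longrightarrow> coxeter_cong J m vs us"
| trans: "coxeter_cong J m us vs \<Longrightarrow> coxeter_cong J m vs ws \<Longrightarrow> coxeter_cong J m us ws"

text \<open>\<open>G\<close> is generated by the \<open>s i\<close>, \<open>i \<in> J\<close>, and the \<open>(s i s j)\<^sup>m\<^sup>i\<^sup>j = 1\<close> are defining relations.\<close>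

definition coxeter_system ::
  "('a, 'm) monoid_scheme \<Rightarrow> 'i set \<Rightarrow> ('i \<Rightarrow> 'i \<Rightarrow> nat) \<Rightarrow> ('i \<Rightarrow> 'a) \<Rightarrow> bool" where
  "coxeter_system G J m s \<longleftrightarrow>
     group G \<and> s ` J \<subseteq> carrier G \<and> generate G (s ` J) = carrier G \<and>
     (\<forall>us \<in> lists J. \<forall>vs \<in> lists J.
        word_prod G s us = word_prod G s vs \<longleftrightarrow> coxeter_cong J m us vs)"

definition coxeter_length :: "('a, 'm) monoid_scheme \<Rightarrow> 'i set \<Rightarrow> ('i \<Rightarrow> 'a) \<Rightarrow> 'a \<Rightarrow> nat" where
  "coxeter_length G J s w = (LEAST k. \<exists>us \<in> lists J. length us = k \<and> word_prod G s us = w)"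

text \<open>The Coxeter matrix of the diagram \<open>t = s\<^sub>1 - s\<^sub>2 - \<dots> - s\<^sub>n\<^sub>-\<^sub>1\<close> on \<open>{..<n}\<close>:
  index \<open>0\<close> stands for \<open>t\<close> and index \<open>i \<ge> 1\<close> for \<open>s\<^sub>i\<close>.\<close>

definition type_C :: "nat \<Rightarrow> nat \<Rightarrow> nat" where
  "type_C i j =
    (if i = j then 1
     else if {i, j} = {0, 1} then 4
     else if j = Suc i \<or> i = Suc j then 3
     else 2)"

section \<open>The generators of the generalized descent algebra\<close>

text \<open>Index shift: \<open>t_refl G s i\<close> is \<open>t\<^sub>i\<^sub>+\<^sub>1\<close>.\<close>

primrec t_refl :: "('a, 'm) monoid_scheme \<Rightarrow> (nat \<Rightarrow> 'a) \<Rightarrow> nat \<Rightarrow> 'a" where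
  "t_refl G s 0 = s 0"
| "t_refl G s (Suc i) = s (Suc i) \<otimes>\<^bsub>G\<^esub> t_refl G s i \<otimes>\<^bsub>G\<^esub> s (Suc i)"

definition S_ext :: "('a, 'm) monoid_scheme \<Rightarrow> nat \<Rightarrow> (nat \<Rightarrow> 'a) \<Rightarrow> 'a set" where
  "S_ext G n s = s ` {..<n} \<union> t_refl G s ` {..<n}"

definition P0 :: "('a, 'm) monoid_scheme \<Rightarrow> nat \<Rightarrow> (nat \<Rightarrow> 'a) \<Rightarrow> 'a set set" where
  "P0 G n s = {I. I \<subseteq> S_ext G n s \<and> I = generate G I \<inter> S_ext G n s}"

definition X_set :: "('a, 'm) monoid_scheme \<Rightarrow> nat \<Rightarrow> (nat \<Rightarrow> 'a) \<Rightarrow> 'a set \<Rightarrow> 'a set" where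
  "X_set G n s I =
    {w \<in> carrier G. \<forall>r \<in> I.
       coxeter_length G {..<n} s (w \<otimes>\<^bsub>G\<^esub> r) > coxeter_length G {..<n} s w}"

definition conj_sets :: "('a, 'm) monoid_scheme \<Rightarrow> 'a set \<Rightarrow> 'a set \<Rightarrow> bool" where
  "conj_sets G I I' \<longleftrightarrow> (\<exists>w \<in> carrier G. I' = (\<lambda>r. w \<otimes>\<^bsub>G\<^esub> r \<otimes>\<^bsub>G\<^esub> inv\<^bsub>G\<^esub> w) ` I)"

section \<open>Group algebras\<close>

text \<open>A function \<open>f\<close> stands for the formal sum of the \<open>f w \<cdot> w\<close>; multiplication is convolution.\<close>

definition group_ring :: "('a, 'm) monoid_scheme \<Rightarrow> ('a \<Rightarrow> 'r::comm_ring_1) ring" where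
  "group_ring G =
    \<lparr>carrier = {f. finite {x. f x \<noteq> 0} \<and> {x. f x \<noteq> 0} \<subseteq> carrier G},
     mult = (\<lambda>f g w. \<Sum>(x, y) \<in> {(x, y). f x \<noteq> 0 \<and> g y \<noteq> 0 \<and> x \<otimes>\<^bsub>G\<^esub> y = w}. f x * g y),
     one = (\<lambda>w. if w = \<one>\<^bsub>G\<^esub> then 1 else 0),
     zero = (\<lambda>w. 0),
     add = (\<lambda>f g w. f w + g w)\<rparr>"

abbreviation int_group_ring :: "('a, 'm) monoid_scheme \<Rightarrow> ('a \<Rightarrow> int) ring" where
  "int_group_ring G \<equiv> group_ring G"

abbreviation rat_group_ring :: "('a, 'm) monoid_scheme \<Rightarrow> ('a \<Rightarrow> rat) ring" where
  "rat_group_ring G \<equiv> group_ring G"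

abbreviation int_span :: "('a, 'm) ring_scheme \<Rightarrow> 'a set \<Rightarrow> 'a set" where
  "int_span R A \<equiv> generate (add_monoid R) A"

definition int_independent :: "('i \<Rightarrow> 'a \<Rightarrow> int) \<Rightarrow> 'i set \<Rightarrow> bool" where
  "int_independent x A \<longleftrightarrow>
    (\<forall>c :: 'i \<Rightarrow> int. (\<forall>w. (\<Sum>i\<in>A. c i * x i w) = 0) \<longrightarrow> (\<forall>i\<in>A. c i = 0))"

text \<open>For an additive subgroup \<open>M\<close> of \<open>\<int>G\<close>, this is the image of \<open>\<rat> \<otimes> M\<close> in
  \<open>\<rat> \<otimes> \<int>G = \<rat>G\<close> under the canonical map \<open>q \<otimes> m \<mapsto> q m\<close>, which is injective since \<open>\<rat>\<close>
  is flat over \<open>\<int>\<close>.\<close>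

definition rat_ext :: "('a \<Rightarrow> int) set \<Rightarrow> ('a \<Rightarrow> rat) set" where
  "rat_ext M = {(\<lambda>w. \<Sum>m\<in>F. q m * of_int (m w)) | q F. finite F \<and> F \<subseteq> M}"

definition x_elem :: "('a, 'm) monoid_scheme \<Rightarrow> nat \<Rightarrow> (nat \<Rightarrow> 'a) \<Rightarrow> 'a set \<Rightarrow> 'a \<Rightarrow> int" where
  "x_elem G n s I = (\<lambda>w. if w \<in> X_set G n s I then 1 else 0)"

definition Sigma_ext :: "('a, 'm) monoid_scheme \<Rightarrow> nat \<Rightarrow> (nat \<Rightarrow> 'a) \<Rightarrow> ('a \<Rightarrow> int) set" where
  "Sigma_ext G n s = int_span (int_group_ring G) (x_elem G n s ` P0 G n s)"

abbreviation Sigma_ring :: "('a, 'm) monoid_scheme \<Rightarrow> nat \<Rightarrow> (nat \<Rightarrow> 'a) \<Rightarrow> ('a \<Rightarrow> int) ring" where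
  "Sigma_ring G n s \<equiv> (int_group_ring G)\<lparr>carrier := Sigma_ext G n s\<rparr>"

abbreviation rat_Sigma_ring ::
  "('a, 'm) monoid_scheme \<Rightarrow> nat \<Rightarrow> (nat \<Rightarrow> 'a) \<Rightarrow> ('a \<Rightarrow> rat) ring" where
  "rat_Sigma_ring G n s \<equiv> (rat_group_ring G)\<lparr>carrier := rat_ext (Sigma_ext G n s)\<rparr>"

section \<open>The Jacobson radical\<close>

text \<open>The library's ideals are two-sided.\<close>

definition left_ideal :: "'a set \<Rightarrow> ('a, 'm) ring_scheme \<Rightarrow> bool" where
  "left_ideal L R \<longleftrightarrow>
    subgroup L (add_monoid R) \<and> (\<forall>a \<in> carrier R. \<forall>x \<in> L. a \<otimes>\<^bsub>R\<^esub> x \<in> L)"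

definition maximal_left_ideal :: "'a set \<Rightarrow> ('a, 'm) ring_scheme \<Rightarrow> bool" where
  "maximal_left_ideal L R \<longleftrightarrow>
    left_ideal L R \<and> L \<noteq> carrier R \<and>
    (\<forall>L'. left_ideal L' R \<and> L \<subseteq> L' \<longrightarrow> L' = L \<or> L' = carrier R)"

definition jacobson_radical :: "('a, 'm) ring_scheme \<Rightarrow> 'a set" where
  "jacobson_radical R = {x \<in> carrier R. \<forall>L. maximal_left_ideal L R \<longrightarrow> x \<in> L}"

section \<open>Complex characters\<close>

definition representation ::
  "('a, 'm) monoid_scheme \<Rightarrow> nat \<Rightarrow> ('a \<Rightarrow> complex mat) \<Rightarrow> bool" where
  "representation G d \<rho> \<longleftrightarrow> \<rho> \<in> hom G (units_of (ring_mat TYPE(complex) d ()))"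

definition irreducible_representation ::
  "('a, 'm) monoid_scheme \<Rightarrow> nat \<Rightarrow> ('a \<Rightarrow> complex mat) \<Rightarrow> bool" where
  "irreducible_representation G d \<rho> \<longleftrightarrow>
    representation G d \<rho> \<and> d > 0 \<and>
    (\<forall>U. VectorSpace.subspace class_ring U (module_vec TYPE(complex) d) \<and>
         (\<forall>g \<in> carrier G. \<forall>u \<in> U. \<rho> g *\<^sub>v u \<in> U) \<longrightarrow>
         U = {0\<^sub>v d} \<or> U = carrier_vec d)"

text \<open>Functions on the group are extended by \<open>0\<close> outside its carrier.\<close>

definition rep_character ::
  "('a, 'm) monoid_scheme \<Rightarrow> nat \<Rightarrow> ('a \<Rightarrow> complex mat) \<Rightarrow> 'a \<Rightarrow> complex" where
  "rep_character G d \<rho> = (\<lambda>g. if g \<in> carrier G then (\<Sum>i<d. \<rho> g $$ (i, i)) else 0)"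

definition Irr :: "('a, 'm) monoid_scheme \<Rightarrow> ('a \<Rightarrow> complex) set" where
  "Irr G = {rep_character G d \<rho> | d \<rho>. irreducible_representation G d \<rho>}"

definition function_ring :: "('a, 'm) monoid_scheme \<Rightarrow> ('a \<Rightarrow> complex) ring" where
  "function_ring G =
    \<lparr>carrier = {f. \<forall>x. x \<notin> carrier G \<longrightarrow> f x = 0},
     mult = (\<lambda>f g x. f x * g x),
     one = (\<lambda>x. if x \<in> carrier G then 1 else 0),
     zero = (\<lambda>x. 0),
     add = (\<lambda>f g x. f x + g x)\<rparr>"

definition virtual_character_ring :: "('a, 'm) monoid_scheme \<Rightarrow> ('a \<Rightarrow> complex) ring" where
  "virtual_character_ring G = (function_ring G)\<lparr>carrier := int_span (function_ring G) (Irr G)\<rparr>"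

text \<open>The class function on a finite group induced from a class function of a subgroup.\<close>

definition induced ::
  "('a, 'm) monoid_scheme \<Rightarrow> 'a set \<Rightarrow> ('a \<Rightarrow> complex) \<Rightarrow> 'a \<Rightarrow> complex" where
  "induced G H \<chi> = (\<lambda>g. if g \<in> carrier G then
      (\<Sum>x \<in> {x \<in> carrier G. inv\<^bsub>G\<^esub> x \<otimes>\<^bsub>G\<^esub> g \<otimes>\<^bsub>G\<^esub> x \<in> H}.
         \<chi> (inv\<^bsub>G\<^esub> x \<otimes>\<^bsub>G\<^esub> g \<otimes>\<^bsub>G\<^esub> x)) / of_nat (card H)
      else 0)"

end

theory Submission
  imports Defs "Jordan_Normal_Form.Jordan_Normal_Form_Existence" "Jordan_Normal_Form.DL_Rank"
    "HOL-Combinatorics.Permutations" "HOL-Combinatorics.Orbits"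
begin

text \<open>
  The group \<open>W\<close> is identified with the signed permutations of \<open>{1..n}\<close>, and the theorem is
  translated into a calculus of words \<open>F : {1..n} \<Rightarrow> nat\<close>, in which an even letter marks a negative
  position. Standardization assigns to \<open>F\<close> the signed permutation \<open>st F\<close> that lists the positions in the order
  of their letters, with the prescribed signs; and \<open>F\<close> also has a function \<open>m F\<close> on \<open>W\<close>, which at \<open>g\<close>
  is zero unless \<open>F\<close> is constant on the cycles of \<open>g\<close>, and is then the product of the signs of \<open>g\<close> at the even
  letters. For a set of words closed under rearrangement, let \<open>Y\<close> be the sum of the \<open>st F\<close> in the group ring
  and \<open>M\<close> the sum of the \<open>m F\<close>. There is one operation on sets of words, forming pairs, such that \<open>Y\<close> turns it into the
  product of the group ring (\<open>conv_Y\<close>) and \<open>M\<close> into the pointwise product (\<open>M_mult\<close>).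

  Each \<open>I\<close> in \<open>P0\<close> comes from a weakly increasing word \<open>b\<close>: an odd letter stands for a hyperoctahedral factor
  of \<open>W\<^sub>I\<close>, an even letter for a symmetric one. Then \<open>x\<^sub>I = Y (spl b)\<close> (\<open>x_elem_Y\<close>), and
  \<open>Ind 1 = M (spl b)\<close> (\<open>induced_eq_M\<close>), the latter by a Fourier transform over the sign changes
  (\<open>fixed_colourings\<close>). Conversely every \<open>Y\<close> of a closed set is an integral combination of the \<open>x\<^sub>I\<close> whose image
  under \<open>\<theta>\<close> is \<open>M\<close> (\<open>family_in_span\<close>). Hence \<open>\<Sigma>'\<close> is closed under products and \<open>\<theta>\<close> is multiplicative.

  For surjectivity, \<open>M (rcl f)\<close> and \<open>\<epsilon> M (rcl h)\<close>, with \<open>\<epsilon>\<close> the sign of the underlying permutation, are paired.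
  The scalar product counts matrices with entries \<open>0\<close> and \<open>1\<close> and given margins, as for elementary and complete
  symmetric functions, so that after conjugating the margins it is unitriangular (\<open>D_self\<close>, \<open>D_nonzero\<close>). A
  class function orthogonal to all \<open>M (rcl f)\<close> vanishes, since these functions separate the signed cycle types
  (\<open>class_function_eq_zero\<close>). As scalar products of characters are integers, every character is an integral
  combination of induced ones. The same triangularity shows that the \<open>Ind 1\<close> for nonconjugate \<open>W\<^sub>I\<close> are
  independent, which gives the kernel (\<open>Th_types_independent\<close>, \<open>kernel_as_differences\<close>).

  For the radical, the coefficient of the identity in an element of \<open>\<Sigma>'\<close> is the scalar product of its image with the trivial
  character. For an element of the kernel all powers therefore have trace zero in the regular representation, so the
  element is nilpotent and lies in the radical. Conversely, evaluation of \<open>\<theta>\<close> at a group element maps \<open>\<rat>\<Sigma>'\<close> onto a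
  field, so the radical is contained in the kernel.
\<close>

section \<open>Signed permutations and their length\<close>

definition sperm :: "nat => (int => int) set" where
  "sperm n = {w. bij w \<and> (\<forall>x. w (- x) = - w x) \<and> (\<forall>x. int n < \<bar>x\<bar> --> w x = x)}"

text \<open>The image of \<open>t\<close> for \<open>k = 0\<close>, and of \<open>s\<^sub>k\<close> for \<open>k > 0\<close>.\<close>

definition gen :: "nat => int => int" where
  "gen k x = (if k = 0 then (if \<bar>x\<bar> = 1 then - x else x)
     else if x = int k then int k + 1 else if x = int k + 1 then int k
     else if x = - int k then - int k - 1 else if x = - int k - 1 then - int k else x)"

definition flip :: "int => int => int" where
  "flip i x = (if \<bar>x\<bar> = i then - x else x)"

lemma spermI: "bij w ==> (\<And>x. w (- x) = - w x) ==> (\<And>x. int n < \<bar>x\<bar> ==> w x = x) ==> w \<in> sperm n"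
  by (auto simp: sperm_def)

lemma sperm_minus: "w \<in> sperm n ==> w (- x) = - w x"
  by (auto simp: sperm_def)

lemma sperm_0: "w \<in> sperm n ==> w 0 = 0"
  using sperm_minus[of w n 0] by simp

lemma sperm_bij: "w \<in> sperm n ==> bij w"
  by (auto simp: sperm_def)

lemma sperm_eq_iff: "w \<in> sperm n ==> w x = w y \<longleftrightarrow> x = y"
  using sperm_bij[of w n] by (auto simp: bij_def dest: injD)

lemma sperm_zero_iff: "w \<in> sperm n ==> w x = 0 \<longleftrightarrow> x = 0"
  using sperm_eq_iff[of w n x 0] sperm_0[of w n] by simp

lemma sperm_out: "w \<in> sperm n ==> int n < \<bar>x\<bar> ==> w x = x"
  by (auto simp: sperm_def)

lemma sperm_le: assumes "w \<in> sperm n" "\<bar>x\<bar> \<le> int n" shows "\<bar>w x\<bar> \<le> int n"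
proof (rule ccontr)
  assume *: "\<not> \<bar>w x\<bar> \<le> int n"
  then have "w (w x) = w x" using sperm_out[OF assms(1), of "w x"] by auto
  then have "w x = x" using sperm_eq_iff[OF assms(1)] by blast
  then show False using * assms by auto
qed

lemma sperm_abs: "w \<in> sperm n ==> \<bar>w \<bar>x\<bar>\<bar> = \<bar>w x\<bar>"
  using sperm_minus[of w n x] by (auto simp: abs_if)

lemma sperm_abs_eq_iff: "w \<in> sperm n ==> \<bar>w x\<bar> = \<bar>w y\<bar> \<longleftrightarrow> \<bar>x\<bar> = \<bar>y\<bar>"
  using sperm_minus[of w n y] sperm_eq_iff[of w n x y] sperm_eq_iff[of w n x "-y"]
  by (auto simp: abs_eq_iff)

lemma sperm_comp: "v \<in> sperm n ==> w \<in> sperm n ==> v \<circ> w \<in> sperm n"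
  by (auto simp: sperm_def intro: bij_comp)

lemma sperm_id: "id \<in> sperm n"
  by (auto simp: sperm_def)

lemma sperm_ext:
  assumes "v \<in> sperm n" "w \<in> sperm n" "\<And>i. 1 \<le> i ==> i \<le> int n ==> v i = w i"
  shows "v = w"
proof
  fix x :: int
  consider "int n < \<bar>x\<bar>" | "x = 0" | "1 \<le> x" "x \<le> int n" | "1 \<le> - x" "- x \<le> int n" by fastforce
  then show "v x = w x"
  proof cases
    case 4 then show ?thesis using assms(3)[of "-x"] sperm_minus[OF assms(1), of x] sperm_minus[OF assms(2), of x] by simp
  next
    case 1 then show ?thesis using assms by (simp add: sperm_out)
  next
    case 2 then show ?thesis using sperm_0 assms by metis
  qed (use assms in auto)
qed

lemma finite_sperm: "finite (sperm n)"
proof -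
  let ?R = "%w. restrict w {1..int n}"
  have "inj_on ?R (sperm n)"
  proof (rule inj_onI)
    fix v w assume *: "v \<in> sperm n" "w \<in> sperm n" "?R v = ?R w"
    have "v i = w i" if "1 \<le> i" "i \<le> int n" for i
      using fun_cong[OF *(3), of i] that by simp
    then show "v = w" using sperm_ext * by blast
  qed
  moreover have "?R ` sperm n \<subseteq> PiE {1..int n} (%_. {- int n..int n})"
    using sperm_le by (fastforce simp: abs_le_iff)
  ultimately show ?thesis
    by (meson finite_PiE finite_atLeastAtMost_int finite_imageD finite_subset)
qed

lemma gen_gen [simp]: "gen k (gen k x) = x"
  by (auto simp: gen_def)

lemma gen_sperm: assumes "k < n" shows "gen k \<in> sperm n"
proof (rule spermI)
  show "bij (gen k)" by (rule o_bij[of "gen k"]) (auto simp: fun_eq_iff)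
qed (use assms in \<open>auto simp: gen_def\<close>)

lemma flip_flip [simp]: "flip i (flip i x) = x"
  by (auto simp: flip_def)

lemma flip_sperm: assumes "1 \<le> i" "i \<le> int n" shows "flip i \<in> sperm n"
proof (rule spermI)
  show "bij (flip i)" by (rule o_bij[of "flip i"]) (auto simp: fun_eq_iff)
qed (use assms in \<open>auto simp: flip_def\<close>)

lemma gen_0: "gen 0 = flip 1" by (auto simp: gen_def flip_def fun_eq_iff)

lemma gen_flip: "k > 0 ==> gen k \<circ> flip (int k) \<circ> gen k = flip (int k + 1)"
  by (auto simp: gen_def flip_def fun_eq_iff)

lemma gen_commute: "Suc i < j ==> gen i (gen j x) = gen j (gen i x)"
proof -
  assume ij: "Suc i < j"
  consider "x = int j" | "x = int j + 1" | "x = - int j" | "x = - int j - 1"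
    | (o) "x ~= int j" "x ~= int j + 1" "x ~= - int j" "x ~= - int j - 1" by blast
  then show ?thesis
  proof cases
    case o
    have fx: "gen j y = y" if "y ~= int j" "y ~= int j + 1" "y ~= - int j" "y ~= - int j - 1" for y
      using ij that by (simp add: gen_def)
    have "gen i x = x \<or> \<bar>gen i x\<bar> \<le> int i + 1" by (simp add: gen_def)
    then have "gen j (gen i x) = gen i x" using o ij by (intro fx) auto
    then show ?thesis using fx o by simp
  qed (use ij in \<open>auto simp: gen_def\<close>)
qed

lemma gen_braid3: "0 < i ==> gen i (gen (Suc i) (gen i x)) = gen (Suc i) (gen i (gen (Suc i) x))"
proof -
  assume i: "0 < i"
  consider "x = int i" | "x = int i + 1" | "x = int i + 2" | "x = - int i" | "x = - int i - 1"
    | "x = - int i - 2" | (o) "x ~= int i" "x ~= int i + 1" "x ~= int i + 2" "x ~= - int i"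
      "x ~= - int i - 1" "x ~= - int i - 2" by blast
  then show ?thesis
  proof cases
    case o
    then have "gen i x = x" "gen (Suc i) x = x" using i by (simp_all add: gen_def)
    then show ?thesis by simp
  qed (use i in \<open>simp_all add: gen_def\<close>)
qed

lemma gen_braid4: "gen 0 (gen (Suc 0) (gen 0 (gen (Suc 0) x))) = gen (Suc 0) (gen 0 (gen (Suc 0) (gen 0 x)))"
proof -
  consider "x = 1" | "x = 2" | "x = - 1" | "x = - 2" | (o) "x ~= 1" "x ~= 2" "x ~= - 1" "x ~= - 2" by blast
  then show ?thesis
  proof cases
    case o
    then have "gen 0 x = x" "gen (Suc 0) x = x" by (auto simp add: gen_def)
    then show ?thesis by simp
  qed (simp_all add: gen_def)
qed

text \<open>A pair \<open>(i, j)\<close> stands for the positive root \<open>e\<^sub>j - e\<^sub>i\<close>, where \<open>e\<^sub>-\<^sub>i = - e\<^sub>i\<close>.\<close>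

definition roots :: "nat => (int \<times> int) set" where
  "roots n = {(i, j). 1 \<le> j \<and> j \<le> int n \<and> - j \<le> i \<and> i < j \<and> i ~= 0}"

definition invs :: "nat => (int => int) => (int \<times> int) set" where
  "invs n w = {(i, j) \<in> roots n. w j < w i}"

definition len :: "nat => (int => int) => nat" where
  "len n w = card (invs n w)"

lemma finite_roots: "finite (roots n)"
proof -
  have "roots n \<subseteq> {- int n..int n} \<times> {- int n..int n}" by (auto simp: roots_def)
  then show ?thesis by (rule finite_subset) auto
qed

lemma finite_invs: "finite (invs n w)"
  unfolding invs_def by (rule finite_subset[OF _ finite_roots[of n]]) auto

text \<open>For \<open>k = 0\<close> this says \<open>w 1 < 0\<close>, as \<open>w 0 = 0\<close>.\<close>

definition des :: "(int => int) => nat => bool" where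
  "des w k \<longleftrightarrow> w (int k + 1) < w (int k)"

text \<open>The generator \<open>gen k\<close> permutes the positive roots except for the simple root \<open>k\<close>, which it
  negates, and it moves the inversions accordingly.\<close>

lemma len_gen:
  assumes w: "w \<in> sperm n" and k: "k < n"
  shows "len n (w \<circ> gen k) = (if des w k then len n w - 1 else len n w + 1)"
    and "des w k ==> len n w > 0"
proof -
  define r where "r = (if k = 0 then (-1, 1) else (int k, int k + 1))"
  define \<tau> where "\<tau> = (%(i, j). if k > 0 \<and> (i, j) = (- int k, int k + 1) then (i, j) else (gen k i, gen k j))"
  have r: "r \<in> roots n" using k by (auto simp: r_def roots_def)
  have m: "w (- x) = - w x" for x using sperm_minus[OF w] .
  have z: "w 0 = 0" using sperm_0[OF w] .
  have "w 1 ~= 0" using sperm_zero_iff[OF w, of 1] by simp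
  have rw: "r \<in> invs n w \<longleftrightarrow> des w k"
    using r z m[of 1] \<open>w 1 ~= 0\<close> by (auto simp: invs_def r_def des_def)
  have rw': "r \<in> invs n (w \<circ> gen k) \<longleftrightarrow> \<not> des w k"
    using r z m[of 1] \<open>w 1 ~= 0\<close> sperm_eq_iff[OF w, of "int k" "int k + 1"]
    by (auto simp: invs_def r_def des_def gen_def not_less)
  have \<tau>\<tau>: "\<tau> (\<tau> p) = p" if "p \<in> roots n" for p
    using that by (cases p) (auto simp: \<tau>_def gen_def roots_def)
  have \<tau>r: "\<tau> p \<in> roots n - {r}" if "p \<in> roots n - {r}" for p
  proof (cases p)
    case (Pair i j)
    then show ?thesis using that k
      by (cases "k = 0") (auto simp: \<tau>_def roots_def r_def gen_def split: if_splits)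
  qed
  have \<tau>w: "p \<in> invs n (w \<circ> gen k) \<longleftrightarrow> \<tau> p \<in> invs n w" if "p \<in> roots n - {r}" for p
  proof (cases p)
    case (Pair i j)
    have "fst p ~= 0" using that by (auto simp: roots_def)
    show ?thesis
    proof (cases "k > 0 \<and> (i, j) = (- int k, int k + 1)")
      case True
      then have "\<tau> p = p" "w (gen k i) = - w (int k + 1)" "w (gen k j) = w (int k)"
          "w i = - w (int k)"
        using Pair m[of "int k + 1"] m[of "int k"] by (auto simp: \<tau>_def gen_def)
      then show ?thesis using that True Pair by (auto simp: invs_def)
    next
      case False
      then have "\<tau> p = (gen k i, gen k j)" using Pair by (auto simp: \<tau>_def)
      then show ?thesis using that \<tau>r[OF that] Pair by (auto simp: invs_def)
    qed
  qed
  have "bij_betw \<tau> (invs n (w \<circ> gen k) - {r}) (invs n w - {r})"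
  proof (rule bij_betw_byWitness[where f' = \<tau>])
    have sub: "invs n v \<subseteq> roots n" for v by (auto simp: invs_def)
    show "\<tau> ` (invs n (w \<circ> gen k) - {r}) \<subseteq> invs n w - {r}"
    proof (rule image_subsetI)
      fix p assume p: "p \<in> invs n (w \<circ> gen k) - {r}"
      then have "p \<in> roots n - {r}" using sub by blast
      then show "\<tau> p \<in> invs n w - {r}" using p \<tau>w \<tau>r by blast
    qed
    show "\<tau> ` (invs n w - {r}) \<subseteq> invs n (w \<circ> gen k) - {r}"
    proof (rule image_subsetI)
      fix p assume p: "p \<in> invs n w - {r}"
      then have q: "p \<in> roots n - {r}" using sub by blast
      have "\<tau> p \<in> invs n (w \<circ> gen k)" using \<tau>w[OF \<tau>r[OF q]] p q by (simp add: \<tau>\<tau>)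
      then show "\<tau> p \<in> invs n (w \<circ> gen k) - {r}" using \<tau>r[OF q] by blast
    qed
  qed (use \<tau>\<tau> in \<open>auto simp: invs_def\<close>)
  then have c: "card (invs n (w \<circ> gen k) - {r}) = card (invs n w - {r})"
    by (rule bij_betw_same_card)
  show "len n (w \<circ> gen k) = (if des w k then len n w - 1 else len n w + 1)"
  proof (cases "des w k")
    case True
    then have "card (invs n w) = Suc (card (invs n w - {r}))"
      "invs n (w \<circ> gen k) - {r} = invs n (w \<circ> gen k)"
      using rw rw' by (auto intro!: card.remove[OF finite_invs] simp del: card_Diff_insert)
    then show ?thesis using c True by (simp add: len_def)
  next
    case False
    then have "card (invs n (w \<circ> gen k)) = Suc (card (invs n (w \<circ> gen k) - {r}))"
      "invs n w - {r} = invs n w"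
      using rw rw' by (auto intro!: card.remove[OF finite_invs] simp del: card_Diff_insert)
    then show ?thesis using c False by (simp add: len_def)
  qed
  show "des w k ==> len n w > 0"
    using rw finite_invs[of n w] by (auto simp: len_def card_gt_0_iff)
qed

lemma no_des_id:
  assumes w: "w \<in> sperm n" and nd: "\<And>k. k < n ==> \<not> des w k"
  shows "w = id"
proof -
  have lt: "w (int k) < w (int k + 1)" if "k < n" for k
    using nd[OF that] sperm_eq_iff[OF w, of "int k" "int k + 1"] by (auto simp: des_def not_less)
  have ge: "w (int k) \<ge> int k" if "k \<le> n" for k using that
  proof (induction k)
    case 0 then show ?case using sperm_0[OF w] by simp
  next
    case (Suc k) then show ?case using lt[of k] by (simp add: add.commute)
  qed
  have le: "w (int (n - k)) \<le> int (n - k)" if "k \<le> n" for k using that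
  proof (induction k)
    case 0 then show ?case using sperm_le[OF w, of "int n"] by simp
  next
    case (Suc k)
    then have "w (int (n - Suc k)) < w (int (n - k))" using lt[of "n - Suc k"]
      by (simp add: of_nat_diff)
    then show ?case using Suc by (simp add: of_nat_diff)
  qed
  have "w i = i" if i: "1 \<le> i" "i \<le> int n" for i
  proof -
    have "i \<le> w i" using ge[of "nat i"] i by simp
    moreover have "w i \<le> i" using le[of "n - nat i"] i by (simp add: of_nat_diff)
    ultimately show ?thesis by simp
  qed
  then show ?thesis using sperm_ext[OF w sperm_id] by simp
qed

definition evl :: "nat list => int => int" where
  "evl us = foldr (%i f. gen i \<circ> f) us id"

lemma evl_Nil [simp]: "evl [] = id" and evl_Cons [simp]: "evl (i # us) = gen i \<circ> evl us"
  by (auto simp: evl_def)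

lemma evl_append [simp]: "evl (us @ vs) = evl us \<circ> evl vs"
  by (induction us) (auto simp: comp_assoc)

lemma evl_sperm: "us \<in> lists {..<n} ==> evl us \<in> sperm n"
  by (induction us) (auto intro!: sperm_comp sperm_id gen_sperm)

lemma evl_snoc: "evl (us @ [k]) = evl us \<circ> gen k"
  by (simp only: evl_append evl_Cons evl_Nil comp_id)

lemma len_id: "len n id = 0"
proof -
  have "invs n id = {}" by (auto simp: invs_def roots_def)
  then show ?thesis by (simp add: len_def)
qed

lemma len_evl_le: "us \<in> lists {..<n} ==> len n (evl us) \<le> length us"
proof (induction us rule: rev_induct)
  case (snoc k us)
  then have "len n (evl us \<circ> gen k) \<le> len n (evl us) + 1"
    using len_gen(1)[of "evl us" n k] evl_sperm[of us n] by auto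
  moreover have "len n (evl us) \<le> length us" using snoc by auto
  ultimately show ?case by (simp only: evl_snoc length_append_singleton)
qed (simp only: evl_Nil len_id)

lemma reduced_word_exists:
  "w \<in> sperm n ==> \<exists>us \<in> lists {..<n}. length us = len n w \<and> evl us = w"
proof (induction "len n w" arbitrary: w)
  case 0
  have "w = id" using no_des_id[OF \<open>w \<in> sperm n\<close>] len_gen(2)[OF \<open>w \<in> sperm n\<close>] 0 by (metis less_irrefl)
  then show ?case by (metis lists.Nil evl_Nil len_id list.size(3))
next
  case (Suc l)
  have "\<exists>k<n. des w k"
  proof (rule ccontr)
    assume "\<not> ?thesis"
    then have "w = id" using no_des_id Suc.prems by blast
    then show False using Suc.hyps by (simp add: len_id)
  qed
  then obtain k where k: "k < n" "des w k" by blast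
  let ?v = "w \<circ> gen k"
  have v: "?v \<in> sperm n" using Suc.prems k by (simp add: sperm_comp gen_sperm)
  have "l = len n ?v" using len_gen(1)[OF Suc.prems k(1)] k Suc.hyps by simp
  then obtain us where us: "us \<in> lists {..<n}" "length us = len n ?v" "evl us = ?v"
    using Suc.hyps(1) v by blast
  have "evl (us @ [k]) = w" using us by (auto simp: fun_eq_iff)
  then show ?case using us k \<open>l = _\<close> Suc.hyps(2)
    by (intro bexI[of _ "us @ [k]"]) auto
qed

definition braid_words :: "nat => nat => nat list \<times> nat list" where
  "braid_words i j = (if j > Suc i then ([j, i], [i, j])
     else if i > 0 then ([i, j, i], [j, i, j]) else ([j, i, j, i], [i, j, i, j]))"

text \<open>The parabolic subgroup of two descents is finite, and its longest element, in each of its two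
  reduced expressions, can be split off on the right.\<close>

lemma rank_two_descent:
  assumes w: "w \<in> sperm n" and ij: "i < j" "j < n" and d: "des w i" "des w j"
    and ab: "braid_words i j = (a, b)"
  obtains y where "y \<in> sperm n" "w = y \<circ> evl a" "w = y \<circ> evl b"
    "len n w = len n y + length a"
proof -
  have i: "i < n" using ij by simp
  have g: "gen i \<in> sperm n" "gen j \<in> sperm n" using ij by (auto intro: gen_sperm)
  consider (2) "j > Suc i" | (3) "j = Suc i" "i > 0" | (4) "i = 0" "j = Suc 0" using ij by linarith
  then show thesis
  proof cases
    case 2
    let ?v = "w \<circ> gen i"
    have v: "?v \<in> sperm n" "?v \<circ> gen j \<in> sperm n" using w g by (auto intro: sperm_comp)
    have "des ?v j" using d 2 by (auto simp: des_def gen_def)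
    then have "len n w = len n (?v \<circ> gen j) + 2"
      using len_gen[OF w i] len_gen[OF v(1) ij(2)] d by auto
    moreover have "w = ?v \<circ> gen j \<circ> evl a" "w = ?v \<circ> gen j \<circ> evl b"
      using ab 2 gen_commute[OF 2, symmetric] by (auto simp: braid_words_def fun_eq_iff)
    ultimately show thesis using that[of "?v \<circ> gen j"] v ab 2 by (auto simp: braid_words_def)
  next
    case 3
    let ?v = "w \<circ> gen i" let ?u = "?v \<circ> gen j" let ?y = "?u \<circ> gen i"
    have v: "?v \<in> sperm n" "?u \<in> sperm n" "?y \<in> sperm n" using w g by (auto intro: sperm_comp)
    have "des ?v j" "des ?u i" using d 3 by (auto simp: des_def gen_def add.commute)
    then have "len n w = len n ?y + 3"
      using len_gen[OF w i] len_gen[OF v(1) ij(2)] len_gen[OF v(2) i] d by auto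
    moreover have "w = ?y \<circ> evl a" "w = ?y \<circ> evl b"
      using ab 3 gen_braid3[of i] by (auto simp: braid_words_def fun_eq_iff)
    ultimately show thesis using that[of ?y] v ab 3 by (auto simp: braid_words_def)
  next
    case 4
    let ?v = "w \<circ> gen i" let ?u = "?v \<circ> gen j" let ?t = "?u \<circ> gen i" let ?y = "?t \<circ> gen j"
    have v: "?v \<in> sperm n" "?u \<in> sperm n" "?t \<in> sperm n" "?y \<in> sperm n"
      using w g by (auto intro: sperm_comp)
    have "w 0 = 0" "w (-1) = - w 1" "w (-2) = - w 2"
      using sperm_0[OF w] sperm_minus[OF w, of 1] sperm_minus[OF w, of 2] by simp_all
    then have "des ?v j" "des ?u i" "des ?t j" using d 4 by (auto simp: des_def gen_def)
    then have "len n w = len n ?y + 4"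
      using len_gen[OF w i] len_gen[OF v(1) ij(2)] len_gen[OF v(2) i] len_gen[OF v(3) ij(2)] d by auto
    moreover have "w = ?y \<circ> evl a" "w = ?y \<circ> evl b"
      using ab 4 gen_braid4 by (auto simp: braid_words_def fun_eq_iff)
    ultimately show thesis using that[of ?y] v ab 4 by (auto simp: braid_words_def)
  qed
qed

section \<open>Length and sign changes\<close>

text \<open>The map \<open>(a, i) \<mapsto> (a, i)\<close>, and \<open>(a, b) \<mapsto> (flip i a, b)\<close> for \<open>b \<noteq> i\<close>, carries inversions of \<open>w\<close>
  to inversions of \<open>w \<circ> flip i\<close>, and misses the root \<open>(- i, i)\<close>.\<close>

lemma len_flip_less:
  assumes w: "w \<in> sperm n" and i: "1 \<le> i" "i \<le> int n" and pos: "0 < w i"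
  shows "len n w < len n (w \<circ> flip i)"
proof -
  define \<phi> where "\<phi> = (%(a, b). if b = i then (a, b) else (flip i a, b))"
  have m: "w (- x) = - w x" for x using sperm_minus[OF w] .
  have inj: "inj \<phi>"
    by (rule injI) (auto simp: \<phi>_def flip_def split: if_splits prod.splits)
  have sub: "\<phi> ` invs n w \<subseteq> invs n (w \<circ> flip i) - {(- i, i)}"
  proof (rule image_subsetI)
    fix p assume p: "p \<in> invs n w"
    obtain a b where ab: "p = (a, b)" by (cases p)
    have r: "(a, b) \<in> roots n" "w b < w a" using p ab by (auto simp: invs_def)
    show "\<phi> p \<in> invs n (w \<circ> flip i) - {(- i, i)}"
    proof (cases "b = i")
      case True
      then have "a ~= - i" using r pos m[of i] by auto
      moreover have "\<bar>a\<bar> ~= i" using True r \<open>a ~= - i\<close> by (auto simp: roots_def)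
      ultimately show ?thesis using True r ab pos m[of i] i
        by (auto simp: \<phi>_def invs_def flip_def)
    next
      case False
      have "\<bar>b\<bar> ~= i" using False r by (auto simp: roots_def)
      have "(flip i a, b) \<in> roots n" using r False by (auto simp: roots_def flip_def)
      then show ?thesis using False r ab \<open>\<bar>b\<bar> ~= i\<close>
        by (auto simp: \<phi>_def invs_def) (auto simp: flip_def)
    qed
  qed
  have "(- i, i) \<in> invs n (w \<circ> flip i)"
    using i pos m[of i] by (auto simp: invs_def roots_def flip_def)
  then have "\<phi> ` invs n w \<subset> invs n (w \<circ> flip i)" using sub by blast
  then have "card (\<phi> ` invs n w) < card (invs n (w \<circ> flip i))"
    using finite_invs by (rule psubset_card_mono[rotated])
  then show ?thesis using card_image[OF inj_on_subset[OF inj, of "invs n w"]] by (simp add: len_def)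
qed

lemma len_flip_iff:
  assumes w: "w \<in> sperm n" and i: "1 \<le> i" "i \<le> int n"
  shows "len n w < len n (w \<circ> flip i) \<longleftrightarrow> 0 < w i"
proof
  assume *: "len n w < len n (w \<circ> flip i)"
  show "0 < w i"
  proof (rule ccontr)
    assume "\<not> 0 < w i"
    moreover have "w i ~= 0" using sperm_zero_iff[OF w, of i] i by simp
    ultimately have "0 < (w \<circ> flip i) i" using sperm_minus[OF w, of i] i by (auto simp: flip_def)
    then have "len n (w \<circ> flip i) < len n (w \<circ> flip i \<circ> flip i)"
      using len_flip_less sperm_comp[OF w flip_sperm[OF i]] i by blast
    moreover have "w \<circ> flip i \<circ> flip i = w" by (auto simp: fun_eq_iff)
    ultimately show False using * by simp
  qed
qed (use len_flip_less assms in blast)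

lemma len_gen_iff:
  assumes w: "w \<in> sperm n" and k: "k < n"
  shows "len n w < len n (w \<circ> gen k) \<longleftrightarrow> w (int k) < w (int k + 1)"
  using len_gen[OF w k] sperm_eq_iff[OF w, of "int k" "int k + 1"] by (auto simp: des_def)

section \<open>The Coxeter group as a group of signed permutations\<close>

locale coxeter_C = group G for G (structure) +
  fixes n :: nat and s :: "nat => 'a"
  assumes cox: "coxeter_system G {..<n} type_C s"
begin

abbreviation wp :: "nat list => 'a" where "wp \<equiv> word_prod G s"

lemma s_closed [simp]: "i < n ==> s i \<in> carrier G"
  using cox by (auto simp: coxeter_system_def)

lemma wp_Nil [simp]: "wp [] = \<one>" and wp_Cons [simp]: "wp (i # us) = s i \<otimes> wp us"
  by (auto simp: word_prod_def)

lemma wp_closed [simp]: "us \<in> lists {..<n} ==> wp us \<in> carrier G"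
  by (induction us) auto

lemma wp_append: "us \<in> lists {..<n} ==> vs \<in> lists {..<n} ==> wp (us @ vs) = wp us \<otimes> wp vs"
  by (induction us) (auto simp: m_assoc)

lemma wp_eq_iff: "us \<in> lists {..<n} ==> vs \<in> lists {..<n} ==>
    wp us = wp vs \<longleftrightarrow> coxeter_cong {..<n} type_C us vs"
  using cox by (auto simp: coxeter_system_def)

lemma wp_rel:
  assumes "i < n" "j < n"
  shows "wp (concat (replicate (type_C i j) [i, j])) = \<one>"
proof -
  let ?u = "concat (replicate (type_C i j) [i, j])"
  have "?u \<in> lists {..<n}" using assms by (auto simp: in_lists_conv_set)
  moreover have "coxeter_cong {..<n} type_C ([] @ ?u @ []) ([] @ [])"
    by (rule coxeter_cong.rel) (use assms in auto)
  ultimately show ?thesis using wp_eq_iff[of ?u "[]"] by simp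
qed

lemma s_square [simp]: "i < n ==> s i \<otimes> s i = \<one>"
  using wp_rel[of i i] by (simp add: type_C_def)

lemma inv_s [simp]: "i < n ==> inv (s i) = s i"
  by (intro inv_equality) auto

lemma inv_wp: "us \<in> lists {..<n} ==> inv (wp us) = wp (rev us)"
  by (induction us) (auto simp: inv_mult_group wp_append in_lists_conv_set)

lemma wp_split:
  assumes "u \<in> lists {..<n}" "v \<in> lists {..<n}" "wp (u @ v) = \<one>"
  shows "wp u = wp (rev v)"
  using assms inv_equality[of "wp u" "wp v"] by (simp add: wp_append inv_wp)

lemma wp_braid:
  assumes ij: "i < j" "j < n" and ab: "braid_words i j = (a, b)"
  shows "wp a = wp b"
proof -
  have i: "i < n" using ij by simp
  consider (2) "j > Suc i" | (3) "j = Suc i" "i > 0" | (4) "i = 0" "j = Suc 0" using ij by linarith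
  then show ?thesis
  proof cases
    case 2
    then have m: "type_C i j = 2" by (auto simp: type_C_def doubleton_eq_iff)
    have r: "wp ([i, j] @ [i, j]) = \<one>" using wp_rel[OF i ij(2)] unfolding m by (simp add: numeral_eq_Suc)
    have e: "wp [i, j] = wp (rev [i, j])" by (rule wp_split[OF _ _ r]) (use i ij in auto)
    have ab': "b = [i, j]" "a = rev [i, j]" using ab 2 by (auto simp: braid_words_def)
    show ?thesis unfolding ab' by (rule e[symmetric])
  next
    case 3
    then have m: "type_C i j = 3" by (auto simp: type_C_def doubleton_eq_iff)
    have r: "wp ([i, j, i] @ [j, i, j]) = \<one>" using wp_rel[OF i ij(2)] unfolding m by (simp add: numeral_eq_Suc)
    have e: "wp [i, j, i] = wp (rev [j, i, j])" by (rule wp_split[OF _ _ r]) (use i ij in auto)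
    have ab': "a = [i, j, i]" "b = rev [j, i, j]" using ab 3 by (auto simp: braid_words_def)
    show ?thesis unfolding ab' by (rule e)
  next
    case 4
    then have m: "type_C i j = 4" by (auto simp: type_C_def doubleton_eq_iff)
    have r: "wp ([i, j, i, j] @ [i, j, i, j]) = \<one>" using wp_rel[OF i ij(2)] unfolding m by (simp add: numeral_eq_Suc)
    have e: "wp [i, j, i, j] = wp (rev [i, j, i, j])" by (rule wp_split[OF _ _ r]) (use i ij in auto)
    have ab': "b = [i, j, i, j]" "a = rev [i, j, i, j]" using ab 4 by (auto simp: braid_words_def)
    show ?thesis unfolding ab' by (rule e[symmetric])
  qed
qed

lemma evl_rel: "evl (concat (replicate (type_C i j) [i, j])) = id"
proof -
  have cs: "i = j \<or> (i = 0 \<and> j = Suc 0 \<or> i = Suc 0 \<and> j = 0)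
      \<or> (i > 0 \<and> j > 0 \<and> (j = Suc i \<or> i = Suc j)) \<or> (Suc i < j \<or> Suc j < i)"
    by linarith
  consider (1) "i = j" | (2) "i = 0 \<and> j = Suc 0 \<or> i = Suc 0 \<and> j = 0"
    | (3) "i > 0" "j > 0" "j = Suc i \<or> i = Suc j" | (4) "Suc i < j \<or> Suc j < i"
    using cs by satx
  then show ?thesis
  proof cases
    case 1 then show ?thesis by (simp add: type_C_def fun_eq_iff)
  next
    case 2
    then have m: "type_C i j = 4" by (auto simp: type_C_def)
    have a: "gen 0 (gen (Suc 0) (gen 0 (gen (Suc 0) (gen 0 (gen (Suc 0) (gen 0 (gen (Suc 0) x))))))) = x" for x
      by (subst gen_braid4) simp
    have b: "gen (Suc 0) (gen 0 (gen (Suc 0) (gen 0 (gen (Suc 0) (gen 0 (gen (Suc 0) (gen 0 x))))))) = x" for x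
      by (subst gen_braid4[symmetric]) simp
    have r: "concat (replicate (type_C i j) [i, j]) = [i, j, i, j, i, j, i, j]"
      unfolding m(1) by (simp add: numeral_eq_Suc)
    from 2 show ?thesis unfolding r
    proof (elim disjE conjE)
      assume "i = 0" "j = Suc 0"
      then show "evl [i, j, i, j, i, j, i, j] = id" by (intro ext) (simp add: a)
    next
      assume "i = Suc 0" "j = 0"
      then show "evl [i, j, i, j, i, j, i, j] = id" by (intro ext) (simp add: b)
    qed
  next
    case 3
    then have m: "type_C i j = 3" by (auto simp: type_C_def doubleton_eq_iff)
    have a: "gen k (gen (Suc k) (gen k (gen (Suc k) (gen k (gen (Suc k) x))))) = x" if "k > 0" for k x
      by (subst gen_braid3[OF that]) simp
    have b: "gen (Suc k) (gen k (gen (Suc k) (gen k (gen (Suc k) (gen k x))))) = x" if "k > 0" for k x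
      by (subst gen_braid3[OF that, symmetric]) simp
    have r: "concat (replicate (type_C i j) [i, j]) = [i, j, i, j, i, j]"
      unfolding m by (simp add: numeral_eq_Suc)
    from 3(3) show ?thesis unfolding r
    proof (elim disjE)
      assume "j = Suc i"
      then show "evl [i, j, i, j, i, j] = id" using 3 by (intro ext) (simp add: a)
    next
      assume "i = Suc j"
      then show "evl [i, j, i, j, i, j] = id" using 3 by (intro ext) (simp add: b)
    qed
  next
    case 4
    then have m: "type_C i j = 2" by (auto simp: type_C_def doubleton_eq_iff)
    have "gen i (gen j x) = gen j (gen i x)" for x
      using 4
    proof
      assume "Suc i < j" then show ?thesis by (rule gen_commute)
    next
      assume "Suc j < i" then show ?thesis by (rule gen_commute[symmetric])
    qed
    then have "gen i (gen j (gen i (gen j x))) = x" for x by (metis gen_gen)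
    then show ?thesis using m by (simp add: numeral_eq_Suc fun_eq_iff)
  qed
qed

lemma cong_evl: "coxeter_cong J type_C us vs ==> evl us = evl vs"
  by (induction rule: coxeter_cong.induct) (simp_all add: evl_rel)

lemma wp_eq_imp_evl_eq:
  "us \<in> lists {..<n} ==> vs \<in> lists {..<n} ==> wp us = wp vs ==> evl us = evl vs"
  using wp_eq_iff cong_evl by blast

lemma carrier_wp:
  assumes "g \<in> carrier G" shows "\<exists>us \<in> lists {..<n}. wp us = g"
proof -
  have "g \<in> generate G (s ` {..<n})" using assms cox by (auto simp: coxeter_system_def)
  then show ?thesis
  proof (induction rule: generate.induct)
    case one then show ?case by (intro bexI[of _ "[]"]) auto
  next
    case (incl h) then obtain i where "i < n" "h = s i" by auto
    then show ?case by (intro bexI[of _ "[i]"]) auto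
  next
    case (inv h) then obtain i where "i < n" "h = s i" by auto
    then show ?case by (intro bexI[of _ "[i]"]) auto
  next
    case (eng h1 h2)
    then obtain u v where "u \<in> lists {..<n}" "wp u = h1" "v \<in> lists {..<n}" "wp v = h2" by blast
    then show ?case by (intro bexI[of _ "u @ v"]) (auto simp: wp_append)
  qed
qed

lemma reduced_last_descent:
  assumes "u \<in> lists {..<n}" "i < n" "len n (evl (u @ [i])) = length (u @ [i])"
  shows "des (evl (u @ [i])) i" "len n (evl u) = length u"
proof -
  let ?w = "evl (u @ [i])"
  have w: "?w \<in> sperm n" using assms by (intro evl_sperm) auto
  have u: "?w \<circ> gen i = evl u" by (auto simp: fun_eq_iff)
  have "len n (evl u) \<le> length u" using assms len_evl_le by blast
  then show "des ?w i" "len n (evl u) = length u"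
    using len_gen[OF w assms(2)] assms(3) unfolding u by (auto split: if_splits)
qed

text \<open>Tits' solution of the word problem: two reduced words of the same signed permutation that end
  in different letters can both be rewritten to end in the two sides of a braid relation, and words
  with a common last letter are shortened.\<close>

lemma tits:
  assumes "us \<in> lists {..<n}" "vs \<in> lists {..<n}" "evl us = evl vs"
    "len n (evl us) = length us" "length us = length vs"
  shows "wp us = wp vs"
  using assms
proof (induction "length us" arbitrary: us vs)
  case 0 then show ?case by simp
next
  case (Suc l)
  obtain u i where u: "us = u @ [i]" using Suc(2) by (metis length_Suc_conv_rev)
  obtain v j where v: "vs = v @ [j]" using Suc by (metis length_Suc_conv_rev)
  have L: "u \<in> lists {..<n}" "v \<in> lists {..<n}" "i < n" "j < n" using Suc u v by auto
  have same: "wp (x @ [k]) = wp (y @ [k])"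
    if x: "x \<in> lists {..<n}" and y: "y \<in> lists {..<n}" and k: "k < n"
      and e: "evl (x @ [k]) = evl (y @ [k])"
      and r: "len n (evl (x @ [k])) = Suc l" "length x = l" "length y = l" for x y k
  proof -
    have c: "evl (z @ [k]) \<circ> gen k = evl z" for z by (simp add: fun_eq_iff)
    have "evl x = evl y" using arg_cong[OF e, of "%f. f \<circ> gen k"] unfolding c .
    moreover have "len n (evl x) = length x" using reduced_last_descent(2)[OF x k] r by simp
    ultimately have "wp x = wp y" using Suc(1)[of x y] x y r by simp
    then show ?thesis using x y k by (simp add: wp_append)
  qed
  have step: "wp (x @ [i]) = wp (y @ [j])"
    if x: "x \<in> lists {..<n}" and y: "y \<in> lists {..<n}" and ij: "i < j" "j < n"
      and e: "evl (x @ [i]) = evl (y @ [j])"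
      and r: "len n (evl (x @ [i])) = Suc l" "length x = l" "length y = l" for x y i j
  proof -
    let ?w = "evl (x @ [i])"
    have i: "i < n" using ij by simp
    have w: "?w \<in> sperm n" using x i by (intro evl_sperm) auto
    have d: "des ?w i" using reduced_last_descent(1)[OF x i] r by simp
    have d': "des ?w j" using reduced_last_descent(1)[OF y ij(2)] r e by simp
    obtain a b where ab: "braid_words i j = (a, b)" by fastforce
    obtain z where z: "z \<in> sperm n" "?w = z \<circ> evl a" "?w = z \<circ> evl b" "len n ?w = len n z + length a"
      using rank_two_descent[OF w ij d d' ab] .
    obtain a' b' where a': "a = a' @ [i]" "b = b' @ [j]" "length a' = length b'"
      "a' \<in> lists {..<n}" "b' \<in> lists {..<n}"
    proof -
      show thesis
        using that[of "butlast a" "butlast b"] ab i ij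
        by (auto simp: braid_words_def split: if_splits)
    qed
    obtain p where p: "p \<in> lists {..<n}" "length p = len n z" "evl p = z"
      using reduced_word_exists[OF z(1)] by blast
    have pa: "p @ a' \<in> lists {..<n}" "p @ b' \<in> lists {..<n}" using p a' by auto
    have la: "length (p @ a') = l" "length (p @ b') = l" using p(2) a'(1,3) z(4) r(1) by auto
    have "evl (x @ [i]) = evl p \<circ> evl (a' @ [i])" using z(2) unfolding a'(1) p(3) .
    then have ea: "evl (x @ [i]) = evl ((p @ a') @ [i])" by (simp only: append_assoc evl_append)
    have "evl (x @ [i]) = evl p \<circ> evl (b' @ [j])" using z(3) unfolding a'(2) p(3) .
    then have eb: "evl ((p @ b') @ [j]) = evl (x @ [i])" by (simp only: append_assoc evl_append)
    have "wp (x @ [i]) = wp ((p @ a') @ [i])"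
      by (rule same[OF x pa(1) i ea r(1,2) la(1)])
    also have "\<dots> = wp p \<otimes> wp a" unfolding a'(1) append_assoc
      using p(1) a'(4) i by (intro wp_append) auto
    also have "\<dots> = wp p \<otimes> wp b" unfolding wp_braid[OF ij ab] ..
    also have "\<dots> = wp ((p @ b') @ [j])" unfolding a'(2) append_assoc
      using p(1) a'(5) ij by (intro wp_append[symmetric]) auto
    also have "\<dots> = wp (y @ [j])"
      by (rule same[OF pa(2) y ij(2) HOL.trans[OF eb e] _ la(2) r(3)]) (simp only: eb r(1))
    finally show ?thesis .
  qed
  consider "i = j" | "i < j" | "j < i" by linarith
  then show ?case
  proof cases
    case 1
    show ?thesis unfolding u v 1
      by (rule same[OF L(1,2,4)]) (use Suc(2-) u v 1 in \<open>simp_all del: evl_append\<close>)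
  next
    case 2
    show ?thesis unfolding u v
      by (rule step[OF L(1,2) 2 L(4)]) (use Suc(2-) u v in \<open>simp_all del: evl_append\<close>)
  next
    case 3
    show ?thesis unfolding u v
      by (rule step[OF L(2,1) 3 L(3), symmetric]) (use Suc(2-) u v in \<open>simp_all del: evl_append\<close>)
  qed
qed

text \<open>When appending a letter shortens the product, the old word can be chosen to end in this
  letter, by \<open>tits\<close>.\<close>

lemma reduce_word:
  assumes "us \<in> lists {..<n}"
  shows "\<exists>vs \<in> lists {..<n}. wp vs = wp us \<and> length vs = len n (evl us)"
  using assms
proof (induction us rule: rev_induct)
  case Nil show ?case
    by (intro bexI[of _ "[]"]) (simp_all only: evl_Nil len_id list.size lists.Nil simp_thms)
next
  case (snoc k us)
  have k: "k < n" and us: "us \<in> lists {..<n}" using snoc.prems by auto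
  obtain vs where vs: "vs \<in> lists {..<n}" "wp vs = wp us" "length vs = len n (evl us)"
    using snoc.IH[OF us] by blast
  have e: "evl vs = evl us" using wp_eq_imp_evl_eq[OF vs(1) us vs(2)] .
  have S: "evl us \<in> sperm n" using evl_sperm[OF us] .
  show ?case
  proof (cases "des (evl us) k")
    case False
    then have l: "length (vs @ [k]) = len n (evl (us @ [k]))" using len_gen(1)[OF S k] vs(3) unfolding evl_snoc by simp
    have "wp (vs @ [k]) = wp (us @ [k])" using wp_append[of vs "[k]"] wp_append[of us "[k]"] vs k us by simp
    then show ?thesis using vs(1) k l by (intro bexI[of _ "vs @ [k]"]) (simp_all del: evl_append)
  next
    case True
    let ?v = "evl us \<circ> gen k"
    have v: "?v \<in> sperm n" using S k by (simp add: sperm_comp gen_sperm)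
    obtain x where x: "x \<in> lists {..<n}" "length x = len n ?v" "evl x = ?v"
      using reduced_word_exists[OF v] by blast
    have "len n ?v + 1 = len n (evl us)" using len_gen[OF S k] True by simp
    then have l: "length vs = length (x @ [k])" using vs(3) x(2) by simp
    have xk: "x @ [k] \<in> lists {..<n}" using x k by simp
    have ev: "evl vs = evl (x @ [k])"
      unfolding evl_snoc x(3) e by (simp add: fun_eq_iff)
    have "len n (evl vs) = length vs" unfolding e vs(3) ..
    then have w: "wp us = wp (x @ [k])" using tits[OF vs(1) xk ev _ l] vs(2) by simp
    have "wp (us @ [k]) = wp us \<otimes> s k" using us k wp_append[of us "[k]"] by simp
    also have "\<dots> = wp x \<otimes> s k \<otimes> s k" unfolding w using x(1) k wp_append[of x "[k]"] by simp
    also have "\<dots> = wp x" using x(1) k by (simp add: m_assoc)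
    finally have "wp x = wp (us @ [k])" by (rule HOL.sym)
    moreover have "length x = len n (evl (us @ [k]))" unfolding evl_snoc by (rule x(2))
    ultimately show ?thesis using x(1) by blast
  qed
qed

lemma evl_eq_imp_wp_eq:
  assumes "us \<in> lists {..<n}" "vs \<in> lists {..<n}" "evl us = evl vs" shows "wp us = wp vs"
proof -
  obtain u where u: "u \<in> lists {..<n}" "wp u = wp us" "length u = len n (evl us)"
    using reduce_word[OF assms(1)] by blast
  obtain v where v: "v \<in> lists {..<n}" "wp v = wp vs" "length v = len n (evl vs)"
    using reduce_word[OF assms(2)] by blast
  have "evl u = evl us" "evl v = evl vs"
    using wp_eq_imp_evl_eq[OF u(1) assms(1) u(2)] wp_eq_imp_evl_eq[OF v(1) assms(2) v(2)] .
  then have "wp u = wp v" using tits[OF u(1) v(1)] u(3) v(3) assms(3) by simp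
  then show ?thesis using u v by simp
qed

text \<open>Well defined by \<open>wp_eq_imp_evl_eq\<close> and faithful by \<open>evl_eq_imp_wp_eq\<close>.\<close>

definition act :: "'a => int => int" where
  "act g = evl (SOME us. us \<in> lists {..<n} \<and> wp us = g)"

lemma act_wp: "us \<in> lists {..<n} ==> act (wp us) = evl us"
  unfolding act_def
  by (rule someI2[of _ us]) (auto intro: wp_eq_imp_evl_eq)

lemma act_sperm: "g \<in> carrier G ==> act g \<in> sperm n"
  using carrier_wp act_wp evl_sperm by metis

lemma act_mult: "g \<in> carrier G ==> h \<in> carrier G ==> act (g \<otimes> h) = act g \<circ> act h"
proof -
  assume "g \<in> carrier G" "h \<in> carrier G"
  then obtain u v where uv: "u \<in> lists {..<n}" "wp u = g" "v \<in> lists {..<n}" "wp v = h"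
    using carrier_wp by meson
  then show ?thesis using act_wp[of "u @ v"] act_wp[of u] act_wp[of v] by (auto simp: wp_append)
qed

lemma act_inj: "g \<in> carrier G ==> h \<in> carrier G ==> act g = act h ==> g = h"
  using carrier_wp act_wp evl_eq_imp_wp_eq by metis

lemma act_surj: "w \<in> sperm n ==> \<exists>g \<in> carrier G. act g = w"
  using reduced_word_exists act_wp wp_closed by metis

lemma act_s: "k < n ==> act (s k) = gen k"
  using act_wp[of "[k]"] by simp

lemma t_refl_closed [simp]: "k < n ==> t_refl G s k \<in> carrier G"
  by (induction k) auto

lemma act_t_refl: "k < n ==> act (t_refl G s k) = flip (int k + 1)"
proof (induction k)
  case 0 then show ?case by (simp add: act_s gen_0)
next
  case (Suc k)
  then show ?case using gen_flip[of "Suc k"]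
    by (simp add: act_mult act_s add.commute)
qed

lemma length_eq: assumes "g \<in> carrier G" shows "coxeter_length G {..<n} s g = len n (act g)"
  unfolding coxeter_length_def
proof (rule Least_equality)
  obtain u where u: "u \<in> lists {..<n}" "wp u = g" using carrier_wp assms by blast
  then show "\<exists>us\<in>lists {..<n}. length us = len n (act g) \<and> wp us = g"
    using reduce_word[OF u(1)] act_wp[OF u(1)] by auto
next
  fix k assume "\<exists>us\<in>lists {..<n}. length us = k \<and> wp us = g"
  then show "len n (act g) \<le> k" using len_evl_le act_wp by fastforce
qed

lemma ascent_s: "g \<in> carrier G ==> k < n ==>
    coxeter_length G {..<n} s (g \<otimes> s k) > coxeter_length G {..<n} s g \<longleftrightarrow>
    act g (int k) < act g (int k + 1)"
  using len_gen_iff[OF act_sperm, of g k] by (simp add: length_eq act_mult act_s)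

lemma ascent_t: "g \<in> carrier G ==> k < n ==>
    coxeter_length G {..<n} s (g \<otimes> t_refl G s k) > coxeter_length G {..<n} s g \<longleftrightarrow>
    0 < act g (int k + 1)"
  using len_flip_iff[OF act_sperm, of g "int k + 1"] by (simp add: length_eq act_mult act_t_refl)

end

section \<open>Traces of complex matrices\<close>

lemma sum_card_image_fibres:
  assumes "finite A" "finite B" "f ` A \<subseteq> B"
  shows "card A = (\<Sum>b\<in>B. card {a \<in> A. f a = b})"
proof -
  have "card A = (\<Sum>a\<in>A. 1)" by simp
  also have "\<dots> = (\<Sum>b\<in>B. \<Sum>a | a \<in> A \<and> f a = b. 1)" by (rule sum.group[OF assms, symmetric])
  finally show ?thesis by simp
qed

definition mtrace :: "'a::comm_ring_1 mat => 'a" where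
  "mtrace A = (\<Sum>i<dim_row A. A $$ (i, i))"

lemma mtrace_mult_comm:
  assumes "A \<in> carrier_mat n m" "B \<in> carrier_mat m n"
  shows "mtrace (A * B) = mtrace (B * A)"
proof -
  have "mtrace (A * B) = (\<Sum>i<n. \<Sum>j<m. A $$ (i, j) * B $$ (j, i))"
    using assms by (auto simp: mtrace_def scalar_prod_def atLeast0LessThan intro!: sum.cong)
  also have "\<dots> = (\<Sum>j<m. \<Sum>i<n. A $$ (i, j) * B $$ (j, i))" by (rule sum.swap)
  also have "\<dots> = mtrace (B * A)"
    using assms by (auto simp: mtrace_def scalar_prod_def atLeast0LessThan mult.commute intro!: sum.cong)
  finally show ?thesis .
qed

lemma mtrace_conj:
  assumes "A \<in> carrier_mat n n" "P \<in> carrier_mat n n" "Q \<in> carrier_mat n n" "P * Q = 1\<^sub>m n"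
  shows "mtrace (Q * A * P) = mtrace A"
proof -
  have "mtrace (Q * A * P) = mtrace (P * (Q * A))"
    using assms by (intro mtrace_mult_comm[of _ n n]) auto
  also have "P * (Q * A) = (P * Q) * A"
    by (rule assoc_mult_mat[OF assms(2,3,1), symmetric])
  finally show ?thesis using assms by simp
qed

lemma triangularize:
  fixes A :: "complex mat"
  assumes "A \<in> carrier_mat n n"
  obtains B P Q where "B \<in> carrier_mat n n" "P \<in> carrier_mat n n" "Q \<in> carrier_mat n n"
    "P * Q = 1\<^sub>m n" "Q * P = 1\<^sub>m n" "A = P * B * Q" "upper_triangular B"
proof -
  obtain as where "char_poly A = (\<Prod>a\<leftarrow>as. [:- a, 1:])" using char_poly_factorized[OF assms] by blast
  then obtain B where B: "B \<in> carrier_mat n n" "upper_triangular B" "similar_mat A B"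
    using schur_decomposition_exists[OF assms] by blast
  then obtain P Q where "similar_mat_wit A B P Q" unfolding similar_mat_def by blast
  then show thesis using that B similar_mat_witD2[OF assms] by metis
qed

lemma sum_Nats: "(\<And>i. i \<in> A ==> f i \<in> \<nat>) ==> sum f A \<in> \<nat>"
  by (induction A rule: infinite_finite_induct) auto

text \<open>In triangular form the diagonal entries are idempotent complex numbers.\<close>

lemma idempotent_trace_Nats:
  fixes E :: "complex mat"
  assumes E: "E \<in> carrier_mat n n" "E * E = E"
  shows "mtrace E \<in> \<nat>"
proof -
  obtain B P Q where B: "B \<in> carrier_mat n n" "P \<in> carrier_mat n n" "Q \<in> carrier_mat n n"
    "P * Q = 1\<^sub>m n" "Q * P = 1\<^sub>m n" "E = P * B * Q" "upper_triangular B"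
    using triangularize[OF E(1)] by metis
  have "mtrace E = mtrace B" unfolding B(6) by (rule mtrace_conj[OF B(1,3,2,5)])
  have "Q * E * P = (Q * P) * B * (Q * P)" unfolding B(6)
    using B(1,2,3) by (simp add: assoc_mult_mat[of _ n n _ n _ n])
  then have QEP: "Q * E * P = B" using B by simp
  have "B * B = Q * E * (P * Q) * E * P" unfolding QEP[symmetric]
    using B(1,2,3) E by (simp add: assoc_mult_mat[of _ n n _ n _ n])
  also have "\<dots> = Q * (E * E) * P" using B E by (simp add: assoc_mult_mat[of _ n n _ n _ n])
  finally have BB: "B * B = B" using E QEP by simp
  have d: "B $$ (i, i) \<in> \<nat>" if i: "i < n" for i
  proof -
    have z: "B $$ (i, k) * B $$ (k, i) = 0" if "k < n" "k ~= i" for k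
      using B(7) B(1) i that unfolding upper_triangular_def by (cases "k < i") auto
    have "B $$ (i, i) = (B * B) $$ (i, i)" unfolding BB ..
    also have "\<dots> = (\<Sum>k<n. B $$ (i, k) * B $$ (k, i))"
      using B(1) i by (auto simp: scalar_prod_def atLeast0LessThan)
    also have "\<dots> = (\<Sum>k\<in>{i}. B $$ (i, k) * B $$ (k, i))"
      by (rule sum.mono_neutral_right) (use i z in auto)
    finally have "B $$ (i, i) = 0 \<or> B $$ (i, i) = 1" by simp
    then show ?thesis by auto
  qed
  have "mtrace B \<in> \<nat>" unfolding mtrace_def using d B(1) by (intro sum_Nats) auto
  then show ?thesis using \<open>mtrace E = mtrace B\<close> by simp
qed

text \<open>A polynomial that vanishes at \<open>0\<close> and at all eigenvalues but one turns the vanishing of the power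
  sums into the vanishing of a multiplicity.\<close>

lemma power_sums_zero:
  fixes b :: "nat => complex"
  assumes "\<And>k. k \<ge> 1 ==> (\<Sum>i<n. b i ^ k) = 0" "i < n"
  shows "b i = 0"
proof (rule ccontr)
  assume nz: "b i ~= 0"
  define S where "S = b ` {..<n} - {0, b i}"
  define p where "p = [:0, 1:] * (\<Prod>e\<in>S. [:- e, 1:])"
  have fS: "finite S" by (simp add: S_def)
  have p0: "Polynomial.coeff p 0 = 0" by (simp add: p_def)
  have "(\<Sum>j<n. poly p (b j)) = (\<Sum>j<n. \<Sum>k\<le>degree p. Polynomial.coeff p k * b j ^ k)"
    by (simp add: poly_altdef)
  also have "\<dots> = (\<Sum>k\<le>degree p. Polynomial.coeff p k * (\<Sum>j<n. b j ^ k))"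
    by (subst sum.swap) (simp add: sum_distrib_left)
  also have "\<dots> = 0"
  proof (rule sum.neutral, rule ballI)
    fix k assume "k \<in> {..degree p}"
    show "Polynomial.coeff p k * (\<Sum>j<n. b j ^ k) = 0" using assms(1)[of k] p0 by (cases "k = 0") auto
  qed
  finally have s: "(\<Sum>j<n. poly p (b j)) = 0" .
  have v: "poly p (b j) = (if b j = b i then poly p (b i) else 0)" if "j < n" for j
    using that fS by (auto simp: p_def poly_prod S_def)
  have "(\<Sum>j<n. poly p (b j)) = (\<Sum>j\<in>{j. j < n \<and> b j = b i}. poly p (b i))"
    by (rule sum.mono_neutral_cong_right) (auto simp: v)
  then have "of_nat (card {j. j < n \<and> b j = b i}) * poly p (b i) = 0" using s by simp
  moreover have "poly p (b i) ~= 0" using fS nz by (auto simp: p_def poly_prod S_def)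
  moreover have "card {j. j < n \<and> b j = b i} ~= 0" using assms(2) by auto
  ultimately show False by auto
qed

lemma pow_mat_conj:
  assumes "B \<in> carrier_mat n n" "P \<in> carrier_mat n n" "Q \<in> carrier_mat n n" "Q * P = 1\<^sub>m n" "P * Q = 1\<^sub>m n"
  shows "(P * B * Q) ^\<^sub>m k = P * (B ^\<^sub>m k) * Q"
proof (induction k)
  case 0 then show ?case using assms by simp
next
  case (Suc k)
  have c: "B ^\<^sub>m k \<in> carrier_mat n n" using assms by simp
  have X: "(P * X * Q) * (P * B * Q) = P * (X * B) * Q" if X: "X \<in> carrier_mat n n" for X
  proof -
    have "(P * X * Q) * (P * B * Q) = P * X * (Q * P) * B * Q"
      using assms(1-3) X by (simp add: assoc_mult_mat[of _ n n _ n _ n])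
    then show ?thesis using assms X by (simp add: assoc_mult_mat[of _ n n _ n _ n])
  qed
  have "(P * B * Q) ^\<^sub>m Suc k = (P * B ^\<^sub>m k * Q) * (P * B * Q)" using Suc by simp
  also have "\<dots> = P * (B ^\<^sub>m Suc k) * Q" using X[OF c] by simp
  finally show ?case .
qed

lemma upper_triangular_pow_diag:
  assumes "B \<in> carrier_mat n n" "upper_triangular B" "j \<le> i" "i < n"
  shows "(B ^\<^sub>m k) $$ (i, j) = (if i = j then (B $$ (i, i)) ^ k else (0::'a::comm_ring_1))"
  using assms(3,4)
proof (induction k arbitrary: i j)
  case 0 then show ?case using assms by simp
next
  case (Suc k)
  have c: "B ^\<^sub>m k \<in> carrier_mat n n" using assms by simp
  have "(B ^\<^sub>m Suc k) $$ (i, j) = (\<Sum>l<n. (B ^\<^sub>m k) $$ (i, l) * B $$ (l, j))"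
    using assms(1) c Suc.prems by (simp add: scalar_prod_def atLeast0LessThan)
  also have "\<dots> = (\<Sum>l\<in>{i}. (B ^\<^sub>m k) $$ (i, l) * B $$ (l, j))"
  proof (rule sum.mono_neutral_right)
    show "\<forall>l\<in>{..<n} - {i}. (B ^\<^sub>m k) $$ (i, l) * B $$ (l, j) = 0"
    proof
      fix l assume l: "l \<in> {..<n} - {i}"
      show "(B ^\<^sub>m k) $$ (i, l) * B $$ (l, j) = 0"
      proof (cases "l < i")
        case True then show ?thesis using Suc.IH[of l i] Suc.prems by simp
      next
        case False
        then have "j < l" using l Suc.prems by auto
        then show ?thesis using assms l unfolding upper_triangular_def by auto
      qed
    qed
  qed (use Suc.prems in auto)
  also have "\<dots> = (if i = j then (B $$ (i, i)) ^ Suc k else 0)"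
    using Suc assms(1,2) unfolding upper_triangular_def by auto
  finally show ?case .
qed

lemma strictly_upper_triangular_pow:
  assumes "B \<in> carrier_mat n n" "\<And>i j. j \<le> i ==> i < n ==> B $$ (i, j) = (0::'a::comm_ring_1)"
    "i < n" "j < n" "j < i + k"
  shows "(B ^\<^sub>m k) $$ (i, j) = 0"
  using assms(3-5)
proof (induction k arbitrary: i j)
  case 0 then show ?case using assms by simp
next
  case (Suc k)
  have c: "B ^\<^sub>m k \<in> carrier_mat n n" using assms by simp
  have "(B ^\<^sub>m Suc k) $$ (i, j) = (\<Sum>l<n. (B ^\<^sub>m k) $$ (i, l) * B $$ (l, j))"
    using assms(1) c Suc.prems by (simp add: scalar_prod_def atLeast0LessThan)
  also have "\<dots> = 0"
  proof (rule sum.neutral, rule ballI)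
    fix l assume l: "l \<in> {..<n}"
    show "(B ^\<^sub>m k) $$ (i, l) * B $$ (l, j) = 0"
      using Suc.IH[of i l] Suc.prems l assms(2)[of j l] by (cases "l < i + k") auto
  qed
  finally show ?case .
qed

text \<open>The power sums of the eigenvalues vanish, hence so do the eigenvalues.\<close>

lemma nilpotent_if_traces_zero:
  fixes A :: "complex mat"
  assumes A: "A \<in> carrier_mat n n" and tr: "\<And>k. k \<ge> 1 ==> mtrace (A ^\<^sub>m k) = 0"
  shows "A ^\<^sub>m n = 0\<^sub>m n n"
proof -
  obtain B P Q where B: "B \<in> carrier_mat n n" "P \<in> carrier_mat n n" "Q \<in> carrier_mat n n"
    "P * Q = 1\<^sub>m n" "Q * P = 1\<^sub>m n" "A = P * B * Q" "upper_triangular B"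
    using triangularize[OF A] by metis
  have pw: "A ^\<^sub>m k = P * (B ^\<^sub>m k) * Q" for k unfolding B(6) by (rule pow_mat_conj) (use B in auto)
  have t: "mtrace (A ^\<^sub>m k) = (\<Sum>i<n. (B $$ (i, i)) ^ k)" for k
  proof -
    have c: "B ^\<^sub>m k \<in> carrier_mat n n" using B by simp
    have "mtrace (A ^\<^sub>m k) = mtrace (B ^\<^sub>m k)" unfolding pw by (rule mtrace_conj[OF c B(3,2,5)])
    also have "\<dots> = (\<Sum>i<n. (B $$ (i, i)) ^ k)"
      using upper_triangular_pow_diag[OF B(1,7)] c by (auto simp: mtrace_def intro!: sum.cong)
    finally show ?thesis .
  qed
  have "B $$ (i, i) = 0" if "i < n" for i
    using power_sums_zero[of "%i. B $$ (i, i)" n i] tr that unfolding t by blast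
  then have s: "B $$ (i, j) = 0" if "j \<le> i" "i < n" for i j
    using that B(1,7) unfolding upper_triangular_def by (cases "i = j") auto
  have "B ^\<^sub>m n = 0\<^sub>m n n"
    by (rule eq_matI) (use B strictly_upper_triangular_pow[OF B(1) s] in auto)
  then show ?thesis unfolding pw using B by simp
qed

section \<open>Representations\<close>

lemma representation_iff:
  fixes G (structure)
  assumes "group G"
  shows "representation G d \<rho> \<longleftrightarrow> (\<forall>g\<in>carrier G. \<rho> g \<in> carrier_mat d d) \<and>
    (\<forall>g\<in>carrier G. \<forall>h\<in>carrier G. \<rho> (g \<otimes>\<^bsub>G\<^esub> h) = \<rho> g * \<rho> h) \<and> \<rho> \<one>\<^bsub>G\<^esub> = 1\<^sub>m d"
    (is "_ = ?R")
proof
  interpret group G by fact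
  let ?M = "ring_mat TYPE(complex) d ()"
  interpret M: ring ?M by (rule ring_mat)
  interpret U: group "units_of ?M" by (rule M.units_group)
  have U: "carrier (units_of ?M) \<subseteq> carrier_mat d d"
    by (auto simp: units_of_carrier Units_def ring_mat_def)
  have um: "monoid.mult (units_of ?M) = (*)" and uo: "one (units_of ?M) = 1\<^sub>m d"
    by (simp_all add: units_of_def ring_mat_def)
  show ?R if r: "representation G d \<rho>"
  proof -
    interpret group_hom G "units_of ?M" \<rho>
      using r by unfold_locales (simp add: representation_def)
    show ?thesis using hom_closed U hom_mult hom_one unfolding um uo by auto
  qed
  show "representation G d \<rho>" if r: ?R
  proof -
    have "\<rho> g \<in> Units ?M" if g: "g \<in> carrier G" for g
    proof -
      have "\<rho> (inv g) * \<rho> g = 1\<^sub>m d" "\<rho> g * \<rho> (inv g) = 1\<^sub>m d"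
        using r g by (metis inv_closed l_inv, metis inv_closed r_inv)
      then show ?thesis using r g unfolding Units_def ring_mat_def by auto
    qed
    then show ?thesis using r unfolding representation_def
      by (intro homI) (auto simp: um units_of_carrier)
  qed
qed

lemma rep_character_eq: "representation G d \<rho> ==> group G ==> g \<in> carrier G ==>
    rep_character G d \<rho> g = mtrace (\<rho> g)"
  by (auto simp: rep_character_def mtrace_def representation_iff)

lemma rep_character_class_function:
  fixes G (structure)
  assumes "group G" "representation G d \<rho>" "g \<in> carrier G" "x \<in> carrier G"
  shows "rep_character G d \<rho> (x \<otimes>\<^bsub>G\<^esub> g \<otimes>\<^bsub>G\<^esub> inv\<^bsub>G\<^esub> x) = rep_character G d \<rho> g"
proof -
  interpret group G by fact
  have r: "\<And>g. g \<in> carrier G ==> \<rho> g \<in> carrier_mat d d"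
    "\<And>g h. g \<in> carrier G ==> h \<in> carrier G ==> \<rho> (g \<otimes> h) = \<rho> g * \<rho> h" "\<rho> \<one> = 1\<^sub>m d"
    using assms(2) by (auto simp: representation_iff[OF assms(1)])
  have "mtrace (\<rho> x * \<rho> g * \<rho> (inv x)) = mtrace (\<rho> g)"
    using r assms(3,4) r(2)[of "inv x" x] by (intro mtrace_conj[of _ d]) auto
  then show ?thesis using assms(3,4) rep_character_eq[OF assms(2,1)] r(2) by simp
qed

lemma twist_representation:
  fixes G (structure) and \<epsilon> :: "'a => complex"
  assumes "group G" "representation G d \<rho>"
    and e: "\<epsilon> \<one> = 1" "\<And>g h. g \<in> carrier G ==> h \<in> carrier G ==> \<epsilon> (g \<otimes> h) = \<epsilon> g * \<epsilon> h"
  shows "\<exists>\<rho>'. representation G d \<rho>' \<and> rep_character G d \<rho>' = (%g. \<epsilon> g * rep_character G d \<rho> g)"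
proof -
  interpret group G by fact
  have r: "\<And>g. g \<in> carrier G ==> \<rho> g \<in> carrier_mat d d"
    "\<And>g h. g \<in> carrier G ==> h \<in> carrier G ==> \<rho> (g \<otimes> h) = \<rho> g * \<rho> h" "\<rho> \<one> = 1\<^sub>m d"
    using assms(2) by (auto simp: representation_iff[OF assms(1)])
  let ?r = "%g. \<epsilon> g \<cdot>\<^sub>m \<rho> g"
  have m: "?r (g \<otimes> h) = ?r g * ?r h" if "g \<in> carrier G" "h \<in> carrier G" for g h
  proof (rule eq_matI)
    fix i j assume ij: "i < dim_row (?r g * ?r h)" "j < dim_col (?r g * ?r h)"
    then have ij: "i < d" "j < d" using r(1)[of g] r(1)[of h] that by auto
    show "?r (g \<otimes> h) $$ (i, j) = (?r g * ?r h) $$ (i, j)"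
      using r(1)[of g] r(1)[of h] that ij r(1)[of "g \<otimes> h"]
      by (simp add: r(2) e(2) scalar_prod_def sum_distrib_left mult_ac)
  qed (use r(1)[of g] r(1)[of h] r(1)[of "g \<otimes> h"] that in auto)
  have "representation G d ?r" unfolding representation_iff[OF assms(1)]
    using r m e by auto
  moreover have "rep_character G d ?r = (%g. \<epsilon> g * rep_character G d \<rho> g)"
  proof
    fix g show "rep_character G d ?r g = \<epsilon> g * rep_character G d \<rho> g"
    proof (cases "g \<in> carrier G")
      case True then show ?thesis using r(1)[of g] by (simp add: rep_character_def sum_distrib_left)
    qed (simp add: rep_character_def)
  qed
  ultimately show ?thesis by blast
qed

lemma permutation_representation:
  fixes G (structure) and \<alpha> :: "'a => 'b => 'b"
  assumes "group G" "finite \<Omega>"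
    and a: "\<And>g w. g \<in> carrier G ==> w \<in> \<Omega> ==> \<alpha> g w \<in> \<Omega>" "\<And>w. w \<in> \<Omega> ==> \<alpha> \<one> w = w"
      "\<And>g h w. g \<in> carrier G ==> h \<in> carrier G ==> w \<in> \<Omega> ==> \<alpha> (g \<otimes> h) w = \<alpha> g (\<alpha> h w)"
  shows "\<exists>d \<rho>. representation G d \<rho> \<and> rep_character G d \<rho> =
    (%g. if g \<in> carrier G then of_nat (card {w \<in> \<Omega>. \<alpha> g w = w}) else 0)"
proof -
  interpret group G by fact
  let ?d = "card \<Omega>"
  obtain e where e: "bij_betw e {0..<?d} \<Omega>" using ex_bij_betw_nat_finite[OF assms(2)] by blast
  have ei: "e i \<in> \<Omega>" if "i < ?d" for i using e that by (auto simp: bij_betw_def)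
  have inj: "e i = e j \<longleftrightarrow> i = j" if "i < ?d" "j < ?d" for i j
    using e that by (auto simp: bij_betw_def dest: inj_onD)
  have sur: "\<exists>l<?d. e l = w" if "w \<in> \<Omega>" for w
    using e that by (auto simp: bij_betw_def) (metis atLeastLessThan_iff imageE)
  let ?r = "%g. mat ?d ?d (%(i, j). if \<alpha> g (e j) = e i then 1 else (0::complex))"
  have m: "?r (g \<otimes> h) = ?r g * ?r h" if gh: "g \<in> carrier G" "h \<in> carrier G" for g h
  proof (rule eq_matI)
    fix i j assume "i < dim_row (?r g * ?r h)" "j < dim_col (?r g * ?r h)"
    then have ij: "i < ?d" "j < ?d" by auto
    obtain l where l: "l < ?d" "e l = \<alpha> h (e j)" using sur a(1)[OF gh(2) ei[OF ij(2)]] by blast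
    have "(?r g * ?r h) $$ (i, j) = (\<Sum>k<?d. (if \<alpha> g (e k) = e i then 1 else 0) * (if \<alpha> h (e j) = e k then 1 else 0))"
      using ij by (simp add: scalar_prod_def atLeast0LessThan)
    also have "\<dots> = (\<Sum>k\<in>{l}. (if \<alpha> g (e k) = e i then 1 else 0) * (if \<alpha> h (e j) = e k then 1 else 0))"
      by (rule sum.mono_neutral_right) (use l inj in \<open>auto simp flip: l(2)\<close>)
    also have "\<dots> = ?r (g \<otimes> h) $$ (i, j)"
      using ij l a(3)[OF gh ei[OF ij(2)]] by simp
    finally show "?r (g \<otimes> h) $$ (i, j) = (?r g * ?r h) $$ (i, j)" by simp
  qed auto
  have o: "?r \<one> = 1\<^sub>m ?d"
    by (rule eq_matI) (use a(2) ei inj in auto)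
  have "representation G ?d ?r" unfolding representation_iff[OF assms(1)]
    using m o by auto
  moreover have "rep_character G ?d ?r g = of_nat (card {w \<in> \<Omega>. \<alpha> g w = w})" if "g \<in> carrier G" for g
  proof -
    have "e ` {i \<in> {0..<?d}. \<alpha> g (e i) = e i} = {w \<in> \<Omega>. \<alpha> g w = w}"
    proof (intro equalityI subsetI)
      fix w assume w: "w \<in> {w \<in> \<Omega>. \<alpha> g w = w}"
      then obtain l where "l < ?d" "e l = w" using sur by blast
      then show "w \<in> e ` {i \<in> {0..<?d}. \<alpha> g (e i) = e i}" using w by force
    qed (use ei in auto)
    then have "bij_betw e {i \<in> {0..<?d}. \<alpha> g (e i) = e i} {w \<in> \<Omega>. \<alpha> g w = w}"
      using e unfolding bij_betw_def by (auto intro: inj_on_subset)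
    then have "card {w \<in> \<Omega>. \<alpha> g w = w} = card {i \<in> {0..<?d}. \<alpha> g (e i) = e i}"
      by (simp add: bij_betw_same_card)
    moreover have "rep_character G ?d ?r g = (\<Sum>i<?d. if \<alpha> g (e i) = e i then 1 else 0)"
      using that by (simp add: rep_character_def)
    moreover have "\<dots> = (\<Sum>i\<in>{i \<in> {0..<?d}. \<alpha> g (e i) = e i}. 1)"
      by (rule sum.mono_neutral_cong_right) auto
    ultimately show ?thesis by simp
  qed
  ultimately show ?thesis
    by (intro exI[of _ ?d] exI[of _ ?r]) (auto simp: rep_character_def fun_eq_iff)
qed

text \<open>The average of the operators \<open>\<rho> h\<close> is idempotent.\<close>

lemma average_character_Nats:
  fixes G (structure)
  assumes "group G" "representation G d \<rho>" "subgroup H G" "finite H"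
  shows "(\<Sum>h\<in>H. rep_character G d \<rho> h) / of_nat (card H) \<in> \<nat>"
proof -
  interpret group G by fact
  interpret H: subgroup H G by fact
  have r: "\<And>g. g \<in> carrier G ==> \<rho> g \<in> carrier_mat d d"
    "\<And>g h. g \<in> carrier G ==> h \<in> carrier G ==> \<rho> (g \<otimes> h) = \<rho> g * \<rho> h" "\<rho> \<one> = 1\<^sub>m d"
    using assms(2) by (auto simp: representation_iff[OF assms(1)])
  have c: "card H ~= 0" using assms(4) H.one_closed by (metis card_0_eq empty_iff)
  let ?E = "mat d d (%(i, j). (\<Sum>h\<in>H. \<rho> h $$ (i, j)) / of_nat (card H))"
  have "?E * ?E = ?E"
  proof (rule eq_matI)
    fix i j assume "i < dim_row ?E" "j < dim_col ?E"
    then have ij: "i < d" "j < d" by auto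
    have "(?E * ?E) $$ (i, j) = (\<Sum>l<d. ((\<Sum>h\<in>H. \<rho> h $$ (i, l)) / of_nat (card H)) * ((\<Sum>k\<in>H. \<rho> k $$ (l, j)) / of_nat (card H)))"
      using ij by (simp add: scalar_prod_def atLeast0LessThan)
    also have "\<dots> = (\<Sum>l<d. \<Sum>h\<in>H. \<Sum>k\<in>H. \<rho> h $$ (i, l) * \<rho> k $$ (l, j)) / of_nat (card H) / of_nat (card H)"
      by (simp add: sum_divide_distrib sum_product)
    also have "(\<Sum>l<d. \<Sum>h\<in>H. \<Sum>k\<in>H. \<rho> h $$ (i, l) * \<rho> k $$ (l, j)) =
        (\<Sum>h\<in>H. \<Sum>k\<in>H. \<Sum>l<d. \<rho> h $$ (i, l) * \<rho> k $$ (l, j))"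
      by (subst sum.swap) (intro sum.cong HOL.refl sum.swap)
    also have "\<dots> = (\<Sum>h\<in>H. \<Sum>k\<in>H. \<rho> (h \<otimes> k) $$ (i, j))"
    proof (intro sum.cong HOL.refl)
      fix h k assume "h \<in> H" "k \<in> H"
      then have "h \<in> carrier G" "k \<in> carrier G" by auto
      then show "(\<Sum>l<d. \<rho> h $$ (i, l) * \<rho> k $$ (l, j)) = \<rho> (h \<otimes> k) $$ (i, j)"
        using r(1)[of h] r(1)[of k] ij by (simp add: r(2) scalar_prod_def atLeast0LessThan)
    qed
    also have "\<dots> = (\<Sum>h\<in>H. \<Sum>k\<in>H. \<rho> k $$ (i, j))"
    proof (rule sum.cong[OF HOL.refl])
      fix h assume h: "h \<in> H"
      show "(\<Sum>k\<in>H. \<rho> (h \<otimes> k) $$ (i, j)) = (\<Sum>k\<in>H. \<rho> k $$ (i, j))"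
        by (rule sum.reindex_bij_witness[of _ "%k. inv h \<otimes> k" "%k. h \<otimes> k"])
          (use h in \<open>auto simp: m_assoc[symmetric]\<close>)
    qed
    finally show "(?E * ?E) $$ (i, j) = ?E $$ (i, j)" using ij c by simp
  qed auto
  then have "mtrace ?E \<in> \<nat>" by (intro idempotent_trace_Nats[of _ d]) auto
  also have "mtrace ?E = (\<Sum>i<d. \<Sum>h\<in>H. \<rho> h $$ (i, i)) / of_nat (card H)"
    by (simp add: mtrace_def sum_divide_distrib)
  also have "(\<Sum>i<d. \<Sum>h\<in>H. \<rho> h $$ (i, i)) = (\<Sum>h\<in>H. rep_character G d \<rho> h)"
    by (subst sum.swap) (auto simp: rep_character_def intro!: sum.cong)
  finally show ?thesis .
qed

lemma frobenius_trivial: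
  fixes G (structure) and \<chi> :: "'a => complex"
  assumes "group G" "finite (carrier G)" "subgroup H G"
    and cf: "\<And>g x. g \<in> carrier G ==> x \<in> carrier G ==> \<chi> (x \<otimes> g \<otimes> inv x) = \<chi> g"
  shows "(\<Sum>g\<in>carrier G. \<chi> g * induced G H (%_. 1) g) =
    of_nat (card (carrier G)) * ((\<Sum>h\<in>H. \<chi> h) / of_nat (card H))"
proof -
  interpret group G by fact
  interpret H: subgroup H G by fact
  have fH: "finite H" using assms(2) H.subset by (rule rev_finite_subset)
  have "(\<Sum>g\<in>carrier G. \<chi> g * induced G H (%_. 1) g) =
      (\<Sum>g\<in>carrier G. \<Sum>x\<in>carrier G. if inv x \<otimes> g \<otimes> x \<in> H then \<chi> g / of_nat (card H) else 0)"
  proof (rule sum.cong[OF HOL.refl])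
    fix g assume g: "g \<in> carrier G"
    have "(\<Sum>x\<in>carrier G. if inv x \<otimes> g \<otimes> x \<in> H then \<chi> g / of_nat (card H) else 0)
       = (\<Sum>x\<in>{x \<in> carrier G. inv x \<otimes> g \<otimes> x \<in> H}. \<chi> g / of_nat (card H))"
      by (rule sum.mono_neutral_cong_right) (use assms(2) in auto)
    then show "\<chi> g * induced G H (%_. 1) g = (\<Sum>x\<in>carrier G. if inv x \<otimes> g \<otimes> x \<in> H then \<chi> g / of_nat (card H) else 0)"
      using g by (simp add: induced_def)
  qed
  also have "\<dots> = (\<Sum>x\<in>carrier G. \<Sum>g\<in>carrier G. if inv x \<otimes> g \<otimes> x \<in> H then \<chi> g / of_nat (card H) else 0)"
    by (rule sum.swap)
  also have "\<dots> = (\<Sum>x\<in>carrier G. (\<Sum>h\<in>H. \<chi> h) / of_nat (card H))"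
  proof (rule sum.cong[OF HOL.refl])
    fix x assume x: "x \<in> carrier G"
    have c: "inv x \<otimes> (x \<otimes> y) = y" "x \<otimes> (inv x \<otimes> y) = y" if "y \<in> carrier G" for y
      using x that by (simp_all add: m_assoc[symmetric])
    have a: "inv x \<otimes> (x \<otimes> h \<otimes> inv x) \<otimes> x = h" if "h \<in> carrier G" for h
      using x that by (simp add: m_assoc c)
    have b: "x \<otimes> (inv x \<otimes> g \<otimes> x) \<otimes> inv x = g" if "g \<in> carrier G" for g
      using x that by (simp add: m_assoc c)
    have d: "\<chi> (inv x \<otimes> g \<otimes> x) = \<chi> g" if "g \<in> carrier G" for g
      using cf[of "inv x \<otimes> g \<otimes> x" x] b[OF that] x that by simp
    have "(\<Sum>g\<in>carrier G. if inv x \<otimes> g \<otimes> x \<in> H then \<chi> g / of_nat (card H) else 0)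
       = (\<Sum>g\<in>{g \<in> carrier G. inv x \<otimes> g \<otimes> x \<in> H}. \<chi> g / of_nat (card H))"
      by (rule sum.mono_neutral_cong_right) (use assms(2) in auto)
    also have "\<dots> = (\<Sum>h\<in>H. \<chi> h / of_nat (card H))"
      by (rule sum.reindex_bij_witness[of _ "%h. x \<otimes> h \<otimes> inv x" "%g. inv x \<otimes> g \<otimes> x"])
        (use x a b d H.subset in \<open>auto simp: subset_iff\<close>)
    finally show "(\<Sum>g\<in>carrier G. if inv x \<otimes> g \<otimes> x \<in> H then \<chi> g / of_nat (card H) else 0)
        = (\<Sum>h\<in>H. \<chi> h) / of_nat (card H)" by (simp add: sum_divide_distrib)
  qed
  finally show ?thesis by simp
qed

text \<open>It is the permutation character of the left cosets.\<close>

lemma induced_trivial_is_character: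
  fixes G (structure)
  assumes "group G" "finite (carrier G)" "subgroup H G"
  shows "\<exists>d \<rho>. representation G d \<rho> \<and> rep_character G d \<rho> = induced G H (%_. 1)"
proof -
  interpret group G by fact
  interpret H: subgroup H G by fact
  have fH: "finite H" using assms(2) H.subset by (rule rev_finite_subset)
  have c: "card H ~= 0" using fH H.one_closed by (metis card_0_eq empty_iff)
  let ?\<Omega> = "(%x. x <# H) ` carrier G"
  have as: "g <# (x <# H) = (g \<otimes> x) <# H" if "g \<in> carrier G" "x \<in> carrier G" for g x
    using lcos_m_assoc[OF H.subset that] .
  have 1: "\<exists>d \<rho>. representation G d \<rho> \<and> rep_character G d \<rho> =
    (%g. if g \<in> carrier G then of_nat (card {w \<in> ?\<Omega>. g <# w = w}) else 0)"
    by (rule permutation_representation[OF assms(1)]) (use assms(2) as in \<open>auto simp: m_assoc\<close>)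
  have eq: "y <# H = x <# H \<longleftrightarrow> inv x \<otimes> y \<in> H" if xy: "x \<in> carrier G" "y \<in> carrier G" for x y
  proof
    assume "y <# H = x <# H"
    moreover have "y \<in> y <# H" using xy H.one_closed by (force simp: l_coset_def)
    ultimately have "y \<in> x <# H" by simp
    then obtain h where "h \<in> H" "y = x \<otimes> h" by (auto simp: l_coset_def)
    then show "inv x \<otimes> y \<in> H" using xy by (simp add: m_assoc[symmetric])
  next
    assume "inv x \<otimes> y \<in> H"
    then have "y \<in> x <# H" using xy by (auto simp: l_coset_def m_assoc[symmetric] intro!: bexI[of _ "inv x \<otimes> y"])
    then show "y <# H = x <# H" using l_repr_independence[OF _ xy(1) assms(3)] by simp
  qed
  have "of_nat (card {w \<in> ?\<Omega>. g <# w = w}) = induced G H (%_. 1) g" if g: "g \<in> carrier G" for g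
  proof -
    let ?F = "{w \<in> ?\<Omega>. g <# w = w}"
    let ?X = "{x \<in> carrier G. inv x \<otimes> g \<otimes> x \<in> H}"
    have X: "?X = {x \<in> carrier G. x <# H \<in> ?F}"
    proof -
      have "g <# (x <# H) = x <# H \<longleftrightarrow> inv x \<otimes> g \<otimes> x \<in> H" if "x \<in> carrier G" for x
        using g that by (simp add: as eq m_assoc)
      then show ?thesis by auto
    qed
    have "card ?X = (\<Sum>w\<in>?F. card {x \<in> ?X. x <# H = w})"
      by (rule sum_card_image_fibres) (use assms(2) X in \<open>auto\<close>)
    also have "\<dots> = (\<Sum>w\<in>?F. card H)"
    proof (rule sum.cong[OF HOL.refl])
      fix w assume w: "w \<in> ?F"
      then obtain y where y: "y \<in> carrier G" "w = y <# H" by blast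
      have "{x \<in> ?X. x <# H = w} = (%h. y \<otimes> h) ` H"
      proof (intro equalityI subsetI)
        fix x assume "x \<in> {x \<in> ?X. x <# H = w}"
        then have "x \<in> carrier G" "inv y \<otimes> x \<in> H" using y eq by auto
        then show "x \<in> (%h. y \<otimes> h) ` H" using y by (auto simp: m_assoc[symmetric] intro!: image_eqI[of _ _ "inv y \<otimes> x"])
      next
        fix x assume "x \<in> (%h. y \<otimes> h) ` H"
        then obtain h where h: "h \<in> H" "x = y \<otimes> h" by blast
        then have "x \<in> carrier G" "x <# H = w" using y eq[of y x] by (auto simp: m_assoc[symmetric])
        then show "x \<in> {x \<in> ?X. x <# H = w}" unfolding X using w by auto
      qed
      moreover have "inj_on (%h. y \<otimes> h) H" using y by (auto simp: inj_on_def)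
      ultimately show "card {x \<in> ?X. x <# H = w} = card H" by (simp add: card_image)
    qed
    finally have "card ?X = card ?F * card H" by simp
    then show ?thesis using g c by (simp add: induced_def)
  qed
  then have "(%g. if g \<in> carrier G then of_nat (card {w \<in> ?\<Omega>. g <# w = w}) else 0) = induced G H (%_. 1)"
    by (auto simp: fun_eq_iff induced_def)
  then show ?thesis using 1 by simp
qed

text \<open>A basis of \<open>U\<close> extended to a basis of the whole space, as the columns of \<open>P\<close>.\<close>

lemma (in vec_space) invariant_flag:
  assumes U: "subspace class_ring U V" "U ~= {0\<^sub>v n}" "U ~= carrier_vec n"
  obtains k P Q where "0 < k" "k < n" "P \<in> carrier_mat n n" "Q \<in> carrier_mat n n"
    "P * Q = 1\<^sub>m n" "Q * P = 1\<^sub>m n" "\<And>j. j < k ==> col P j \<in> U"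
    "\<And>u i. u \<in> U ==> k \<le> i ==> i < n ==> row Q i \<bullet> u = 0"
proof -
  have sm: "submodule class_ring U V" using U(1) by (simp add: subspace_def)
  have Uc: "U \<subseteq> carrier_vec n" using submodule.subset[OF sm] by simp
  have li: "finite A \<and> card A \<le> n" if "A \<subseteq> carrier_vec n" "lin_indpt A" for A
    using li_le_dim[OF fin_dim _ that(2)] that(1) dim_is_n by auto
  have e0: "lin_indpt {}" by (auto simp: lin_dep_def)
  obtain A where A: "finite A" "maximal A (%A. A \<subseteq> U \<and> lin_indpt A)"
    using maximal_exists[of "%A. A \<subseteq> U \<and> lin_indpt A" n "{}"] li[OF subset_trans[OF _ Uc]] e0 by blast
  have AU: "A \<subseteq> U" "lin_indpt A" using A(2) by (auto simp: maximal_def)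
  have Ac: "A \<subseteq> carrier_vec n" using AU Uc by blast
  have sp: "U \<subseteq> span A"
  proof
    fix u assume u: "u \<in> U"
    show "u \<in> span A"
    proof (rule ccontr)
      assume n: "u \<notin> span A"
      then have "u \<notin> A" using in_own_span[of A] Ac by auto
      then have "lin_indpt (A \<union> {u})" using lin_dep_iff_in_span[of A u] Ac AU u Uc n by auto
      then have "A \<union> {u} = A" using A(2) AU u unfolding maximal_def by blast
      then show False using \<open>u \<notin> A\<close> by blast
    qed
  qed
  obtain B where B: "finite B" "maximal B (%A. A \<subseteq> carrier V \<and> lin_indpt A)" "A \<subseteq> B"
  proof -
    obtain B where "finite B" and B: "maximal B (%S. A \<subseteq> S \<and> S \<subseteq> carrier V \<and> lin_indpt S)"
      using maximal_exists[of "%S. A \<subseteq> S \<and> S \<subseteq> carrier V \<and> lin_indpt S" n A] li Ac AU by auto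
    have "maximal B (%A. A \<subseteq> carrier V \<and> lin_indpt A)" "A \<subseteq> B"
      using B unfolding maximal_def by blast+
    then show thesis using that \<open>finite B\<close> by blast
  qed
  have Bc: "B \<subseteq> carrier_vec n" "lin_indpt B" using B(2) by (auto simp: maximal_def)
  have "basis B" using max_li_is_basis[of B] B(2) by simp
  then have cB: "card B = n" using dim_basis[OF B(1)] dim_is_n by simp
  obtain as where as: "set as = A" "distinct as" using finite_distinct_list[OF A(1)] by blast
  obtain bs where bs: "set bs = B - A" "distinct bs" using finite_distinct_list[of "B - A"] B(1) by blast
  let ?l = "as @ bs"
  let ?k = "length as"
  let ?P = "mat_of_cols n ?l"
  have l: "set ?l = B" "distinct ?l" using as bs B(3) by auto
  have len: "length ?l = n" using distinct_card[OF l(2)] l(1) cB by simp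
  have P: "?P \<in> carrier_mat n n" using len by auto
  have cols: "cols ?P = ?l" using l(1) Bc(1) by (intro cols_mat_of_cols) auto
  have "rank ?P = n" using lin_indpt_full_rank[OF P] cols l Bc(2) by simp
  then have "det ?P ~= 0" using det_zero_low_rank[OF P] by fastforce
  then have "?P \<in> Units (ring_mat TYPE('a) n ())" by (rule det_non_zero_imp_unit[OF P])
  then obtain Q where Q: "Q \<in> carrier_mat n n" "?P * Q = 1\<^sub>m n" "Q * ?P = 1\<^sub>m n"
    unfolding Units_def ring_mat_def by auto
  have colP: "col ?P j = ?l ! j" if "j < n" for j
    using that len cols P by (metis carrier_matD(2) cols_nth)
  have k0: "0 < ?k"
  proof (rule ccontr)
    assume "\<not> 0 < ?k"
    then have "A = {}" using as by auto
    then have "U \<subseteq> {0\<^sub>v n}" using sp span_empty by auto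
    then show False using U(2) submodule.zero_closed[OF sm] by auto
  qed
  have kn: "?k < n"
  proof (rule ccontr)
    assume "\<not> ?k < n"
    moreover have "length as + length bs = n" using len by simp
    ultimately have "length bs = 0" by linarith
    then have "bs = []" by simp
    then have "A = B" using bs B(3) by auto
    then have "span A = carrier_vec n" using \<open>basis B\<close> by (simp add: basis_def)
    moreover have "span A \<subseteq> U" by (rule span_is_subset[OF AU(1) sm])
    ultimately show False using U(3) Uc by blast
  qed
  have z: "row Q i \<bullet> u = 0" if u: "u \<in> U" and i: "?k \<le> i" "i < n" for u i
  proof -
    let ?N = "{u \<in> carrier_vec n. row Q i \<bullet> u = 0}"
    have rQ: "row Q i \<in> carrier_vec n" using Q(1) i by auto
    have "submodule class_ring ?N V"
      by (unfold_locales)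
        (use rQ in \<open>auto simp: module_vec_simps class_ring_simps scalar_prod_add_distrib[of _ n]\<close>)
    moreover have "A \<subseteq> ?N"
    proof
      fix a assume a: "a \<in> A"
      then obtain j where j: "j < ?k" "as ! j = a" using as by (metis in_set_conv_nth)
      then have jn: "j < n" "j ~= i" using kn i by auto
      have "row Q i \<bullet> a = (Q * ?P) $$ (i, j)"
        using colP[of j] j jn i Q(1) P by (simp add: nth_append)
      then show "a \<in> ?N" using Q(3) jn i a Ac by auto
    qed
    ultimately have "span A \<subseteq> ?N" by (intro span_is_subset)
    then show ?thesis using sp u by auto
  qed
  have "col ?P j \<in> U" if "j < ?k" for j
  proof -
    have "j < n" using that kn by simp
    then have "col ?P j = as ! j" using colP[of j] that by (simp add: nth_append)
    then show ?thesis using that as AU by auto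
  qed
  then show thesis using that[OF k0 kn P Q] z by blast
qed

text \<open>A proper invariant subspace makes the representation block triangular, and the character is
  the sum of the characters of the two diagonal blocks.\<close>

lemma character_in_Irr_span:
  fixes G (structure)
  assumes "group G" "representation G d \<rho>"
  shows "rep_character G d \<rho> \<in> generate (add_monoid (function_ring G)) (Irr G)"
  using assms(2)
proof (induction d arbitrary: \<rho> rule: less_induct)
  case (less d)
  interpret group G by fact
  let ?S = "generate (add_monoid (function_ring G)) (Irr G)"
  have r: "\<And>g. g \<in> carrier G ==> \<rho> g \<in> carrier_mat d d"
    "\<And>g h. g \<in> carrier G ==> h \<in> carrier G ==> \<rho> (g \<otimes> h) = \<rho> g * \<rho> h" "\<rho> \<one> = 1\<^sub>m d"
    using less.prems by (auto simp: representation_iff[OF assms(1)])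
  show ?case
  proof (cases "d = 0 \<or> irreducible_representation G d \<rho>")
    case True
    then show ?thesis
    proof
      assume "d = 0"
      then have "rep_character G d \<rho> = one (add_monoid (function_ring G))"
        by (auto simp: rep_character_def function_ring_def fun_eq_iff)
      then show ?thesis using generate.one by metis
    next
      assume "irreducible_representation G d \<rho>"
      then show ?thesis by (intro generate.incl) (auto simp: Irr_def)
    qed
  next
    case False
    interpret vec_space "TYPE(complex)" d .
    have "\<exists>U. (subspace class_ring U V \<and> (\<forall>g\<in>carrier G. \<forall>u\<in>U. \<rho> g *\<^sub>v u \<in> U))
        \<and> U ~= {0\<^sub>v d} \<and> U ~= carrier_vec d"
      using False less.prems unfolding irreducible_representation_def by auto
    then obtain U where U: "subspace class_ring U V" "U ~= {0\<^sub>v d}" "U ~= carrier_vec d"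
      and inv: "\<And>g u. g \<in> carrier G ==> u \<in> U ==> \<rho> g *\<^sub>v u \<in> U"
      by blast
    have "submodule class_ring U V" using U(1) by (simp add: subspace_def)
    then have Uc: "U \<subseteq> carrier_vec d" using submodule.subset by fastforce
    obtain k P Q where k: "0 < k" "k < d" and PQ: "P \<in> carrier_mat d d" "Q \<in> carrier_mat d d"
        "P * Q = 1\<^sub>m d" "Q * P = 1\<^sub>m d" and cP: "\<And>j. j < k ==> col P j \<in> U"
        and rQ: "\<And>u i. u \<in> U ==> k \<le> i ==> i < d ==> row Q i \<bullet> u = 0"
      using invariant_flag[OF U] by metis
    define M where "M g = Q * \<rho> g * P" for g
    have Mc: "M g \<in> carrier_mat d d" if "g \<in> carrier G" for g
      using that r(1) PQ by (auto simp: M_def)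
    have Mm: "M (g \<otimes> h) = M g * M h" if gh: "g \<in> carrier G" "h \<in> carrier G" for g h
    proof -
      have "M g * M h = Q * \<rho> g * (P * Q) * \<rho> h * P"
        using r(1)[OF gh(1)] r(1)[OF gh(2)] PQ(1,2) by (simp add: M_def assoc_mult_mat[of _ d d _ d _ d])
      also have "\<dots> = M (g \<otimes> h)"
        using r(1)[OF gh(1)] r(1)[OF gh(2)] PQ gh by (simp add: M_def r(2) assoc_mult_mat[of _ d d _ d _ d])
      finally show ?thesis by simp
    qed
    have M1: "M \<one> = 1\<^sub>m d" using r(3) PQ by (simp add: M_def)
    have Mz: "M g $$ (i, j) = 0" if g: "g \<in> carrier G" and ij: "k \<le> i" "i < d" "j < k" for g i j
    proof -
      have u: "\<rho> g *\<^sub>v col P j \<in> U" using inv g cP ij by blast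
      have "M g $$ (i, j) = (Q * (\<rho> g * P)) $$ (i, j)"
        using r(1)[OF g] PQ by (simp add: M_def)
      also have "\<dots> = row Q i \<bullet> col (\<rho> g * P) j"
        using r(1)[OF g] PQ ij k by simp
      also have "col (\<rho> g * P) j = \<rho> g *\<^sub>v col P j"
        using r(1)[OF g] PQ ij k by (intro col_mult2[of _ d d _ d]) auto
      finally show ?thesis using rQ[OF u] ij by simp
    qed
    have Mp: "(M g * M h) $$ (i, j) = (\<Sum>l<d. M g $$ (i, l) * M h $$ (l, j))"
      if "g \<in> carrier G" "h \<in> carrier G" "i < d" "j < d" for g h i j
      using Mc[OF that(1)] Mc[OF that(2)] that(3,4) by (simp add: scalar_prod_def atLeast0LessThan)
    let ?A = "%g. mat k k (%(i, j). M g $$ (i, j))"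
    let ?B = "%g. mat (d - k) (d - k) (%(i, j). M g $$ (i + k, j + k))"
    have split: "(\<Sum>l<d. f l) = (\<Sum>l<k. f l) + (\<Sum>l<d - k. f (l + k))" for f :: "nat => complex"
      using sum.atLeastLessThan_concat[of 0 k d f] sum.shift_bounds_nat_ivl[of f 0 k "d - k"] k
      by (simp add: atLeast0LessThan add.commute)
    have A: "representation G k ?A" unfolding representation_iff[OF assms(1)]
    proof (intro conjI ballI)
      fix g h assume gh: "g \<in> carrier G" "h \<in> carrier G"
      show "?A (g \<otimes> h) = ?A g * ?A h"
      proof (rule eq_matI)
        fix i j assume "i < dim_row (?A g * ?A h)" "j < dim_col (?A g * ?A h)"
        then have ij: "i < k" "j < k" by auto
        then have "(M (g \<otimes> h)) $$ (i, j) = (\<Sum>l<k. M g $$ (i, l) * M h $$ (l, j))"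
          using Mm[OF gh] Mp[OF gh, of i j] k split[of "%l. M g $$ (i, l) * M h $$ (l, j)"] Mz[OF gh(2)] by simp
        then show "?A (g \<otimes> h) $$ (i, j) = (?A g * ?A h) $$ (i, j)"
          using ij by (simp add: scalar_prod_def atLeast0LessThan)
      qed auto
    qed (use M1 k in auto)
    have B: "representation G (d - k) ?B" unfolding representation_iff[OF assms(1)]
    proof (intro conjI ballI)
      fix g h assume gh: "g \<in> carrier G" "h \<in> carrier G"
      show "?B (g \<otimes> h) = ?B g * ?B h"
      proof (rule eq_matI)
        fix i j assume "i < dim_row (?B g * ?B h)" "j < dim_col (?B g * ?B h)"
        then have ij: "i + k < d" "j + k < d" by auto
        then have "(M (g \<otimes> h)) $$ (i + k, j + k) = (\<Sum>l<d - k. M g $$ (i + k, l + k) * M h $$ (l + k, j + k))"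
          using Mm[OF gh] Mp[OF gh, of "i + k" "j + k"] split[of "%l. M g $$ (i + k, l) * M h $$ (l, j + k)"] Mz[OF gh(1)] by simp
        then show "?B (g \<otimes> h) $$ (i, j) = (?B g * ?B h) $$ (i, j)"
          using ij by (simp add: scalar_prod_def atLeast0LessThan)
      qed auto
    qed (use M1 k in auto)
    have "rep_character G d \<rho> g = rep_character G k ?A g + rep_character G (d - k) ?B g" for g
    proof (cases "g \<in> carrier G")
      case True
      have "mtrace (\<rho> g) = mtrace (M g)" unfolding M_def
        by (rule mtrace_conj[symmetric, OF r(1)[OF True] PQ(1,2,3)])
      also have "\<dots> = (\<Sum>l<d. M g $$ (l, l))" using Mc[OF True] by (simp add: mtrace_def)
      finally show ?thesis using True rep_character_eq[OF less.prems assms(1) True] split[of "%l. M g $$ (l, l)"]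
        by (simp add: rep_character_def)
    qed (simp add: rep_character_def)
    then have "rep_character G d \<rho> = rep_character G k ?A \<otimes>\<^bsub>add_monoid (function_ring G)\<^esub> rep_character G (d - k) ?B"
      by (simp add: function_ring_def fun_eq_iff)
    then show ?thesis
      using generate.eng[OF less.IH[OF _ A] less.IH[OF _ B]] k by simp
  qed
qed

section \<open>Convolution\<close>

locale finite_group = group G for G (structure) +
  assumes fin: "finite (carrier G)"
begin

lemma group_ring_simps [simp]:
  "zero (group_ring G) = (%w. 0)"
  "add (group_ring G) f g = (%w. f w + g w)"
  "one (group_ring G) = (%w. if w = \<one> then 1 else 0)"
  by (simp_all add: group_ring_def)

lemma group_ring_carrier: "carrier (group_ring G :: ('a => 'r::comm_ring_1) ring) = {f. \<forall>x. x \<notin> carrier G --> f x = 0}"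
proof -
  have "finite {x. f x ~= 0} \<and> {x. f x ~= 0} \<subseteq> carrier G \<longleftrightarrow> (\<forall>x. x \<notin> carrier G --> f x = 0)"
    for f :: "'a => 'r"
    using fin finite_subset[of "{x. f x ~= 0}" "carrier G"] by auto
  then show ?thesis by (simp add: group_ring_def)
qed

definition conv :: "('a => 'r::comm_ring_1) => ('a => 'r) => 'a => 'r" where
  "conv f g w = (\<Sum>x\<in>carrier G. \<Sum>y\<in>carrier G. if x \<otimes> y = w then f x * g y else 0)"

lemma group_ring_mult:
  assumes "f \<in> carrier (group_ring G)" "g \<in> carrier (group_ring G)"
  shows "f \<otimes>\<^bsub>group_ring G\<^esub> g = conv f g"
proof
  fix w
  let ?S = "{(x, y). f x ~= 0 \<and> g y ~= 0 \<and> x \<otimes> y = w}"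
  have "(f \<otimes>\<^bsub>group_ring G\<^esub> g) w = (\<Sum>(x, y)\<in>?S. f x * g y)"
    by (simp add: group_ring_def)
  also have "\<dots> = (\<Sum>(x, y)\<in>carrier G \<times> carrier G. if x \<otimes> y = w then f x * g y else 0)"
  proof (rule sum.mono_neutral_cong_left)
    show "finite (carrier G \<times> carrier G)" using fin by simp
    show "?S \<subseteq> carrier G \<times> carrier G" using assms by (auto simp: group_ring_carrier)
  qed (auto split: if_splits)
  also have "\<dots> = conv f g w" by (simp add: conv_def sum.cartesian_product)
  finally show "(f \<otimes>\<^bsub>group_ring G\<^esub> g) w = conv f g w" .
qed

lemma conv_eq: "w \<in> carrier G ==> conv f g w = (\<Sum>x\<in>carrier G. f x * g (inv x \<otimes> w))"
proof -
  assume w: "w \<in> carrier G"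
  have "(\<Sum>y\<in>carrier G. if x \<otimes> y = w then f x * g y else 0) = f x * g (inv x \<otimes> w)"
    if x: "x \<in> carrier G" for x
  proof -
    have "x \<otimes> y = w \<longleftrightarrow> y = inv x \<otimes> w" if "y \<in> carrier G" for y
      using x w that by (auto simp: m_assoc[symmetric])
    then have "(\<Sum>y\<in>carrier G. if x \<otimes> y = w then f x * g y else 0)
      = (\<Sum>y\<in>carrier G. if y = inv x \<otimes> w then f x * g y else 0)"
      by (intro sum.cong) auto
    then show ?thesis using fin x w by (simp add: sum.delta')
  qed
  then show ?thesis by (simp add: conv_def)
qed

lemma conv_out: "w \<notin> carrier G ==> conv f g w = 0"
  unfolding conv_def by (intro sum.neutral ballI) auto

lemma conv_closed: "conv f g \<in> carrier (group_ring G)"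
  by (simp add: group_ring_carrier conv_out)

lemma sum_left_translate: "x \<in> carrier G ==> (\<Sum>y\<in>carrier G. f (x \<otimes> y)) = (\<Sum>y\<in>carrier G. f y)"
  by (rule sum.reindex_bij_witness[of _ "%y. inv x \<otimes> y" "%y. x \<otimes> y"]) (auto simp: m_assoc[symmetric])

lemma conv_assoc: "conv (conv f g) h = conv f (conv g h)"
proof
  fix w
  show "conv (conv f g) h w = conv f (conv g h) w"
  proof (cases "w \<in> carrier G")
    case True
    have "conv (conv f g) h w = (\<Sum>y\<in>carrier G. \<Sum>x\<in>carrier G. f x * g (inv x \<otimes> y) * h (inv y \<otimes> w))"
      using True by (simp add: conv_eq sum_distrib_right cong: sum.cong)
    also have "\<dots> = (\<Sum>x\<in>carrier G. \<Sum>y\<in>carrier G. f x * g (inv x \<otimes> y) * h (inv y \<otimes> w))"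
      by (rule sum.swap)
    also have "\<dots> = (\<Sum>x\<in>carrier G. \<Sum>y\<in>carrier G. f x * g y * h (inv y \<otimes> (inv x \<otimes> w)))"
    proof (rule sum.cong[OF HOL.refl])
      fix x assume x: "x \<in> carrier G"
      have "inv x \<otimes> (x \<otimes> y) = y" "inv (x \<otimes> y) \<otimes> w = inv y \<otimes> (inv x \<otimes> w)" if "y \<in> carrier G" for y
        using x that True by (simp_all add: m_assoc[symmetric] inv_mult_group)
      then show "(\<Sum>y\<in>carrier G. f x * g (inv x \<otimes> y) * h (inv y \<otimes> w)) = (\<Sum>y\<in>carrier G. f x * g y * h (inv y \<otimes> (inv x \<otimes> w)))"
        using sum_left_translate[OF x, of "%y. f x * g (inv x \<otimes> y) * h (inv y \<otimes> w)"] by (simp cong: sum.cong)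
    qed
    also have "\<dots> = conv f (conv g h) w"
      using True by (simp add: conv_eq sum_distrib_left mult.assoc cong: sum.cong)
    finally show ?thesis .
  qed (simp add: conv_out)
qed

lemma conv_one_left: "f \<in> carrier (group_ring G) ==> conv (%w. if w = \<one> then 1 else 0) f = f"
proof
  fix w assume f: "f \<in> carrier (group_ring G)"
  show "conv (%w. if w = \<one> then 1 else 0) f w = f w"
  proof (cases "w \<in> carrier G")
    case True
    have "conv (%w. if w = \<one> then 1 else 0) f w = (\<Sum>x\<in>carrier G. if x = \<one> then f (inv x \<otimes> w) else 0)"
      using True by (auto simp: conv_eq intro!: sum.cong)
    then show ?thesis using fin True by (simp add: sum.delta')
  qed (use f in \<open>simp add: conv_out group_ring_carrier\<close>)
qed

lemma conv_one_right: "f \<in> carrier (group_ring G) ==> conv f (%w. if w = \<one> then 1 else 0) = f"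
proof
  fix w assume f: "f \<in> carrier (group_ring G)"
  show "conv f (%w. if w = \<one> then 1 else 0) w = f w"
  proof (cases "w \<in> carrier G")
    case True
    have "inv x \<otimes> w = \<one> \<longleftrightarrow> x = w" if "x \<in> carrier G" for x
      using that True by (metis inv_closed inv_equality inv_inv l_inv)
    then have "conv f (%w. if w = \<one> then 1 else 0) w = (\<Sum>x\<in>carrier G. if x = w then f x else 0)"
      using True by (auto simp: conv_eq intro!: sum.cong)
    then show ?thesis using fin True by (simp add: sum.delta')
  qed (use f in \<open>simp add: conv_out group_ring_carrier\<close>)
qed

lemma conv_add_left: "conv (%w. f w + g w) h = (%w. conv f h w + conv g h w)"
  by (rule ext) (simp add: conv_def sum.distrib[symmetric] distrib_right if_distrib cong: if_cong sum.cong)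

lemma conv_add_right: "conv h (%w. f w + g w) = (%w. conv h f w + conv h g w)"
  by (rule ext) (simp add: conv_def sum.distrib[symmetric] distrib_left if_distrib cong: if_cong sum.cong)

lemma ring_group_ring: "ring (group_ring G :: ('a => 'r::comm_ring_1) ring)"
proof (rule ringI)
  let ?R = "group_ring G :: ('a => 'r) ring"
  show "abelian_group ?R"
  proof (rule abelian_groupI)
    fix f assume "f \<in> carrier ?R"
    then show "\<exists>g\<in>carrier ?R. g \<oplus>\<^bsub>?R\<^esub> f = \<zero>\<^bsub>?R\<^esub>"
      by (intro bexI[of _ "%w. - f w"]) (auto simp: group_ring_carrier)
  qed (auto simp: group_ring_carrier algebra_simps)
  show "monoid ?R"
  proof (rule monoidI)
    show o: "\<one>\<^bsub>?R\<^esub> \<in> carrier ?R" by (auto simp: group_ring_carrier)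
    fix f g h assume fgh: "f \<in> carrier ?R" "g \<in> carrier ?R" "h \<in> carrier ?R"
    show "f \<otimes>\<^bsub>?R\<^esub> g \<in> carrier ?R" using fgh by (simp add: group_ring_mult conv_closed)
    show "f \<otimes>\<^bsub>?R\<^esub> g \<otimes>\<^bsub>?R\<^esub> h = f \<otimes>\<^bsub>?R\<^esub> (g \<otimes>\<^bsub>?R\<^esub> h)"
      using fgh by (simp add: group_ring_mult conv_closed conv_assoc)
    show "\<one>\<^bsub>?R\<^esub> \<otimes>\<^bsub>?R\<^esub> f = f" using group_ring_mult[OF o fgh(1)] fgh by (simp add: conv_one_left)
    show "f \<otimes>\<^bsub>?R\<^esub> \<one>\<^bsub>?R\<^esub> = f" using group_ring_mult[OF fgh(1) o] fgh by (simp add: conv_one_right)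
  qed
  fix f g h assume fgh: "f \<in> carrier ?R" "g \<in> carrier ?R" "h \<in> carrier ?R"
  have s: "(%w. f w + g w) \<in> carrier ?R" using fgh by (auto simp: group_ring_carrier)
  show "(f \<oplus>\<^bsub>?R\<^esub> g) \<otimes>\<^bsub>?R\<^esub> h = f \<otimes>\<^bsub>?R\<^esub> h \<oplus>\<^bsub>?R\<^esub> g \<otimes>\<^bsub>?R\<^esub> h"
    using fgh s by (simp add: group_ring_mult conv_add_left)
  show "h \<otimes>\<^bsub>?R\<^esub> (f \<oplus>\<^bsub>?R\<^esub> g) = h \<otimes>\<^bsub>?R\<^esub> f \<oplus>\<^bsub>?R\<^esub> h \<otimes>\<^bsub>?R\<^esub> g"
    using fgh s by (simp add: group_ring_mult conv_add_right)
qed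

lemma group_ring_minus:
  fixes f :: "'a => 'r::comm_ring_1"
  assumes "f \<in> carrier (group_ring G)"
  shows "\<ominus>\<^bsub>group_ring G\<^esub> f = (%w. - f w)"
proof -
  interpret R: ring "group_ring G :: ('a => 'r) ring" by (rule ring_group_ring)
  show ?thesis by (rule R.minus_equality) (use assms in \<open>auto simp: group_ring_carrier\<close>)
qed

lemma conv_sum_left: "conv (%w. \<Sum>i\<in>I. c i * f i w) h = (%w. \<Sum>i\<in>I. c i * conv (f i) h w)"
proof (induction I rule: infinite_finite_induct)
  case (insert i I)
  have s: "conv (%w. c i * f i w) h = (%w. c i * conv (f i) h w)"
    by (rule ext) (simp add: conv_def sum_distrib_left mult.assoc if_distrib cong: if_cong)
  show ?case using insert conv_add_left[of "%w. c i * f i w"] by (simp add: s)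
qed (auto simp: conv_def fun_eq_iff intro!: sum.neutral)

lemma conv_sum_right: "conv h (%w. \<Sum>i\<in>I. c i * f i w) = (%w. \<Sum>i\<in>I. c i * conv h (f i) w)"
proof (induction I rule: infinite_finite_induct)
  case (insert i I)
  have s: "conv h (%w. c i * f i w) = (%w. c i * conv h (f i) w)"
    by (rule ext) (simp add: conv_def sum_distrib_left mult.left_commute if_distrib cong: if_cong)
  show ?case using insert conv_add_right[of h "%w. c i * f i w"] by (simp add: s)
qed (auto simp: conv_def fun_eq_iff intro!: sum.neutral)

lemma conv_of_int: "conv (%w. of_int (f w)) (%w. of_int (g w)) = (%w. of_int (conv f g w))"
  by (rule ext) (auto simp: conv_def intro!: sum.cong)

end

section \<open>The action on signed letters\<close>

lemma sperm_extend:
  assumes f: "\<And>i. i \<in> {1..int n} ==> \<bar>f i\<bar> \<in> {1..int n}"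
    and inj: "inj_on (%i. \<bar>f i\<bar>) {1..int n}"
  obtains w where "w \<in> sperm n" "\<And>i. i \<in> {1..int n} ==> w i = f i"
proof -
  let ?P = "{1..int n}"
  define w where "w x = (if x \<in> ?P then f x else if - x \<in> ?P then - f (- x) else x)" for x
  have odd: "w (- x) = - w x" for x by (auto simp: w_def)
  have out: "w x = x" if "int n < \<bar>x\<bar>" for x using that by (auto simp: w_def)
  have w0: "w 0 = 0" by (simp add: w_def)
  have wP: "w i = f i" if "i \<in> ?P" for i using that by (simp add: w_def)
  have aw: "\<bar>w x\<bar> \<in> ?P \<longleftrightarrow> \<bar>x\<bar> \<in> ?P" for x
    using f[of x] f[of "- x"] by (auto simp: w_def)
  have awx: "\<bar>w x\<bar> = \<bar>f \<bar>x\<bar>\<bar>" if "\<bar>x\<bar> \<in> ?P" for x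
    using that odd[of x] by (cases "x \<ge> 0") (auto simp: w_def)
  have "inj w"
  proof (rule injI)
    fix x y assume e: "w x = w y"
    consider "\<bar>x\<bar> \<in> ?P" | "\<bar>x\<bar> \<notin> ?P" by blast
    then show "x = y"
    proof cases
      case 1
      then have y: "\<bar>y\<bar> \<in> ?P" using aw e by metis
      then have "\<bar>x\<bar> = \<bar>y\<bar>" using inj_onD[OF inj, of "\<bar>x\<bar>" "\<bar>y\<bar>"] 1 awx[OF 1] awx[OF y] e by simp
      moreover have "w y ~= 0" using aw[of y] y by auto
      ultimately show ?thesis using e odd[of y] by (auto simp: abs_eq_iff)
    next
      case 2
      then have y: "\<bar>y\<bar> \<notin> ?P" using aw e by metis
      have "w z = z" if "\<bar>z\<bar> \<notin> ?P" for z using that by (auto simp: w_def)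
      then show ?thesis using 2 y e by metis
    qed
  qed
  moreover have "surj w"
  proof -
    have "w ` {- int n..int n} = {- int n..int n}"
    proof (rule endo_inj_surj)
      show "w ` {- int n..int n} \<subseteq> {- int n..int n}"
      proof (rule image_subsetI)
        fix x assume x: "x \<in> {- int n..int n}"
        show "w x \<in> {- int n..int n}"
        proof (cases "x = 0")
          case False
          then have "\<bar>x\<bar> \<in> ?P" using x by auto
          then have "\<bar>w x\<bar> \<in> ?P" using aw by blast
          then show ?thesis by auto
        qed (simp add: w0)
      qed
      show "inj_on w {- int n..int n}" using \<open>inj w\<close> by (rule inj_on_subset) simp
    qed simp
    then have "y \<in> range w" if "y \<in> {- int n..int n}" for y using that by blast
    moreover have "y \<in> range w" if "y \<notin> {- int n..int n}" for y
      using out[of y] that by (intro range_eqI[of _ _ y]) auto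
    ultimately show ?thesis by blast
  qed
  ultimately have "w \<in> sperm n" using odd out by (intro spermI bijI) auto
  then show thesis using that wP by blast
qed

context coxeter_C begin

abbreviation pos :: "int set" where "pos \<equiv> {1..int n}"

lemma finite_carrier: "finite (carrier G)"
proof -
  have "inj_on act (carrier G)" using act_inj by (auto intro: inj_onI)
  moreover have "act ` carrier G \<subseteq> sperm n" using act_sperm by blast
  ultimately show ?thesis using finite_sperm finite_subset finite_imageD by blast
qed

lemma act_one [simp]: "act \<one> = id"
  using act_wp[of "[]"] by simp

lemma act_mult_apply: "g \<in> carrier G ==> h \<in> carrier G ==> act (g \<otimes> h) x = act g (act h x)"
  by (simp add: act_mult)

lemma act_inv: "g \<in> carrier G ==> act g (act (inv g) x) = x" "g \<in> carrier G ==> act (inv g) (act g x) = x"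
  using act_mult_apply[of g "inv g" x] act_mult_apply[of "inv g" g x] by simp_all

lemma act_minus: "g \<in> carrier G ==> act g (- x) = - act g x"
  using sperm_minus act_sperm by blast

lemma act_0 [simp]: "g \<in> carrier G ==> act g 0 = 0"
  using sperm_0 act_sperm by blast

lemma act_eq_iff: "g \<in> carrier G ==> act g x = act g y \<longleftrightarrow> x = y"
  using sperm_eq_iff act_sperm by blast

lemma act_eq_0_iff: "g \<in> carrier G ==> act g x = 0 \<longleftrightarrow> x = 0"
  using sperm_zero_iff act_sperm by blast

lemma act_abs: "g \<in> carrier G ==> \<bar>act g \<bar>x\<bar>\<bar> = \<bar>act g x\<bar>"
  using sperm_abs act_sperm by blast

lemma act_abs_eq_iff: "g \<in> carrier G ==> \<bar>act g x\<bar> = \<bar>act g y\<bar> \<longleftrightarrow> \<bar>x\<bar> = \<bar>y\<bar>"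
  using sperm_abs_eq_iff act_sperm by blast

lemma act_pos: assumes "g \<in> carrier G" shows "\<bar>act g x\<bar> \<in> pos \<longleftrightarrow> \<bar>x\<bar> \<in> pos"
proof -
  have c: "\<bar>act h y\<bar> \<in> pos" if "\<bar>y\<bar> \<in> pos" "h \<in> carrier G" for h y
  proof -
    have y: "\<bar>y\<bar> \<le> int n" "y ~= 0" using that(1) by auto
    have "\<bar>act h y\<bar> \<le> int n" by (rule sperm_le[OF act_sperm[OF that(2)] y(1)])
    moreover have "act h y ~= 0" using act_eq_0_iff[OF that(2)] y(2) by simp
    ultimately show ?thesis by simp
  qed
  show ?thesis
  proof
    assume "\<bar>act g x\<bar> \<in> pos"
    from c[OF this inv_closed[OF assms]] show "\<bar>x\<bar> \<in> pos" unfolding act_inv(2)[OF assms] .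
  qed (rule c[OF _ assms])
qed

lemma act_pos_abs: "g \<in> carrier G ==> v \<in> pos ==> \<bar>act g v\<bar> \<in> pos"
  using act_pos[of g v] by auto

lemma act_ext: "g \<in> carrier G ==> h \<in> carrier G ==> (\<And>i. i \<in> pos ==> act g i = act h i) ==> g = h"
  using act_inj sperm_ext[OF act_sperm act_sperm, of g h] by auto

lemma act_extend:
  assumes "\<And>i. i \<in> pos ==> \<bar>f i\<bar> \<in> pos" "inj_on (%i. \<bar>f i\<bar>) pos"
  obtains g where "g \<in> carrier G" "\<And>i. i \<in> pos ==> act g i = f i"
  using sperm_extend[OF assms] act_surj by metis

lemma bij_act: "g \<in> carrier G ==> bij_betw (%v. \<bar>act g v\<bar>) pos pos"
  by (rule bij_betw_byWitness[where f' = "%v. \<bar>act (inv g) v\<bar>"])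
    (use act_pos_abs in \<open>auto simp: act_abs act_inv\<close>)

section \<open>Standardization of words\<close>

text \<open>Positions are compared by their letters; ties are broken by the signed values, so that
  positive positions with equal letters increase and negative ones decrease in absolute value.\<close>

definition lx :: "(int => nat) => int => int => bool" where
  "lx F x y \<longleftrightarrow> F \<bar>x\<bar> < F \<bar>y\<bar> \<or> F \<bar>x\<bar> = F \<bar>y\<bar> \<and> x < y"

definition sorts :: "(int => nat) => 'a => bool" where
  "sorts F g \<longleftrightarrow> g \<in> carrier G \<and> (\<forall>i\<in>pos. 0 < act g i \<longleftrightarrow> odd (F \<bar>act g i\<bar>)) \<and>
    (\<forall>i. 1 \<le> i \<and> i < int n --> lx F (act g i) (act g (i + 1)))"

lemma lx_trans: "lx F x y ==> lx F y z ==> lx F x z"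
  by (auto simp: lx_def)

lemma sorts_mono:
  assumes "sorts F g" "1 \<le> i" "i < j" "j \<le> int n"
  shows "lx F (act g i) (act g j)"
  using assms(3,4)
proof (induction j rule: int_gr_induct)
  case base then show ?case using assms by (auto simp: sorts_def)
next
  case (step j)
  then have "lx F (act g j) (act g (j + 1))" using assms by (auto simp: sorts_def)
  then show ?case using step lx_trans by auto
qed

lemma sorts_weak_mono:
  assumes "sorts F g" "1 \<le> i" "i \<le> j" "j \<le> int n"
  shows "F \<bar>act g i\<bar> \<le> F \<bar>act g j\<bar>"
  using sorts_mono[OF assms(1,2) _ assms(4)] assms(3) by (cases "i = j") (auto simp: lx_def)

lemma sorts_exists: "\<exists>g. sorts F g"
proof -
  define \<epsilon> where "\<epsilon> v = (if odd (F v) then v else - v)" for v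
  define E where "E = \<epsilon> ` pos"
  define N where "N = 2 * int n + 2"
  define K where "K x = int (F \<bar>x\<bar>) * N + x" for x
  have ab: "\<bar>\<epsilon> v\<bar> = v" if "v \<in> pos" for v using that by (auto simp: \<epsilon>_def)
  have E: "\<bar>x\<bar> \<in> pos" "x = \<epsilon> \<bar>x\<bar>" if "x \<in> E" for x
    using that ab by (auto simp: E_def simp del: atLeastAtMost_iff)
  have Klx: "lx F x y" if "x \<in> E" "y \<in> E" "K x < K y" for x y
  proof (rule ccontr)
    assume "\<not> lx F x y"
    then have c: "F \<bar>y\<bar> < F \<bar>x\<bar> \<or> F \<bar>x\<bar> = F \<bar>y\<bar> \<and> y \<le> x" by (auto simp: lx_def)
    have "K y \<le> K x"
    proof (cases "F \<bar>y\<bar> < F \<bar>x\<bar>")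
      case True
      then have "(int (F \<bar>y\<bar>) + 1) * N \<le> int (F \<bar>x\<bar>) * N"
        by (intro mult_right_mono) (auto simp: N_def)
      moreover have "y \<le> x + N" using E(1)[OF that(1)] E(1)[OF that(2)] by (auto simp: N_def)
      ultimately show ?thesis by (simp add: K_def algebra_simps)
    next
      case False then show ?thesis using c by (simp add: K_def)
    qed
    then show False using that by simp
  qed
  have Kinj: "inj_on K E"
  proof (rule inj_onI)
    fix x y assume xy: "x \<in> E" "y \<in> E" "K x = K y"
    have l: "F \<bar>a\<bar> \<ge> F \<bar>b\<bar>" if "a \<in> E" "b \<in> E" "K a = K b" for a b
    proof (rule ccontr)
      assume "\<not> F \<bar>b\<bar> \<le> F \<bar>a\<bar>"
      then have "(int (F \<bar>a\<bar>) + 1) * N \<le> int (F \<bar>b\<bar>) * N"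
        by (intro mult_right_mono) (auto simp: N_def)
      moreover have "a < b + N" using E(1)[OF that(1)] E(1)[OF that(2)] by (auto simp: N_def)
      ultimately show False using that(3) by (simp add: K_def algebra_simps)
    qed
    have "F \<bar>x\<bar> = F \<bar>y\<bar>" using l[of x y] l[of y x] xy by simp
    then show "x = y" using xy by (simp add: K_def)
  qed
  define L where "L = sorted_list_of_set (K ` E)"
  have "card (K ` E) = card E" using Kinj by (rule card_image)
  moreover have "inj_on \<epsilon> pos" using ab by (metis inj_onI)
  ultimately have len: "length L = n" by (simp add: L_def E_def card_image)
  have fE: "finite (K ` E)" by (simp add: E_def)
  have setL: "set L = K ` E" using fE by (simp add: L_def)
  have srt: "L ! a < L ! b" if "a < b" "b < n" for a b
    using that len strict_sorted_list_of_set[of "K ` E"] unfolding L_def[symmetric]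
    by (simp add: sorted_wrt_nth_less)
  define f where "f i = inv_into E K (L ! nat (i - 1))" for i
  have f: "f i \<in> E" "K (f i) = L ! nat (i - 1)" if "i \<in> pos" for i
  proof -
    have "nat (i - 1) < length L" using len that by auto
    then have "L ! nat (i - 1) \<in> K ` E" using setL nth_mem by metis
    then show "f i \<in> E" "K (f i) = L ! nat (i - 1)" by (simp_all add: f_def inv_into_into f_inv_into_f)
  qed
  have lt: "K (f i) < K (f j)" if "i \<in> pos" "j \<in> pos" "i < j" for i j
    using f(2)[OF that(1)] f(2)[OF that(2)] srt[of "nat (i - 1)" "nat (j - 1)"] that by auto
  have inj: "inj_on (%i. \<bar>f i\<bar>) pos"
  proof (rule inj_onI)
    fix i j assume ij: "i \<in> pos" "j \<in> pos" "\<bar>f i\<bar> = \<bar>f j\<bar>"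
    then have "f i = f j" using E(2)[OF f(1)[OF ij(1)]] E(2)[OF f(1)[OF ij(2)]] by simp
    then show "i = j" using lt[of i j] lt[of j i] ij by (metis less_irrefl linorder_neqE)
  qed
  obtain g where g: "g \<in> carrier G" "\<And>i. i \<in> pos ==> act g i = f i"
    using act_extend[OF _ inj] E(1)[OF f(1)] by metis
  have "sorts F g" unfolding sorts_def
  proof (intro conjI ballI allI impI)
    fix i assume i: "i \<in> pos"
    have "0 < \<epsilon> v \<longleftrightarrow> odd (F v)" if "v \<in> pos" for v using that by (auto simp: \<epsilon>_def)
    then show "0 < act g i \<longleftrightarrow> odd (F \<bar>act g i\<bar>)" using E[OF f(1)[OF i]] g(2)[OF i] by metis
  next
    fix i assume i: "1 \<le> i \<and> i < int n"
    then have p: "i \<in> pos" "i + 1 \<in> pos" by auto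
    show "lx F (act g i) (act g (i + 1))"
      unfolding g(2)[OF p(1)] g(2)[OF p(2)] by (rule Klx[OF f(1)[OF p(1)] f(1)[OF p(2)] lt[OF p]]) simp
  qed (rule g(1))
  then show ?thesis by blast
qed

lemma sorts_unique:
  assumes g: "sorts F g" and h: "sorts F h" shows "g = h"
proof -
  have gc: "g \<in> carrier G" and hc: "h \<in> carrier G" using assms by (auto simp: sorts_def)
  have key: "act a i = act b i \<or> (\<exists>j\<in>pos. j < i \<and> act b j = act a i \<or> j < i \<and> act a j = act b i)"
    if abi: "a \<in> carrier G" "b \<in> carrier G" "sorts F a" "sorts F b" "i \<in> pos" for a b i
  proof -
    have ex: "\<exists>j\<in>pos. act y j = act x i" if xy: "sorts F x" "sorts F y" and i: "i \<in> pos" for x y i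
    proof -
      have c: "x \<in> carrier G" "y \<in> carrier G" using xy by (auto simp: sorts_def)
      define j where "j = \<bar>act (inv y) (act x i)\<bar>"
      have j: "j \<in> pos" using act_pos_abs[OF c(1) i] act_pos[of "inv y" "act x i"] c by (simp add: j_def)
      have a: "\<bar>act y j\<bar> = \<bar>act x i\<bar>" using c by (simp add: j_def act_abs act_inv)
      then have "0 < act y j \<longleftrightarrow> 0 < act x i" using xy i j by (simp add: sorts_def)
      moreover have "act x i ~= 0" using act_eq_0_iff[OF c(1), of i] i by auto
      ultimately have "act y j = act x i" using a by (auto simp: abs_if split: if_splits)
      then show ?thesis using j by blast
    qed
    obtain j where j: "j \<in> pos" "act b j = act a i" using ex[OF abi(3,4,5)] by blast
    obtain k where k: "k \<in> pos" "act a k = act b i" using ex[OF abi(4,3,5)] by blast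
    show ?thesis
    proof (cases "j < i \<or> k < i \<or> j = i")
      case False
      then have "i < j" "i \<le> k" by auto
      then have "lx F (act b i) (act b j)" using sorts_mono[OF abi(4) _ \<open>i < j\<close>] abi(5) j(1) by auto
      moreover have "lx F (act a i) (act a k) \<or> act a i = act a k"
        using sorts_mono[OF abi(3), of i k] abi(5) k \<open>i \<le> k\<close> by (cases "i = k") auto
      ultimately show ?thesis using j k by (auto simp: lx_def)
    qed (use j k in auto)
  qed
  have "act g i = act h i" if "i \<in> pos" for i
    using that
  proof (induction "nat i" arbitrary: i rule: less_induct)
    case less
    have IH: "act g j = act h j" if "j \<in> pos" "j < i" for j
      using less that by auto
    from key[OF gc hc g h less.prems] show ?case
    proof (elim disjE bexE conjE)
      fix j assume "j \<in> pos" "j < i" "act h j = act g i"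
      then show ?thesis using IH[of j] act_eq_iff[OF gc, of j i] by auto
    next
      fix j assume "j \<in> pos" "j < i" "act g j = act h i"
      then show ?thesis using IH[of j] act_eq_iff[OF hc, of j i] by auto
    qed
  qed
  then show ?thesis using act_ext gc hc by blast
qed

definition st :: "(int => nat) => 'a" where "st F = (THE g. sorts F g)"

lemma st_sorts: "sorts F (st F)"
  unfolding st_def using sorts_exists sorts_unique by (metis theI)

lemma st_eq_iff: "st F = g \<longleftrightarrow> sorts F g"
  using st_sorts sorts_unique by blast

lemma st_closed [simp]: "st F \<in> carrier G"
  using st_sorts by (auto simp: sorts_def)

section \<open>Contents of words\<close>

definition cnt :: "(int => nat) => nat => nat" where
  "cnt F j = card {v \<in> pos. F v = j}"

lemma cnt_cong: "(\<And>v. v \<in> pos ==> F v = F' v) ==> cnt F = cnt F'"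
  unfolding cnt_def by (intro ext arg_cong[of _ _ card]) auto

lemma cnt_act: assumes "g \<in> carrier G" shows "cnt (%v. F \<bar>act g v\<bar>) = cnt F"
proof
  fix j
  have "(%v. \<bar>act g v\<bar>) ` {v \<in> pos. F \<bar>act g v\<bar> = j} = {v \<in> pos. F v = j}"
  proof (intro equalityI subsetI)
    fix u assume u: "u \<in> {v \<in> pos. F v = j}"
    then have "u \<in> (%v. \<bar>act g v\<bar>) ` pos" using bij_act[OF assms] unfolding bij_betw_def by blast
    then obtain v where "v \<in> pos" "u = \<bar>act g v\<bar>" by blast
    then show "u \<in> (%v. \<bar>act g v\<bar>) ` {v \<in> pos. F \<bar>act g v\<bar> = j}" using u by auto
  qed (use act_pos_abs[OF assms] in auto)
  moreover have "inj_on (%v. \<bar>act g v\<bar>) {v \<in> pos. F \<bar>act g v\<bar> = j}"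
    using bij_act[OF assms] by (rule inj_on_subset[OF bij_betw_imp_inj_on]) blast
  ultimately show "cnt (%v. F \<bar>act g v\<bar>) j = cnt F j"
    unfolding cnt_def using card_image by fastforce
qed

lemma mono_cnt_unique:
  assumes b: "\<And>i j. 1 \<le> i ==> i \<le> j ==> j \<le> int n ==> b i \<le> b j"
    and c: "\<And>i j. 1 \<le> i ==> i \<le> j ==> j \<le> int n ==> c i \<le> c j"
    and eq: "cnt b = cnt c" and i: "i \<in> pos"
  shows "b i = c i"
proof -
  have S: "card {v \<in> pos. f v \<le> j} = (\<Sum>k\<le>j. cnt f k)" for f :: "int => nat" and j
  proof -
    have "{v \<in> pos. f v \<le> j} = (\<Union>k\<in>{..j}. {v \<in> pos. f v = k})" by auto
    moreover have "card (\<Union>k\<in>{..j}. {v \<in> pos. f v = k}) = (\<Sum>k\<in>{..j}. card {v \<in> pos. f v = k})"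
      by (rule card_UN_disjoint) (auto simp del: atLeastAtMost_iff)
    ultimately show ?thesis unfolding cnt_def by simp
  qed
  have key: "f i \<le> j \<longleftrightarrow> i \<le> int (card {v \<in> pos. f v \<le> j})"
    if f: "\<And>i j. 1 \<le> i ==> i \<le> j ==> j \<le> int n ==> f i \<le> f j" for f :: "int => nat" and j
  proof
    assume "f i \<le> j"
    then have "{1..i} \<subseteq> {v \<in> pos. f v \<le> j}" using f[of _ i] i by fastforce
    then have "card {1..i} \<le> card {v \<in> pos. f v \<le> j}"
      by (intro card_mono finite_subset[of "{v \<in> pos. f v \<le> j}" pos]) blast+
    then show "i \<le> int (card {v \<in> pos. f v \<le> j})" using i by simp
  next
    assume a: "i \<le> int (card {v \<in> pos. f v \<le> j})"
    show "f i \<le> j"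
    proof (rule ccontr)
      assume "\<not> f i \<le> j"
      have "{v \<in> pos. f v \<le> j} \<subseteq> {1..i - 1}"
      proof
        fix v assume v: "v \<in> {v \<in> pos. f v \<le> j}"
        then have "\<not> i \<le> v" using f[of i v] i \<open>\<not> f i \<le> j\<close> by auto
        then show "v \<in> {1..i - 1}" using v by auto
      qed
      then have "card {v \<in> pos. f v \<le> j} \<le> card {1..i - 1}" by (intro card_mono) auto
      then have "int (card {v \<in> pos. f v \<le> j}) \<le> i - 1" using i by (simp add: le_nat_iff)
      then show False using a by simp
    qed
  qed
  have "b i \<le> j \<longleftrightarrow> c i \<le> j" for j
  proof -
    have "b i \<le> j \<longleftrightarrow> i \<le> int (card {v \<in> pos. b v \<le> j})" by (rule key) (rule b)
    moreover have "c i \<le> j \<longleftrightarrow> i \<le> int (card {v \<in> pos. c v \<le> j})" by (rule key) (rule c)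
    ultimately show ?thesis unfolding S eq by blast
  qed
  then show ?thesis by (metis order_antisym order_refl)
qed

text \<open>The two words are sorted into the same weakly increasing word. The letters \<open>2 F + 1\<close> are odd,
  so the sorting elements are positive.\<close>

lemma cnt_eq_imp_conj:
  assumes "cnt F = cnt F'"
  obtains g where "g \<in> carrier G" "\<And>v. v \<in> pos ==> 0 < act g v" "\<And>v. v \<in> pos ==> F v = F' (act g v)"
proof -
  let ?p = "st (%v. 2 * F v + 1)" and ?q = "st (%v. 2 * F' v + 1)"
  have pp: "0 < act ?p i" "0 < act ?q i" if "i \<in> pos" for i
    using st_sorts[of "%v. 2 * F v + 1"] st_sorts[of "%v. 2 * F' v + 1"] that by (auto simp: sorts_def)
  have m: "F \<bar>act ?p i\<bar> \<le> F \<bar>act ?p j\<bar>" "F' \<bar>act ?q i\<bar> \<le> F' \<bar>act ?q j\<bar>"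
    if "1 \<le> i" "i \<le> j" "j \<le> int n" for i j
    using sorts_weak_mono[OF st_sorts that, of "%v. 2 * F v + 1"]
      sorts_weak_mono[OF st_sorts that, of "%v. 2 * F' v + 1"] by auto
  have e: "F \<bar>act ?p i\<bar> = F' \<bar>act ?q i\<bar>" if "i \<in> pos" for i
    using mono_cnt_unique[of "%i. F \<bar>act ?p i\<bar>" "%i. F' \<bar>act ?q i\<bar>", OF m] that assms by (simp add: cnt_act)
  have ip: "0 < act (inv ?p) v \<and> act (inv ?p) v \<in> pos" if v: "v \<in> pos" for v
  proof -
    let ?i = "\<bar>act (inv ?p) v\<bar>"
    have i: "?i \<in> pos" using act_pos_abs v by simp
    have "\<bar>act ?p ?i\<bar> = \<bar>v\<bar>" by (simp add: act_abs act_inv)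
    then have "act ?p ?i = v" using pp(1)[OF i] v by auto
    then have "?i = act (inv ?p) v" by (metis act_inv(2) st_closed)
    then show ?thesis using i by auto
  qed
  show thesis
  proof (rule that[of "?q \<otimes> inv ?p"])
    fix v assume v: "v \<in> pos"
    let ?i = "act (inv ?p) v"
    have i: "?i \<in> pos" using ip v by blast
    have a: "act (?q \<otimes> inv ?p) v = act ?q ?i" by (simp add: act_mult_apply)
    show "0 < act (?q \<otimes> inv ?p) v" unfolding a using pp(2) i by blast
    have "F v = F \<bar>act ?p ?i\<bar>" using v by (simp add: act_inv)
    then show "F v = F' (act (?q \<otimes> inv ?p) v)" unfolding a using e[OF i] pp(2)[OF i] by simp
  qed simp
qed

end

section \<open>Closed families of words and their products\<close>

sublocale coxeter_C \<subseteq> finite_group G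
  by unfold_locales (rule finite_carrier)

context coxeter_C begin

text \<open>The words with the same content as \<open>F\<close>. Functions are extensional, so that a word is
  determined by its letters at \<open>pos\<close>.\<close>

definition rcl :: "(int => nat) => (int => nat) set" where
  "rcl F = {F' \<in> extensional pos. cnt F' = cnt F}"

definition closed_family :: "(int => nat) set => bool" where
  "closed_family \<H> \<longleftrightarrow> finite \<H> \<and> \<H> \<subseteq> extensional pos \<and> (\<forall>F\<in>\<H>. rcl F \<subseteq> \<H>)"

definition Y :: "(int => nat) set => 'a => int" where
  "Y \<H> g = (\<Sum>F\<in>\<H>. if st F = g then 1 else 0)"

text \<open>Summed over a rearrangement class, this gives the character induced from a product of
  hyperoctahedral groups, one for each letter: from the linear character that is the product of all
  signs at the even letters and trivial at the odd ones. The summand of \<open>F\<close> belongs to one coset.\<close>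

definition m :: "(int => nat) => 'a => int" where
  "m F g = (if \<forall>v\<in>pos. F \<bar>act g v\<bar> = F v
     then \<Prod>v\<in>pos. if even (F v) then sgn (act g v) else 1 else 0)"

definition M :: "(int => nat) set => 'a => int" where
  "M \<H> g = (\<Sum>F\<in>\<H>. m F g)"

lemma finite_pos_Collect [simp]: "finite {v \<in> pos. P v}"
  by (rule finite_subset[of _ pos]) auto

lemma cnt_pos_iff: "cnt F j > 0 \<longleftrightarrow> j \<in> F ` pos"
  using finite_pos_Collect[of "%v. F v = j"] by (auto simp: cnt_def card_gt_0_iff simp del: atLeastAtMost_iff)

lemma cnt_restrict [simp]: "cnt (restrict F pos) = cnt F"
  by (rule cnt_cong) auto

lemma rcl_values: "F' \<in> rcl F ==> F' ` pos = F ` pos"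
proof -
  assume "F' \<in> rcl F"
  then have "j \<in> F' ` pos \<longleftrightarrow> j \<in> F ` pos" for j
    using cnt_pos_iff[of F' j] cnt_pos_iff[of F j] by (simp add: rcl_def)
  then show ?thesis by blast
qed

lemma finite_rcl: "finite (rcl F)"
proof (rule finite_subset)
  show "rcl F \<subseteq> PiE pos (%_. F ` pos)"
  proof
    fix F' assume F': "F' \<in> rcl F"
    then show "F' \<in> PiE pos (%_. F ` pos)" using rcl_values[OF F'] by (auto simp: rcl_def PiE_def)
  qed
qed (auto intro: finite_PiE)

lemma rcl_refl: "F \<in> extensional pos ==> F \<in> rcl F"
  by (simp add: rcl_def)

lemma rcl_eq: "F' \<in> rcl F ==> rcl F' = rcl F"
  by (simp add: rcl_def)

lemma closed_rcl: "closed_family (rcl F)"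
  unfolding closed_family_def using finite_rcl rcl_eq by (auto simp: rcl_def)

lemma rcl_act: "g \<in> carrier G ==> restrict (%v. F \<bar>act g v\<bar>) pos \<in> rcl F"
  by (simp add: rcl_def cnt_act)

lemma closed_family_act: "closed_family \<H> ==> F \<in> \<H> ==> g \<in> carrier G ==>
    restrict (%v. F \<bar>act g v\<bar>) pos \<in> \<H>"
  using rcl_act unfolding closed_family_def by blast

lemma closed_familyI:
  assumes "finite \<H>" "\<H> \<subseteq> extensional pos"
    "\<And>F g. F \<in> \<H> ==> g \<in> carrier G ==> restrict (%v. F \<bar>act g v\<bar>) pos \<in> \<H>"
  shows "closed_family \<H>"
proof -
  have "F' \<in> \<H>" if F: "F \<in> \<H>" and F': "F' \<in> rcl F" for F F'
  proof -
    have "cnt F' = cnt F" using F' by (simp add: rcl_def)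
    then obtain g where g: "g \<in> carrier G" "\<And>v. v \<in> pos ==> 0 < act g v"
        "\<And>v. v \<in> pos ==> F' v = F (act g v)"
      using cnt_eq_imp_conj[of F' F] by blast
    have "F' = restrict (%v. F \<bar>act g v\<bar>) pos"
    proof
      fix v show "F' v = restrict (%v. F \<bar>act g v\<bar>) pos v"
        using g(2)[of v] g(3)[of v] F' by (cases "v \<in> pos") (auto simp: rcl_def extensional_def)
    qed
    then show ?thesis using assms(3)[OF F g(1)] by simp
  qed
  then show ?thesis using assms unfolding closed_family_def by blast
qed

lemma sorts_cong1: assumes "\<And>v. v \<in> pos ==> F v = F' v" "sorts F g" shows "sorts F' g"
proof -
  have g: "g \<in> carrier G" using assms(2) by (simp add: sorts_def)
  have a: "F' \<bar>act g i\<bar> = F \<bar>act g i\<bar>" if "i \<in> pos" for i using assms(1)[OF act_pos_abs[OF g that]] by simp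
  show ?thesis unfolding sorts_def
  proof (intro conjI ballI allI impI g)
    fix i assume i: "i \<in> pos"
    show "0 < act g i \<longleftrightarrow> odd (F' \<bar>act g i\<bar>)" unfolding a[OF i] using assms(2) i by (simp add: sorts_def)
  next
    fix i assume i: "1 \<le> i \<and> i < int n"
    then have "lx F (act g i) (act g (i + 1))" using assms(2) by (simp add: sorts_def)
    then show "lx F' (act g i) (act g (i + 1))" using a[of i] a[of "i + 1"] i by (simp add: lx_def)
  qed
qed

lemma sorts_cong: assumes "\<And>v. v \<in> pos ==> F v = F' v" shows "sorts F g \<longleftrightarrow> sorts F' g"
  using sorts_cong1[of F F' g] sorts_cong1[of F' F g] assms by metis

lemma m_cong:
  assumes "g \<in> carrier G" "\<And>v. v \<in> pos ==> F v = F' v" shows "m F g = m F' g"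
proof -
  have "F \<bar>act g v\<bar> = F' \<bar>act g v\<bar>" if "v \<in> pos" for v using assms(2) act_pos_abs[OF assms(1) that] by blast
  then have 1: "(\<forall>v\<in>pos. F \<bar>act g v\<bar> = F v) \<longleftrightarrow> (\<forall>v\<in>pos. F' \<bar>act g v\<bar> = F' v)"
    using assms(2) by metis
  have 2: "(\<Prod>v\<in>pos. if even (F v) then sgn (act g v) else 1) = (\<Prod>v\<in>pos. if even (F' v) then sgn (act g v) else 1)"
    by (rule prod.cong[OF HOL.refl]) (simp only: assms(2))
  show ?thesis unfolding m_def 1 2 ..
qed

subsection \<open>Products\<close>

text \<open>An injective encoding of a pair of letters \<open>(b, a)\<close> with \<open>a < K\<close> whose order is lexicographic,
  but reversed in \<open>a\<close> when \<open>b\<close> is even, because the second factor then reverses the positions. The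
  parity says whether the two signs agree.\<close>

definition code :: "nat => nat => nat => nat" where
  "code K b a = 2 * (b * K + (if odd b then a else K - 1 - a)) + (if odd a = odd b then 1 else 0)"

lemma code_even [simp]: "even (code K b a) \<longleftrightarrow> (even a \<longleftrightarrow> odd b)"
  by (simp add: code_def)

lemma code_less1: assumes "b < b'" "a < K" "a' < K" shows "code K b a < code K b' a'"
proof -
  have "Suc b * K \<le> b' * K" using assms(1) by (intro mult_right_mono) auto
  moreover have "(if odd b then a else K - 1 - a) < K" using assms by auto
  ultimately have "b * K + (if odd b then a else K - 1 - a) < b' * K + (if odd b' then a' else K - 1 - a')"
    by simp
  then show ?thesis unfolding code_def by simp
qed

lemma code_less2: "a < a' ==> a' < K ==> odd b ==> code K b a < code K b a'"
  "a < a' ==> a' < K ==> even b ==> code K b a' < code K b a"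
  by (auto simp: code_def)

lemma code_inj: assumes "code K b a = code K b' a'" "a < K" "a' < K" shows "b = b' \<and> a = a'"
proof -
  have "b = b'" using code_less1[of b b' a K a'] code_less1[of b' b a' K a] assms
    by (metis less_irrefl linorder_neqE_nat)
  moreover have "a = a'" using code_less2[of a a' K b] code_less2[of a' a K b] assms \<open>b = b'\<close>
    by (metis less_irrefl linorder_neqE_nat)
  ultimately show ?thesis by simp
qed

definition pw :: "nat => (int => nat) => (int => nat) => int => nat" where
  "pw K h f = restrict (%v. code K (h v) (f v)) pos"

text \<open>\<open>code\<close> is injective, so a pair word is constant on cycles exactly when both words are. A sign
  contributes to the pair word when exactly one of the two letters is even; if both are even, its
  square contributes.\<close>

lemma m_pw:
  assumes g: "g \<in> carrier G" and f: "\<And>v. v \<in> pos ==> f v < K"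
  shows "m (pw K h f) g = m f g * m h g"
proof -
  have ga: "\<bar>act g v\<bar> \<in> pos" if "v \<in> pos" for v using act_pos_abs[OF g that] .
  have fx: "(\<forall>v\<in>pos. pw K h f \<bar>act g v\<bar> = pw K h f v) \<longleftrightarrow>
      (\<forall>v\<in>pos. f \<bar>act g v\<bar> = f v) \<and> (\<forall>v\<in>pos. h \<bar>act g v\<bar> = h v)"
  proof -
    have "pw K h f \<bar>act g v\<bar> = pw K h f v \<longleftrightarrow> f \<bar>act g v\<bar> = f v \<and> h \<bar>act g v\<bar> = h v" if v: "v \<in> pos" for v
      using code_inj[of K "h \<bar>act g v\<bar>" "f \<bar>act g v\<bar>" "h v" "f v"] f[OF v] f[OF ga[OF v]] v ga[OF v]
      by (auto simp: pw_def simp del: atLeastAtMost_iff)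
    then show ?thesis by blast
  qed
  have "(\<Prod>v\<in>pos. if even (pw K h f v) then sgn (act g v) else 1) =
      (\<Prod>v\<in>pos. (if even (f v) then sgn (act g v) else 1) * (if even (h v) then sgn (act g v) else 1))"
  proof (rule prod.cong[OF HOL.refl])
    fix v assume v: "v \<in> pos"
    have "act g v ~= 0" using act_eq_0_iff[OF g, of v] v by auto
    then have "sgn (act g v) * sgn (act g v) = 1" by (simp add: sgn_if)
    then show "(if even (pw K h f v) then sgn (act g v) else 1) =
        (if even (f v) then sgn (act g v) else 1) * (if even (h v) then sgn (act g v) else 1)"
      using v by (simp add: pw_def)
  qed
  then show ?thesis unfolding m_def fx by (simp add: prod.distrib)
qed

text \<open>The product first sorts by \<open>h\<close>, transported along \<open>st f\<close>, and then by \<open>f\<close>: in the given order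
  where \<open>h\<close> is odd, and in reverse order where it is even.\<close>

lemma st_mult:
  assumes f: "\<And>v. v \<in> pos ==> f v < K"
  shows "st f \<otimes> st h = st (pw K (%v. h \<bar>act (inv (st f)) v\<bar>) f)"
proof -
  let ?u = "st f" and ?v = "st h"
  let ?H = "%v. code K (h \<bar>act (inv ?u) v\<bar>) (f v)"
  have u: "sorts f ?u" and v: "sorts h ?v" by (rule st_sorts)+
  have H: "?H \<bar>act ?u x\<bar> = code K (h \<bar>x\<bar>) (f \<bar>act ?u x\<bar>)" for x
    using act_abs[of "inv ?u" "act ?u x"] act_inv(2)[OF st_closed, of f x] by simp
  have usgn: "0 < act ?u x \<longleftrightarrow> odd (f \<bar>act ?u x\<bar>)" if "x \<in> pos" for x
    using u that by (simp add: sorts_def)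
  have usgn': "0 < act ?u x \<longleftrightarrow> (0 < x \<longleftrightarrow> odd (f \<bar>act ?u x\<bar>))" if x: "\<bar>x\<bar> \<in> pos" for x
  proof (cases "0 < x")
    case True then show ?thesis using usgn[of x] x by simp
  next
    case False
    then have p: "- x \<in> pos" using x by auto
    have "act ?u (- x) = - act ?u x" by (simp add: act_minus)
    moreover have "act ?u x ~= 0" using act_eq_0_iff[of ?u x] x by auto
    ultimately show ?thesis using usgn[OF p] False by auto
  qed
  have "sorts ?H (?u \<otimes> ?v)" unfolding sorts_def
  proof (intro conjI ballI allI impI)
    fix i assume i: "i \<in> pos"
    let ?x = "act ?v i"
    have x: "\<bar>?x\<bar> \<in> pos" using act_pos_abs i by simp
    have "0 < ?x \<longleftrightarrow> odd (h \<bar>?x\<bar>)" using v i by (simp add: sorts_def)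
    then show "0 < act (?u \<otimes> ?v) i \<longleftrightarrow> odd (?H \<bar>act (?u \<otimes> ?v) i\<bar>)"
      unfolding act_mult_apply[OF st_closed st_closed] H usgn'[OF x] by auto
  next
    fix i assume i: "1 \<le> i \<and> i < int n"
    let ?x = "act ?v i" and ?y = "act ?v (i + 1)"
    have x: "\<bar>?x\<bar> \<in> pos" "\<bar>?y\<bar> \<in> pos" using act_pos_abs[of ?v i] act_pos_abs[of ?v "i + 1"] i by auto
    have ux: "\<bar>act ?u ?x\<bar> \<in> pos" "\<bar>act ?u ?y\<bar> \<in> pos" using x act_pos by auto
    have sx: "0 < ?x \<longleftrightarrow> odd (h \<bar>?x\<bar>)" "0 < ?y \<longleftrightarrow> odd (h \<bar>?y\<bar>)"
      using v i by (simp_all add: sorts_def)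
    have "lx h ?x ?y" using v i by (simp add: sorts_def)
    then consider (1) "h \<bar>?x\<bar> < h \<bar>?y\<bar>" | (2) "h \<bar>?x\<bar> = h \<bar>?y\<bar>" "?x < ?y" "odd (h \<bar>?x\<bar>)"
      | (3) "h \<bar>?x\<bar> = h \<bar>?y\<bar>" "?x < ?y" "even (h \<bar>?x\<bar>)" by (auto simp: lx_def)
    then have "lx ?H (act ?u ?x) (act ?u ?y)"
    proof cases
      case 1
      then show ?thesis unfolding lx_def H using code_less1 f ux by blast
    next
      case 2
      then have "1 \<le> ?x" "?y \<le> int n" using sx x by auto
      then have "lx f (act ?u ?x) (act ?u ?y)" using sorts_mono[OF u] 2 by blast
      then show ?thesis unfolding lx_def H using code_less2(1) f ux 2 by metis
    next
      case 3
      then have "1 \<le> - ?y" "- ?x \<le> int n" "- ?y < - ?x" using sx x by auto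
      then have "lx f (act ?u (- ?y)) (act ?u (- ?x))" using sorts_mono[OF u] by blast
      then have "f \<bar>act ?u ?y\<bar> < f \<bar>act ?u ?x\<bar> \<or> f \<bar>act ?u ?y\<bar> = f \<bar>act ?u ?x\<bar> \<and> act ?u ?x < act ?u ?y"
        unfolding lx_def by (simp add: act_minus)
      then show ?thesis unfolding lx_def H using code_less2(2) f ux 3 by metis
    qed
    then show "lx ?H (act (?u \<otimes> ?v) i) (act (?u \<otimes> ?v) (i + 1))"
      by (simp only: act_mult_apply[OF st_closed st_closed])
  qed simp
  then have "sorts (pw K (%v. h \<bar>act (inv ?u) v\<bar>) f) (?u \<otimes> ?v)"
    using sorts_cong[of "pw K (%v. h \<bar>act (inv ?u) v\<bar>) f" ?H] by (simp add: pw_def del: atLeastAtMost_iff)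
  then show ?thesis using st_eq_iff by metis
qed

lemma conv_delta:
  "a \<in> carrier G ==> b \<in> carrier G ==>
    conv (%g. if a = g then 1 else 0) (%g. if b = g then 1 else (0::int)) w = (if a \<otimes> b = w then 1 else 0)"
proof -
  assume ab: "a \<in> carrier G" "b \<in> carrier G"
  have "conv (%g. if a = g then 1 else 0) (%g. if b = g then 1 else (0::int)) w =
    (\<Sum>x\<in>carrier G. if a = x then (\<Sum>y\<in>carrier G. if b = y then (if x \<otimes> y = w then 1 else 0) else 0) else 0)"
    unfolding conv_def by (intro sum.cong) (auto intro!: sum.cong)
  then show ?thesis using ab finite_carrier by simp
qed

definition pairs :: "nat => (int => nat) set => (int => nat) set => (int => nat) set" where
  "pairs K A B = (%(f, h). pw K h f) ` (A \<times> B)"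

lemma pw_inj:
  assumes "A \<subseteq> extensional pos" "B \<subseteq> extensional pos" "\<And>f v. f \<in> A ==> v \<in> pos ==> f v < K"
  shows "inj_on (%(f, h). pw K h f) (A \<times> B)"
proof (rule inj_onI, clarify)
  fix f h f' h' assume *: "f \<in> A" "h \<in> B" "f' \<in> A" "h' \<in> B" "pw K h f = pw K h' f'"
  have "h v = h' v \<and> f v = f' v" if v: "v \<in> pos" for v
  proof (rule code_inj)
    show "code K (h v) (f v) = code K (h' v) (f' v)" using fun_cong[OF *(5), of v] v by (simp add: pw_def)
  qed (use assms(3) * v in auto)
  then show "f = f' \<and> h = h'" using * assms(1,2)
    by (metis extensionalityI subsetD)
qed

text \<open>By \<open>st_mult\<close>; transporting \<open>h\<close> along \<open>st f\<close> permutes the closed family \<open>B\<close>.\<close>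

lemma conv_Y:
  assumes A: "closed_family A" and B: "closed_family B" and K: "\<And>f v. f \<in> A ==> v \<in> pos ==> f v < K"
  shows "conv (Y A) (Y B) = Y (pairs K A B)"
proof
  fix w
  have Bf: "finite B" "B \<subseteq> extensional pos" and Af: "finite A" "A \<subseteq> extensional pos"
    using A B by (auto simp: closed_family_def)
  have s: "(\<Sum>h\<in>B. if st f \<otimes> st h = w then 1 else (0::int)) = (\<Sum>h\<in>B. if st (pw K h f) = w then 1 else 0)"
    if f: "f \<in> A" for f
  proof -
    let ?u = "st f"
    let ?i = "%g h. restrict (%v. h \<bar>act g v\<bar>) pos"
    have cl: "?i g h \<in> B" if "g \<in> carrier G" "h \<in> B" for g h using closed_family_act[OF B that(2,1)] .
    have ii: "?i g (?i g' h) = h" if "g \<in> carrier G" "g' \<in> carrier G" "h \<in> B" "\<And>v. act g' (act g v) = v" for g g' h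
    proof
      fix v
      show "?i g (?i g' h) v = h v"
      proof (cases "v \<in> pos")
        case True
        then have "\<bar>act g' \<bar>act g v\<bar>\<bar> = v" using act_abs[OF that(2), of "act g v"] that(4)[of v] by simp
        then show ?thesis using True act_pos_abs[OF that(1) True] by (simp del: atLeastAtMost_iff)
      next
        case False then show ?thesis using that(3) Bf(2) by (auto simp: extensional_def)
      qed
    qed
    show ?thesis
    proof (rule sum.reindex_bij_witness[of _ "?i ?u" "?i (inv ?u)"])
      fix h assume h: "h \<in> B"
      show "?i ?u (?i (inv ?u) h) = h" by (rule ii) (use h in \<open>simp_all add: act_inv\<close>)
      show "?i (inv ?u) h \<in> B" by (rule cl) (use h in simp_all)
      have "pw K (?i (inv ?u) h) f = pw K (%v. h \<bar>act (inv ?u) v\<bar>) f" by (auto simp: pw_def fun_eq_iff)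
      then have "st f \<otimes> st h = st (pw K (?i (inv ?u) h) f)" using st_mult[of f K h] K[OF f] by simp
      then show "(if st (pw K (?i (inv ?u) h) f) = w then 1 else 0) = (if st f \<otimes> st h = w then 1 else (0::int))" by simp
    next
      fix h assume h: "h \<in> B"
      show "?i (inv ?u) (?i ?u h) = h" by (rule ii) (use h in \<open>simp_all add: act_inv\<close>)
      show "?i ?u h \<in> B" by (rule cl) (use h in simp_all)
    qed
  qed
  have pi: "inj_on (%(f, h). pw K h f) (A \<times> B)" by (rule pw_inj[OF Af(2) Bf(2)]) (rule K)
  have Y1: "Y C = (%g. \<Sum>F\<in>C. 1 * (if st F = g then 1 else 0))" for C by (simp add: Y_def fun_eq_iff)
  have "conv (Y A) (Y B) w = (\<Sum>f\<in>A. \<Sum>h\<in>B. if st f \<otimes> st h = w then 1 else 0)"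
    unfolding Y1 conv_sum_left conv_sum_right by (simp add: conv_delta)
  also have "\<dots> = (\<Sum>f\<in>A. \<Sum>h\<in>B. if st (pw K h f) = w then 1 else 0)" by (rule sum.cong[OF HOL.refl]) (rule s)
  also have "\<dots> = (\<Sum>(f, h)\<in>A \<times> B. if st (pw K h f) = w then 1 else 0)" by (simp add: sum.cartesian_product)
  also have "\<dots> = Y (pairs K A B) w"
    unfolding Y_def pairs_def sum.reindex[OF pi] by (simp add: case_prod_unfold)
  finally show "conv (Y A) (Y B) w = Y (pairs K A B) w" .
qed

lemma M_mult:
  assumes A: "closed_family A" and B: "closed_family B" and K: "\<And>f v. f \<in> A ==> v \<in> pos ==> f v < K"
    and g: "g \<in> carrier G"
  shows "M A g * M B g = M (pairs K A B) g"
proof -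
  have Bf: "B \<subseteq> extensional pos" and Af: "A \<subseteq> extensional pos" using A B by (auto simp: closed_family_def)
  have pi: "inj_on (%(f, h). pw K h f) (A \<times> B)" by (rule pw_inj[OF Af Bf]) (rule K)
  have "M (pairs K A B) g = (\<Sum>(f, h)\<in>A \<times> B. m (pw K h f) g)"
    unfolding M_def pairs_def sum.reindex[OF pi] by (simp add: case_prod_unfold)
  also have "\<dots> = (\<Sum>(f, h)\<in>A \<times> B. m f g * m h g)"
    using m_pw[OF g] K by (intro sum.cong) auto
  also have "\<dots> = M A g * M B g" by (simp add: M_def sum_product sum.cartesian_product)
  finally show ?thesis by simp
qed

lemma closed_pairs:
  assumes A: "closed_family A" and B: "closed_family B"
  shows "closed_family (pairs K A B)"
proof (rule closed_familyI)
  show "finite (pairs K A B)" using A B by (simp add: pairs_def closed_family_def)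
  show "pairs K A B \<subseteq> extensional pos" by (auto simp: pairs_def pw_def)
  fix F g assume "F \<in> pairs K A B" and g: "g \<in> carrier G"
  then obtain f h where fh: "f \<in> A" "h \<in> B" "F = pw K h f" by (auto simp: pairs_def)
  let ?i = "%h. restrict (%v. h \<bar>act g v\<bar>) pos"
  have "?i F = pw K (?i h) (?i f)"
  proof
    fix v show "?i F v = pw K (?i h) (?i f) v"
      using act_pos_abs[OF g, of v] by (cases "v \<in> pos") (auto simp: fh(3) pw_def simp del: atLeastAtMost_iff)
  qed
  then show "?i F \<in> pairs K A B"
    using closed_family_act[OF A fh(1) g] closed_family_act[OF B fh(2) g] by (auto simp: pairs_def)
qed

end

section \<open>Counting fixed colourings\<close>

lemma prod_one_plus:
  fixes a :: "'b => int"
  assumes "finite U"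
  shows "(\<Prod>v\<in>U. 1 + a v) = (\<Sum>K\<in>Pow U. \<Prod>v\<in>K. a v)"
  using assms
proof (induction U)
  case (insert u U)
  have "(\<Sum>K\<in>insert u ` Pow U. \<Prod>v\<in>K. a v) = (\<Sum>K\<in>Pow U. \<Prod>v\<in>insert u K. a v)"
    using insert.hyps by (intro sum.reindex_cong[of "insert u"]) (auto simp: inj_on_def)
  also have "\<dots> = (\<Sum>K\<in>Pow U. a u * (\<Prod>v\<in>K. a v))"
  proof (rule sum.cong[OF HOL.refl])
    fix K assume "K \<in> Pow U"
    then have "finite K" "u \<notin> K" using insert.hyps finite_subset by auto
    then show "(\<Prod>v\<in>insert u K. a v) = a u * (\<Prod>v\<in>K. a v)" by simp
  qed
  finally have s: "(\<Sum>K\<in>insert u ` Pow U. \<Prod>v\<in>K. a v) = a u * (\<Sum>K\<in>Pow U. \<Prod>v\<in>K. a v)"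
    by (simp add: sum_distrib_left)
  have "(\<Sum>K\<in>Pow (insert u U). \<Prod>v\<in>K. a v) = (\<Sum>K\<in>Pow U. \<Prod>v\<in>K. a v) + (\<Sum>K\<in>insert u ` Pow U. \<Prod>v\<in>K. a v)"
    unfolding Pow_insert by (rule sum.union_disjoint) (use insert.hyps in auto)
  then show ?case using insert s by (simp add: distrib_right)
qed simp

lemma prod_one_plus_signs:
  fixes x :: "'b => int"
  assumes "finite U" "\<And>v. v \<in> U ==> x v = 1 \<or> x v = - 1"
  shows "(\<Prod>v\<in>U. 1 + x v) = (if \<forall>v\<in>U. x v = 1 then 2 ^ card U else 0)"
proof (cases "\<forall>v\<in>U. x v = 1")
  case False
  then obtain v where "v \<in> U" "1 + x v = 0" using assms(2) by force
  then show ?thesis using assms(1) False by (metis prod_zero)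
qed simp

text \<open>Expand the indicator of the condition on \<open>N\<close> into a product of factors \<open>(1 + \<dots>) / 2\<close>, indexed
  by \<open>U\<close>, and interchange the sums: the sum over \<open>N\<close> of the term for \<open>K \<subseteq> U\<close> vanishes unless \<open>K\<close> is
  stable under \<open>p\<close>.\<close>

lemma fixed_colourings:
  fixes e :: "'b => int"
  assumes U: "finite U" and p: "bij_betw p U U" and e: "\<And>v. v \<in> U ==> e v = 1 \<or> e v = - 1"
  shows "(\<Sum>N\<in>Pow U. if \<forall>v\<in>U. (p v \<in> N \<longleftrightarrow> v \<in> N) \<longleftrightarrow> e v = 1 then 1 else 0) =
    (\<Sum>N\<in>Pow U. if \<forall>v\<in>U. p v \<in> N \<longleftrightarrow> v \<in> N then \<Prod>v\<in>N. e v else 0)" (is "?L = ?R")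
proof -
  define s where "s N v = (if v \<in> N then - 1 else 1 :: int)" for N and v :: 'b
  have pU: "p v \<in> U" if "v \<in> U" for v using p that by (auto simp: bij_betw_def)
  have "2 ^ card U * ?L = (\<Sum>N\<in>Pow U. \<Sum>K\<in>Pow U. \<Prod>v\<in>K. e v * (s N v * s N (p v)))"
    unfolding sum_distrib_left
  proof (rule sum.cong[OF HOL.refl])
    fix N
    have "(\<Prod>v\<in>U. 1 + e v * (s N v * s N (p v))) =
        (if \<forall>v\<in>U. e v * (s N v * s N (p v)) = 1 then 2 ^ card U else 0)"
      by (rule prod_one_plus_signs[OF U]) (use e in \<open>force simp: s_def\<close>)
    moreover have "e v * (s N v * s N (p v)) = 1 \<longleftrightarrow> ((p v \<in> N \<longleftrightarrow> v \<in> N) \<longleftrightarrow> e v = 1)" if "v \<in> U" for v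
      using e[OF that] by (auto simp: s_def)
    ultimately show "2 ^ card U * (if \<forall>v\<in>U. (p v \<in> N \<longleftrightarrow> v \<in> N) \<longleftrightarrow> e v = 1 then 1 else 0) =
        (\<Sum>K\<in>Pow U. \<Prod>v\<in>K. e v * (s N v * s N (p v)))"
      unfolding prod_one_plus[OF U, symmetric] by (simp cong: ball_cong)
  qed
  also have "\<dots> = (\<Sum>K\<in>Pow U. \<Sum>N\<in>Pow U. \<Prod>v\<in>K. e v * (s N v * s N (p v)))" by (rule sum.swap)
  also have "\<dots> = (\<Sum>K\<in>Pow U. 2 ^ card U * (if \<forall>v\<in>U. p v \<in> K \<longleftrightarrow> v \<in> K then \<Prod>v\<in>K. e v else 0))"
  proof (rule sum.cong[OF HOL.refl])
    fix K assume K: "K \<in> Pow U"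
    then have fK: "finite K" and KU: "K \<subseteq> U" using U finite_subset by auto
    have ip: "inj_on p U" using p by (simp add: bij_betw_def)
    have pK: "p ` K \<subseteq> U" "inj_on p K" using pU KU ip by (auto intro: inj_on_subset)
    define t where "t v = s K v * s (p ` K) v" for v
    have a: "(\<Prod>v\<in>K'. s N v) = (\<Prod>v\<in>N. s K' v)" if "K' \<subseteq> U" "N \<subseteq> U" for K' N
    proof -
      have "(\<Prod>v\<in>K'. s N v) = (\<Prod>v\<in>U. if v \<in> K' \<and> v \<in> N then - 1 else 1)"
        using U that by (intro prod.mono_neutral_cong_left) (auto simp: s_def)
      also have "\<dots> = (\<Prod>v\<in>N. s K' v)"
        using U that by (intro prod.mono_neutral_cong_right) (auto simp: s_def)
      finally show ?thesis .
    qed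
    have "(\<Sum>N\<in>Pow U. \<Prod>v\<in>K. e v * (s N v * s N (p v))) = (\<Prod>v\<in>K. e v) * (\<Sum>N\<in>Pow U. \<Prod>v\<in>N. t v)"
      unfolding sum_distrib_left
    proof (rule sum.cong[OF HOL.refl])
      fix N assume "N \<in> Pow U"
      then have N: "N \<subseteq> U" by simp
      have "(\<Prod>v\<in>K. s N (p v)) = (\<Prod>w\<in>p ` K. s N w)" using pK by (simp add: prod.reindex)
      then show "(\<Prod>v\<in>K. e v * (s N v * s N (p v))) = (\<Prod>v\<in>K. e v) * (\<Prod>v\<in>N. t v)"
        using a[OF KU N] a[OF pK(1) N] by (simp add: prod.distrib t_def)
    qed
    also have "(\<Sum>N\<in>Pow U. \<Prod>v\<in>N. t v) = (if \<forall>v\<in>U. t v = 1 then 2 ^ card U else 0)"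
      unfolding prod_one_plus[OF U, symmetric] by (rule prod_one_plus_signs[OF U]) (auto simp: t_def s_def)
    also have "(\<forall>v\<in>U. t v = 1) \<longleftrightarrow> (\<forall>v\<in>U. p v \<in> K \<longleftrightarrow> v \<in> K)"
    proof -
      have t1: "t v = 1 \<longleftrightarrow> (v \<in> p ` K \<longleftrightarrow> v \<in> K)" for v by (auto simp: t_def s_def)
      have im: "p v \<in> p ` K \<longleftrightarrow> v \<in> K" if "v \<in> U" for v using that KU ip by (auto dest: inj_onD)
      have "(\<forall>v\<in>U. t v = 1) \<longleftrightarrow> p ` K = K" unfolding t1 using pK(1) KU by blast
      also have "\<dots> \<longleftrightarrow> (\<forall>v\<in>U. p v \<in> K \<longleftrightarrow> v \<in> K)"
      proof
        assume "p ` K = K" then show "\<forall>v\<in>U. p v \<in> K \<longleftrightarrow> v \<in> K" using im by metis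
      next
        assume *: "\<forall>v\<in>U. p v \<in> K \<longleftrightarrow> v \<in> K"
        then have "p ` K \<subseteq> K" using KU by blast
        then show "p ` K = K" using fK pK(2) by (intro endo_inj_surj)
      qed
      finally show ?thesis .
    qed
    finally show "(\<Sum>N\<in>Pow U. \<Prod>v\<in>K. e v * (s N v * s N (p v))) =
        2 ^ card U * (if \<forall>v\<in>U. p v \<in> K \<longleftrightarrow> v \<in> K then \<Prod>v\<in>K. e v else 0)" by simp
  qed
  also have "\<dots> = 2 ^ card U * ?R" by (simp add: sum_distrib_left)
  finally show ?thesis by simp
qed

context coxeter_C begin

section \<open>The subgroups generated by closed sets of generators\<close>

definition mono_word :: "(int => nat) => bool" where
  "mono_word b \<longleftrightarrow> (\<forall>i j. 1 \<le> i \<and> i \<le> j \<and> j \<le> int n --> b i \<le> b j)"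

text \<open>The generators in \<open>S\<^sub>n\<close> and among the \<open>t\<^sub>i\<close> that stabilize the word \<open>b\<close> and fix the sign at
  its even letters.\<close>

definition gens :: "(int => nat) => 'a set" where
  "gens b = {s k | k. 1 \<le> k \<and> k < n \<and> b (int k) = b (int k + 1)} \<union>
     {t_refl G s k | k. k < n \<and> odd (b (int k + 1))}"

text \<open>This is \<open>X\<^sub>I\<close> for \<open>I = gens b\<close>, by \<open>X_set_gens\<close>.\<close>

definition Xb :: "(int => nat) => 'a set" where
  "Xb b = {g \<in> carrier G. (\<forall>i. 1 \<le> i \<and> i < int n \<and> b i = b (i + 1) --> act g i < act g (i + 1)) \<and>
     (\<forall>i\<in>pos. odd (b i) --> 0 < act g i)}"

definition stab :: "(int => nat) => 'a set" where
  "stab b = {g \<in> carrier G. \<forall>v\<in>pos. b \<bar>act g v\<bar> = b v \<and> (even (b v) --> 0 < act g v)}"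

text \<open>Every even letter \<open>k\<close> of \<open>b\<close> is split into \<open>2 k\<close> and \<open>2 k + 1\<close>, to be read with negative and
  positive sign; an odd letter \<open>k\<close> only becomes \<open>2 k + 1\<close>.\<close>

definition spl :: "(int => nat) => (int => nat) set" where
  "spl b = {F \<in> extensional pos. cnt (%v. F v div 2) = cnt b \<and> (\<forall>v\<in>pos. odd (F v div 2) --> odd (F v))}"

lemma X_set_gens: "X_set G n s (gens b) = Xb b"
proof (intro equalityI subsetI)
  fix g assume g: "g \<in> X_set G n s (gens b)"
  then have gc: "g \<in> carrier G" by (simp add: X_set_def)
  have "act g i < act g (i + 1)" if "1 \<le> i \<and> i < int n \<and> b i = b (i + 1)" for i
  proof -
    define k where "k = nat i"
    have k: "i = int k" using that by (simp add: k_def)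
    have "s k \<in> gens b" using that unfolding k by (auto simp: gens_def)
    then show ?thesis using g ascent_s[OF gc, of k] that unfolding k by (simp add: X_set_def)
  qed
  moreover have "0 < act g i" if "i \<in> pos" "odd (b i)" for i
  proof -
    define k where "k = nat (i - 1)"
    have k: "i = int k + 1" using that by (simp add: k_def)
    have "t_refl G s k \<in> gens b" using that unfolding k by (auto simp: gens_def)
    then show ?thesis using g ascent_t[OF gc, of k] that unfolding k by (simp add: X_set_def)
  qed
  ultimately show "g \<in> Xb b" using gc by (auto simp: Xb_def)
next
  fix g assume g: "g \<in> Xb b"
  then have gc: "g \<in> carrier G" by (simp add: Xb_def)
  have "coxeter_length G {..<n} s (g \<otimes> r) > coxeter_length G {..<n} s g" if "r \<in> gens b" for r
    using that unfolding gens_def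
  proof (elim UnE CollectE exE conjE)
    fix k assume k: "r = s k" "1 \<le> k" "k < n" "b (int k) = b (int k + 1)"
    then show ?thesis using g ascent_s[OF gc k(3)] by (auto simp: Xb_def)
  next
    fix k assume k: "r = t_refl G s k" "k < n" "odd (b (int k + 1))"
    then show ?thesis using g ascent_t[OF gc k(2)] by (auto simp: Xb_def)
  qed
  then show "g \<in> X_set G n s (gens b)" using gc by (simp add: X_set_def)
qed

lemma stab_subgroup: "subgroup (stab b) G"
proof (rule subgroupI)
  show "stab b \<subseteq> carrier G" by (auto simp: stab_def)
  have "\<one> \<in> stab b" by (auto simp: stab_def)
  then show "stab b ~= {}" by blast
next
  fix g assume g: "g \<in> stab b"
  then have gc: "g \<in> carrier G" by (simp add: stab_def)
  have "b \<bar>act (inv g) v\<bar> = b v \<and> (even (b v) --> 0 < act (inv g) v)" if v: "v \<in> pos" for v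
  proof -
    let ?u = "\<bar>act (inv g) v\<bar>"
    have u: "?u \<in> pos" using act_pos_abs gc v by simp
    have a: "\<bar>act g ?u\<bar> = v" using act_abs[OF gc, of "act (inv g) v"] v by (simp add: act_inv gc)
    have b: "b v = b ?u" "even (b ?u) --> 0 < act g ?u"
    proof -
      have "b \<bar>act g ?u\<bar> = b ?u \<and> (even (b ?u) --> 0 < act g ?u)" using g u unfolding stab_def by blast
      then show "b v = b ?u" "even (b ?u) --> 0 < act g ?u" unfolding a by simp_all
    qed
    have "0 < act (inv g) v" if "even (b v)"
    proof -
      have "act g ?u = v" using a b that by auto
      then have "act (inv g) v = ?u" using act_inv(2)[OF gc, of ?u] by simp
      then show ?thesis using u by auto
    qed
    then show ?thesis using b by simp
  qed
  then show "inv g \<in> stab b" using gc by (simp add: stab_def)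
next
  fix g h assume gh: "g \<in> stab b" "h \<in> stab b"
  then have c: "g \<in> carrier G" "h \<in> carrier G" by (auto simp: stab_def)
  have "b \<bar>act (g \<otimes> h) v\<bar> = b v \<and> (even (b v) --> 0 < act (g \<otimes> h) v)" if v: "v \<in> pos" for v
  proof -
    let ?u = "\<bar>act h v\<bar>"
    have u: "?u \<in> pos" using act_pos_abs c v by simp
    have "\<bar>act (g \<otimes> h) v\<bar> = \<bar>act g ?u\<bar>" using c by (simp add: act_mult_apply act_abs)
    moreover have "b \<bar>act g ?u\<bar> = b ?u" "b ?u = b v" using gh u v by (auto simp: stab_def)
    moreover have "0 < act (g \<otimes> h) v" if e: "even (b v)"
    proof -
      have "0 < act h v" using gh v e by (auto simp: stab_def)
      then have "act h v = ?u" by simp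
      moreover have "0 < act g ?u" using gh u \<open>b ?u = b v\<close> e by (auto simp: stab_def)
      ultimately show ?thesis using c by (simp add: act_mult_apply)
    qed
    ultimately show ?thesis by simp
  qed
  then show "g \<otimes> h \<in> stab b" using c by (simp add: stab_def)
qed

lemma S_ext_cases:
  assumes "r \<in> S_ext G n s"
  obtains k where "1 \<le> k" "k < n" "r = s k" | k where "k < n" "r = t_refl G s k"
proof -
  from assms have "r \<in> s ` {..<n} \<or> r \<in> t_refl G s ` {..<n}" by (simp add: S_ext_def)
  then show thesis
  proof
    assume "r \<in> s ` {..<n}"
    then obtain k where k: "k < n" "r = s k" by auto
    show thesis
    proof (cases "k = 0")
      case True then show thesis using that(2)[of 0] k by simp
    next
      case False then show thesis using that(1)[of k] k by simp
    qed
  next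
    assume "r \<in> t_refl G s ` {..<n}" then show thesis using that(2) by auto
  qed
qed

lemma s_in_stab: assumes "1 \<le> k" "k < n" shows "s k \<in> stab b \<longleftrightarrow> b (int k) = b (int k + 1)"
proof
  assume "s k \<in> stab b"
  then have "b \<bar>act (s k) (int k)\<bar> = b (int k)" using assms by (auto simp: stab_def)
  then show "b (int k) = b (int k + 1)" using assms by (auto simp: act_s gen_def)
next
  assume e: "b (int k) = b (int k + 1)"
  have "b \<bar>gen k v\<bar> = b v \<and> 0 < gen k v" if "v \<in> pos" for v
    using that assms e by (auto simp: gen_def)
  then show "s k \<in> stab b" using assms by (simp add: stab_def act_s)
qed

lemma t_in_stab: assumes "k < n" shows "t_refl G s k \<in> stab b \<longleftrightarrow> odd (b (int k + 1))"
proof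
  assume t: "t_refl G s k \<in> stab b"
  have "int k + 1 \<in> pos" using assms by auto
  then have "even (b (int k + 1)) --> 0 < act (t_refl G s k) (int k + 1)" using t by (simp add: stab_def)
  then show "odd (b (int k + 1))" using assms by (auto simp: act_t_refl flip_def)
next
  assume "odd (b (int k + 1))"
  then show "t_refl G s k \<in> stab b" using assms by (auto simp: stab_def act_t_refl flip_def add.commute)
qed

lemma gens_subset_S_ext: "gens b \<subseteq> S_ext G n s"
  by (auto simp: gens_def S_ext_def)

lemma gens_eq: "gens b = stab b \<inter> S_ext G n s"
proof (intro equalityI subsetI)
  fix r assume "r \<in> gens b"
  then have "r \<in> S_ext G n s" using gens_subset_S_ext by blast
  moreover have "r \<in> stab b" using \<open>r \<in> gens b\<close> s_in_stab t_in_stab by (auto simp: gens_def)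
  ultimately show "r \<in> stab b \<inter> S_ext G n s" by blast
next
  fix r assume r: "r \<in> stab b \<inter> S_ext G n s"
  then have "r \<in> S_ext G n s" by blast
  then show "r \<in> gens b"
    by (cases rule: S_ext_cases) (use r s_in_stab t_in_stab in \<open>auto simp: gens_def\<close>)
qed

lemma gens_carrier: "gens b \<subseteq> carrier G"
  by (auto simp: gens_eq stab_def)

lemma generate_gens_subset: "generate G (gens b) \<subseteq> stab b"
  by (rule generate_subgroup_incl[OF _ stab_subgroup]) (auto simp: gens_eq)

lemma gens_P0: "gens b \<in> P0 G n s"
proof -
  have "generate G (gens b) \<inter> S_ext G n s = gens b"
  proof -
    have "gens b \<subseteq> generate G (gens b)" by (auto intro: generate.incl)
    then show ?thesis using generate_gens_subset gens_eq[of b] gens_subset_S_ext[of b] by blast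
  qed
  then show ?thesis using gens_subset_S_ext by (auto simp: P0_def)
qed

lemma s_s_cancel: "k < n ==> x \<in> carrier G ==> s k \<otimes> (s k \<otimes> x) = x"
  by (simp add: m_assoc[symmetric])

lemma t_refl_Suc: "Suc k < n ==> t_refl G s (Suc k) = s (Suc k) \<otimes> t_refl G s k \<otimes> s (Suc k)"
  by simp

lemma t_refl_Suc': assumes "Suc k < n" shows "t_refl G s k = s (Suc k) \<otimes> t_refl G s (Suc k) \<otimes> s (Suc k)"
proof -
  have "s (Suc k) \<otimes> t_refl G s (Suc k) \<otimes> s (Suc k) =
      (s (Suc k) \<otimes> s (Suc k)) \<otimes> t_refl G s k \<otimes> (s (Suc k) \<otimes> s (Suc k))"
    using assms by (simp only: t_refl.simps) (simp add: m_assoc s_s_cancel)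
  then show ?thesis using assms by simp
qed

text \<open>The blocks of \<open>b\<close> are the maximal intervals whose simple reflections lie in \<open>I\<close>. Closedness of
  \<open>I\<close> forces the \<open>t\<^sub>i\<close> of a block to lie in \<open>I\<close> together.\<close>

lemma P0_gens:
  assumes "I \<in> P0 G n s"
  obtains b where "mono_word b" "I = gens b" "\<And>v. v \<in> pos ==> b v < 2 * n"
proof -
  have IS: "I \<subseteq> S_ext G n s" and Igen: "I = generate G I \<inter> S_ext G n s" using assms by (auto simp: P0_def)
  have Ic: "I \<subseteq> carrier G" using IS by (auto simp: S_ext_def)
  define d where "d i = card {j \<in> {1..<i}. s (nat j) \<notin> I}" for i :: int
  define b where "b i = 2 * d i + (if t_refl G s (nat (i - 1)) \<in> I then 1 else 0)" for i
  have dstep: "d (i + 1) = d i + (if s (nat i) \<in> I then 0 else 1)" if "1 \<le> i" for i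
  proof -
    have "{j \<in> {1..<i + 1}. s (nat j) \<notin> I} =
      (if s (nat i) \<in> I then {j \<in> {1..<i}. s (nat j) \<notin> I} else insert i {j \<in> {1..<i}. s (nat j) \<notin> I})"
    proof -
      have "{1..<i + 1} = insert i {1..<i}" using that by auto
      then show ?thesis by auto
    qed
    moreover have "finite {j \<in> {1..<i}. s (nat j) \<notin> I}" by (rule finite_subset[of _ "{1..<i}"]) auto
    then have "card (insert i {j \<in> {1..<i}. s (nat j) \<notin> I}) = Suc (card {j \<in> {1..<i}. s (nat j) \<notin> I})"
      by (rule card_insert_disjoint) simp
    ultimately show ?thesis unfolding d_def by (cases "s (nat i) \<in> I") (simp_all only: if_True if_False)
  qed
  have tt: "t_refl G s k \<in> I \<longleftrightarrow> t_refl G s (Suc k) \<in> I" if "Suc k < n" "s (Suc k) \<in> I" for k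
  proof -
    have Sx: "t_refl G s k \<in> S_ext G n s" "t_refl G s (Suc k) \<in> S_ext G n s"
      using that by (auto simp: S_ext_def simp del: t_refl.simps)
    have g: "s (Suc k) \<otimes> r \<otimes> s (Suc k) \<in> generate G I" if "r \<in> I" for r
      using that \<open>s (Suc k) \<in> I\<close> by (intro generate.eng generate.incl)
    show ?thesis using g[of "t_refl G s k"] g[of "t_refl G s (Suc k)"] t_refl_Suc[OF that(1)]
        t_refl_Suc'[OF that(1)] Sx Igen by (metis IntI)
  qed
  have stp: "b i \<le> b (i + 1) \<and> (b i = b (i + 1) \<longleftrightarrow> s (nat i) \<in> I)" if i: "1 \<le> i" "i < int n" for i
  proof -
    have n: "nat i = Suc (nat (i - 1))" "nat (i + 1 - 1) = Suc (nat (i - 1))" using i by auto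
    have l: "Suc (nat (i - 1)) < n" using i by auto
    show ?thesis
    proof (cases "s (nat i) \<in> I")
      case True
      then have "b (i + 1) = b i" unfolding b_def using dstep[OF i(1)] tt[OF l] n by simp
      then show ?thesis using True by simp
    next
      case False
      then show ?thesis unfolding b_def using dstep[OF i(1)] by auto
    qed
  qed
  have mono: "mono_word b" unfolding mono_word_def
  proof (intro allI impI)
    fix i j assume ij: "1 \<le> i \<and> i \<le> j \<and> j \<le> int n"
    have "i \<le> j ==> j \<le> int n ==> b i \<le> b j"
    proof (induction j rule: int_ge_induct)
      case (step j) then show ?case using stp[of j] ij by fastforce
    qed simp
    then show "b i \<le> b j" using ij by simp
  qed
  have mem: "r \<in> gens b \<longleftrightarrow> r \<in> I" if "r \<in> S_ext G n s" for r
  proof -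
    have s1: "s k \<in> gens b \<longleftrightarrow> s k \<in> I" if "1 \<le> k" "k < n" for k
      using stp[of "int k"] that s_in_stab[OF that, of b] by (auto simp: gens_eq S_ext_def)
    have t1: "t_refl G s k \<in> gens b \<longleftrightarrow> t_refl G s k \<in> I" if "k < n" for k
      using that t_in_stab[OF that, of b] by (auto simp: gens_eq S_ext_def b_def)
    show ?thesis using that by (cases rule: S_ext_cases) (auto simp: s1 t1)
  qed
  have "b v < 2 * n" if v: "v \<in> pos" for v
  proof -
    have "d v \<le> card {1..<v}" unfolding d_def by (intro card_mono) auto
    then have "d v < n" using v by auto
    then show ?thesis by (simp add: b_def)
  qed
  then show thesis using that[OF mono] mem gens_subset_S_ext[of b] IS by blast
qed

section \<open>Coset representatives and induced characters\<close>

lemma S_ext_length: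
  assumes g: "g \<in> carrier G" and r: "r \<in> S_ext G n s"
    and na: "\<not> coxeter_length G {..<n} s (g \<otimes> r) > coxeter_length G {..<n} s g"
  shows "coxeter_length G {..<n} s (g \<otimes> r) < coxeter_length G {..<n} s g"
  using r
proof (cases rule: S_ext_cases)
  case (1 k)
  have gr: "g \<otimes> s k \<in> carrier G" "g \<otimes> s k \<otimes> s k = g" using g 1 by (simp_all add: m_assoc)
  have "act g (int k + 1) ~= act g (int k)" using act_eq_iff[OF g] by simp
  then have "act g (int k + 1) < act g (int k)" using na ascent_s[OF g 1(2)] 1 by simp
  moreover have "act (g \<otimes> s k) (int k) = act g (int k + 1)" "act (g \<otimes> s k) (int k + 1) = act g (int k)"
    using g 1 by (simp_all add: act_mult_apply act_s gen_def)
  ultimately show ?thesis using ascent_s[OF gr(1) 1(2)] gr(2) 1 by simp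
next
  case (2 k)
  let ?t = "t_refl G s k"
  have "act (?t \<otimes> ?t) = act \<one>" using 2 by (simp add: act_mult act_t_refl fun_eq_iff)
  then have tt: "?t \<otimes> ?t = \<one>" using act_inj[of "?t \<otimes> ?t" \<one>] 2 by simp
  have gr: "g \<otimes> ?t \<in> carrier G" "g \<otimes> ?t \<otimes> ?t = g" using g 2 tt by (simp_all add: m_assoc)
  have "act g (int k + 1) ~= 0" using act_eq_0_iff[OF g, of "int k + 1"] by simp
  then have "act g (int k + 1) < 0" using na ascent_t[OF g 2(1)] 2 by simp
  moreover have "act (g \<otimes> ?t) (int k + 1) = - act g (int k + 1)"
    using g 2 by (simp add: act_mult_apply act_t_refl flip_def act_minus[of g "int k + 1", simplified])
  ultimately show ?thesis using ascent_t[OF gr(1) 2(1)] gr(2) 2 by simp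
qed

text \<open>The word that \<open>x\<close> sorts, with blocks prescribed by \<open>b\<close> and signs by \<open>x\<close>.\<close>

definition wdof :: "(int => nat) => 'a => int => nat" where
  "wdof b x = restrict (%v. 2 * b \<bar>act (inv x) v\<bar> + (if 0 < act x \<bar>act (inv x) v\<bar> then 1 else 0)) pos"

lemma act_inv_abs: "x \<in> carrier G ==> \<bar>act (inv x) \<bar>act x i\<bar>\<bar> = \<bar>i\<bar>"
  using act_abs[of "inv x" "act x i"] by (simp add: act_inv)

lemma act_inv_abs': "x \<in> carrier G ==> \<bar>act x \<bar>act (inv x) i\<bar>\<bar> = \<bar>i\<bar>"
  using act_abs[of "x" "act (inv x) i"] by (simp add: act_inv)

lemma wdof_act: "x \<in> carrier G ==> i \<in> pos ==> wdof b x \<bar>act x i\<bar> = 2 * b i + (if 0 < act x i then 1 else 0)"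
  using act_pos_abs[of x i] act_inv_abs[of x i] by (simp add: wdof_def)

lemma st_wdof:
  assumes mb: "mono_word b" and x: "x \<in> Xb b" shows "st (wdof b x) = x"
proof -
  have xc: "x \<in> carrier G" using x by (simp add: Xb_def)
  have "sorts (wdof b x) x" unfolding sorts_def
  proof (intro conjI ballI allI impI xc)
    fix i assume "i \<in> pos" then show "0 < act x i \<longleftrightarrow> odd (wdof b x \<bar>act x i\<bar>)" by (simp add: wdof_act[OF xc])
  next
    fix i assume i: "1 \<le> i \<and> i < int n"
    have le: "b i \<le> b (i + 1)" using mb i by (auto simp: mono_word_def)
    have lt: "b i = b (i + 1) --> act x i < act x (i + 1)" using x i by (simp add: Xb_def)
    have w: "wdof b x \<bar>act x i\<bar> = 2 * b i + (if 0 < act x i then 1 else 0)"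
      "wdof b x \<bar>act x (i + 1)\<bar> = 2 * b (i + 1) + (if 0 < act x (i + 1) then 1 else 0)"
      using wdof_act[OF xc] i by simp_all
    show "lx (wdof b x) (act x i) (act x (i + 1))"
      unfolding lx_def w using le lt by (cases "b i = b (i + 1)") auto
  qed
  then show ?thesis using st_eq_iff by blast
qed

lemma wdof_spl: assumes "x \<in> Xb b" shows "wdof b x \<in> spl b"
proof -
  have xc: "x \<in> carrier G" using assms by (simp add: Xb_def)
  have d: "wdof b x v div 2 = b \<bar>act (inv x) v\<bar>" if "v \<in> pos" for v using that by (simp add: wdof_def)
  have "cnt (%v. wdof b x v div 2) = cnt (%v. b \<bar>act (inv x) v\<bar>)" by (rule cnt_cong) (rule d)
  also have "\<dots> = cnt b" using xc by (simp add: cnt_act)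
  finally have c: "cnt (%v. wdof b x v div 2) = cnt b" .
  have "odd (wdof b x v)" if v: "v \<in> pos" "odd (wdof b x v div 2)" for v
  proof -
    have "\<bar>act (inv x) v\<bar> \<in> pos" using act_pos_abs v xc by simp
    then have "0 < act x \<bar>act (inv x) v\<bar>" using assms v d[OF v(1)] by (simp add: Xb_def)
    then show ?thesis using v by (simp add: wdof_def)
  qed
  then show ?thesis using c by (simp add: spl_def wdof_def)
qed

lemma spl_sorted:
  assumes mb: "mono_word b" and F: "F \<in> spl b" and i: "i \<in> pos"
  shows "F \<bar>act (st F) i\<bar> = 2 * b i + (if 0 < act (st F) i then 1 else 0)"
proof -
  let ?x = "st F"
  have "F \<bar>act ?x i\<bar> div 2 = b i"
  proof (rule mono_cnt_unique[OF _ _ _ i])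
    fix i j :: int assume "1 \<le> i" "i \<le> j" "j \<le> int n"
    then show "F \<bar>act ?x i\<bar> div 2 \<le> F \<bar>act ?x j\<bar> div 2" "b i \<le> b j"
      using sorts_weak_mono[OF st_sorts, of i j F] mb by (auto intro: div_le_mono simp: mono_word_def)
  next
    show "cnt (%i. F \<bar>act ?x i\<bar> div 2) = cnt b"
      using F cnt_act[of ?x "%v. F v div 2"] by (simp add: spl_def)
  qed
  moreover have "0 < act ?x i \<longleftrightarrow> odd (F \<bar>act ?x i\<bar>)" using st_sorts[of F] i by (simp add: sorts_def)
  moreover have "F \<bar>act ?x i\<bar> = 2 * (F \<bar>act ?x i\<bar> div 2) + (if odd (F \<bar>act ?x i\<bar>) then 1 else 0)"
    by (cases "odd (F \<bar>act ?x i\<bar>)") simp_all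
  ultimately show ?thesis by (simp only:)
qed

lemma st_spl:
  assumes mb: "mono_word b" and F: "F \<in> spl b"
  shows "st F \<in> Xb b" "wdof b (st F) = F"
proof -
  let ?x = "st F"
  have s: "sorts F ?x" by (rule st_sorts)
  show X: "?x \<in> Xb b" unfolding Xb_def
  proof (intro CollectI conjI allI impI ballI st_closed)
    fix i assume i: "1 \<le> i \<and> i < int n \<and> b i = b (i + 1)"
    then have "lx F (act ?x i) (act ?x (i + 1))" using s by (simp add: sorts_def)
    moreover have "F \<bar>act ?x i\<bar> = 2 * b i + (if 0 < act ?x i then 1 else 0)"
        "F \<bar>act ?x (i + 1)\<bar> = 2 * b (i + 1) + (if 0 < act ?x (i + 1) then 1 else 0)"
      using spl_sorted[OF mb F] i by auto
    ultimately show "act ?x i < act ?x (i + 1)" using i by (auto simp: lx_def split: if_splits)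
  next
    fix i assume i: "i \<in> pos" "odd (b i)"
    have a: "\<bar>act ?x i\<bar> \<in> pos" using act_pos_abs i by simp
    have e: "F \<bar>act ?x i\<bar> = 2 * b i + (if 0 < act ?x i then 1 else 0)" by (rule spl_sorted[OF mb F i(1)])
    then have "F \<bar>act ?x i\<bar> div 2 = b i" by simp
    then have "odd (F \<bar>act ?x i\<bar>)" using F a i(2) by (simp add: spl_def)
    then show "0 < act ?x i" using e by (simp split: if_splits)
  qed
  show "wdof b ?x = F"
  proof
    fix v
    show "wdof b ?x v = F v"
    proof (cases "v \<in> pos")
      case True
      let ?i = "\<bar>act (inv ?x) v\<bar>"
      have i: "?i \<in> pos" using act_pos_abs True by simp
      have "\<bar>act ?x ?i\<bar> = v" using act_inv_abs'[of ?x v] True by simp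
      then show ?thesis using wdof_act[OF st_closed i, of b F] spl_sorted[OF mb F i] by metis
    next
      case False then show ?thesis using F by (auto simp: wdof_def spl_def extensional_def)
    qed
  qed
qed

lemma bij_st_spl: "mono_word b ==> bij_betw st (spl b) (Xb b)"
  by (rule bij_betw_byWitness[where f' = "wdof b"]) (use st_spl st_wdof wdof_spl in auto)

lemma closed_spl: "closed_family (spl b)"
proof (rule closed_familyI)
  show "spl b \<subseteq> extensional pos" by (auto simp: spl_def)
  show "finite (spl b)"
  proof (rule finite_subset)
    let ?V = "{k. k div 2 \<in> b ` pos}"
    show "spl b \<subseteq> PiE pos (%_. ?V)"
    proof
      fix F assume F: "F \<in> spl b"
      have "F v div 2 \<in> b ` pos" if v: "v \<in> pos" for v
      proof -
        have "cnt (%v. F v div 2) (F v div 2) > 0" unfolding cnt_pos_iff using v by blast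
        then show ?thesis using F cnt_pos_iff[of b] by (simp add: spl_def)
      qed
      then show "F \<in> PiE pos (%_. ?V)" using F by (auto simp: spl_def PiE_def)
    qed
    have "?V \<subseteq> (%(k, c). 2 * k + c) ` (b ` pos \<times> {0, 1})"
    proof
      fix k assume "k \<in> ?V"
      then show "k \<in> (%(k, c). 2 * k + c) ` (b ` pos \<times> {0, 1})"
        by (intro image_eqI[of _ _ "(k div 2, k mod 2)"]) auto
    qed
    then have "finite ?V" by (rule finite_subset) auto
    then show "finite (PiE pos (%_. ?V))" by (intro finite_PiE) auto
  qed
  fix F g assume F: "F \<in> spl b" and g: "g \<in> carrier G"
  have "cnt (%v. restrict (%v. F \<bar>act g v\<bar>) pos v div 2) = cnt (%v. F \<bar>act g v\<bar> div 2)"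
    by (rule cnt_cong) simp
  also have "\<dots> = cnt b" using cnt_act[OF g, of "%v. F v div 2"] F by (simp add: spl_def)
  finally show "restrict (%v. F \<bar>act g v\<bar>) pos \<in> spl b"
    using F act_pos_abs[OF g] by (simp add: spl_def del: atLeastAtMost_iff)
qed

text \<open>The elements of \<open>X\<^sub>I\<close> correspond to the words in \<open>spl b\<close> through \<open>st\<close> and \<open>wdof\<close>.\<close>

lemma x_elem_Y: assumes "mono_word b" shows "x_elem G n s (gens b) = Y (spl b)"
proof
  fix g
  have "Y (spl b) g = (\<Sum>x\<in>Xb b. if x = g then 1 else 0)"
    unfolding Y_def by (rule sum.reindex_bij_betw[OF bij_st_spl[OF assms]])
  moreover have "finite (Xb b)" by (rule finite_subset[OF _ finite_carrier]) (auto simp: Xb_def)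
  ultimately show "x_elem G n s (gens b) g = Y (spl b) g"
    by (simp add: x_elem_def X_set_gens)
qed

lemma Xb_stab_unique:
  assumes mb: "mono_word b" and x: "x \<in> Xb b" and y: "y \<in> Xb b" and h: "inv x \<otimes> y \<in> stab b"
  shows "x = y"
proof -
  have xc: "x \<in> carrier G" and yc: "y \<in> carrier G" using x y by (auto simp: Xb_def)
  let ?h = "inv x \<otimes> y"
  have yh: "act y i = act x (act ?h i)" for i
    using xc yc by (simp add: act_mult_apply act_inv)
  have "wdof b x v = wdof b y v" for v
  proof (cases "v \<in> pos")
    case True
    let ?i = "\<bar>act (inv y) v\<bar>"
    have i: "?i \<in> pos" using act_pos_abs True yc by simp
    have v: "v = \<bar>act y ?i\<bar>" using act_inv_abs'[OF yc, of v] True by simp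
    let ?k = "\<bar>act ?h ?i\<bar>"
    have k: "?k \<in> pos" using act_pos_abs i xc yc by simp
    have v': "v = \<bar>act x ?k\<bar>" using v yh act_abs[OF xc] by simp
    have bk: "b ?k = b ?i" "even (b ?i) --> 0 < act ?h ?i" using h i by (auto simp: stab_def)
    have "0 < act x ?k \<longleftrightarrow> 0 < act y ?i"
    proof (cases "even (b ?i)")
      case True
      then have "act ?h ?i = ?k" using bk by simp
      then show ?thesis using yh[of ?i] by simp
    next
      case False
      then show ?thesis using x y i k bk by (simp add: Xb_def)
    qed
    moreover have "wdof b x v = 2 * b ?k + (if 0 < act x ?k then 1 else 0)"
      using wdof_act[OF xc k, of b] unfolding v'[symmetric] .
    moreover have "wdof b y v = 2 * b ?i + (if 0 < act y ?i then 1 else 0)"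
      using wdof_act[OF yc i, of b] unfolding v[symmetric] .
    ultimately show ?thesis using bk(1) by simp
  next
    case False then show ?thesis by (simp add: wdof_def del: atLeastAtMost_iff)
  qed
  then have "wdof b x = wdof b y" by blast
  then show ?thesis using st_wdof[OF mb x] st_wdof[OF mb y] by metis
qed

text \<open>An element of minimal length in the coset \<open>g W\<^sub>I\<close> lies in \<open>X\<^sub>I\<close>.\<close>

lemma Xb_factorization:
  assumes g: "g \<in> carrier G"
  obtains x h where "x \<in> Xb b" "h \<in> generate G (gens b)" "g = x \<otimes> h"
proof -
  interpret H: subgroup "generate G (gens b)" G by (rule generate_is_subgroup[OF gens_carrier])
  let ?l = "coxeter_length G {..<n} s"
  obtain h where h: "h \<in> generate G (gens b)"
    and min: "\<And>h'. h' \<in> generate G (gens b) ==> ?l (g \<otimes> h) \<le> ?l (g \<otimes> h')"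
    using ex_has_least_nat[of "%h. h \<in> generate G (gens b)" \<one> "%h. ?l (g \<otimes> h)"] H.one_closed by blast
  have hc: "h \<in> carrier G" using h H.subset by blast
  have "?l (g \<otimes> h \<otimes> r) > ?l (g \<otimes> h)" if r: "r \<in> gens b" for r
  proof (rule ccontr)
    assume "\<not> ?thesis"
    moreover have "r \<in> S_ext G n s" using r gens_subset_S_ext by blast
    ultimately have "?l (g \<otimes> h \<otimes> r) < ?l (g \<otimes> h)" using S_ext_length g hc by blast
    moreover have rg: "r \<in> generate G (gens b)" using r by (rule generate.incl)
    then have "g \<otimes> h \<otimes> r = g \<otimes> (h \<otimes> r)" using g hc H.subset by (intro m_assoc) auto
    ultimately show False using min[OF H.m_closed[OF h rg]] by simp
  qed
  then have "g \<otimes> h \<in> Xb b" unfolding X_set_gens[symmetric] using g hc by (simp add: X_set_def)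
  moreover have "g = g \<otimes> h \<otimes> inv h" using g hc by (simp add: m_assoc)
  ultimately show thesis using that[of "g \<otimes> h" "inv h"] H.m_inv_closed[OF h] by blast
qed

text \<open>The cosets of the possibly smaller group \<open>W\<^sub>I\<close> and of the stabilizer of \<open>b\<close> have the same
  representatives, so the two groups agree.\<close>

lemma generate_gens: assumes mb: "mono_word b" shows "generate G (gens b) = stab b"
proof
  show "stab b \<subseteq> generate G (gens b)"
  proof
    fix y assume y: "y \<in> stab b"
    interpret S: subgroup "stab b" G by (rule stab_subgroup)
    have yc: "y \<in> carrier G" using y S.subset by blast
    obtain x h where xh: "x \<in> Xb b" "h \<in> generate G (gens b)" "y = x \<otimes> h"
      using Xb_factorization[OF yc] by blast
    have xc: "x \<in> carrier G" using xh by (simp add: Xb_def)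
    have hs: "h \<in> stab b" using xh generate_gens_subset by blast
    have "x = y \<otimes> inv h" using xh xc hs S.subset by (auto simp: m_assoc)
    then have xs: "x \<in> stab b" using y hs by simp
    have o: "\<one> \<in> Xb b" by (simp add: Xb_def)
    have "inv \<one> \<otimes> x \<in> stab b" using xs xc by simp
    then have "\<one> = x" using Xb_stab_unique[OF mb o xh(1)] by blast
    then show "y \<in> generate G (gens b)" using xh hs S.subset by auto
  qed
qed (rule generate_gens_subset)

text \<open>\<open>Xb b\<close> represents the cosets of \<open>stab b\<close>.\<close>

lemma induced_eq_card:
  assumes mb: "mono_word b" and g: "g \<in> carrier G"
  shows "induced G (generate G (gens b)) (%_. 1) g = of_nat (card {x \<in> Xb b. inv x \<otimes> g \<otimes> x \<in> stab b})"
proof -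
  interpret S: subgroup "stab b" G by (rule stab_subgroup)
  let ?A = "{x \<in> carrier G. inv x \<otimes> g \<otimes> x \<in> stab b}"
  let ?X = "{x \<in> Xb b. inv x \<otimes> g \<otimes> x \<in> stab b}"
  have fin: "finite (stab b)" by (rule finite_subset[OF S.subset finite_carrier])
  have Xc: "Xb b \<subseteq> carrier G" by (auto simp: Xb_def)
  have cancel: "inv h \<otimes> (h \<otimes> y) = y" "h \<otimes> (inv h \<otimes> y) = y" if "h \<in> carrier G" "y \<in> carrier G" for h y
    using that by (simp_all add: m_assoc[symmetric])
  have key: "inv (x \<otimes> h) \<otimes> g \<otimes> (x \<otimes> h) \<in> stab b \<longleftrightarrow> inv x \<otimes> g \<otimes> x \<in> stab b"
    if "x \<in> carrier G" "h \<in> stab b" for x h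
  proof -
    have hc: "h \<in> carrier G" using that by auto
    have e: "inv (x \<otimes> h) \<otimes> g \<otimes> (x \<otimes> h) = inv h \<otimes> (inv x \<otimes> g \<otimes> x) \<otimes> h"
      using that hc g by (simp add: inv_mult_group m_assoc)
    have e': "inv x \<otimes> g \<otimes> x = h \<otimes> (inv h \<otimes> (inv x \<otimes> g \<otimes> x) \<otimes> h) \<otimes> inv h"
      using that hc g by (simp add: m_assoc cancel)
    show ?thesis
    proof
      assume "inv (x \<otimes> h) \<otimes> g \<otimes> (x \<otimes> h) \<in> stab b"
      then show "inv x \<otimes> g \<otimes> x \<in> stab b" unfolding e using S.m_closed[OF S.m_closed[OF that(2)] S.m_inv_closed[OF that(2)]] e' by metis
    next
      assume a: "inv x \<otimes> g \<otimes> x \<in> stab b"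
      show "inv (x \<otimes> h) \<otimes> g \<otimes> (x \<otimes> h) \<in> stab b" unfolding e
        by (rule S.m_closed[OF S.m_closed[OF S.m_inv_closed[OF that(2)] a] that(2)])
    qed
  qed
  have "bij_betw (%(x, h). x \<otimes> h) (?X \<times> stab b) ?A"
    unfolding bij_betw_def
  proof
    show "inj_on (%(x, h). x \<otimes> h) (?X \<times> stab b)"
    proof (rule inj_onI, clarify)
      fix x h y k assume *: "x \<in> Xb b" "h \<in> stab b" "y \<in> Xb b" "k \<in> stab b" "x \<otimes> h = y \<otimes> k"
      have c: "x \<in> carrier G" "y \<in> carrier G" "h \<in> carrier G" "k \<in> carrier G" using * Xc by auto
      have "inv x \<otimes> y = inv x \<otimes> (y \<otimes> k) \<otimes> inv k" using c by (simp add: m_assoc)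
      also have "\<dots> = h \<otimes> inv k" unfolding *(5)[symmetric] using c by (simp add: cancel)
      finally have "inv x \<otimes> y \<in> stab b" using * by simp
      then have "x = y" using Xb_stab_unique[OF mb] * by blast
      then show "x = y \<and> h = k" using *(5) c by simp
    qed
    show "(%(x, h). x \<otimes> h) ` (?X \<times> stab b) = ?A"
    proof (intro equalityI subsetI)
      fix z assume "z \<in> (%(x, h). x \<otimes> h) ` (?X \<times> stab b)"
      then obtain x h where "x \<in> ?X" "h \<in> stab b" "z = x \<otimes> h" by auto
      then show "z \<in> ?A" using key[of x h] Xc by auto
    next
      fix z assume z: "z \<in> ?A"
      then have "z \<in> carrier G" by blast
      then obtain x h where xh: "x \<in> Xb b" "h \<in> generate G (gens b)" "z = x \<otimes> h"
        using Xb_factorization by blast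
      then have "h \<in> stab b" using generate_gens_subset by blast
      then show "z \<in> (%(x, h). x \<otimes> h) ` (?X \<times> stab b)" using z xh key[of x h] Xc
        by (intro image_eqI[of _ _ "(x, h)"]) auto
    qed
  qed
  then have "card ?A = card ?X * card (stab b)"
    by (simp add: bij_betw_same_card[symmetric] card_cartesian_product)
  moreover have "card (stab b) ~= 0" using fin S.one_closed by (metis card_0_eq empty_iff)
  ultimately show ?thesis using g by (simp add: induced_def generate_gens[OF mb])
qed

lemma conj_in_stab_iff:
  assumes mb: "mono_word b" and F: "F \<in> spl b" and g: "g \<in> carrier G"
  shows "inv (st F) \<otimes> g \<otimes> st F \<in> stab b \<longleftrightarrow>
    (\<forall>v\<in>pos. F \<bar>act g v\<bar> div 2 = F v div 2 \<and>
      (even (F v div 2) --> ((odd (F \<bar>act g v\<bar>) \<longleftrightarrow> odd (F v)) \<longleftrightarrow> 0 < act g v)))" (is "_ \<longleftrightarrow> (\<forall>v\<in>pos. ?P v)")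
proof -
  let ?x = "st F"
  let ?y = "inv ?x \<otimes> g \<otimes> ?x"
  have yc: "?y \<in> carrier G" using g by simp
  have xy: "act ?x (act ?y i) = act g (act ?x i)" for i using g by (simp add: act_mult_apply act_inv)
  have eq: "b \<bar>act ?y i\<bar> = b i \<and> (even (b i) --> 0 < act ?y i) \<longleftrightarrow> ?P \<bar>act ?x i\<bar>" if i: "i \<in> pos" for i
  proof -
    let ?v = "\<bar>act ?x i\<bar>" and ?k = "\<bar>act ?y i\<bar>"
    have v: "?v \<in> pos" and k: "?k \<in> pos" using act_pos_abs i yc by auto
    have gv: "\<bar>act g ?v\<bar> = \<bar>act ?x ?k\<bar>"
      unfolding act_abs[OF g] act_abs[OF st_closed] xy ..
    have Fv: "F ?v = 2 * b i + (if 0 < act ?x i then 1 else 0)" by (rule spl_sorted[OF mb F i])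
    have Fk: "F \<bar>act g ?v\<bar> = 2 * b ?k + (if 0 < act ?x ?k then 1 else 0)"
      unfolding gv by (rule spl_sorted[OF mb F k])
    have nz: "act ?x i ~= 0" "act ?y i ~= 0" "act g (act ?x i) ~= 0"
      using act_eq_0_iff[OF st_closed, of F i] act_eq_0_iff[OF yc, of i] act_eq_0_iff[OF g, of "act ?x i"] i by auto
    have sg: "0 < act g ?v \<longleftrightarrow> (0 < act ?x i \<longleftrightarrow> 0 < act g (act ?x i))"
      using nz act_minus[OF g, of "act ?x i"] by (cases "0 < act ?x i") auto
    have sx: "0 < act ?x ?k \<longleftrightarrow> (0 < act ?y i \<longleftrightarrow> 0 < act g (act ?x i))"
      using nz act_minus[of ?x "act ?y i"] xy[of i] by (cases "0 < act ?y i") auto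
    show ?thesis unfolding Fv Fk sg using sx by auto
  qed
  have "?y \<in> stab b \<longleftrightarrow> (\<forall>i\<in>pos. ?P \<bar>act ?x i\<bar>)"
    using yc eq by (simp add: stab_def del: atLeastAtMost_iff)
  also have "\<dots> \<longleftrightarrow> (\<forall>v\<in>(%i. \<bar>act ?x i\<bar>) ` pos. ?P v)" by simp
  also have "(%i. \<bar>act ?x i\<bar>) ` pos = pos" using bij_act[OF st_closed] by (simp add: bij_betw_def)
  finally show ?thesis .
qed

text \<open>The words of a splitting of \<open>b\<close> are pairs of a rearrangement of \<open>b\<close> and a set of positions, among those with
  an even letter, that receive the negative copy of the letter.\<close>

lemma sum_spl:
  fixes \<phi> :: "(int => nat) => int"
  shows "(\<Sum>F\<in>spl b. \<phi> F) = (\<Sum>f\<in>rcl b. \<Sum>N\<in>Pow {v \<in> pos. even (f v)}.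
    \<phi> (restrict (%v. 2 * f v + (if v \<in> N then 0 else 1)) pos))"
proof -
  let ?U = "%f. {v \<in> pos. even (f v)}"
  let ?j = "%(f, N). restrict (%v. 2 * f v + (if v \<in> N then 0 else 1)) pos :: int => nat"
  let ?i = "%F. (restrict (%v. F v div 2) pos, {v \<in> pos. even (F v)})"
  have "(\<Sum>F\<in>spl b. \<phi> F) = (\<Sum>p\<in>(SIGMA f:rcl b. Pow (?U f)). \<phi> (?j p))"
  proof (rule sum.reindex_bij_witness[of _ ?j ?i])
    fix F assume F: "F \<in> spl b"
    show "?j (?i F) = F"
    proof
      fix v show "?j (?i F) v = F v"
        using F by (cases "v \<in> pos") (auto simp: spl_def extensional_def)
    qed
    have "cnt (restrict (%v. F v div 2) pos) = cnt b" using F by (simp add: spl_def)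
    then show "?i F \<in> (SIGMA f:rcl b. Pow (?U f))" using F by (auto simp: rcl_def spl_def)
    show "\<phi> (?j (?i F)) = \<phi> F" using \<open>?j (?i F) = F\<close> by simp
  next
    fix p assume "p \<in> (SIGMA f:rcl b. Pow (?U f))"
    then obtain f N where p: "p = (f, N)" "f \<in> rcl b" "N \<subseteq> ?U f" by auto
    have d: "?j (f, N) v div 2 = f v" if "v \<in> pos" for v using that by simp
    have "cnt (%v. ?j (f, N) v div 2) = cnt f" by (rule cnt_cong) (rule d)
    then have "cnt (%v. ?j (f, N) v div 2) = cnt b" using p by (simp add: rcl_def)
    moreover have "odd (?j (f, N) v)" if "v \<in> pos" "odd (f v)" for v using that p(3) by auto
    ultimately show "?j p \<in> spl b" unfolding p(1) spl_def using d by (simp del: atLeastAtMost_iff)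
    have 1: "restrict (%v. ?j (f, N) v div 2) pos = f"
    proof
      fix v show "restrict (%v. ?j (f, N) v div 2) pos v = f v"
        using p(2) by (cases "v \<in> pos") (auto simp: rcl_def extensional_def)
    qed
    have 2: "{v \<in> pos. even (?j (f, N) v)} = N" using p(3) by auto
    show "?i (?j p) = p" unfolding p(1) using 1 2 by simp
  qed
  also have "\<dots> = (\<Sum>f\<in>rcl b. \<Sum>N\<in>Pow (?U f). \<phi> (?j (f, N)))"
    by (subst sum.Sigma) (use finite_rcl in \<open>auto simp: case_prod_unfold simp del: atLeastAtMost_iff\<close>)
  finally show ?thesis by simp
qed

text \<open>For a fixed rearrangement \<open>f\<close> of \<open>b\<close>, summing over the signs at the even letters counts fixed
  colourings, and \<open>fixed_colourings\<close> turns this count into the sum of the values \<open>m\<close>.\<close>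

lemma induced_eq_M:
  assumes mb: "mono_word b" and g: "g \<in> carrier G"
  shows "induced G (generate G (gens b)) (%_. 1) g = of_int (M (spl b) g)"
proof -
  let ?C = "%F. \<forall>v\<in>pos. F \<bar>act g v\<bar> div 2 = F v div 2 \<and>
      (even (F v div 2) --> ((odd (F \<bar>act g v\<bar>) \<longleftrightarrow> odd (F v)) \<longleftrightarrow> 0 < act g v))"
  have "{x \<in> Xb b. inv x \<otimes> g \<otimes> x \<in> stab b} = st ` {F \<in> spl b. ?C F}"
  proof (intro equalityI subsetI)
    fix x assume x: "x \<in> {x \<in> Xb b. inv x \<otimes> g \<otimes> x \<in> stab b}"
    then have "x \<in> st ` spl b" using bij_st_spl[OF mb] unfolding bij_betw_def by simp
    then obtain F where F: "F \<in> spl b" "x = st F" by blast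
    then have "?C F" using x conj_in_stab_iff[OF mb F(1) g] by simp
    then show "x \<in> st ` {F \<in> spl b. ?C F}" using F by blast
  next
    fix x assume "x \<in> st ` {F \<in> spl b. ?C F}"
    then obtain F where F: "F \<in> spl b" "?C F" "x = st F" by blast
    then show "x \<in> {x \<in> Xb b. inv x \<otimes> g \<otimes> x \<in> stab b}"
      using conj_in_stab_iff[OF mb F(1) g] st_spl(1)[OF mb F(1)] by simp
  qed
  moreover have "inj_on st {F \<in> spl b. ?C F}"
    using bij_st_spl[OF mb] unfolding bij_betw_def by (auto intro: inj_on_subset)
  ultimately have "card {x \<in> Xb b. inv x \<otimes> g \<otimes> x \<in> stab b} = card {F \<in> spl b. ?C F}"
    by (simp add: card_image)
  moreover have fs: "finite (spl b)" using closed_spl by (simp add: closed_family_def)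
  then have "int (card {F \<in> spl b. ?C F}) = (\<Sum>F\<in>spl b. if ?C F then 1 else 0)"
    by (simp add: sum.If_cases Int_def)
  moreover have "\<dots> = (\<Sum>F\<in>spl b. m F g)"
    unfolding sum_spl
  proof (rule sum.cong[OF HOL.refl])
    fix f assume "f \<in> rcl b"
    let ?U = "{v \<in> pos. even (f v)}"
    let ?F = "%N. restrict (%v. 2 * f v + (if v \<in> N then 0 else 1)) pos :: int => nat"
    have ga: "\<bar>act g v\<bar> \<in> pos" if "v \<in> pos" for v using act_pos_abs[OF g that] .
    show "(\<Sum>N\<in>Pow ?U. if ?C (?F N) then 1 else 0) = (\<Sum>N\<in>Pow ?U. m (?F N) g)"
    proof (cases "\<forall>v\<in>pos. f \<bar>act g v\<bar> = f v")
      case False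
      then obtain v where v: "v \<in> pos" "f \<bar>act g v\<bar> ~= f v" by blast
      have d: "?F N \<bar>act g v\<bar> div 2 ~= ?F N v div 2" for N using v ga[OF v(1)] by simp
      have 1: "\<not> ?C (?F N)" for N using v(1) d[of N] by blast
      have "?F N \<bar>act g v\<bar> ~= ?F N v" for N using d[of N] by (rule contrapos_nn) (simp only:)
      then have "\<not> (\<forall>v\<in>pos. ?F N \<bar>act g v\<bar> = ?F N v)" for N using v(1) by blast
      then have 2: "m (?F N) g = 0" for N unfolding m_def by (rule if_not_P)
      show ?thesis unfolding 2 if_not_P[OF 1] ..
    next
      case True
      let ?p = "%v. \<bar>act g v\<bar>"
      let ?e = "%v. sgn (act g v)"
      have fU: "finite ?U" by (rule finite_pos_Collect)
      have pU: "?p v \<in> ?U" if "v \<in> ?U" for v using that ga True by auto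
      have bp: "bij_betw ?p ?U ?U"
      proof -
        have "inj_on ?p ?U" using bij_act[OF g] by (auto simp: bij_betw_def intro: inj_on_subset)
        moreover have "?p ` ?U = ?U" using endo_inj_surj[OF fU _ \<open>inj_on ?p ?U\<close>] pU by blast
        ultimately show ?thesis by (simp add: bij_betw_def)
      qed
      have nz: "act g v ~= 0" if "v \<in> pos" for v using act_eq_0_iff[OF g, of v] that by auto
      have e: "?e v = 1 \<or> ?e v = - 1" if "v \<in> ?U" for v using nz that by (auto simp: sgn_if)
      have e1: "?e v = 1 \<longleftrightarrow> 0 < act g v" for v by (auto simp: sgn_if)
      have C: "?C (?F N) \<longleftrightarrow> (\<forall>v\<in>?U. (?p v \<in> N \<longleftrightarrow> v \<in> N) \<longleftrightarrow> ?e v = 1)" if "N \<in> Pow ?U" for N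
      proof -
        have "(?F N \<bar>act g v\<bar> div 2 = ?F N v div 2 \<and>
           (even (?F N v div 2) --> ((odd (?F N \<bar>act g v\<bar>) \<longleftrightarrow> odd (?F N v)) \<longleftrightarrow> 0 < act g v)))
           \<longleftrightarrow> (even (f v) --> ((?p v \<in> N \<longleftrightarrow> v \<in> N) \<longleftrightarrow> ?e v = 1))" if v: "v \<in> pos" for v
          using v ga[OF v] True e1 by simp
        then show ?thesis by blast
      qed
      have mm: "m (?F N) g = (if \<forall>v\<in>?U. ?p v \<in> N \<longleftrightarrow> v \<in> N then \<Prod>v\<in>N. ?e v else 0)" if N: "N \<in> Pow ?U" for N
      proof -
        have "?F N \<bar>act g v\<bar> = ?F N v \<longleftrightarrow> (?p v \<in> N \<longleftrightarrow> v \<in> N)" if v: "v \<in> pos" for v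
          using v ga[OF v] True by simp
        moreover have "?p v \<notin> N \<and> v \<notin> N" if "v \<in> pos" "v \<notin> ?U" for v
          using N that True by auto
        ultimately have 1: "(\<forall>v\<in>pos. ?F N \<bar>act g v\<bar> = ?F N v) \<longleftrightarrow> (\<forall>v\<in>?U. ?p v \<in> N \<longleftrightarrow> v \<in> N)"
          by blast
        have 2: "(\<Prod>v\<in>pos. if even (?F N v) then ?e v else 1) = (\<Prod>v\<in>N. ?e v)"
          by (rule prod.mono_neutral_cong_right) (use N in auto)
        show ?thesis unfolding m_def 1 2 ..
      qed
      have "(\<Sum>N\<in>Pow ?U. if ?C (?F N) then 1 else 0) = (\<Sum>N\<in>Pow ?U. if \<forall>v\<in>?U. (?p v \<in> N \<longleftrightarrow> v \<in> N) \<longleftrightarrow> ?e v = 1 then 1 else (0::int))"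
        by (rule sum.cong[OF HOL.refl]) (simp only: C)
      also have "\<dots> = (\<Sum>N\<in>Pow ?U. if \<forall>v\<in>?U. ?p v \<in> N \<longleftrightarrow> v \<in> N then \<Prod>v\<in>N. ?e v else 0)"
        by (rule fixed_colourings[OF fU bp e])
      also have "\<dots> = (\<Sum>N\<in>Pow ?U. m (?F N) g)" by (rule sum.cong[OF HOL.refl]) (simp only: mm)
      finally show ?thesis .
    qed
  qed
  ultimately have "int (card {x \<in> Xb b. inv x \<otimes> g \<otimes> x \<in> stab b}) = M (spl b) g" by (simp add: M_def)
  from this[symmetric] show ?thesis unfolding induced_eq_card[OF mb g] by (simp only: of_int_of_nat_eq)
qed

end

section \<open>Integral combinations\<close>

lemma int_span_eq:
  fixes T :: "('b => 'r::comm_ring_1) ring" and x :: "'i => 'b => 'r"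
  assumes T: "abelian_group T" and add: "\<And>f g. add T f g = (%w. f w + g w)" and z: "zero T = (%w. 0)"
    and A: "finite A" and x: "\<And>i. i \<in> A ==> x i \<in> carrier T"
  shows "generate (add_monoid T) (x ` A) = {(%w. \<Sum>i\<in>A. of_int (c i) * x i w) | c. True}"
proof -
  interpret abelian_group T by fact
  let ?S = "generate (add_monoid T) (x ` A)"
  have xs: "x ` A \<subseteq> carrier T" using x by auto
  have carr: "?S \<subseteq> carrier T" by (rule add.generate_incl[OF xs])
  interpret S: subgroup ?S "add_monoid T" by (rule add.generate_is_subgroup[OF xs])
  have neg: "inv\<^bsub>add_monoid T\<^esub> f = (%w. - f w)" if "f \<in> carrier T" for f
  proof
    fix w
    have "\<ominus>\<^bsub>T\<^esub> f \<oplus>\<^bsub>T\<^esub> f = \<zero>\<^bsub>T\<^esub>" using that by (rule l_neg)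
    then have "(\<ominus>\<^bsub>T\<^esub> f) w + f w = 0" unfolding add z by (rule fun_cong)
    then show "(inv\<^bsub>add_monoid T\<^esub> f) w = - f w" by (simp add: a_inv_def eq_neg_iff_add_eq_0)
  qed
  have addS: "(%w. f w + g w) \<in> ?S" if "f \<in> ?S" "g \<in> ?S" for f g
    using S.m_closed[OF that] by (simp add: add)
  have negS: "(%w. - f w) \<in> ?S" if "f \<in> ?S" for f
    using S.m_inv_closed[OF that] neg that carr by auto
  have zS: "(%w. 0) \<in> ?S" using S.one_closed by (simp add: z)
  have mult: "(%w. of_int k * f w) \<in> ?S" if f: "f \<in> ?S" for f k
  proof (induction k rule: int_induct[where k = 0])
    case base then show ?case using zS by simp
  next
    case (step1 i) then show ?case using addS[OF step1(2) f] by (simp add: algebra_simps)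
  next
    case (step2 i) then show ?case using addS[OF step2(2) negS[OF f]] by (simp add: algebra_simps)
  qed
  have "(%w. \<Sum>i\<in>B. of_int (c i) * x i w) \<in> ?S" if "B \<subseteq> A" for B c
    using finite_subset[OF that A] that
  proof (induction B)
    case (insert i B)
    have "x i \<in> ?S" using insert.prems by (auto intro: generate.incl)
    then show ?case using addS[OF mult[of "x i" "c i"]] insert by simp
  qed (use zS in simp)
  moreover have "\<exists>c. f = (%w. \<Sum>i\<in>A. of_int (c i) * x i w)" if "f \<in> ?S" for f
    using that
  proof (induction rule: generate.induct)
    case one then show ?case by (intro exI[of _ "%_. 0"]) (simp add: z)
  next
    case (incl h)
    then obtain j where j: "j \<in> A" "h = x j" by blast
    have "of_int (if i = j then 1 else 0) * x i w = (if i = j then x i w else 0)" for i w by simp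
    then show ?case using j A by (intro exI[of _ "%i. if i = j then 1 else 0"]) (simp del: of_int_of_bool)
  next
    case (inv h)
    then obtain j where j: "j \<in> A" "h = x j" by blast
    have "of_int (if i = j then - 1 else 0) * x i w = (if i = j then - x i w else 0)" for i w by simp
    then show ?case using j A neg[of h] x[OF j(1)]
      by (intro exI[of _ "%i. if i = j then - 1 else 0"]) simp
  next
    case (eng f g)
    then obtain c d where "f = (%w. \<Sum>i\<in>A. of_int (c i) * x i w)" "g = (%w. \<Sum>i\<in>A. of_int (d i) * x i w)"
      by blast
    then show ?case
      by (intro exI[of _ "%i. c i + d i"]) (simp add: add sum.distrib distrib_right)
  qed
  ultimately show ?thesis by blast
qed

context coxeter_C begin

lemma sorts_relabel:
  assumes "strict_mono \<phi>" "\<And>k. even (\<phi> k) \<longleftrightarrow> even k"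
  shows "sorts (%v. \<phi> (F v)) g \<longleftrightarrow> sorts F g"
  using assms by (simp add: sorts_def lx_def strict_mono_less strict_mono_eq)

lemma m_relabel:
  assumes "inj \<phi>" "\<And>k. even (\<phi> k) \<longleftrightarrow> even k"
  shows "m (%v. \<phi> (F v)) g = m F g"
  using assms by (simp add: m_def inj_eq)

lemma cnt_comp: assumes "cnt F = cnt F'" shows "cnt (%v. \<phi> (F v)) = cnt (%v. \<phi> (F' v))"
proof -
  obtain g where g: "g \<in> carrier G" "\<And>v. v \<in> pos ==> 0 < act g v" "\<And>v. v \<in> pos ==> F v = F' (act g v)"
    using cnt_eq_imp_conj[OF assms] by blast
  have "cnt (%v. \<phi> (F v)) = cnt (%v. \<phi> (F' \<bar>act g v\<bar>))"
  proof (rule cnt_cong)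
    fix v assume "v \<in> pos"
    then show "\<phi> (F v) = \<phi> (F' \<bar>act g v\<bar>)" using g(2)[of v] g(3)[of v] by (simp del: atLeastAtMost_iff)
  qed
  then show ?thesis using cnt_act[OF g(1), of "%v. \<phi> (F' v)"] by simp
qed

text \<open>The number of negative positions.\<close>

definition nsize :: "(int => nat) => nat" where
  "nsize F = card {v \<in> pos. even (F v)}"

lemma nsize_cnt: "cnt F = cnt F' ==> nsize F = nsize F'"
proof -
  assume "cnt F = cnt F'"
  then have "cnt (%v. F v mod 2) 0 = cnt (%v. F' v mod 2) 0" using cnt_comp[of F F' "%k. k mod 2"] by simp
  then show ?thesis by (simp add: cnt_def nsize_def even_iff_mod_2_eq_zero)
qed

lemma sorted_rearrangement:
  obtains b where "mono_word b" "cnt b = cnt F"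
proof -
  let ?b = "%i. F \<bar>act (st F) i\<bar>"
  have "mono_word ?b" unfolding mono_word_def using sorts_weak_mono[OF st_sorts] by blast
  moreover have "cnt ?b = cnt F" by (rule cnt_act) simp
  ultimately show thesis using that by blast
qed

lemma finite_P0: "finite (P0 G n s)"
proof (rule finite_subset)
  show "P0 G n s \<subseteq> Pow (S_ext G n s)" by (auto simp: P0_def)
  show "finite (Pow (S_ext G n s))" by (simp add: S_ext_def)
qed

text \<open>The element of \<open>\<Sigma>'\<close> with coefficients \<open>c\<close>.\<close>

definition comb :: "('a set => int) => 'a => int" where
  "comb c w = (\<Sum>I\<in>P0 G n s. c I * x_elem G n s I w)"

text \<open>The image of \<open>comb c\<close> under \<open>\<theta>\<close>.\<close>

definition Th :: "('a set => int) => 'a => complex" where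
  "Th c g = (\<Sum>I\<in>P0 G n s. of_int (c I) * induced G (generate G I) (%_. 1) g)"

lemma comb_add: "comb (%I. c I + d I) = (%w. comb c w + comb d w)"
  by (simp add: comb_def fun_eq_iff distrib_right sum.distrib)

lemma Th_add: "Th (%I. c I + d I) = (%w. Th c w + Th d w)"
  by (simp add: Th_def fun_eq_iff distrib_right sum.distrib)

lemma comb_diff: "comb (%I. c I - d I) = (%w. comb c w - comb d w)"
  by (simp add: comb_def fun_eq_iff left_diff_distrib sum_subtractf)

lemma Th_diff: "Th (%I. c I - d I) = (%w. Th c w - Th d w)"
  by (simp add: Th_def fun_eq_iff left_diff_distrib sum_subtractf)

lemma comb_sum: "comb (%I. \<Sum>j\<in>J. a j * c j I) = (%w. \<Sum>j\<in>J. a j * comb (c j) w)"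
proof
  fix w
  have "comb (%I. \<Sum>j\<in>J. a j * c j I) w = (\<Sum>I\<in>P0 G n s. \<Sum>j\<in>J. a j * (c j I * x_elem G n s I w))"
    by (simp add: comb_def sum_distrib_right mult.assoc)
  also have "\<dots> = (\<Sum>j\<in>J. a j * comb (c j) w)" unfolding comb_def sum_distrib_left by (rule sum.swap)
  finally show "comb (%I. \<Sum>j\<in>J. a j * c j I) w = (\<Sum>j\<in>J. a j * comb (c j) w)" .
qed

lemma Th_sum: "Th (%I. \<Sum>j\<in>J. a j * c j I) = (%w. \<Sum>j\<in>J. of_int (a j) * Th (c j) w)"
proof
  fix w
  have "Th (%I. \<Sum>j\<in>J. a j * c j I) w = (\<Sum>I\<in>P0 G n s. \<Sum>j\<in>J. of_int (a j) * (of_int (c j I) * induced G (generate G I) (%_. 1) w))"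
    by (simp add: Th_def sum_distrib_right mult.assoc)
  also have "\<dots> = (\<Sum>j\<in>J. of_int (a j) * Th (c j) w)" unfolding Th_def sum_distrib_left by (rule sum.swap)
  finally show "Th (%I. \<Sum>j\<in>J. a j * c j I) w = (\<Sum>j\<in>J. of_int (a j) * Th (c j) w)" .
qed

definition dlt :: "'a set => 'a set => int" where "dlt J I = (if I = J then 1 else 0)"

lemma comb_dlt: "J \<in> P0 G n s ==> comb (dlt J) = x_elem G n s J"
  using finite_P0 by (simp add: comb_def dlt_def fun_eq_iff if_distrib[of "%x. x * _"] cong: if_cong)

lemma Th_dlt: "J \<in> P0 G n s ==> Th (dlt J) = induced G (generate G J) (%_. 1)"
  using finite_P0 by (simp add: Th_def dlt_def fun_eq_iff if_distrib[of "%x. of_int x * _"] cong: if_cong)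

lemma Y_classes:
  assumes "closed_family \<H>"
  shows "Y \<H> w = (\<Sum>C\<in>rcl ` \<H>. Y C w)" "M \<H> w = (\<Sum>C\<in>rcl ` \<H>. M C w)"
proof -
  have f: "finite \<H>" and e: "\<H> \<subseteq> extensional pos" and c: "\<And>F. F \<in> \<H> ==> rcl F \<subseteq> \<H>"
    using assms by (auto simp: closed_family_def)
  have U: "\<Union> (rcl ` \<H>) = \<H>" using c e rcl_refl by blast
  have d: "A \<inter> B = {}" if "A \<in> rcl ` \<H>" "B \<in> rcl ` \<H>" "A ~= B" for A B
    using that rcl_eq by blast
  have s: "sum \<phi> \<H> = (\<Sum>C\<in>rcl ` \<H>. sum \<phi> C)" for \<phi> :: "(int => nat) => int"
  proof -
    have "sum \<phi> (\<Union> (rcl ` \<H>)) = (sum \<circ> sum) \<phi> (rcl ` \<H>)"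
      by (rule sum.Union_disjoint) (use finite_rcl d in auto)
    then show ?thesis by (simp add: U)
  qed
  show "Y \<H> w = (\<Sum>C\<in>rcl ` \<H>. Y C w)" "M \<H> w = (\<Sum>C\<in>rcl ` \<H>. M C w)"
    unfolding Y_def M_def by (rule s)+
qed

lemma closed_family_diff:
  assumes "closed_family A" "closed_family B" shows "closed_family (A - B)"
proof -
  have "F' \<notin> B" if "F \<in> A - B" "F' \<in> rcl F" for F F'
  proof
    assume "F' \<in> B"
    then have "rcl F \<subseteq> B" using assms(2) rcl_eq[OF that(2)] by (auto simp: closed_family_def)
    moreover have "F \<in> rcl F" using that assms(1) rcl_refl by (auto simp: closed_family_def)
    ultimately show False using that by blast
  qed
  then show ?thesis using assms unfolding closed_family_def by blast
qed

lemma Y_M_diff: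
  assumes "finite A" "B \<subseteq> A"
  shows "Y (A - B) w = Y A w - Y B w" "M (A - B) w = M A w - M B w"
  unfolding Y_def M_def using assms by (simp_all add: sum_diff)

text \<open>Splitting off the leading words of \<open>spl b\<close>, those in which every even letter stays negative, expresses
  the sum over a rearrangement class through one \<open>x\<^sub>I\<close> and classes with fewer negative positions.\<close>

lemma class_in_span:
  "\<exists>c. Y (rcl f) = comb c \<and> (\<forall>g\<in>carrier G. Th c g = of_int (M (rcl f) g))"
proof (induction "nsize f" arbitrary: f rule: less_induct)
  case less
  obtain b where b: "mono_word b" "cnt b = cnt f" using sorted_rearrangement by blast
  let ?\<phi> = "%k::nat. 2 * k + k mod 2"
  have sm: "strict_mono ?\<phi>"
  proof (rule strict_monoI)
    fix x y :: nat assume "x < y"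
    moreover have "x mod 2 < 2" by simp
    ultimately show "?\<phi> x < ?\<phi> y" by linarith
  qed
  have ev: "even (?\<phi> k) \<longleftrightarrow> even k" for k by simp
  let ?r = "%F. restrict (%v. ?\<phi> (F v)) pos"
  let ?T = "?r ` rcl f"
  have inj: "inj_on ?r (rcl f)"
  proof (rule inj_onI)
    fix F F' assume F: "F \<in> rcl f" "F' \<in> rcl f" "?r F = ?r F'"
    show "F = F'"
    proof (rule extensionalityI[of _ pos])
      fix v assume v: "v \<in> pos"
      then have "?\<phi> (F v) = ?\<phi> (F' v)" using fun_cong[OF F(3), of v] by simp
      then show "F v = F' v" using strict_mono_eq[OF sm] by blast
    qed (use F in \<open>auto simp: rcl_def\<close>)
  qed
  have str: "st (?r F) = st F" for F
  proof -
    have "sorts (%v. ?\<phi> (F v)) (st F)" using sorts_relabel[OF sm ev] st_sorts by blast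
    then have "sorts (?r F) (st F)" by (rule sorts_cong1[rotated]) simp
    then show ?thesis using st_eq_iff by blast
  qed
  have YT: "Y ?T = Y (rcl f)" unfolding Y_def sum.reindex[OF inj] by (simp add: str)
  have MT: "M ?T g = M (rcl f) g" if "g \<in> carrier G" for g
  proof -
    have "m (?r F) g = m F g" for F
      using m_cong[OF that, of "?r F" "%v. ?\<phi> (F v)"] m_relabel[OF strict_mono_imp_inj_on[OF sm] ev] by simp
    then show ?thesis unfolding M_def sum.reindex[OF inj] by simp
  qed
  have T: "F \<in> ?T \<longleftrightarrow> F \<in> spl b \<and> (\<forall>v\<in>pos. even (F v div 2) --> even (F v))" for F
  proof
    assume "F \<in> ?T"
    then obtain F0 where F0: "F0 \<in> rcl f" "F = ?r F0" by blast
    have d: "F v div 2 = F0 v" if "v \<in> pos" for v using that F0 by simp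
    have "cnt (%v. F v div 2) = cnt F0" by (rule cnt_cong) (rule d)
    then show "F \<in> spl b \<and> (\<forall>v\<in>pos. even (F v div 2) --> even (F v))"
      using F0 b(2) by (simp add: spl_def rcl_def)
  next
    assume F: "F \<in> spl b \<and> (\<forall>v\<in>pos. even (F v div 2) --> even (F v))"
    let ?F0 = "restrict (%v. F v div 2) pos"
    have "?F0 \<in> rcl f" using F b(2) by (simp add: spl_def rcl_def)
    moreover have "F = ?r ?F0"
    proof
      fix v show "F v = ?r ?F0 v"
      proof (cases "v \<in> pos")
        case True
        have "even (F v div 2) \<longleftrightarrow> even (F v)" using F True by (auto simp: spl_def simp del: atLeastAtMost_iff)
        then have "(F v div 2) mod 2 = F v mod 2" by presburger
        then show ?thesis using True by (simp del: atLeastAtMost_iff)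
      next
        case False then show ?thesis using F by (auto simp: spl_def extensional_def)
      qed
    qed
    ultimately show "F \<in> ?T" by blast
  qed
  have Tspl: "?T \<subseteq> spl b" using T by blast
  have closedT: "closed_family ?T"
  proof (rule closed_familyI)
    show "finite ?T" using finite_rcl by simp
    fix F g assume "F \<in> ?T" and g: "g \<in> carrier G"
    then obtain F0 where F0: "F0 \<in> rcl f" "F = ?r F0" by blast
    have "restrict (%v. F \<bar>act g v\<bar>) pos = ?r (restrict (%v. F0 \<bar>act g v\<bar>) pos)"
    proof
      fix v show "restrict (%v. F \<bar>act g v\<bar>) pos v = ?r (restrict (%v. F0 \<bar>act g v\<bar>) pos) v"
        using act_pos_abs[OF g, of v] F0 by (cases "v \<in> pos") (simp_all del: atLeastAtMost_iff)
    qed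
    then show "restrict (%v. F \<bar>act g v\<bar>) pos \<in> ?T"
      using closed_family_act[OF closed_rcl F0(1) g] by blast
  qed auto
  let ?R = "spl b - ?T"
  have cR: "closed_family ?R" by (rule closed_family_diff[OF closed_spl closedT])
  have small: "nsize F < nsize f" if F: "F \<in> ?R" for F
  proof -
    obtain v where v: "v \<in> pos" "even (F v div 2)" "odd (F v)" using F T by blast
    have "{v \<in> pos. even (F v)} \<subset> {v \<in> pos. even (F v div 2)}"
      using F v by (auto simp: spl_def simp del: atLeastAtMost_iff)
    then have "nsize F < nsize (%v. F v div 2)" unfolding nsize_def
      by (rule psubset_card_mono[OF finite_pos_Collect])
    also have "nsize (%v. F v div 2) = nsize f" using F b(2) by (intro nsize_cnt) (simp add: spl_def)
    finally show ?thesis .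
  qed
  have "\<forall>C\<in>rcl ` ?R. \<exists>c. Y C = comb c \<and> (\<forall>g\<in>carrier G. Th c g = of_int (M C g))"
    using less small by blast
  from bchoice[OF this] obtain c
    where c: "\<And>C. C \<in> rcl ` ?R ==> Y C = comb (c C) \<and> (\<forall>g\<in>carrier G. Th (c C) g = of_int (M C g))"
    by blast
  let ?e = "%I. \<Sum>C\<in>rcl ` ?R. 1 * c C I"
  have YR: "Y ?R = comb ?e"
    unfolding comb_sum using c Y_classes(1)[OF cR] by (simp add: fun_eq_iff)
  have MR: "Th ?e g = of_int (M ?R g)" if "g \<in> carrier G" for g
    unfolding Th_sum using c that Y_classes(2)[OF cR] by simp
  have fs: "finite (spl b)" using closed_spl by (simp add: closed_family_def)
  let ?d = "%I. dlt (gens b) I - ?e I"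
  have "comb ?d = Y (rcl f)"
    unfolding comb_diff comb_dlt[OF gens_P0] x_elem_Y[OF b(1)] YR[symmetric] YT[symmetric]
    by (simp add: fun_eq_iff Y_M_diff[OF fs Tspl])
  moreover have "Th ?d g = of_int (M (rcl f) g)" if "g \<in> carrier G" for g
    unfolding Th_diff Th_dlt[OF gens_P0] MR[OF that] induced_eq_M[OF b(1) that] MT[OF that, symmetric]
    by (simp add: Y_M_diff[OF fs Tspl])
  ultimately show ?case by (intro exI[of _ ?d]) simp
qed

lemma family_in_span:
  assumes "closed_family \<H>"
  shows "\<exists>c. Y \<H> = comb c \<and> (\<forall>g\<in>carrier G. Th c g = of_int (M \<H> g))"
proof -
  have "\<forall>C\<in>rcl ` \<H>. \<exists>c. Y C = comb c \<and> (\<forall>g\<in>carrier G. Th c g = of_int (M C g))"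
    using class_in_span by blast
  from bchoice[OF this] obtain c
    where c: "\<And>C. C \<in> rcl ` \<H> ==> Y C = comb (c C) \<and> (\<forall>g\<in>carrier G. Th (c C) g = of_int (M C g))"
    by blast
  have "Y \<H> = comb (%I. \<Sum>C\<in>rcl ` \<H>. 1 * c C I)"
    unfolding comb_sum using c Y_classes(1)[OF assms] by (simp add: fun_eq_iff)
  moreover have "Th (%I. \<Sum>C\<in>rcl ` \<H>. 1 * c C I) g = of_int (M \<H> g)" if "g \<in> carrier G" for g
    unfolding Th_sum using c that Y_classes(2)[OF assms] by simp
  ultimately show ?thesis by blast
qed

lemma family_bound:
  fixes \<H> :: "(int => nat) set"
  assumes "finite \<H>" obtains K where "\<And>F v. F \<in> \<H> ==> v \<in> pos ==> F v < K"
proof -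
  let ?V = "(%(F, v). F v) ` (\<H> \<times> pos)"
  have "F v < Suc (Max ?V)" if "F \<in> \<H>" "v \<in> pos" for F v
  proof -
    have "F v \<in> ?V" using that by (intro image_eqI[of _ _ "(F, v)"]) auto
    then show ?thesis using assms by (simp add: less_Suc_eq_le)
  qed
  then show thesis using that by blast
qed

text \<open>Both identities come from the family of pairs.\<close>

lemma x_mult:
  assumes "I \<in> P0 G n s" "J \<in> P0 G n s"
  shows "\<exists>c. conv (x_elem G n s I) (x_elem G n s J) = comb c \<and>
    (\<forall>g\<in>carrier G. Th c g = induced G (generate G I) (%_. 1) g * induced G (generate G J) (%_. 1) g)"
proof -
  obtain a where a: "mono_word a" "I = gens a" using P0_gens[OF assms(1)] by blast
  obtain b where b: "mono_word b" "J = gens b" using P0_gens[OF assms(2)] by blast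
  have "finite (spl a)" using closed_spl by (simp add: closed_family_def)
  then obtain K where K: "\<And>F v. F \<in> spl a ==> v \<in> pos ==> F v < K" using family_bound by blast
  obtain c where c: "Y (pairs K (spl a) (spl b)) = comb c"
      "\<And>g. g \<in> carrier G ==> Th c g = of_int (M (pairs K (spl a) (spl b)) g)"
    using family_in_span[OF closed_pairs[OF closed_spl closed_spl]] by metis
  have "conv (x_elem G n s I) (x_elem G n s J) = comb c"
    unfolding a(2) b(2) x_elem_Y[OF a(1)] x_elem_Y[OF b(1)] c(1)[symmetric]
    by (rule conv_Y[OF closed_spl closed_spl]) (rule K)
  moreover have "Th c g = induced G (generate G I) (%_. 1) g * induced G (generate G J) (%_. 1) g"
    if "g \<in> carrier G" for g
  proof -
    have "M (spl a) g * M (spl b) g = M (pairs K (spl a) (spl b)) g"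
      by (rule M_mult[OF closed_spl closed_spl _ that]) (rule K)
    then show ?thesis
      unfolding c(2)[OF that] a(2) b(2) induced_eq_M[OF a(1) that] induced_eq_M[OF b(1) that]
      by (simp flip: of_int_mult)
  qed
  ultimately show ?thesis by blast
qed

lemma induced_out: "g \<notin> carrier G ==> induced G H \<chi> g = 0"
  by (simp add: induced_def)

lemma comb_mult:
  "\<exists>e. conv (comb c) (comb d) = comb e \<and> Th e = (%g. Th c g * Th d g)"
proof -
  let ?P = "P0 G n s"
  have "\<forall>I\<in>?P. \<forall>J\<in>?P. \<exists>e. conv (x_elem G n s I) (x_elem G n s J) = comb e \<and>
    (\<forall>g\<in>carrier G. Th e g = induced G (generate G I) (%_. 1) g * induced G (generate G J) (%_. 1) g)"
    using x_mult by blast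
  then obtain e where e: "\<And>I J. I \<in> ?P ==> J \<in> ?P ==> conv (x_elem G n s I) (x_elem G n s J) = comb (e I J)"
    "\<And>I J g. I \<in> ?P ==> J \<in> ?P ==> g \<in> carrier G ==>
      Th (e I J) g = induced G (generate G I) (%_. 1) g * induced G (generate G J) (%_. 1) g"
    by metis
  let ?e = "%A. \<Sum>I\<in>?P. c I * (\<Sum>J\<in>?P. d J * e I J A)"
  have cb: "comb a = (%w. \<Sum>I\<in>?P. a I * x_elem G n s I w)" for a by (simp add: comb_def fun_eq_iff)
  have "conv (comb c) (comb d) = (%w. \<Sum>I\<in>?P. c I * (\<Sum>J\<in>?P. d J * conv (x_elem G n s I) (x_elem G n s J) w))"
    unfolding cb[of c] cb[of d] conv_sum_left conv_sum_right ..
  also have "\<dots> = comb ?e" unfolding comb_sum using e(1) by (simp add: fun_eq_iff)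
  finally have 1: "conv (comb c) (comb d) = comb ?e" .
  have "Th ?e g = Th c g * Th d g" for g
  proof (cases "g \<in> carrier G")
    case True
    have "Th ?e g = (\<Sum>I\<in>?P. of_int (c I) * (\<Sum>J\<in>?P. of_int (d J) *
        (induced G (generate G I) (%_. 1) g * induced G (generate G J) (%_. 1) g)))"
      unfolding Th_sum using e(2) True by simp
    also have "\<dots> = (\<Sum>I\<in>?P. \<Sum>J\<in>?P. of_int (c I) * (of_int (d J) *
        (induced G (generate G I) (%_. 1) g * induced G (generate G J) (%_. 1) g)))"
      by (simp only: sum_distrib_left)
    also have "\<dots> = (\<Sum>I\<in>?P. \<Sum>J\<in>?P. (of_int (c I) * induced G (generate G I) (%_. 1) g) *
        (of_int (d J) * induced G (generate G J) (%_. 1) g))"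
      by (intro sum.cong HOL.refl) (simp only: mult_ac)
    also have "\<dots> = Th c g * Th d g" by (simp only: Th_def sum_product)
    finally show ?thesis .
  next
    case False
    then have "Th a g = 0" for a by (simp add: Th_def induced_out)
    then show ?thesis by simp
  qed
  then show ?thesis using 1 by blast
qed

text \<open>The word with one odd block has \<open>W\<^sub>I = W\<close> and \<open>X\<^sub>I = {1}\<close>.\<close>

lemma one_comb:
  "\<exists>c. comb c = (%w. if w = \<one> then 1 else 0) \<and> Th c = (%g. if g \<in> carrier G then 1 else 0)"
proof -
  let ?b = "%_::int. 1::nat"
  have mb: "mono_word ?b" by (simp add: mono_word_def)
  have st: "stab ?b = carrier G" by (auto simp: stab_def)
  have "x = \<one>" if "x \<in> Xb ?b" for x
  proof -
    have 1: "\<one> \<in> Xb ?b" by (simp add: Xb_def)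
    have "inv \<one> \<otimes> x \<in> stab ?b" unfolding st using that by (simp add: Xb_def)
    then show ?thesis using Xb_stab_unique[OF mb 1 that] by simp
  qed
  then have X: "Xb ?b = {\<one>}" by (auto simp: Xb_def)
  have "comb (dlt (gens ?b)) = (%w. if w = \<one> then 1 else 0)"
    unfolding comb_dlt[OF gens_P0] x_elem_def X_set_gens X by auto
  moreover have "Th (dlt (gens ?b)) = (%g. if g \<in> carrier G then 1 else 0)"
  proof
    fix g
    show "Th (dlt (gens ?b)) g = (if g \<in> carrier G then 1 else 0)"
    proof (cases "g \<in> carrier G")
      case True
      have "{x \<in> Xb ?b. inv x \<otimes> g \<otimes> x \<in> stab ?b} = {\<one>}" unfolding X st using True by auto
      then show ?thesis unfolding Th_dlt[OF gens_P0] induced_eq_card[OF mb True] using True by (simp only:) simp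
    next
      case False then show ?thesis unfolding Th_dlt[OF gens_P0] by (simp add: induced_out)
    qed
  qed
  ultimately show ?thesis by blast
qed

section \<open>Linear independence\<close>

text \<open>The element lies in \<open>Xb b\<close>. If it also lies in \<open>Xb c\<close>, then the odd letters of \<open>c\<close> stand at
  odd letters of \<open>b\<close>; and if the odd letters stand at the same positions, every block of \<open>c\<close> is
  contained in a block of \<open>b\<close>.\<close>

lemma separating_element:
  fixes b :: "int => nat"
  obtains w where "w \<in> carrier G" "\<And>i. i \<in> pos ==> 0 < act w i \<longleftrightarrow> odd (b i)"
    "\<And>i j. i \<in> pos ==> j \<in> pos ==> i < j ==> b i = b j ==> act w i < act w j"
    "\<And>i j. i \<in> pos ==> j \<in> pos ==> b i < b j ==> (even (b i) \<longleftrightarrow> even (b j)) ==> act w j < act w i"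
proof -
  obtain B where B0: "\<And>F v. F \<in> {b} ==> v \<in> pos ==> F v < B"
    using family_bound[of "{b}"] by blast
  then have B: "b v < B" if "v \<in> pos" for v using that by blast
  define F where "F i = (if odd (b i) then 2 * (B - b i) + 1 else 2 * b i)" for i
  let ?u = "st F"
  let ?w = "inv ?u"
  have s: "sorts F ?u" by (rule st_sorts)
  have wp: "\<bar>act ?w i\<bar> \<in> pos" if "i \<in> pos" for i using act_pos_abs that by simp
  have uw: "\<bar>act ?u \<bar>act ?w i\<bar>\<bar> = i" if "i \<in> pos" for i using act_inv_abs'[OF st_closed, of F i] that by simp
  have sg: "0 < act ?w i \<longleftrightarrow> odd (F i)" if i: "i \<in> pos" for i
  proof -
    let ?k = "\<bar>act ?w i\<bar>"
    have "0 < act ?u ?k \<longleftrightarrow> odd (F i)" using s wp[OF i] uw[OF i] by (simp add: sorts_def)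
    moreover have "act ?u (act ?w i) = i" by (simp add: act_inv)
    then have "0 < act ?u ?k \<longleftrightarrow> 0 < act ?w i"
      using i act_minus[of ?u "act ?w i"] wp[OF i] by (cases "0 < act ?w i") auto
    ultimately show ?thesis by simp
  qed
  have lt: "F i < F j \<or> F i = F j \<and> (if odd (F i) then i < j else j < i)"
    if ij: "i \<in> pos" "j \<in> pos" "\<bar>act ?w i\<bar> < \<bar>act ?w j\<bar>" for i j
  proof -
    let ?k = "\<bar>act ?w i\<bar>" and ?l = "\<bar>act ?w j\<bar>"
    have l: "lx F (act ?u ?k) (act ?u ?l)" using sorts_mono[OF s] wp ij by simp
    have e: "act ?u \<bar>act ?w i\<bar> = (if odd (F i) then i else - i)" if i: "i \<in> pos" for i
    proof -
      have "act ?u (act ?w i) = i" by (simp add: act_inv)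
      then show ?thesis using sg[OF i] wp[OF i] act_minus[of ?u "act ?w i"]
        by (cases "0 < act ?w i") (auto simp: abs_if split: if_splits)
    qed
    have l': "F i < F j \<or> F i = F j \<and> act ?u ?k < act ?u ?l"
      using l unfolding lx_def uw[OF ij(1)] uw[OF ij(2)] .
    show ?thesis using l' unfolding e[OF ij(1)] e[OF ij(2)] by auto
  qed
  have ne: "\<bar>act ?w i\<bar> ~= \<bar>act ?w j\<bar>" if "i \<in> pos" "j \<in> pos" "i ~= j" for i j
    using act_abs_eq_iff[of ?w i j] that by auto
  have Fo: "odd (F i) \<longleftrightarrow> odd (b i)" for i by (simp add: F_def)
  show thesis
  proof (rule that[of ?w])
    show "0 < act ?w i \<longleftrightarrow> odd (b i)" if "i \<in> pos" for i using sg[OF that] Fo by simp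
  next
    fix i j assume ij: "i \<in> pos" "j \<in> pos" "i < j" "b i = b j"
    then have FF: "F i = F j" by (simp add: F_def)
    have "\<bar>act ?w i\<bar> < \<bar>act ?w j\<bar> \<or> \<bar>act ?w j\<bar> < \<bar>act ?w i\<bar>" using ne[OF ij(1,2)] ij by auto
    then show "act ?w i < act ?w j" using lt[OF ij(1,2)] lt[OF ij(2,1)] FF ij sg[OF ij(1)] sg[OF ij(2)]
      by (cases "odd (F i)") auto
  next
    fix i j assume ij: "i \<in> pos" "j \<in> pos" "b i < b j" "even (b i) \<longleftrightarrow> even (b j)"
    have "i ~= j" using ij by auto
    then have c: "\<bar>act ?w i\<bar> < \<bar>act ?w j\<bar> \<or> \<bar>act ?w j\<bar> < \<bar>act ?w i\<bar>" using ne[OF ij(1,2)] by auto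
    show "act ?w j < act ?w i"
    proof (cases "odd (b i)")
      case True
      then have "F j < F i" using ij B[OF ij(2)] by (simp add: F_def)
      then show ?thesis using c lt[OF ij(1,2)] sg[OF ij(1)] sg[OF ij(2)] Fo True ij by auto
    next
      case False
      then have "F i < F j" using ij by (simp add: F_def)
      then show ?thesis using c lt[OF ij(2,1)] sg[OF ij(1)] sg[OF ij(2)] Fo False ij by auto
    qed
  qed simp
qed

definition Tset :: "(int => nat) => int set" where "Tset b = {i \<in> pos. odd (b i)}"
definition Aset :: "(int => nat) => int set" where "Aset b = {i \<in> pos. i < int n \<and> b i = b (i + 1)}"

lemma gens_cong: assumes "Tset b = Tset c" "Aset b = Aset c" shows "gens b = gens c"
proof -
  have "odd (b (int k + 1)) \<longleftrightarrow> odd (c (int k + 1))" if "k < n" for k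
  proof -
    have "int k + 1 \<in> Tset b \<longleftrightarrow> int k + 1 \<in> Tset c" unfolding assms(1) ..
    then show ?thesis using that by (simp add: Tset_def)
  qed
  moreover have "b (int k) = b (int k + 1) \<longleftrightarrow> c (int k) = c (int k + 1)" if "1 \<le> k" "k < n" for k
  proof -
    have "int k \<in> Aset b \<longleftrightarrow> int k \<in> Aset c" unfolding assms(2) ..
    then show ?thesis using that by (simp add: Aset_def)
  qed
  ultimately show ?thesis unfolding gens_def by (intro arg_cong2[of _ _ _ _ "(\<union>)"] Collect_cong) auto
qed

text \<open>Evaluation at the separating elements gives a triangular matrix, in the order by the number of
  odd letters first and by the blocks second.\<close>

lemma x_independent: "int_independent (x_elem G n s) (P0 G n s)"
  unfolding int_independent_def
proof (intro allI impI ballI)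
  let ?P = "P0 G n s"
  fix c :: "'a set => int" and I assume z: "\<forall>w. (\<Sum>i\<in>?P. c i * x_elem G n s i w) = 0" and "I \<in> ?P"
  obtain b where b: "\<And>I. I \<in> ?P ==> mono_word (b I) \<and> I = gens (b I)"
  proof -
    have "\<forall>I\<in>?P. \<exists>b. mono_word b \<and> I = gens b"
    proof
      fix I assume "I \<in> ?P"
      then show "\<exists>b. mono_word b \<and> I = gens b" by (rule P0_gens) blast
    qed
    from bchoice[OF this] show thesis using that by blast
  qed
  define \<mu> where "\<mu> I = card (Tset (b I)) * (n + 1) + card (Aset (b I))" for I
  have fA: "finite (Aset b)" "card (Aset b) < n + 1" for b
  proof -
    show "finite (Aset b)" unfolding Aset_def by (rule finite_pos_Collect)
    have "card (Aset b) \<le> card pos" by (rule card_mono) (auto simp: Aset_def)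
    then show "card (Aset b) < n + 1" by simp
  qed
  show "c I = 0" using \<open>I \<in> ?P\<close>
  proof (induction "\<mu> I" arbitrary: I rule: less_induct)
    case less
    have "\<exists>w\<in>carrier G. (\<forall>i\<in>pos. 0 < act w i \<longleftrightarrow> odd (b I i)) \<and>
        (\<forall>i\<in>pos. \<forall>j\<in>pos. i < j --> b I i = b I j --> act w i < act w j) \<and>
        (\<forall>i\<in>pos. \<forall>j\<in>pos. b I i < b I j --> (even (b I i) \<longleftrightarrow> even (b I j)) --> act w j < act w i)"
      by (rule separating_element[of "b I"]) blast
    then obtain w where w: "w \<in> carrier G" "\<And>i. i \<in> pos ==> 0 < act w i \<longleftrightarrow> odd (b I i)"
      "\<And>i j. i \<in> pos ==> j \<in> pos ==> i < j ==> b I i = b I j ==> act w i < act w j"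
      "\<And>i j. i \<in> pos ==> j \<in> pos ==> b I i < b I j ==> (even (b I i) \<longleftrightarrow> even (b I j)) ==> act w j < act w i"
      by blast
    have wX: "w \<in> Xb (b I)" using w by (auto simp: Xb_def)
    have J: "c J = 0 \<or> J = I" if J: "J \<in> ?P" "w \<in> Xb (b J)" for J
    proof -
      have T: "Tset (b J) \<subseteq> Tset (b I)" using J(2) w(2) by (auto simp: Xb_def Tset_def)
      have fT: "finite (Tset (b I))" unfolding Tset_def by (rule finite_pos_Collect)
      show ?thesis
      proof (cases "Tset (b J) = Tset (b I)")
        case False
        then have "card (Tset (b J)) < card (Tset (b I))" using T fT by (intro psubset_card_mono) auto
        then have "Suc (card (Tset (b J))) * (n + 1) \<le> card (Tset (b I)) * (n + 1)" by (intro mult_right_mono) auto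
        then have "\<mu> J < \<mu> I" using fA(2)[of "b J"] by (simp add: \<mu>_def)
        then show ?thesis using less.hyps J(1) by blast
      next
        case True
        have "Aset (b J) \<subseteq> Aset (b I)"
        proof
          fix i assume i: "i \<in> Aset (b J)"
          then have p: "i \<in> pos" "i + 1 \<in> pos" "b J i = b J (i + 1)" by (auto simp: Aset_def)
          have "i \<in> Tset (b J) \<longleftrightarrow> i + 1 \<in> Tset (b J)" using p by (simp add: Tset_def)
          then have par: "even (b I i) \<longleftrightarrow> even (b I (i + 1))" unfolding True using p by (simp add: Tset_def)
          have "act w i < act w (i + 1)" using J(2) p by (auto simp: Xb_def)
          moreover have "b I i \<le> b I (i + 1)" using b[OF less.prems] p by (auto simp: mono_word_def)
          ultimately have "b I i = b I (i + 1)" using w(4)[OF p(1,2) _ par] by fastforce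
          then show "i \<in> Aset (b I)" using i by (auto simp: Aset_def)
        qed
        then consider "Aset (b J) = Aset (b I)" | "card (Aset (b J)) < card (Aset (b I))"
          using psubset_card_mono[OF fA(1)] by blast
        then show ?thesis
        proof cases
          case 1 then show ?thesis using gens_cong[OF True] b J(1) less.prems by metis
        next
          case 2 then have "\<mu> J < \<mu> I" using True by (simp add: \<mu>_def)
          then show ?thesis using less.hyps J(1) by blast
        qed
      qed
    qed
    have xw: "x_elem G n s J w = (if w \<in> Xb (b J) then 1 else 0)" if "J \<in> ?P" for J
      using b[OF that] X_set_gens[of "b J"] by (simp add: x_elem_def)
    have "(\<Sum>J\<in>?P. c J * x_elem G n s J w) = (\<Sum>J\<in>{I}. c J * x_elem G n s J w)"
    proof (rule sum.mono_neutral_right[OF finite_P0])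
      show "\<forall>J\<in>?P - {I}. c J * x_elem G n s J w = 0" using J xw by auto
    qed (use less.prems in auto)
    then show ?case using z xw[OF less.prems] wX by simp
  qed
qed

end

section \<open>Bijections that preserve labels\<close>

lemma label_preserving_bij:
  fixes la :: "'b => 'k" and lb :: "'c => 'k"
  assumes A: "finite A" and B: "finite B"
    and c: "\<And>k. card {a \<in> A. la a = k} = card {b \<in> B. lb b = k}"
  obtains \<rho> where "bij_betw \<rho> A B" "\<And>a. a \<in> A ==> lb (\<rho> a) = la a"
proof -
  have "\<exists>h. bij_betw h {a \<in> A. la a = k} {b \<in> B. lb b = k}" for k
    using A B c[of k] by (intro finite_same_card_bij) auto
  then obtain h where h: "\<And>k. bij_betw (h k) {a \<in> A. la a = k} {b \<in> B. lb b = k}" by metis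
  define \<rho> where "\<rho> a = h (la a) a" for a
  have r: "\<rho> a \<in> B \<and> lb (\<rho> a) = la a" if "a \<in> A" for a
    using h[of "la a"] that unfolding \<rho>_def bij_betw_def by blast
  have "inj_on \<rho> A"
  proof (rule inj_onI)
    fix a a' assume a: "a \<in> A" "a' \<in> A" "\<rho> a = \<rho> a'"
    then have l: "la a = la a'" using r by metis
    have "inj_on (h (la a)) {x \<in> A. la x = la a}" using h by (simp add: bij_betw_def)
    then show "a = a'" using a l by (auto simp: \<rho>_def dest: inj_onD)
  qed
  moreover have "\<rho> ` A = B"
  proof
    show "B \<subseteq> \<rho> ` A"
    proof
      fix b assume "b \<in> B"
      then have "b \<in> h (lb b) ` {a \<in> A. la a = lb b}" using h[of "lb b"] unfolding bij_betw_def by blast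
      then show "b \<in> \<rho> ` A" unfolding \<rho>_def by force
    qed
  qed (use r in blast)
  ultimately show thesis using that r by (auto simp: bij_betw_def)
qed

lemma rank_bij:
  fixes A :: "int set"
  assumes "finite A" shows "bij_betw (%v. card {u \<in> A. u < v}) A {..<card A}"
proof -
  let ?r = "%v. card {u \<in> A. u < v}"
  have less: "?r v < ?r w" if "v \<in> A" "w \<in> A" "v < w" for v w
    using assms that by (intro psubset_card_mono) auto
  have inj: "inj_on ?r A"
  proof (rule inj_onI)
    fix v w assume vw: "v \<in> A" "w \<in> A" "?r v = ?r w"
    have "\<not> v < w" "\<not> w < v" using less[OF vw(1,2)] less[OF vw(2,1)] vw(3) by auto
    then show "v = w" by simp
  qed
  have "?r ` A \<subseteq> {..<card A}"
  proof
    fix k assume "k \<in> ?r ` A"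
    then obtain v where "v \<in> A" "k = ?r v" by blast
    moreover have "?r v < card A" using \<open>v \<in> A\<close> assms by (intro psubset_card_mono) auto
    ultimately show "k \<in> {..<card A}" by simp
  qed
  then have "?r ` A = {..<card A}" using card_image[OF inj] by (intro card_subset_eq) auto
  then show ?thesis using inj by (simp add: bij_betw_def)
qed

context coxeter_C begin

section \<open>The sign character of the underlying permutations\<close>

definition ap :: "'a => int => int" where
  "ap g v = (if v \<in> pos then \<bar>act g v\<bar> else v)"

text \<open>The sign of the permutation \<open>|g|\<close>, ignoring the signs of \<open>g\<close>.\<close>

definition eps :: "'a => int" where "eps g = sign (ap g)"

lemma ap_permutes: "g \<in> carrier G ==> ap g permutes pos"
  using bij_act[of g] by (intro bij_imp_permutes) (auto simp: ap_def bij_betw_def inj_on_def image_def)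

lemma eps_mult: assumes "g \<in> carrier G" "h \<in> carrier G" shows "eps (g \<otimes> h) = eps g * eps h"
proof -
  have "ap (g \<otimes> h) = ap g \<circ> ap h"
    using assms act_pos_abs[OF assms(2)] by (auto simp: ap_def fun_eq_iff act_mult_apply act_abs simp del: atLeastAtMost_iff)
  moreover have "permutation (ap g)" "permutation (ap h)"
    using ap_permutes[OF assms(1)] ap_permutes[OF assms(2)] by (auto simp: permutation_permutes)
  ultimately show ?thesis unfolding eps_def by (simp add: sign_compose)
qed

lemma eps_trivial: "(\<And>v. v \<in> pos ==> \<bar>act g v\<bar> = v) ==> eps g = 1"
proof -
  assume "\<And>v. v \<in> pos ==> \<bar>act g v\<bar> = v"
  then have "ap g = id" by (auto simp: ap_def fun_eq_iff)
  then show ?thesis by (simp add: eps_def)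
qed

lemma eps_one: "eps \<one> = 1"
  by (rule eps_trivial) simp

lemma eps_square: "eps g * eps g = 1"
  by (simp add: eps_def sign_def)

lemma sum_translate_right: "t \<in> carrier G ==> (\<Sum>g\<in>carrier G. \<phi> (g \<otimes> t)) = (\<Sum>g\<in>carrier G. \<phi> g)"
  by (rule sum.reindex_bij_witness[of _ "%g. g \<otimes> inv t" "%g. g \<otimes> t"]) (auto simp: m_assoc)

lemma sum_zero_if_odd:
  fixes \<phi> :: "'a => int"
  assumes "t \<in> carrier G" "\<And>g. g \<in> carrier G ==> \<phi> (g \<otimes> t) = - \<phi> g"
  shows "(\<Sum>g\<in>carrier G. \<phi> g) = 0"
  using sum_translate_right[OF assms(1), of \<phi>] assms(2) by (simp add: sum_negf)

definition signs :: "'a set" where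
  "signs = {g \<in> carrier G. \<forall>v\<in>pos. \<bar>act g v\<bar> = v}"

lemma flip_element: assumes "N \<subseteq> pos"
  obtains g where "g \<in> carrier G" "\<And>v. v \<in> pos ==> act g v = (if v \<in> N then - v else v)"
proof (rule act_extend[of "%v. if v \<in> N then - v else v"])
  show "inj_on (%i. \<bar>if i \<in> N then - i else i\<bar>) pos" by (auto simp: inj_on_def)
qed (auto simp: that)

lemma card_signs: "card signs = 2 ^ n"
proof -
  let ?neg = "%g. {v \<in> pos. act g v < 0}"
  have "bij_betw ?neg signs (Pow pos)"
    unfolding bij_betw_def
  proof
    show "inj_on ?neg signs"
    proof (rule inj_onI)
      fix g h assume gh: "g \<in> signs" "h \<in> signs" "?neg g = ?neg h"
      have "act g v = act h v" if v: "v \<in> pos" for v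
      proof -
        have "act g v < 0 \<longleftrightarrow> act h v < 0" using gh(3) v by blast
        moreover have "\<bar>act g v\<bar> = \<bar>act h v\<bar>" using gh v by (simp add: signs_def)
        ultimately show ?thesis by (auto simp: abs_if split: if_splits)
      qed
      then show "g = h" using act_ext gh by (auto simp: signs_def)
    qed
    show "?neg ` signs = Pow pos"
    proof
      show "Pow pos \<subseteq> ?neg ` signs"
      proof
        fix N assume "N \<in> Pow pos"
        then have N: "N \<subseteq> pos" by simp
        obtain g where g: "g \<in> carrier G" "\<And>v. v \<in> pos ==> act g v = (if v \<in> N then - v else v)"
          using flip_element[OF N] by blast
        have "?neg g = N" using g N by (auto split: if_splits)
        moreover have "g \<in> signs" using g by (auto simp: signs_def)
        ultimately show "N \<in> ?neg ` signs" by blast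
      qed
    qed auto
  qed
  then have "card signs = card (Pow pos)" by (rule bij_betw_same_card)
  then show ?thesis by (simp add: card_Pow)
qed

definition pairing :: "(int => nat) => (int => nat) => int" where
  "pairing f h = (\<Sum>g\<in>carrier G. m f g * eps g * m h g)"

text \<open>The pairs \<open>(f v, h v)\<close> are the positions of the ones in a matrix with entries \<open>0\<close> and \<open>1\<close> that
  is block diagonal by parity. The contents of \<open>f\<close> and \<open>h\<close> are its row and column sums.\<close>

definition transversal :: "(int => nat) => (int => nat) => bool" where
  "transversal f h \<longleftrightarrow> inj_on (%v. (f v, h v)) pos \<and> (\<forall>v\<in>pos. even (f v) \<longleftrightarrow> even (h v))"

lemma act_neq_0: "g \<in> carrier G ==> v \<in> pos ==> act g v ~= 0"
  using act_eq_0_iff[of g v] by auto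

text \<open>Multiplication by the transposition of \<open>u\<close> and \<open>v\<close> changes the sign \<open>eps\<close> and preserves \<open>m f\<close>
  and \<open>m h\<close>.\<close>

lemma pairing_not_injective:
  assumes uv: "u \<in> pos" "v \<in> pos" "u ~= v" "f u = f v" "h u = h v"
  shows "pairing f h = 0"
proof -
  let ?\<tau> = "transpose u v"
  have tp: "?\<tau> x \<in> pos" if "x \<in> pos" for x using uv that by (auto simp: transpose_def)
  obtain t where t: "t \<in> carrier G" "\<And>x. x \<in> pos ==> act t x = ?\<tau> x"
  proof (rule act_extend[of ?\<tau>])
    show "\<bar>?\<tau> i\<bar> \<in> pos" if "i \<in> pos" for i using tp[OF that] by auto
    show "inj_on (%i. \<bar>?\<tau> i\<bar>) pos"
    proof (rule inj_onI)
      fix x y assume xy: "x \<in> pos" "y \<in> pos" "\<bar>?\<tau> x\<bar> = \<bar>?\<tau> y\<bar>"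
      then have "?\<tau> x = ?\<tau> y" using tp[OF xy(1)] tp[OF xy(2)] by auto
      then show "x = y" by (metis transpose_involutory)
    qed
  qed blast
  have gt: "act (g \<otimes> t) x = act g (?\<tau> x)" if "g \<in> carrier G" "x \<in> pos" for g x
    using that t by (simp add: act_mult_apply del: atLeastAtMost_iff)
  have bt: "bij_betw ?\<tau> pos pos"
    by (rule bij_betw_byWitness[where f' = ?\<tau>]) (use tp in auto)
  have m_t: "m F (g \<otimes> t) = m F g" if F: "F u = F v" and g: "g \<in> carrier G" for F g
  proof -
    have Ft: "F (?\<tau> x) = F x" for x using F by (auto simp: transpose_def)
    have 1: "(\<forall>x\<in>pos. F \<bar>act (g \<otimes> t) x\<bar> = F x) \<longleftrightarrow> (\<forall>x\<in>pos. F \<bar>act g x\<bar> = F x)"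
    proof -
      have "(\<forall>x\<in>pos. F \<bar>act (g \<otimes> t) x\<bar> = F x) \<longleftrightarrow> (\<forall>x\<in>pos. F \<bar>act g (?\<tau> x)\<bar> = F (?\<tau> x))"
        by (intro ball_cong) (simp_all only: gt[OF g] Ft)
      also have "\<dots> \<longleftrightarrow> (\<forall>x\<in>?\<tau> ` pos. F \<bar>act g x\<bar> = F x)" by blast
      also have "?\<tau> ` pos = pos" using bt unfolding bij_betw_def by blast
      finally show ?thesis .
    qed
    have "(\<Prod>x\<in>pos. if even (F x) then sgn (act (g \<otimes> t) x) else 1) =
        (\<Prod>x\<in>pos. if even (F (?\<tau> x)) then sgn (act g (?\<tau> x)) else 1)"
      by (rule prod.cong[OF HOL.refl]) (simp only: gt[OF g] Ft)
    also have "\<dots> = (\<Prod>x\<in>pos. if even (F x) then sgn (act g x) else 1)"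
      by (rule prod.reindex_bij_betw[OF bt])
    finally show ?thesis unfolding m_def 1 by (simp only:)
  qed
  have "ap t = transpose u v"
  proof
    fix x show "ap t x = transpose u v x"
    proof (cases "x \<in> pos")
      case True then show ?thesis using t(2)[OF True] tp[OF True] by (simp add: ap_def)
    next
      case False then show ?thesis using uv by (auto simp: ap_def transpose_def)
    qed
  qed
  then have "eps t = - 1" using uv(3) by (simp add: eps_def sign_swap_id)
  then have e: "eps (g \<otimes> t) = - eps g" if "g \<in> carrier G" for g using eps_mult[OF that t(1)] by simp
  show ?thesis unfolding pairing_def
    by (rule sum_zero_if_odd[OF t(1)]) (use m_t uv e in simp)
qed

text \<open>Multiplication by the sign change at \<open>v\<close> negates exactly one of \<open>m f\<close> and \<open>m h\<close>.\<close>

lemma pairing_parity: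
  assumes v: "v \<in> pos" "even (f v) ~= even (h v)"
  shows "pairing f h = 0"
proof -
  obtain t where t: "t \<in> carrier G" "\<And>x. x \<in> pos ==> act t x = (if x \<in> {v} then - x else x)"
    using flip_element[of "{v}"] v by blast
  have gt: "act (g \<otimes> t) x = (if x = v then - act g x else act g x)" if "g \<in> carrier G" "x \<in> pos" for g x
    using that t by (simp add: act_mult_apply act_minus del: atLeastAtMost_iff)
  have m_t: "m F (g \<otimes> t) = (if even (F v) then - m F g else m F g)" if g: "g \<in> carrier G" for F g
  proof -
    have 1: "(\<forall>x\<in>pos. F \<bar>act (g \<otimes> t) x\<bar> = F x) \<longleftrightarrow> (\<forall>x\<in>pos. F \<bar>act g x\<bar> = F x)"
      by (intro ball_cong) (simp_all add: gt[OF g] del: atLeastAtMost_iff)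
    have "(\<Prod>x\<in>pos. if even (F x) then sgn (act (g \<otimes> t) x) else 1) =
        (\<Prod>x\<in>pos. (if even (F x) then sgn (act g x) else 1) * (if x = v then (if even (F v) then - 1 else 1) else 1))"
      by (rule prod.cong[OF HOL.refl]) (auto simp: gt[OF g] sgn_minus simp del: atLeastAtMost_iff)
    also have "\<dots> = (\<Prod>x\<in>pos. if even (F x) then sgn (act g x) else 1) * (if even (F v) then - 1 else 1)"
      using v(1) by (simp add: prod.distrib del: atLeastAtMost_iff)
    finally show ?thesis unfolding m_def 1 by simp
  qed
  have "ap t x = x" for x using t(2)[of x] by (auto simp: ap_def)
  then have "ap t = id" by auto
  then have "eps t = 1" by (simp add: eps_def)
  then have e: "eps (g \<otimes> t) = eps g" if "g \<in> carrier G" for g using eps_mult[OF that t(1)] by simp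
  show ?thesis unfolding pairing_def
    by (rule sum_zero_if_odd[OF t(1)]) (use m_t v e in auto)
qed

text \<open>For a transversal pair only the pure sign changes stabilize both words, and each contributes
  \<open>1\<close>.\<close>

lemma pairing_eq: "pairing f h = (if transversal f h then 2 ^ n else 0)"
proof (cases "transversal f h")
  case False
  then consider u v where "u \<in> pos" "v \<in> pos" "u ~= v" "f u = f v" "h u = h v"
    | v where "v \<in> pos" "even (f v) ~= even (h v)"
    unfolding transversal_def inj_on_def by blast
  then show ?thesis using False pairing_not_injective pairing_parity by cases (auto simp del: atLeastAtMost_iff)
next
  case True
  have inj: "inj_on (%v. (f v, h v)) pos" and par: "\<And>v. v \<in> pos ==> even (f v) \<longleftrightarrow> even (h v)"
    using True by (auto simp: transversal_def)
  have "m f g * eps g * m h g = (if g \<in> signs then 1 else 0)" if g: "g \<in> carrier G" for g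
  proof (cases "g \<in> signs")
    case True
    then have a: "\<bar>act g v\<bar> = v" if "v \<in> pos" for v using that by (simp add: signs_def)
    have "eps g = 1" by (rule eps_trivial) (rule a)
    moreover have "m f g * m h g = 1"
    proof -
      have mm: "m F g = (\<Prod>v\<in>pos. if even (F v) then sgn (act g v) else 1)" for F
        using a unfolding m_def by simp
      have "(if even (f v) then sgn (act g v) else 1) * (if even (h v) then sgn (act g v) else 1) = 1" if "v \<in> pos" for v
        using par[OF that] act_neq_0[OF g that] by (simp add: sgn_if)
      then show ?thesis unfolding mm prod.distrib[symmetric] by simp
    qed
    ultimately show ?thesis using True by simp
  next
    case False
    have "m f g = 0 \<or> m h g = 0"
    proof (rule ccontr)
      assume "\<not> ?thesis"
      then have "\<forall>v\<in>pos. f \<bar>act g v\<bar> = f v" "\<forall>v\<in>pos. h \<bar>act g v\<bar> = h v" by (auto simp: m_def split: if_splits)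
      then have "\<bar>act g v\<bar> = v" if "v \<in> pos" for v
        using inj_onD[OF inj, of "\<bar>act g v\<bar>" v] act_pos_abs[OF g that] that by blast
      then show False using False g by (simp add: signs_def)
    qed
    then show ?thesis using False by auto
  qed
  then have "pairing f h = (\<Sum>g\<in>carrier G. if g \<in> signs then 1 else 0)" unfolding pairing_def by simp
  also have "\<dots> = int (card signs)"
    using finite_carrier by (simp add: sum.If_cases signs_def Int_def conj_commute)
  finally show ?thesis using True card_signs by simp
qed

section \<open>Types of words\<close>

text \<open>A numerical substitute for the dominance order on partitions.\<close>

definition Q :: "(int => nat) => nat" where "Q f = (\<Sum>i\<in>f ` pos. cnt f i * cnt f i)"

text \<open>The pair of conjugate partitions to the multiplicities of the even and of the odd letters.\<close>

definition ctype :: "(int => nat) => bool => nat => nat" where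
  "ctype f c j = card {i \<in> f ` pos. odd i = c \<and> j < cnt f i}"

text \<open>A word with the conjugate content: the occurrences of each letter are numbered from \<open>0\<close>, and
  the parity of the letter is kept.\<close>

definition hc :: "(int => nat) => int => nat" where
  "hc b v = 2 * card {u \<in> {u \<in> pos. b u = b v}. u < v} + (if odd (b v) then 1 else 0)"

lemma hc_odd [simp]: "even (hc b v) \<longleftrightarrow> even (b v)" and hc_div [simp]: "hc b v div 2 = card {u \<in> {u \<in> pos. b u = b v}. u < v}"
  by (simp_all add: hc_def)

lemma image_pos_cnt: "cnt f = cnt f' ==> f ` pos = f' ` pos"
  using cnt_pos_iff[of f] cnt_pos_iff[of f'] by (metis subsetI subset_antisym)

lemma Q_cnt: "cnt f = cnt f' ==> Q f = Q f'"
  using image_pos_cnt[of f f'] by (simp add: Q_def)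

lemma hc_rank: "i \<in> b ` pos ==> bij_betw (%v. hc b v div 2) {v \<in> pos. b v = i} {..<cnt b i}"
proof -
  have "bij_betw (%v. card {u \<in> {u \<in> pos. b u = i}. u < v}) {u \<in> pos. b u = i} {..<card {u \<in> pos. b u = i}}"
    by (rule rank_bij) (rule finite_pos_Collect)
  moreover have "hc b v div 2 = card {u \<in> {u \<in> pos. b u = i}. u < v}" if "v \<in> {v \<in> pos. b v = i}" for v
    using that by simp
  then have "bij_betw (%v. hc b v div 2) {v \<in> pos. b v = i} {..<card {u \<in> pos. b u = i}} =
      bij_betw (%v. card {u \<in> {u \<in> pos. b u = i}. u < v}) {v \<in> pos. b v = i} {..<card {u \<in> pos. b u = i}}"
    by (rule bij_betw_cong)
  ultimately show ?thesis unfolding cnt_def by blast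
qed

lemma hc_transversal: "transversal b (hc b)"
  unfolding transversal_def
proof
  show "inj_on (%v. (b v, hc b v)) pos"
  proof (rule inj_onI)
    fix u v assume uv: "u \<in> pos" "v \<in> pos" "(b u, hc b u) = (b v, hc b v)"
    have "inj_on (%v. hc b v div 2) {w \<in> pos. b w = b v}" using hc_rank[of "b v" b] uv by (auto simp: bij_betw_def simp del: atLeastAtMost_iff)
    then show "u = v" by (rule inj_onD) (use uv in auto)
  qed
qed simp

text \<open>The rows meeting a column of the \<open>0\<close>-\<open>1\<close>-matrix given by a pair of words.\<close>

definition rows :: "(int => nat) => (int => nat) => nat => nat set" where
  "rows f h a = f ` {v \<in> pos. h v = a}"

lemma finite_rows [simp]: "finite (rows f h a)"
  unfolding rows_def by (rule finite_imageI) (rule finite_pos_Collect)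

lemma card_rows: assumes "transversal f h" shows "card (rows f h a) = cnt h a"
proof -
  have "inj_on f {v \<in> pos. h v = a}"
    using assms unfolding transversal_def inj_on_def by blast
  then show ?thesis by (simp add: rows_def cnt_def card_image)
qed

lemma cnt_rows: assumes "transversal f h" shows "cnt f i = card {a \<in> h ` pos. i \<in> rows f h a}"
proof -
  have "inj_on h {v \<in> pos. f v = i}"
    using assms unfolding transversal_def inj_on_def by blast
  then have "cnt f i = card (h ` {v \<in> pos. f v = i})" by (simp add: cnt_def card_image)
  also have "h ` {v \<in> pos. f v = i} = {a \<in> h ` pos. i \<in> rows f h a}"
  proof (intro equalityI subsetI)
    fix a assume "a \<in> h ` {v \<in> pos. f v = i}"
    then obtain v where "v \<in> pos" "f v = i" "a = h v" by blast
    then show "a \<in> {a \<in> h ` pos. i \<in> rows f h a}" unfolding rows_def by blast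
  next
    fix a assume "a \<in> {a \<in> h ` pos. i \<in> rows f h a}"
    then have "i \<in> f ` {v \<in> pos. h v = a}" by (simp only: rows_def mem_Collect_eq)
    then obtain v where "v \<in> pos" "h v = a" "i = f v" by blast
    then show "a \<in> h ` {v \<in> pos. f v = i}" by blast
  qed
  finally show ?thesis .
qed

lemma rows_parity: assumes "transversal f h" "i \<in> rows f h a" shows "even i \<longleftrightarrow> even a"
  using assms unfolding transversal_def rows_def by blast

lemma Q_rows:
  assumes t: "transversal f h"
  shows "Q f = (\<Sum>a\<in>h ` pos. \<Sum>a'\<in>h ` pos. card (rows f h a \<inter> rows f h a'))"
proof -
  let ?L = "h ` pos" and ?R = "f ` pos"
  let ?\<delta> = "%i a. if i \<in> rows f h a then 1 else (0::nat)"
  have c: "cnt f i = (\<Sum>a\<in>?L. ?\<delta> i a)" for i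
    unfolding cnt_rows[OF t] by (simp add: sum.If_cases Int_def)
  have "Q f = (\<Sum>i\<in>?R. \<Sum>a\<in>?L. \<Sum>a'\<in>?L. ?\<delta> i a * ?\<delta> i a')" unfolding Q_def c by (simp only: sum_product)
  also have "\<dots> = (\<Sum>a\<in>?L. \<Sum>i\<in>?R. \<Sum>a'\<in>?L. ?\<delta> i a * ?\<delta> i a')" by (rule sum.swap)
  also have "\<dots> = (\<Sum>a\<in>?L. \<Sum>a'\<in>?L. \<Sum>i\<in>?R. ?\<delta> i a * ?\<delta> i a')" by (intro sum.cong HOL.refl sum.swap)
  also have "\<dots> = (\<Sum>a\<in>?L. \<Sum>a'\<in>?L. card (rows f h a \<inter> rows f h a'))"
  proof (intro sum.cong HOL.refl)
    fix a a'
    have "(\<Sum>i\<in>?R. ?\<delta> i a * ?\<delta> i a') = (\<Sum>i\<in>rows f h a \<inter> rows f h a'. 1)"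
      by (rule sum.mono_neutral_cong_right) (auto simp: rows_def simp del: atLeastAtMost_iff)
    then show "(\<Sum>i\<in>?R. ?\<delta> i a * ?\<delta> i a') = card (rows f h a \<inter> rows f h a')" by simp
  qed
  finally show ?thesis .
qed

lemma rows_inter_le:
  assumes t: "transversal f h"
  shows "card (rows f h a \<inter> rows f h a') \<le> (if even a \<longleftrightarrow> even a' then min (cnt h a) (cnt h a') else 0)"
proof (cases "even a \<longleftrightarrow> even a'")
  case True
  have "card (rows f h a \<inter> rows f h a') \<le> card (rows f h a)" "card (rows f h a \<inter> rows f h a') \<le> card (rows f h a')"
    by (auto intro: card_mono)
  then show ?thesis using True card_rows[OF t] by simp
next
  case False
  have "rows f h a \<inter> rows f h a' = {}" using rows_parity[OF t] False by blast
  then show ?thesis using False by simp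
qed

lemma rows_hc: "rows b (hc b) (2 * j + (if c then 1 else 0)) = {i \<in> b ` pos. odd i = c \<and> j < cnt b i}"
proof (intro equalityI subsetI)
  fix i assume "i \<in> rows b (hc b) (2 * j + (if c then 1 else 0))"
  then obtain v where v: "v \<in> pos" "hc b v = 2 * j + (if c then 1 else 0)" "i = b v"
    by (auto simp: rows_def simp del: atLeastAtMost_iff)
  have d: "hc b v div 2 = j" "odd (hc b v) = c" unfolding v(2) by simp_all
  have "hc b v div 2 \<in> {..<cnt b i}" using bij_betwE[OF hc_rank[of i b]] v by blast
  then have "j < cnt b i" "odd i = c" using d v(3) hc_odd[of b v] by (simp_all only: lessThan_iff d)
  then show "i \<in> {i \<in> b ` pos. odd i = c \<and> j < cnt b i}" using v by blast
next
  fix i assume i: "i \<in> {i \<in> b ` pos. odd i = c \<and> j < cnt b i}"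
  then have "j \<in> (%v. hc b v div 2) ` {v \<in> pos. b v = i}" using hc_rank[of i b] by (auto simp: bij_betw_def)
  then obtain v where v: "v \<in> pos" "b v = i" "j = hc b v div 2" by blast
  have "k = 2 * (k div 2) + (if odd k then 1 else 0)" for k :: nat by (cases "odd k") simp_all
  from this[of "hc b v"] have "hc b v = 2 * j + (if c then 1 else 0)" unfolding v(3) using hc_odd[of b v] v(2) i by auto
  then show "i \<in> rows b (hc b) (2 * j + (if c then 1 else 0))" using v unfolding rows_def by blast
qed

lemma cnt_hc: "cnt (hc b) (2 * j + (if c then 1 else 0)) = ctype b c j"
  unfolding card_rows[OF hc_transversal, symmetric] rows_hc ctype_def ..

lemma letter_split: "\<exists>j c. (k::nat) = 2 * j + (if c then 1 else 0) \<and> odd k = c"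
proof -
  have "k = 2 * (k div 2) + (if odd k then 1 else 0)" by (cases "odd k") simp_all
  then show ?thesis by blast
qed

lemma Q_hc:
  "Q b = (\<Sum>a\<in>hc b ` pos. \<Sum>a'\<in>hc b ` pos. if even a \<longleftrightarrow> even a' then min (cnt (hc b) a) (cnt (hc b) a') else 0)"
  unfolding Q_rows[OF hc_transversal]
proof (intro sum.cong HOL.refl)
  fix a a' :: nat
  obtain j c where a: "a = 2 * j + (if c then 1 else 0)" "odd a = c" using letter_split by blast
  obtain j' c' where a': "a' = 2 * j' + (if c' then 1 else 0)" "odd a' = c'" using letter_split by blast
  show "card (rows b (hc b) a \<inter> rows b (hc b) a') = (if even a \<longleftrightarrow> even a' then min (cnt (hc b) a) (cnt (hc b) a') else 0)"
  proof (cases "c = c'")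
    case False
    then have "rows b (hc b) a \<inter> rows b (hc b) a' = {}" unfolding a(1) a'(1) rows_hc by blast
    then show ?thesis using False a(2) a'(2) by auto
  next
    case True
    have "rows b (hc b) a \<subseteq> rows b (hc b) a' \<or> rows b (hc b) a' \<subseteq> rows b (hc b) a"
      unfolding a(1) a'(1) rows_hc True by (cases "j \<le> j'") auto
    then have "card (rows b (hc b) a \<inter> rows b (hc b) a') = min (card (rows b (hc b) a)) (card (rows b (hc b) a'))"
      by (metis Int_absorb1 Int_absorb2 card_mono finite_rows min.absorb1 min.absorb2)
    then show ?thesis using True a(2) a'(2) card_rows[OF hc_transversal] by auto
  qed
qed

text \<open>The number of pairs of positions in a common row is the sum over pairs of columns of the number of rows that
  they share; it is largest when the columns are nested, and then the rows are determined by the columns.\<close>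

lemma transversal_Q:
  assumes t: "transversal f h" and h: "cnt h = cnt (hc b)"
  shows "Q f \<le> Q b"
    and "Q f = Q b ==> ctype f = ctype b"
    and "Q f = Q b ==> i \<in> f ` pos ==> i \<in> rows f h a \<longleftrightarrow> (even i \<longleftrightarrow> even a) \<and> a div 2 < cnt f i"
proof -
  let ?L = "hc b ` pos"
  let ?mn = "%a a'. if even a \<longleftrightarrow> even a' then min (cnt h a) (cnt h a') else 0"
  have L: "h ` pos = ?L" using image_pos_cnt[OF h] .
  have Qf: "Q f = (\<Sum>a\<in>?L. \<Sum>a'\<in>?L. card (rows f h a \<inter> rows f h a'))" unfolding Q_rows[OF t] L ..
  have Qb: "Q b = (\<Sum>a\<in>?L. \<Sum>a'\<in>?L. ?mn a a')" unfolding Q_hc h ..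
  show le: "Q f \<le> Q b" unfolding Qf Qb by (intro sum_mono rows_inter_le[OF t])
  assume eq: "Q f = Q b"
  have "card (rows f h a \<inter> rows f h a') = ?mn a a'" if a: "a \<in> ?L" "a' \<in> ?L" for a a'
  proof -
    have "(\<Sum>a'\<in>?L. card (rows f h x \<inter> rows f h a')) = (\<Sum>a'\<in>?L. ?mn x a')" if x: "x \<in> ?L" for x
    proof (rule ccontr)
      assume ne: "\<not> ?thesis"
      have "Q f < Q b" unfolding Qf Qb
      proof (rule sum_strict_mono_ex1)
        show "\<forall>y\<in>?L. (\<Sum>a'\<in>?L. card (rows f h y \<inter> rows f h a')) \<le> (\<Sum>a'\<in>?L. ?mn y a')"
          by (intro ballI sum_mono rows_inter_le[OF t])
        show "\<exists>y\<in>?L. (\<Sum>a'\<in>?L. card (rows f h y \<inter> rows f h a')) < (\<Sum>a'\<in>?L. ?mn y a')"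
          using ne x by (intro bexI[of _ x] le_neq_trans sum_mono rows_inter_le[OF t])
      qed simp
      then show False using eq by simp
    qed
    from this[OF a(1)] show ?thesis
      using sum_mono_inv[of "%a'. card (rows f h a \<inter> rows f h a')" ?L "%a'. ?mn a a'" a'] a(2) rows_inter_le[OF t]
      by simp
  qed
  note inter = this
  have nest: "rows f h a' \<subseteq> rows f h a" if "a \<in> ?L" "a' \<in> ?L" "even a \<longleftrightarrow> even a'" "cnt h a' \<le> cnt h a" for a a'
  proof -
    have "card (rows f h a \<inter> rows f h a') = card (rows f h a')" using inter[OF that(1,2)] that card_rows[OF t] by simp
    then have "rows f h a \<inter> rows f h a' = rows f h a'" by (intro card_subset_eq) auto
    then show ?thesis by blast
  qed
  have dec: "ctype b c j' \<le> ctype b c j" if "j \<le> j'" for c j j'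
    unfolding ctype_def using that by (intro card_mono) auto
  have down: "i \<in> rows f h (2 * j + (if c then 1 else 0))"
    if "i \<in> rows f h (2 * j' + (if c then 1 else 0))" "j \<le> j'" for i j j' c
  proof -
    let ?a = "2 * j + (if c then 1 else 0)" and ?a' = "2 * j' + (if c then 1 else 0)"
    have le: "cnt h ?a' \<le> cnt h ?a" unfolding h cnt_hc using dec that by blast
    have p: "0 < cnt h ?a'" using that(1) card_rows[OF t, of ?a'] by (metis card_gt_0_iff empty_iff finite_rows)
    then have "?a \<in> ?L" "?a' \<in> ?L" using le cnt_pos_iff[of h] L by (metis less_le_trans, metis)
    then show ?thesis using nest[of ?a ?a'] le that(1) by auto
  qed
  have mem: "i \<in> rows f h (2 * j + (if c then 1 else 0)) \<longleftrightarrow> odd i = c \<and> j < cnt f i" if i: "i \<in> f ` pos" for i j c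
  proof (cases "odd i = c")
    case False
    then show ?thesis using rows_parity[OF t, of i "2 * j + (if c then 1 else 0)"] by auto
  next
    case True
    let ?J = "{j. i \<in> rows f h (2 * j + (if c then 1 else 0))}"
    have inj: "inj (%j. 2 * j + (if c then 1 else (0::nat)))" by (auto simp: inj_def)
    have "(%j. 2 * j + (if c then 1 else 0)) ` ?J = {a \<in> h ` pos. i \<in> rows f h a}"
    proof (intro equalityI subsetI)
      fix a assume "a \<in> (%j. 2 * j + (if c then 1 else 0)) ` ?J"
      then have "i \<in> rows f h a" by blast
      then show "a \<in> {a \<in> h ` pos. i \<in> rows f h a}" unfolding rows_def by blast
    next
      fix a assume a: "a \<in> {a \<in> h ` pos. i \<in> rows f h a}"
      then have "odd a = c" using rows_parity[OF t, of i a] True by auto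
      then have e: "2 * (a div 2) + (if c then 1 else 0) = a" by (cases c) auto
      have "a div 2 \<in> ?J" unfolding mem_Collect_eq e using a by blast
      then show "a \<in> (%j. 2 * j + (if c then 1 else 0)) ` ?J"
        by (rule image_eqI[of _ _ "a div 2", rotated]) (rule e[symmetric])
    qed
    then have img: "card ?J = cnt f i" using card_image[OF inj_on_subset[OF inj, of ?J]] cnt_rows[OF t, of i] by simp
    have cp: "cnt f i > 0" using i cnt_pos_iff[of f] by blast
    then have fJ: "finite ?J" using img card_gt_0_iff by metis
    have dc: "j \<in> ?J" if "j' \<in> ?J" "j \<le> j'" for j j' using down that by blast
    have "j \<in> ?J \<longleftrightarrow> j < card ?J"
    proof
      assume "j \<in> ?J"
      then have "{..j} \<subseteq> ?J" using dc by blast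
      then have "card {..j} \<le> card ?J" by (intro card_mono fJ)
      then show "j < card ?J" by simp
    next
      assume jc: "j < card ?J"
      show "j \<in> ?J"
      proof (rule ccontr)
        assume "j \<notin> ?J"
        then have "?J \<subseteq> {..<j}" using dc by (meson lessThan_iff not_less subsetI)
        then have "card ?J \<le> card {..<j}" by (intro card_mono) auto
        then show False using jc by simp
      qed
    qed
    then show ?thesis using img True by simp
  qed
  have "ctype f c j = ctype b c j" for c j
  proof -
    have "{i \<in> f ` pos. odd i = c \<and> j < cnt f i} = rows f h (2 * j + (if c then 1 else 0))"
      using mem unfolding rows_def by blast
    then show ?thesis using card_rows[OF t, of "2 * j + (if c then 1 else 0)"] cnt_hc[of b j c] h
      by (simp add: ctype_def)
  qed
  then show "ctype f = ctype b" by (simp add: fun_eq_iff)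
  show "i \<in> rows f h a \<longleftrightarrow> (even i \<longleftrightarrow> even a) \<and> a div 2 < cnt f i" if "i \<in> f ` pos"
  proof -
    obtain j c where a: "a = 2 * j + (if c then 1 else 0)" "odd a = c" using letter_split by blast
    have "a div 2 = j" using a(1) by simp
    then show ?thesis using mem[OF that, of j c] a by auto
  qed
qed

section \<open>Unitriangularity of the pairing\<close>

lemma transversal_act:
  assumes g: "g \<in> carrier G" and t: "transversal f h"
  shows "transversal (restrict (%v. f \<bar>act g v\<bar>) pos) (restrict (%v. h \<bar>act g v\<bar>) pos)"
  unfolding transversal_def
proof
  have inj: "inj_on (%v. (f v, h v)) pos" using t by (simp add: transversal_def)
  show "inj_on (%v. (restrict (%v. f \<bar>act g v\<bar>) pos v, restrict (%v. h \<bar>act g v\<bar>) pos v)) pos"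
  proof (rule inj_onI)
    fix u v assume uv: "u \<in> pos" "v \<in> pos"
      "(restrict (%v. f \<bar>act g v\<bar>) pos u, restrict (%v. h \<bar>act g v\<bar>) pos u) =
       (restrict (%v. f \<bar>act g v\<bar>) pos v, restrict (%v. h \<bar>act g v\<bar>) pos v)"
    then have "(f \<bar>act g u\<bar>, h \<bar>act g u\<bar>) = (f \<bar>act g v\<bar>, h \<bar>act g v\<bar>)" by simp
    then have "\<bar>act g u\<bar> = \<bar>act g v\<bar>"
      using inj_onD[OF inj] act_pos_abs[OF g uv(1)] act_pos_abs[OF g uv(2)] by blast
    then show "u = v" using act_abs_eq_iff[OF g] uv by auto
  qed
  show "\<forall>v\<in>pos. even (restrict (%v. f \<bar>act g v\<bar>) pos v) = even (restrict (%v. h \<bar>act g v\<bar>) pos v)"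
    using t act_pos_abs[OF g] by (simp add: transversal_def del: atLeastAtMost_iff)
qed

lemma transversal_same_conj:
  assumes t: "transversal f h" and t': "transversal f' h'"
    and im: "(%v. (f v, h v)) ` pos = (%v. (f' v, h' v)) ` pos"
  obtains g where "g \<in> carrier G" "\<And>v. v \<in> pos ==> f v = f' \<bar>act g v\<bar>" "\<And>v. v \<in> pos ==> h v = h' \<bar>act g v\<bar>"
proof -
  have inj: "inj_on (%v. (f v, h v)) pos" and inj': "inj_on (%v. (f' v, h' v)) pos"
    using t t' by (auto simp: transversal_def)
  define \<pi> where "\<pi> v = inv_into pos (%v. (f' v, h' v)) (f v, h v)" for v
  have p: "\<pi> v \<in> pos" "(f' (\<pi> v), h' (\<pi> v)) = (f v, h v)" if v: "v \<in> pos" for v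
  proof -
    have "(f v, h v) \<in> (%v. (f' v, h' v)) ` pos" unfolding im[symmetric] using v by blast
    then show "\<pi> v \<in> pos" "(f' (\<pi> v), h' (\<pi> v)) = (f v, h v)"
      unfolding \<pi>_def by (rule inv_into_into, rule f_inv_into_f)
  qed
  have ab: "\<bar>\<pi> v\<bar> = \<pi> v" if "v \<in> pos" for v using p(1)[OF that] by auto
  obtain g where g: "g \<in> carrier G" "\<And>v. v \<in> pos ==> act g v = \<pi> v"
  proof (rule act_extend[of \<pi>])
    show "\<bar>\<pi> i\<bar> \<in> pos" if "i \<in> pos" for i using p(1)[OF that] ab[OF that] by simp
    show "inj_on (%i. \<bar>\<pi> i\<bar>) pos"
    proof (rule inj_onI)
      fix u v assume uv: "u \<in> pos" "v \<in> pos" "\<bar>\<pi> u\<bar> = \<bar>\<pi> v\<bar>"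
      then have "(f u, h u) = (f v, h v)" using p(2)[OF uv(1)] p(2)[OF uv(2)] ab by simp
      then show "u = v" using inj_onD[OF inj] uv by blast
    qed
  qed blast
  have "\<bar>act g v\<bar> = \<pi> v" if "v \<in> pos" for v unfolding g(2)[OF that] by (rule ab[OF that])
  then show thesis using that[OF g(1)] p(2) by simp
qed

definition tpairs :: "(int => nat) => (int => nat) => ((int => nat) \<times> (int => nat)) set" where
  "tpairs f b = {(F, h). F \<in> rcl f \<and> h \<in> rcl (hc b) \<and> transversal F h}"

text \<open>By \<open>transversal_Q\<close>, such a pair has the same rows as \<open>(b, hc b)\<close>, so that the two matrices
  have their ones at the same places, and the pairs differ by a permutation of the positions. The
  stabilizer is \<open>signs\<close>.\<close>

lemma tpairs_orbit:
  "tpairs b b = (%g. (restrict (%v. b \<bar>act g v\<bar>) pos, restrict (%v. hc b \<bar>act g v\<bar>) pos)) ` carrier G" (is "_ = ?o ` _")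
proof (intro equalityI subsetI)
  fix p assume "p \<in> ?o ` carrier G"
  then obtain g where "g \<in> carrier G" "p = ?o g" by blast
  then show "p \<in> tpairs b b"
    using rcl_act[of g b] rcl_act[of g "hc b"] transversal_act[OF _ hc_transversal] by (simp add: tpairs_def)
next
  fix p assume "p \<in> tpairs b b"
  then obtain F h where p: "p = (F, h)" "F \<in> rcl b" "h \<in> rcl (hc b)" "transversal F h" by (auto simp: tpairs_def)
  have cF: "cnt F = cnt b" and ch: "cnt h = cnt (hc b)" using p by (auto simp: rcl_def)
  have imF: "F ` pos = b ` pos" by (rule image_pos_cnt[OF cF])
  have QF: "Q F = Q b" by (rule Q_cnt[OF cF])
  have r: "i \<in> rows F h a \<longleftrightarrow> i \<in> rows b (hc b) a" for i a
  proof (cases "i \<in> b ` pos")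
    case True
    show ?thesis
      using transversal_Q(3)[OF p(4) ch QF, of i a] transversal_Q(3)[OF hc_transversal HOL.refl HOL.refl, of i b a] True
      unfolding imF cF by simp
  next
    case False then show ?thesis using imF unfolding rows_def by blast
  qed
  have e: "(i, a) \<in> (%v. (F v, h v)) ` pos \<longleftrightarrow> (i, a) \<in> (%v. (b v, hc b v)) ` pos" for i a
  proof -
    have "(i, a) \<in> (%v. (f v, h v)) ` pos \<longleftrightarrow> i \<in> rows f h a" for f h :: "int => nat"
      unfolding rows_def image_iff Bex_def mem_Collect_eq prod.inject by blast
    then show ?thesis using r[of i a] by simp
  qed
  have im: "(%v. (F v, h v)) ` pos = (%v. (b v, hc b v)) ` pos"
  proof (rule Set.set_eqI)
    fix p :: "nat \<times> nat"
    show "p \<in> (%v. (F v, h v)) ` pos \<longleftrightarrow> p \<in> (%v. (b v, hc b v)) ` pos"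
      using e[of "fst p" "snd p"] unfolding prod.collapse .
  qed
  obtain g where g: "g \<in> carrier G" "\<And>v. v \<in> pos ==> F v = b \<bar>act g v\<bar>" "\<And>v. v \<in> pos ==> h v = hc b \<bar>act g v\<bar>"
    using transversal_same_conj[OF p(4) hc_transversal im] by blast
  have "F = restrict (%v. b \<bar>act g v\<bar>) pos" "h = restrict (%v. hc b \<bar>act g v\<bar>) pos"
    using g(2,3) p(2,3) by (auto simp: rcl_def intro!: extensionalityI[of _ pos])
  then show "p \<in> ?o ` carrier G" using g(1) p(1) by blast
qed

lemma finite_tpairs: "finite (tpairs f b)"
  by (rule finite_subset[of _ "rcl f \<times> rcl (hc b)"]) (auto simp: tpairs_def finite_rcl)

lemma card_tpairs: "2 ^ n * card (tpairs b b) = card (carrier G)"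
proof -
  let ?o = "%g. (restrict (%v. b \<bar>act g v\<bar>) pos, restrict (%v. hc b \<bar>act g v\<bar>) pos)"
  have inj: "inj_on (%v. (b v, hc b v)) pos" using hc_transversal by (simp add: transversal_def)
  have "card (carrier G) = (\<Sum>p\<in>tpairs b b. card {g \<in> carrier G. ?o g = p})"
    by (rule sum_card_image_fibres[OF finite_carrier finite_tpairs]) (simp add: tpairs_orbit)
  also have "\<dots> = (\<Sum>p\<in>tpairs b b. 2 ^ n)"
  proof (rule sum.cong[OF HOL.refl])
    fix p assume "p \<in> tpairs b b"
    then obtain g0 where g0: "g0 \<in> carrier G" "p = ?o g0" unfolding tpairs_orbit by blast
    have eq: "?o g = ?o g0 \<longleftrightarrow> inv g0 \<otimes> g \<in> signs" if g: "g \<in> carrier G" for g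
    proof -
      have "?o g = ?o g0 \<longleftrightarrow> (\<forall>v\<in>pos. (b \<bar>act g v\<bar>, hc b \<bar>act g v\<bar>) = (b \<bar>act g0 v\<bar>, hc b \<bar>act g0 v\<bar>))"
        by (auto simp: fun_eq_iff restrict_def)
      also have "\<dots> \<longleftrightarrow> (\<forall>v\<in>pos. \<bar>act g v\<bar> = \<bar>act g0 v\<bar>)"
        using inj_onD[OF inj] act_pos_abs[OF g] act_pos_abs[OF g0(1)] by (intro ball_cong) (blast, metis)
      also have "\<dots> \<longleftrightarrow> (\<forall>v\<in>pos. \<bar>act (inv g0 \<otimes> g) v\<bar> = v)"
      proof (intro ball_cong HOL.refl)
        fix v assume v: "v \<in> pos"
        have "\<bar>act (inv g0 \<otimes> g) v\<bar> = v \<longleftrightarrow> \<bar>act g0 (act (inv g0 \<otimes> g) v)\<bar> = \<bar>act g0 v\<bar>"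
          using act_abs_eq_iff[OF g0(1)] v by simp
        then show "\<bar>act g v\<bar> = \<bar>act g0 v\<bar> \<longleftrightarrow> \<bar>act (inv g0 \<otimes> g) v\<bar> = v"
          using g g0 by (simp add: act_mult_apply act_inv)
      qed
      finally show ?thesis using g g0 by (simp add: signs_def)
    qed
    have "bij_betw (%g. inv g0 \<otimes> g) {g \<in> carrier G. ?o g = p} signs"
    proof (rule bij_betw_byWitness[where f' = "%e. g0 \<otimes> e"])
      have sc: "e \<in> carrier G" if "e \<in> signs" for e using that by (simp add: signs_def)
      show "\<forall>g\<in>{g \<in> carrier G. ?o g = p}. g0 \<otimes> (inv g0 \<otimes> g) = g" using g0(1) by (simp add: m_assoc[symmetric])
      show i: "\<forall>e\<in>signs. inv g0 \<otimes> (g0 \<otimes> e) = e" using g0(1) sc by (simp add: m_assoc[symmetric])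
      show "(%g. inv g0 \<otimes> g) ` {g \<in> carrier G. ?o g = p} \<subseteq> signs" using eq g0(2) by blast
      show "(%e. g0 \<otimes> e) ` signs \<subseteq> {g \<in> carrier G. ?o g = p}"
      proof (rule image_subsetI)
        fix e assume e: "e \<in> signs"
        then have c: "g0 \<otimes> e \<in> carrier G" using sc g0(1) by blast
        then have "?o (g0 \<otimes> e) = ?o g0" using eq[OF c] i e by simp
        then show "g0 \<otimes> e \<in> {g \<in> carrier G. ?o g = p}" using c g0(2) by blast
      qed
    qed
    then show "card {g \<in> carrier G. ?o g = p} = 2 ^ n" using card_signs by (simp add: bij_betw_same_card)
  qed
  finally show ?thesis by simp
qed

text \<open>Up to the order of the group, the scalar product of \<open>M (rcl f)\<close> with \<open>eps\<close> times
  \<open>M (rcl (hc b))\<close>.\<close>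

definition D :: "(int => nat) => (int => nat) => int" where
  "D f b = (\<Sum>g\<in>carrier G. M (rcl f) g * eps g * M (rcl (hc b)) g)"

lemma sum_M_pairing:
  "(\<Sum>g\<in>carrier G. M \<H> g * eps g * M \<K> g) = (\<Sum>F\<in>\<H>. \<Sum>h\<in>\<K>. pairing F h)"
proof -
  have "(\<Sum>g\<in>carrier G. M \<H> g * eps g * M \<K> g) = (\<Sum>g\<in>carrier G. \<Sum>F\<in>\<H>. \<Sum>h\<in>\<K>. m F g * eps g * m h g)"
  proof (rule sum.cong[OF HOL.refl])
    fix g show "M \<H> g * eps g * M \<K> g = (\<Sum>F\<in>\<H>. \<Sum>h\<in>\<K>. m F g * eps g * m h g)"
      unfolding M_def unfolding sum_distrib_right unfolding sum_distrib_left ..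
  qed
  also have "\<dots> = (\<Sum>F\<in>\<H>. \<Sum>g\<in>carrier G. \<Sum>h\<in>\<K>. m F g * eps g * m h g)" by (rule sum.swap)
  also have "\<dots> = (\<Sum>F\<in>\<H>. \<Sum>h\<in>\<K>. pairing F h)" unfolding pairing_def by (intro sum.cong HOL.refl sum.swap)
  finally show ?thesis .
qed

lemma D_eq: "D f b = 2 ^ n * int (card (tpairs f b))"
proof -
  have "D f b = (\<Sum>(F, h)\<in>rcl f \<times> rcl (hc b). if transversal F h then 2 ^ n else 0)"
    unfolding D_def sum_M_pairing pairing_eq by (simp add: sum.cartesian_product)
  also have "\<dots> = (\<Sum>p\<in>tpairs f b. 2 ^ n)"
    by (rule sum.mono_neutral_cong_right) (auto simp: tpairs_def finite_rcl split: if_splits)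
  finally show ?thesis by simp
qed

lemma D_self: "D b b = int (card (carrier G))"
  unfolding D_eq using card_tpairs[of b] by (metis of_nat_mult of_nat_numeral of_nat_power)

lemma D_nonzero:
  assumes "D f b ~= 0" shows "Q f \<le> Q b" "Q f = Q b ==> ctype f = ctype b"
proof -
  have "tpairs f b ~= {}" using assms unfolding D_eq by auto
  then obtain F h where p: "cnt F = cnt f" "cnt h = cnt (hc b)" "transversal F h" by (auto simp: tpairs_def rcl_def)
  have "Q F = Q f" "ctype F = ctype f"
    using Q_cnt[OF p(1)] image_pos_cnt[OF p(1)] p(1) by (simp_all add: ctype_def fun_eq_iff)
  then show "Q f \<le> Q b" "Q f = Q b ==> ctype f = ctype b"
    using transversal_Q(1,2)[OF p(3,2)] by simp_all
qed

text \<open>The numbers of letters with given parity and multiplicity are differences of the values of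
  \<open>ctype\<close>.\<close>

lemma ctype_bij:
  assumes "ctype f = ctype f'"
  obtains \<rho> where "bij_betw \<rho> (f ` pos) (f' ` pos)" "\<And>i. i \<in> f ` pos ==> even (\<rho> i) \<longleftrightarrow> even i"
    "\<And>i. i \<in> f ` pos ==> cnt f' (\<rho> i) = cnt f i"
proof -
  have c: "card {i \<in> f ` pos. (odd i, cnt f i) = k} = (if snd k = 0 then 0 else ctype f (fst k) (snd k - 1) - ctype f (fst k) (snd k))" for f k
  proof (cases "snd k = 0")
    case True
    have "{i \<in> f ` pos. (odd i, cnt f i) = k} = {}" using cnt_pos_iff[of f] True by (metis (mono_tags, lifting) Collect_empty_eq less_irrefl snd_conv)
    then show ?thesis using True by simp
  next
    case False
    let ?A = "%j. {i \<in> f ` pos. odd i = fst k \<and> j < cnt f i}"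
    have "{i \<in> f ` pos. (odd i, cnt f i) = k} = ?A (snd k - 1) - ?A (snd k)" using False by (cases k) auto
    moreover have "?A (snd k) \<subseteq> ?A (snd k - 1)" by auto
    moreover have "finite (?A (snd k))" by simp
    ultimately show ?thesis using False by (simp add: card_Diff_subset ctype_def)
  qed
  have "card {i \<in> f ` pos. (odd i, cnt f i) = k} = card {i \<in> f' ` pos. (odd i, cnt f' i) = k}" for k
    unfolding c assms ..
  then obtain \<rho> where "bij_betw \<rho> (f ` pos) (f' ` pos)" "\<And>i. i \<in> f ` pos ==> (odd (\<rho> i), cnt f' (\<rho> i)) = (odd i, cnt f i)"
    by (rule label_preserving_bij[of "f ` pos" "f' ` pos" "%i. (odd i, cnt f i)" "%i. (odd i, cnt f' i)", rotated 2]) auto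
  then show thesis using that by simp
qed

lemma cnt_relabel:
  assumes r: "bij_betw \<rho> (f ` pos) (f' ` pos)" "\<And>i. i \<in> f ` pos ==> cnt f' (\<rho> i) = cnt f i" and F: "cnt F = cnt f"
  shows "cnt (%v. \<rho> (F v)) = cnt f'"
proof
  fix j
  have im: "F ` pos = f ` pos" by (rule image_pos_cnt[OF F])
  show "cnt (%v. \<rho> (F v)) j = cnt f' j"
  proof (cases "j \<in> f' ` pos")
    case True
    then obtain i where i: "i \<in> f ` pos" "j = \<rho> i" using r(1) unfolding bij_betw_def by blast
    have "\<rho> (F v) = \<rho> i \<longleftrightarrow> F v = i" if "v \<in> pos" for v
      using r(1) i(1) im that unfolding bij_betw_def inj_on_def by blast
    then have "{v \<in> pos. \<rho> (F v) = j} = {v \<in> pos. F v = i}" unfolding i(2) by blast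
    then have "cnt (%v. \<rho> (F v)) j = cnt F i" unfolding cnt_def by simp
    then show ?thesis using r(2)[OF i(1)] i(2) F by simp
  next
    case False
    then have "cnt f' j = 0" using cnt_pos_iff[of f' j] by simp
    moreover have "j \<notin> (%v. \<rho> (F v)) ` pos" using False im r(1) unfolding bij_betw_def by blast
    then have "cnt (%v. \<rho> (F v)) j = 0" using cnt_pos_iff[of "%v. \<rho> (F v)" j] by simp
    ultimately show ?thesis by simp
  qed
qed

lemma M_ctype:
  assumes "ctype f = ctype f'" and g: "g \<in> carrier G" shows "M (rcl f) g = M (rcl f') g"
proof -
  obtain \<rho> where r: "bij_betw \<rho> (f ` pos) (f' ` pos)" "\<And>i. i \<in> f ` pos ==> even (\<rho> i) \<longleftrightarrow> even i"
    "\<And>i. i \<in> f ` pos ==> cnt f' (\<rho> i) = cnt f i" using ctype_bij[OF assms(1)] by blast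
  let ?\<rho>' = "inv_into (f ` pos) \<rho>"
  have r': "bij_betw ?\<rho>' (f' ` pos) (f ` pos)" by (rule bij_betw_inv_into[OF r(1)])
  have inv: "?\<rho>' (\<rho> i) = i" if "i \<in> f ` pos" for i using bij_betw_inv_into_left[OF r(1) that] .
  have inv': "\<rho> (?\<rho>' i) = i" if "i \<in> f' ` pos" for i using bij_betw_inv_into_right[OF r(1) that] .
  have c': "cnt f (?\<rho>' i) = cnt f' i" if i: "i \<in> f' ` pos" for i
  proof -
    have "?\<rho>' i \<in> f ` pos" using r' i by (auto simp: bij_betw_def)
    then show ?thesis using r(3)[of "?\<rho>' i"] inv'[OF i] by simp
  qed
  show ?thesis unfolding M_def
  proof (rule sum.reindex_bij_witness[of _ "%F. restrict (%v. ?\<rho>' (F v)) pos" "%F. restrict (%v. \<rho> (F v)) pos"])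
    fix F assume F: "F \<in> rcl f"
    have vF: "F v \<in> f ` pos" if "v \<in> pos" for v using rcl_values[OF F] that by blast
    show "restrict (%v. ?\<rho>' (restrict (%v. \<rho> (F v)) pos v)) pos = F"
    proof (rule extensionalityI[of _ pos])
      show "F \<in> extensional pos" using F by (simp add: rcl_def)
    qed (use vF inv in \<open>simp_all del: atLeastAtMost_iff\<close>)
    show "restrict (%v. \<rho> (F v)) pos \<in> rcl f'"
      using cnt_relabel[OF r(1,3)] F by (simp add: rcl_def)
    have 1: "(\<forall>v\<in>pos. \<rho> (F \<bar>act g v\<bar>) = \<rho> (F v)) \<longleftrightarrow> (\<forall>v\<in>pos. F \<bar>act g v\<bar> = F v)"
    proof (intro ball_cong HOL.refl)
      fix v assume v: "v \<in> pos"
      show "\<rho> (F \<bar>act g v\<bar>) = \<rho> (F v) \<longleftrightarrow> F \<bar>act g v\<bar> = F v"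
        using inj_onD[OF bij_betw_imp_inj_on[OF r(1)]] vF[OF v] vF[OF act_pos_abs[OF g v]] by metis
    qed
    have 2: "(\<Prod>v\<in>pos. if even (\<rho> (F v)) then sgn (act g v) else 1) = (\<Prod>v\<in>pos. if even (F v) then sgn (act g v) else 1)"
      by (rule prod.cong[OF HOL.refl]) (simp only: r(2)[OF vF])
    have "m (%v. \<rho> (F v)) g = m F g" unfolding m_def 1 2 ..
    moreover have "m (restrict (%v. \<rho> (F v)) pos) g = m (%v. \<rho> (F v)) g"
      by (rule m_cong[OF g]) (rule restrict_apply')
    ultimately show "m (restrict (%v. \<rho> (F v)) pos) g = m F g" by simp
  next
    fix F assume F: "F \<in> rcl f'"
    have vF: "F v \<in> f' ` pos" if "v \<in> pos" for v using rcl_values[OF F] that by blast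
    show "restrict (%v. \<rho> (restrict (%v. ?\<rho>' (F v)) pos v)) pos = F"
    proof (rule extensionalityI[of _ pos])
      show "F \<in> extensional pos" using F by (simp add: rcl_def)
    qed (use vF inv' in \<open>simp_all del: atLeastAtMost_iff\<close>)
    show "restrict (%v. ?\<rho>' (F v)) pos \<in> rcl f"
      using cnt_relabel[OF r' c'] F by (simp add: rcl_def)
  qed
qed

lemma D_ctype: "ctype f = ctype b ==> D f b = int (card (carrier G))"
  using M_ctype[of f b] D_self[of b] by (simp add: D_def)

section \<open>Conjugate generating sets\<close>

lemma mono_word_interval:
  assumes b: "mono_word b" and i: "1 \<le> i" "i \<le> j" "j \<le> k" "k \<le> int n" and e: "b i = b k"
  shows "b j = b i"
proof -
  have "b i \<le> b j" "b j \<le> b k" using b i by (auto simp: mono_word_def)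
  then show ?thesis using e by simp
qed

text \<open>If two monotone words have the same type, the permutation that moves the blocks of one onto those of the
  other, increasingly on each block, conjugates the generators.\<close>

lemma ctype_conj:
  assumes b: "mono_word b" and b': "mono_word b'" and t: "ctype b = ctype b'"
  shows "\<exists>w\<in>carrier G. gens b' \<subseteq> (%r. inv w \<otimes> r \<otimes> w) ` gens b"
proof -
  obtain \<rho> where r: "bij_betw \<rho> (b ` pos) (b' ` pos)" "\<And>i. i \<in> b ` pos ==> even (\<rho> i) \<longleftrightarrow> even i"
    "\<And>i. i \<in> b ` pos ==> cnt b' (\<rho> i) = cnt b i" using ctype_bij[OF t] by blast
  let ?F = "%v. 2 * \<rho> (b v) + 1"
  let ?w = "st ?F"
  have s: "sorts ?F ?w" by (rule st_sorts)
  have wp: "0 < act ?w i" "act ?w i \<in> pos" "\<bar>act ?w i\<bar> = act ?w i" if i: "i \<in> pos" for i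
  proof -
    show "0 < act ?w i" using s i by (simp add: sorts_def)
    then show "\<bar>act ?w i\<bar> = act ?w i" by simp
    then show "act ?w i \<in> pos" using act_pos_abs[of ?w i] i by simp
  qed
  have bw: "\<rho> (b (act ?w i)) = b' i" if i: "i \<in> pos" for i
  proof -
    have "\<rho> (b \<bar>act ?w i\<bar>) = b' i"
    proof (rule mono_cnt_unique[OF _ _ _ i])
      fix i j :: int assume ij: "1 \<le> i" "i \<le> j" "j \<le> int n"
      show "\<rho> (b \<bar>act ?w i\<bar>) \<le> \<rho> (b \<bar>act ?w j\<bar>)" using sorts_weak_mono[OF s ij] by simp
      show "b' i \<le> b' j" using b' ij by (auto simp: mono_word_def)
    next
      have "cnt (%v. \<rho> (b \<bar>act ?w v\<bar>)) = cnt (%v. \<rho> (b v))" by (rule cnt_act) simp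
      also have "\<dots> = cnt b'" by (rule cnt_relabel[OF r(1,3)]) simp_all
      finally show "cnt (%v. \<rho> (b \<bar>act ?w v\<bar>)) = cnt b'" .
    qed
    then show ?thesis using wp(3)[OF i] by simp
  qed
  have binj: "b x = b y" if "x \<in> pos" "y \<in> pos" "\<rho> (b x) = \<rho> (b y)" for x y
    using r(1) that unfolding bij_betw_def inj_on_def by blast
  have lt: "act ?w i < act ?w j" if ij: "i \<in> pos" "j \<in> pos" "i < j" "b' i = b' j" for i j
  proof -
    have "lx ?F (act ?w i) (act ?w j)" using sorts_mono[OF s] ij by auto
    then show ?thesis unfolding lx_def wp(3)[OF ij(1)] wp(3)[OF ij(2)] bw[OF ij(1)] bw[OF ij(2)] ij(4) by simp
  qed
  have step: "act ?w (i + 1) = act ?w i + 1" if i: "i \<in> pos" "i + 1 \<in> pos" "b' i = b' (i + 1)" for i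
  proof (rule ccontr)
    assume ne: "act ?w (i + 1) ~= act ?w i + 1"
    have l: "act ?w i < act ?w (i + 1)" using lt[OF i(1,2) _ i(3)] by simp
    let ?k = "act ?w i + 1"
    have k: "act ?w i < ?k" "?k < act ?w (i + 1)" using l ne by auto
    have kp: "?k \<in> pos" using wp(2)[OF i(1)] wp(2)[OF i(2)] k by auto
    have "b (act ?w i) = b (act ?w (i + 1))" using binj wp(2) i bw by metis
    then have bk: "b ?k = b (act ?w i)"
      using mono_word_interval[OF b, of "act ?w i" ?k "act ?w (i + 1)"] wp(2)[OF i(1)] wp(2)[OF i(2)] k by auto
    let ?l = "\<bar>act (inv ?w) ?k\<bar>"
    have lp: "?l \<in> pos" using act_pos_abs kp by simp
    have wl: "act ?w ?l = ?k" using act_inv_abs'[of ?w ?k] wp(3)[OF lp] kp by simp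
    have bl: "b' ?l = b' i" using bw[OF lp] bw[OF i(1)] wl bk by simp
    have "?l \<le> i \<or> i + 1 \<le> ?l" by linarith
    then show False
    proof
      assume "?l \<le> i"
      then show False using lt[OF lp i(1) _ bl] wl k by (cases "?l = i") auto
    next
      assume "i + 1 \<le> ?l"
      then show False using lt[OF i(2) lp] bl i(3) wl k by (cases "?l = i + 1") auto
    qed
  qed
  have cs: "?w \<otimes> s k = s k' \<otimes> ?w"
    if k: "1 \<le> k" "k < n" "act ?w (int k) = int k'" "act ?w (int k + 1) = int k' + 1" "1 \<le> k'" "k' < n" for k k'
  proof (rule act_ext)
    fix i assume i: "i \<in> pos"
    have inj: "act ?w i = act ?w x \<longleftrightarrow> i = x" for x by (rule act_eq_iff) simp
    have "gen k i = (if i = int k then int k + 1 else if i = int k + 1 then int k else i)"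
      using i k by (auto simp: gen_def)
    moreover have "gen k' (act ?w i) = (if act ?w i = int k' then int k' + 1 else if act ?w i = int k' + 1 then int k' else act ?w i)"
      using wp(2)[OF i] k by (auto simp: gen_def)
    moreover have "act ?w i = int k' \<longleftrightarrow> i = int k" "act ?w i = int k' + 1 \<longleftrightarrow> i = int k + 1"
      using inj[of "int k"] inj[of "int k + 1"] k(3,4) by simp_all
    ultimately show "act (?w \<otimes> s k) i = act (s k' \<otimes> ?w) i"
      using k by (simp add: act_mult_apply act_s)
  qed (use that in auto)
  have ct: "?w \<otimes> t_refl G s k = t_refl G s k' \<otimes> ?w"
    if k: "k < n" "act ?w (int k + 1) = int k' + 1" "k' < n" for k k'
  proof (rule act_ext)
    fix i assume i: "i \<in> pos"
    have inj: "act ?w i = act ?w x \<longleftrightarrow> i = x" for x by (rule act_eq_iff) simp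
    have "flip (int k + 1) i = (if i = int k + 1 then - i else i)" using i by (auto simp: flip_def)
    moreover have "flip (int k' + 1) (act ?w i) = (if act ?w i = int k' + 1 then - act ?w i else act ?w i)"
      using wp(2)[OF i] by (auto simp: flip_def)
    moreover have "act ?w i = int k' + 1 \<longleftrightarrow> i = int k + 1"
      using inj[of "int k + 1"] k(2) by simp
    ultimately show "act (?w \<otimes> t_refl G s k) i = act (t_refl G s k' \<otimes> ?w) i"
      using k act_minus[OF st_closed, of ?F "int k + 1"] by (simp add: act_mult_apply act_t_refl)
  qed (use that in auto)
  have sub: "gens b' \<subseteq> (%r. inv ?w \<otimes> r \<otimes> ?w) ` gens b"
  proof
    fix x assume "x \<in> gens b'"
    then consider (1) k where "x = s k" "1 \<le> k" "k < n" "b' (int k) = b' (int k + 1)"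
      | (2) k where "x = t_refl G s k" "k < n" "odd (b' (int k + 1))" unfolding gens_def by blast
    then obtain r where "r \<in> gens b" "?w \<otimes> x = r \<otimes> ?w"
    proof cases
      case 1
      define k' where "k' = nat (act ?w (int k))"
      have p: "int k \<in> pos" "int k + 1 \<in> pos" using 1 by auto
      have k': "int k' = act ?w (int k)" using wp(1)[OF p(1)] by (simp add: k'_def)
      have st: "act ?w (int k + 1) = int k' + 1" using step[OF p] 1 k' by simp
      have b1: "1 \<le> k'" "k' < n" using wp(2)[OF p(1)] wp(2)[OF p(2)] k' st by auto
      have "b (act ?w (int k)) = b (act ?w (int k + 1))"
        by (rule binj[OF wp(2)[OF p(1)] wp(2)[OF p(2)]]) (unfold bw[OF p(1)] bw[OF p(2)], rule 1(4))
      then have "s k' \<in> gens b" using b1 k' st by (auto simp: gens_def)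
      then show thesis using that cs[OF 1(2,3) k'[symmetric] st b1] 1(1) by blast
    next
      case 2
      define k' where "k' = nat (act ?w (int k + 1) - 1)"
      have p: "int k + 1 \<in> pos" using 2 by auto
      have k': "act ?w (int k + 1) = int k' + 1" using wp(2)[OF p] by (simp add: k'_def)
      have b1: "k' < n" using wp(2)[OF p] k' by auto
      have "odd (b (act ?w (int k + 1)))"
      proof -
        have "b (act ?w (int k + 1)) \<in> b ` pos" using wp(2)[OF p] by blast
        then show ?thesis using r(2) bw[OF p] 2(3) by metis
      qed
      then have "t_refl G s k' \<in> gens b" using b1 k' by (auto simp: gens_def)
      then show thesis using that ct[OF 2(2) k' b1] 2(1) by blast
    qed
    moreover have xc: "x \<in> carrier G" using \<open>x \<in> gens b'\<close> gens_carrier by blast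
    ultimately have "x = inv ?w \<otimes> r \<otimes> ?w" "r \<in> gens b"
      using gens_carrier[of b] by (auto simp: m_assoc inv_solve_left subset_iff)
    then show "x \<in> (%r. inv ?w \<otimes> r \<otimes> ?w) ` gens b" by blast
  qed
  then show ?thesis by (intro bexI[of _ ?w]) simp_all
qed

lemma ctype_conj_sets:
  assumes b: "mono_word b" and b': "mono_word b'" and t: "ctype b = ctype b'"
  shows "conj_sets G (gens b) (gens b')"
proof -
  obtain w where w: "w \<in> carrier G" "gens b' \<subseteq> (%r. inv w \<otimes> r \<otimes> w) ` gens b" using ctype_conj[OF b b' t] by blast
  obtain w' where w': "w' \<in> carrier G" "gens b \<subseteq> (%r. inv w' \<otimes> r \<otimes> w') ` gens b'" using ctype_conj[OF b' b t[symmetric]] by blast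
  have f: "finite (gens c)" for c by (rule finite_subset[OF gens_carrier finite_carrier])
  have "card (gens b) \<le> card (gens b')" using surj_card_le[OF f w'(2)] .
  then have "gens b' = (%r. inv w \<otimes> r \<otimes> w) ` gens b"
    using w(2) f[of b] by (intro card_seteq) (auto intro: card_image_le order_trans)
  then show ?thesis unfolding conj_sets_def using w(1) by (intro bexI[of _ "inv w"]) auto
qed

lemma conj_sets_induced:
  assumes I: "I \<subseteq> carrier G" and c: "conj_sets G I I'"
  shows "induced G (generate G I') (%_. 1) = induced G (generate G I) (%_. 1)"
proof -
  obtain w where w: "w \<in> carrier G" "I' = (%r. w \<otimes> r \<otimes> inv w) ` I" using c by (auto simp: conj_sets_def)
  let ?c = "%r. w \<otimes> r \<otimes> inv w"
  have hom: "?c (x \<otimes> y) = ?c x \<otimes> ?c y" if "x \<in> carrier G" "y \<in> carrier G" for x y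
  proof -
    have "?c x \<otimes> ?c y = w \<otimes> x \<otimes> (inv w \<otimes> w) \<otimes> y \<otimes> inv w" using w(1) that by (simp only: m_assoc m_closed inv_closed)
    then show ?thesis using w(1) that by (simp add: m_assoc)
  qed
  interpret h: group_hom G G ?c
    by unfold_locales (use w hom in \<open>auto simp: hom_def\<close>)
  have gen: "generate G I' = ?c ` generate G I" unfolding w(2) using h.generate_img[OF I] by simp
  have gc: "generate G I \<subseteq> carrier G" by (rule generate_incl[OF I])
  have cinj: "inj_on ?c (carrier G)" using w(1) by (auto simp: inj_on_def)
  have cd: "card (generate G I') = card (generate G I)" unfolding gen by (rule card_image[OF inj_on_subset[OF cinj gc]])
  show ?thesis
  proof
    fix g
    show "induced G (generate G I') (%_. 1) g = induced G (generate G I) (%_. 1) g"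
    proof (cases "g \<in> carrier G")
      case True
      have mem: "inv x \<otimes> g \<otimes> x \<in> generate G I' \<longleftrightarrow> inv (x \<otimes> w) \<otimes> g \<otimes> (x \<otimes> w) \<in> generate G I" if x: "x \<in> carrier G" for x
      proof -
        let ?y = "inv (x \<otimes> w) \<otimes> g \<otimes> (x \<otimes> w)"
        have yc: "?y \<in> carrier G" using x w True by simp
        have cancel: "w \<otimes> (inv w \<otimes> z) = z" "inv w \<otimes> (w \<otimes> z) = z" if "z \<in> carrier G" for z
          using w(1) that by (simp_all add: m_assoc[symmetric])
        have e: "?c ?y = inv x \<otimes> g \<otimes> x" using x w(1) True by (simp add: inv_mult_group m_assoc cancel)
        show ?thesis unfolding gen e[symmetric] using yc gc cinj by (meson image_eqI inj_on_image_mem_iff)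
      qed
      have "card {x \<in> carrier G. inv x \<otimes> g \<otimes> x \<in> generate G I'} = card {x \<in> carrier G. inv x \<otimes> g \<otimes> x \<in> generate G I}"
      proof (rule bij_betw_same_card[of "%x. x \<otimes> w"], rule bij_betw_byWitness[where f' = "%x. x \<otimes> inv w"])
        show "(%x. x \<otimes> w) ` {x \<in> carrier G. inv x \<otimes> g \<otimes> x \<in> generate G I'} \<subseteq> {x \<in> carrier G. inv x \<otimes> g \<otimes> x \<in> generate G I}"
          using mem w(1) by auto
        show "(%x. x \<otimes> inv w) ` {x \<in> carrier G. inv x \<otimes> g \<otimes> x \<in> generate G I} \<subseteq> {x \<in> carrier G. inv x \<otimes> g \<otimes> x \<in> generate G I'}"
        proof (rule image_subsetI)
          fix x assume x: "x \<in> {x \<in> carrier G. inv x \<otimes> g \<otimes> x \<in> generate G I}"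
          then have "x \<otimes> inv w \<otimes> w = x" using w(1) by (simp add: m_assoc)
          then show "x \<otimes> inv w \<in> {x \<in> carrier G. inv x \<otimes> g \<otimes> x \<in> generate G I'}"
            using x mem[of "x \<otimes> inv w"] w(1) by simp
        qed
      qed (use w(1) in \<open>auto simp: m_assoc\<close>)
      then show ?thesis using True by (simp add: induced_def cd)
    qed (simp add: induced_out)
  qed
qed

end

section \<open>Cycles of a permutation\<close>

lemma orbit_cycle:
  fixes f :: "'b => 'b"
  assumes "permutation f" and c: "c = card (orbit f r)"
  shows "0 < c" "(f ^^ c) r = r" "inj_on (%k. (f ^^ k) r) {..<c}" "orbit f r = (%k. (f ^^ k) r) ` {..<c}"
proof -
  have inj: "inj f" using assms(1) by (simp add: permutation_bijective bij_is_inj)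
  define d where "d = (LEAST k. 0 < k \<and> (f ^^ k) r = r)"
  have "r \<in> orbit f r" using assms(1) by (rule permutation_self_in_orbit)
  then obtain k where "0 < k \<and> (f ^^ k) r = r" unfolding orbit_altdef mem_Collect_eq by metis
  then have d: "0 < d" "(f ^^ d) r = r" unfolding d_def by (metis (mono_tags, lifting) LeastI)+
  have least: "d \<le> k" if "0 < k" "(f ^^ k) r = r" for k unfolding d_def by (rule Least_le) (use that in simp)
  have ne: "(f ^^ i) r ~= (f ^^ j) r" if "i < j" "j < d" for i j
  proof
    assume "(f ^^ i) r = (f ^^ j) r"
    also have "j = i + (j - i)" using that by simp
    finally have "(f ^^ i) r = (f ^^ i) ((f ^^ (j - i)) r)" by (simp add: funpow_add)
    then have "(f ^^ (j - i)) r = r" using inj_fn[OF inj, of i] by (metis injD)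
    then show False using least[of "j - i"] that by simp
  qed
  have i: "inj_on (%k. (f ^^ k) r) {..<d}"
    by (rule linorder_inj_onI) (use ne in auto)
  have o: "orbit f r = (%k. (f ^^ k) r) ` {..<d}" unfolding orbit_altdef_bounded[OF d(2,1)] by auto
  have "c = d" unfolding c o by (simp add: card_image[OF i])
  then show "0 < c" "(f ^^ c) r = r" "inj_on (%k. (f ^^ k) r) {..<c}" "orbit f r = (%k. (f ^^ k) r) ` {..<c}"
    using d i o by simp_all
qed

lemma sgn_prod_cases:
  fixes a :: "'b => int"
  assumes "\<And>v. v \<in> A ==> a v ~= 0"
  shows "(\<Prod>v\<in>A. sgn (a v)) = 1 \<or> (\<Prod>v\<in>A. sgn (a v)) = - 1"
  using assms by (induction A rule: infinite_finite_induct) (auto simp: sgn_if)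

context coxeter_C begin

section \<open>Signed cycles\<close>

text \<open>The cycle of \<open>|g|\<close> through \<open>v\<close>.\<close>

definition orb :: "'a => int => int set" where "orb g v = orbit (ap g) v"

definition csign :: "'a => int => int" where "csign g v = (\<Prod>u\<in>orb g v. sgn (act g u))"

text \<open>The sign collected by \<open>g\<close> along the first \<open>k\<close> steps from \<open>r\<close>, so that \<open>g\<^sup>k r\<close> is this sign
  times \<open>|g|\<^sup>k r\<close>.\<close>

definition psign :: "'a => int => nat => int" where
  "psign g r k = (\<Prod>i<k. sgn (act g ((ap g ^^ i) r)))"

lemma ap_permutation: "g \<in> carrier G ==> permutation (ap g)"
  using ap_permutes[of g] by (auto simp: permutation_permutes)

lemma ap_pos: "g \<in> carrier G ==> v \<in> pos ==> ap g v \<in> pos"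
  using act_pos_abs by (simp add: ap_def del: atLeastAtMost_iff)

lemma ap_fn_pos: "g \<in> carrier G ==> v \<in> pos ==> (ap g ^^ k) v \<in> pos"
  by (induction k) (use ap_pos in \<open>simp_all del: atLeastAtMost_iff\<close>)

lemma orb_pos: "g \<in> carrier G ==> v \<in> pos ==> orb g v \<subseteq> pos"
  unfolding orb_def by (rule permutes_orbit_subset[OF ap_permutes])

lemma orb_self: "g \<in> carrier G ==> v \<in> orb g v"
  unfolding orb_def by (rule permutation_self_in_orbit[OF ap_permutation])

lemma orb_eq: "g \<in> carrier G ==> u \<in> orb g v ==> orb g u = orb g v"
  unfolding orb_def by (rule orbit_cyclic_eq3[OF cyclic_on_orbit'[OF ap_permutation]])

lemma orb_ap: "g \<in> carrier G ==> orb g (ap g v) = orb g v"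
  unfolding orb_def by (rule permutation_orbit_step[OF ap_permutation])

lemma act_ap: "g \<in> carrier G ==> v \<in> pos ==> act g v = sgn (act g v) * ap g v"
  by (simp add: ap_def sgn_mult_abs)

lemma psign_Suc: "psign g r (Suc k) = psign g r k * sgn (act g ((ap g ^^ k) r))"
  by (simp add: psign_def)

lemma psign_cases:
  assumes "g \<in> carrier G" "r \<in> pos" shows "psign g r k = 1 \<or> psign g r k = - 1"
  unfolding psign_def by (rule sgn_prod_cases) (use act_neq_0[OF assms(1) ap_fn_pos[OF assms]] in blast)

lemma psign_cycle:
  assumes g: "g \<in> carrier G"
  shows "psign g r (card (orb g r)) = csign g r"
proof -
  let ?c = "card (orb g r)"
  note c = orbit_cycle[OF ap_permutation[OF g], of ?c r, unfolded orb_def[symmetric], OF HOL.refl]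
  have "csign g r = (\<Prod>u\<in>(%k. (ap g ^^ k) r) ` {..<?c}. sgn (act g u))"
    unfolding csign_def using c(4) by (rule arg_cong)
  also have "\<dots> = (\<Prod>k<?c. sgn (act g ((ap g ^^ k) r)))"
    using c(3) by (simp add: prod.reindex)
  finally show ?thesis by (simp add: psign_def)
qed

text \<open>Follow the cycles of \<open>g\<close> and \<open>h\<close> in parallel from a common base point of each orbit. Going once around, the
  signs picked up by \<open>g\<close> and \<open>h\<close> agree, so that matching the \<open>k\<close>-th images is consistent and intertwines
  \<open>g\<close> and \<open>h\<close>.\<close>

lemma same_signed_cycles_conjugate:
  assumes g: "g \<in> carrier G" and h: "h \<in> carrier G"
    and o: "\<And>v. v \<in> pos ==> orb g v = orb h v" and s: "\<And>v. v \<in> pos ==> csign g v = csign h v"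
  obtains x where "x \<in> carrier G" "h = x \<otimes> g \<otimes> inv x"
proof -
  define r where "r v = (SOME u. u \<in> orb g v)" for v
  have rv: "r v \<in> orb g v" for v unfolding r_def using orb_self[OF g, of v] by (rule someI)
  have rp: "r v \<in> pos" if "v \<in> pos" for v using rv[of v] orb_pos[OF g that] by blast
  have or: "orb g (r v) = orb g v" for v using orb_eq[OF g rv] .
  have r_ap: "r (ap g v) = r v" for v by (simp add: r_def orb_ap[OF g])
  define c where "c v = card (orb g v)" for v
  note cg = orbit_cycle[OF ap_permutation[OF g], of _ "r _", unfolded orb_def[symmetric] or, OF c_def]
  have ohr: "orb h (r v) = orb g v" if "v \<in> pos" for v using o[OF rp[OF that]] or by simp
  note ch0 = orbit_cycle[OF ap_permutation[OF h], of _ "r _", unfolded orb_def[symmetric]]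
  have ch: "(ap h ^^ c v) (r v) = r v" "inj_on (%k. (ap h ^^ k) (r v)) {..<c v}"
    if "v \<in> pos" for v
    using ch0(2,3)[of "c v" v] ohr[OF that] by (simp_all add: c_def)
  have "\<exists>k. k < c v \<and> v = (ap g ^^ k) (r v)" for v
    using orb_self[OF g, of v] cg(4)[of v] by blast
  then obtain d where d: "\<And>v. d v < c v" "\<And>v. v = (ap g ^^ d v) (r v)" by metis
  define x where "x v = psign g (r v) (d v) * psign h (r v) (d v) * (ap h ^^ d v) (r v)" for v
  have ps: "psign g (r v) k * psign g (r v) k = 1" "psign h (r v) k * psign h (r v) k = 1"
    "\<bar>psign g (r v) k\<bar> = 1" "\<bar>psign h (r v) k\<bar> = 1" if "v \<in> pos" for v k
    using psign_cases[OF g rp[OF that], of k] psign_cases[OF h rp[OF that], of k] by auto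
  have hp: "(ap h ^^ k) (r v) \<in> pos" if "v \<in> pos" for v k by (rule ap_fn_pos[OF h rp[OF that]])
  have xa: "\<bar>x v\<bar> = (ap h ^^ d v) (r v)" if "v \<in> pos" for v
    unfolding x_def abs_mult ps(3,4)[OF that] using hp[OF that, of "d v"] by auto
  obtain y where y: "y \<in> carrier G" "\<And>v. v \<in> pos ==> act y v = x v"
  proof (rule act_extend[of x])
    show "\<bar>x v\<bar> \<in> pos" if "v \<in> pos" for v unfolding xa[OF that] by (rule hp[OF that])
    show "inj_on (%v. \<bar>x v\<bar>) pos"
    proof (rule inj_onI)
      fix u v assume uv: "u \<in> pos" "v \<in> pos" "\<bar>x u\<bar> = \<bar>x v\<bar>"
      have e: "(ap h ^^ d u) (r u) = (ap h ^^ d v) (r v)" using uv xa by simp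
      have m: "(ap h ^^ k) (r w) \<in> orb g w" if "w \<in> pos" for w k
      proof -
        have "(ap h ^^ k) (r w) \<in> orb h (r w)" unfolding orb_def
          by (rule funpow_in_orbit[OF permutation_self_in_orbit[OF ap_permutation[OF h]]])
        then show ?thesis unfolding ohr[OF that] .
      qed
      have "orb g u = orb g v"
        using orb_eq[OF g m[OF uv(1), of "d u"]] orb_eq[OF g m[OF uv(2), of "d v"]] e by simp
      then have "r u = r v" "c u = c v" by (simp_all add: r_def c_def)
      then have "d u = d v" using inj_onD[OF ch(2)[OF uv(2)], of "d u" "d v"] e d(1)[of u] d(1)[of v] by simp
      then show "u = v" using d(2)[of u] d(2)[of v] \<open>r u = r v\<close> by simp
    qed
  qed blast
  have step: "act h (x v) = act y (act g v)" if v: "v \<in> pos" for v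
  proof -
    let ?k = "d v" and ?r = "r v"
    let ?a = "sgn (act g v)" and ?b = "sgn (act h ((ap h ^^ ?k) ?r))"
    have sg: "act w (p * z) = p * act w z" if "w \<in> carrier G" "p = 1 \<or> p = - 1" for w p z
      using that act_minus[OF that(1), of z] by auto
    have pg: "psign g ?r (Suc ?k) = psign g ?r ?k * ?a" unfolding psign_Suc d(2)[symmetric] ..
    have ph: "psign h ?r (Suc ?k) = psign h ?r ?k * ?b" by (rule psign_Suc)
    have "psign g ?r ?k * psign h ?r ?k = 1 \<or> psign g ?r ?k * psign h ?r ?k = - 1"
      using psign_cases[OF g rp[OF v], of ?k] psign_cases[OF h rp[OF v], of ?k] by auto
    then have "act h (x v) = psign g ?r ?k * psign h ?r ?k * act h ((ap h ^^ ?k) ?r)"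
      unfolding x_def by (rule sg[OF h])
    also have "\<dots> = psign g ?r ?k * psign h ?r (Suc ?k) * (ap h ^^ Suc ?k) ?r"
      by (subst act_ap[OF h hp[OF v]]) (simp add: ph)
    finally have L: "act h (x v) = psign g ?r ?k * psign h ?r (Suc ?k) * (ap h ^^ Suc ?k) ?r" .
    have a: "?a = 1 \<or> ?a = - 1" using act_neq_0[OF g v] by (auto simp: sgn_if)
    have gv: "ap g v \<in> pos" by (rule ap_pos[OF g v])
    have "act y (act g v) = ?a * act y (ap g v)" by (subst act_ap[OF g v]) (rule sg[OF y(1) a])
    then have R: "act y (act g v) = ?a * x (ap g v)" using y(2)[OF gv] by simp
    have sv: "ap g v = (ap g ^^ Suc ?k) ?r" using arg_cong[OF d(2)[of v], of "ap g"] by simp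
    have cv: "c (ap g v) = c v" by (simp add: c_def orb_ap[OF g])
    have dv: "ap g v = (ap g ^^ d (ap g v)) ?r" using d(2)[of "ap g v"] by (simp add: r_ap)
    have aa: "?a * ?a = 1" using a by auto
    show ?thesis
    proof (cases "Suc ?k = c v")
      case True
      then have "ap g v = (ap g ^^ 0) ?r" using sv cg(2)[of v] by simp
      then have "d (ap g v) = 0" using inj_onD[OF cg(3)[of v], of "d (ap g v)" 0] dv d(1)[of "ap g v"] cv by simp
      then have x0: "x (ap g v) = ?r" by (simp add: x_def r_ap psign_def)
      have ct: "psign g ?r (c v) = psign h ?r (c v)"
      proof -
        have "psign g ?r (c v) = csign g ?r" using psign_cycle[OF g, of ?r] by (simp add: or c_def)
        moreover have "psign h ?r (c v) = csign h ?r" using psign_cycle[OF h, of ?r] ohr[OF v] by (simp add: c_def)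
        ultimately show ?thesis using s[OF rp[OF v]] by simp
      qed
      have "act h (x v) = psign g ?r ?k * psign g ?r (Suc ?k) * ?r"
        unfolding L True using ct ch(1)[OF v] by simp
      also have "\<dots> = ?a * ?r" unfolding pg using ps(1)[OF v, of ?k] by (simp add: mult.assoc[symmetric])
      finally show ?thesis unfolding R x0 .
    next
      case False
      then have l: "Suc ?k < c v" using d(1)[of v] by simp
      have "d (ap g v) = Suc ?k"
        using inj_onD[OF cg(3)[of v], of "d (ap g v)" "Suc ?k"] dv sv d(1)[of "ap g v"] cv l by simp
      then have "x (ap g v) = psign g ?r ?k * ?a * psign h ?r (Suc ?k) * (ap h ^^ Suc ?k) ?r"
        unfolding x_def r_ap by (simp only: pg)
      then have "?a * x (ap g v) = (?a * ?a) * (psign g ?r ?k * psign h ?r (Suc ?k) * (ap h ^^ Suc ?k) ?r)"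
        by (simp only: ac_simps)
      then show ?thesis unfolding R L aa by simp
    qed
  qed
  have "h \<otimes> y = y \<otimes> g"
  proof (rule act_ext)
    fix v assume "v \<in> pos"
    then show "act (h \<otimes> y) v = act (y \<otimes> g) v" using step y g h by (simp add: act_mult_apply del: atLeastAtMost_iff)
  qed (use y g h in auto)
  then have "h = y \<otimes> g \<otimes> inv y" using y(1) g h by (metis inv_solve_right m_closed)
  then show thesis using that y(1) by blast
qed

section \<open>Completeness of the functions \<open>M (rcl f)\<close>\<close>

lemma m_conj:
  assumes g: "g \<in> carrier G" and p: "p \<in> carrier G" "\<And>v. v \<in> pos ==> 0 < act p v"
    and F: "\<And>v. v \<in> pos ==> F v = f (act p v)"
  shows "m F g = m f (p \<otimes> g \<otimes> inv p)"
proof -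
  let ?h = "p \<otimes> g \<otimes> inv p"
  have pp: "act p v \<in> pos" if "v \<in> pos" for v
    using act_pos_abs[OF p(1) that] p(2)[OF that] by (simp del: atLeastAtMost_iff)
  have bij: "bij_betw (act p) pos pos"
  proof -
    have "bij_betw (act p) pos pos \<longleftrightarrow> bij_betw (%v. \<bar>act p v\<bar>) pos pos"
      by (rule bij_betw_cong) (use p(2) in \<open>simp add: less_imp_le del: atLeastAtMost_iff\<close>)
    then show ?thesis using bij_act[OF p(1)] by blast
  qed
  have ha: "act ?h (act p v) = act p (act g v)" for v using g p(1) by (simp add: act_mult_apply act_inv)
  have pa: "\<bar>act p x\<bar> = act p \<bar>x\<bar>" if "\<bar>x\<bar> \<in> pos" for x
    using act_abs[OF p(1), of x] p(2)[OF that] by simp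
  have sg: "sgn (act p x) = sgn x" if x: "\<bar>x\<bar> \<in> pos" for x
  proof (cases "0 < x")
    case True then show ?thesis using p(2)[of x] x by simp
  next
    case False
    then have "x < 0" using x by auto
    then show ?thesis using p(2)[OF x] act_minus[OF p(1), of x] by simp
  qed
  have 1: "(\<forall>v\<in>pos. f \<bar>act ?h v\<bar> = f v) \<longleftrightarrow> (\<forall>v\<in>pos. F \<bar>act g v\<bar> = F v)"
  proof -
    have "(\<forall>v\<in>pos. f \<bar>act ?h v\<bar> = f v) \<longleftrightarrow> (\<forall>v\<in>act p ` pos. f \<bar>act ?h v\<bar> = f v)"
      using bij by (simp add: bij_betw_def)
    also have "\<dots> \<longleftrightarrow> (\<forall>v\<in>pos. F \<bar>act g v\<bar> = F v)"
      unfolding ball_simps(9)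
    proof (intro ball_cong HOL.refl)
      fix v assume v: "v \<in> pos"
      have "\<bar>act g v\<bar> \<in> pos" by (rule act_pos_abs[OF g v])
      then show "f \<bar>act ?h (act p v)\<bar> = f (act p v) \<longleftrightarrow> F \<bar>act g v\<bar> = F v"
        unfolding ha using F[of "\<bar>act g v\<bar>"] F[OF v] pa[of "act g v"] by simp
    qed
    finally show ?thesis .
  qed
  have "(\<Prod>v\<in>pos. if even (f v) then sgn (act ?h v) else 1)
      = (\<Prod>v\<in>pos. if even (f (act p v)) then sgn (act ?h (act p v)) else 1)"
    by (rule prod.reindex_bij_betw[OF bij, symmetric])
  also have "\<dots> = (\<Prod>v\<in>pos. if even (F v) then sgn (act g v) else 1)"
  proof (rule prod.cong[OF HOL.refl])
    fix v assume v: "v \<in> pos"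
    show "(if even (f (act p v)) then sgn (act ?h (act p v)) else 1) = (if even (F v) then sgn (act g v) else 1)"
      unfolding ha F[OF v] sg[OF act_pos_abs[OF g v]] ..
  qed
  finally show ?thesis unfolding m_def 1 by simp
qed

lemma sum_conj: "p \<in> carrier G ==> (\<Sum>g\<in>carrier G. \<phi> (p \<otimes> g \<otimes> inv p)) = (\<Sum>g\<in>carrier G. \<phi> g)"
  by (rule sum.reindex_bij_witness[of _ "%g. inv p \<otimes> g \<otimes> p" "%g. p \<otimes> g \<otimes> inv p"])
    (auto simp: m_assoc, auto simp: m_assoc[symmetric])

definition class_function :: "('a => complex) => bool" where
  "class_function \<chi> \<longleftrightarrow> (\<forall>g. g \<notin> carrier G --> \<chi> g = 0) \<and>
    (\<forall>g\<in>carrier G. \<forall>x\<in>carrier G. \<chi> (x \<otimes> g \<otimes> inv x) = \<chi> g)"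

lemma sum_class_function_M:
  assumes \<chi>: "class_function \<chi>"
  shows "(\<Sum>g\<in>carrier G. \<chi> g * of_int (M (rcl f) g)) = of_nat (card (rcl f)) * (\<Sum>g\<in>carrier G. \<chi> g * of_int (m f g))"
proof -
  have e: "(\<Sum>g\<in>carrier G. \<chi> g * of_int (m F g)) = (\<Sum>g\<in>carrier G. \<chi> g * of_int (m f g))" if "F \<in> rcl f" for F
  proof -
    have "cnt F = cnt f" using that by (simp add: rcl_def)
    then obtain p where p: "p \<in> carrier G" "\<And>v. v \<in> pos ==> 0 < act p v" "\<And>v. v \<in> pos ==> F v = f (act p v)"
      using cnt_eq_imp_conj by blast
    have "(\<Sum>g\<in>carrier G. \<chi> g * of_int (m F g)) =
        (\<Sum>g\<in>carrier G. \<chi> (p \<otimes> g \<otimes> inv p) * of_int (m f (p \<otimes> g \<otimes> inv p)))"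
    proof (rule sum.cong[OF HOL.refl])
      fix g assume g: "g \<in> carrier G"
      show "\<chi> g * of_int (m F g) = \<chi> (p \<otimes> g \<otimes> inv p) * of_int (m f (p \<otimes> g \<otimes> inv p))"
        using \<chi> g p(1) m_conj[of g p F f] p(2,3) by (simp add: class_function_def del: atLeastAtMost_iff)
    qed
    also have "\<dots> = (\<Sum>g\<in>carrier G. \<chi> g * of_int (m f g))" by (rule sum_conj[OF p(1)])
    finally show ?thesis .
  qed
  have "(\<Sum>g\<in>carrier G. \<chi> g * of_int (M (rcl f) g)) = (\<Sum>g\<in>carrier G. \<Sum>F\<in>rcl f. \<chi> g * of_int (m F g))"
    by (simp add: M_def sum_distrib_left)
  also have "\<dots> = (\<Sum>F\<in>rcl f. \<Sum>g\<in>carrier G. \<chi> g * of_int (m F g))" by (rule sum.swap)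
  also have "\<dots> = (\<Sum>F\<in>rcl f. \<Sum>g\<in>carrier G. \<chi> g * of_int (m f g))" by (rule sum.cong[OF HOL.refl]) (rule e)
  finally show ?thesis by simp
qed

text \<open>Labelling the orbits of \<open>g\<^sub>0\<close> and summing over the parities of the labels, with the cycle signs of \<open>g\<^sub>0\<close> as
  weights, isolates the elements that stabilize each orbit of \<open>g\<^sub>0\<close> with the same sign. Those with the same orbits
  are conjugate to \<open>g\<^sub>0\<close>, and the others have smaller orbits. The labels are at most \<open>n\<close>, so the letters
  are at most \<open>2 n + 1\<close>.\<close>

lemma class_function_eq_zero:
  assumes \<chi>: "class_function \<chi>"
    and z: "\<And>f. f \<in> PiE pos (%_. {..<2 * n + 2}) ==> (\<Sum>g\<in>carrier G. \<chi> g * of_int (M (rcl f) g)) = 0"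
  shows "g0 \<in> carrier G ==> \<chi> g0 = 0"
proof (induction "\<Sum>v\<in>pos. card (orb g0 v)" arbitrary: g0 rule: less_induct)
  case less
  note g0 = less.prems
  define p where "p v = nat (Min (orb g0 v))" for v
  have fo: "finite (orb g v)" if "g \<in> carrier G" "v \<in> pos" for g v
    by (rule finite_subset[OF orb_pos[OF that]]) simp
  have mn: "Min (orb g0 v) \<in> orb g0 v" if "v \<in> pos" for v
    by (rule Min_in[OF fo[OF g0 that]]) (use orb_self[OF g0, of v] in blast)
  have pv: "int (p v) \<in> orb g0 v" if "v \<in> pos" for v
  proof -
    have "Min (orb g0 v) \<in> pos" using mn[OF that] orb_pos[OF g0 that] by blast
    then show ?thesis using mn[OF that] by (simp add: p_def)
  qed
  have p_iff: "p u = p v \<longleftrightarrow> u \<in> orb g0 v" if "u \<in> pos" "v \<in> pos" for u v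
  proof
    assume "p u = p v"
    then have "orb g0 u = orb g0 v" using orb_eq[OF g0 pv[OF that(1)]] orb_eq[OF g0 pv[OF that(2)]] by simp
    then show "u \<in> orb g0 v" using orb_self[OF g0, of u] by simp
  next
    assume "u \<in> orb g0 v"
    then show "p u = p v" using orb_eq[OF g0] by (simp add: p_def)
  qed
  have pn: "p v \<le> n" if "v \<in> pos" for v
  proof -
    have "int (p v) \<in> pos" using pv[OF that] orb_pos[OF g0 that] by blast
    then show ?thesis by simp
  qed
  let ?J = "p ` pos"
  let ?B = "%j. {v \<in> pos. p v = j}"
  define e where "e j g = (\<Prod>v\<in>?B j. sgn (act g v))" for j g
  define f where "f K = restrict (%v. 2 * p v + (if p v \<in> K then 0 else 1)) pos" for K
  have e1: "e j g = 1 \<or> e j g = - 1" if "g \<in> carrier G" for j g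
    unfolding e_def by (rule sgn_prod_cases) (use act_neq_0[OF that] in blast)
  have mf: "m (f K) g = (if \<forall>v\<in>pos. p \<bar>act g v\<bar> = p v then \<Prod>j\<in>K. e j g else 0)" if g: "g \<in> carrier G" and K: "K \<subseteq> ?J" for K g
  proof -
    have fv: "f K v = 2 * p v + (if p v \<in> K then 0 else 1)" if "v \<in> pos" for v
      using that by (simp add: f_def)
    have d: "f K v div 2 = p v" if "v \<in> pos" for v unfolding fv[OF that] by simp
    have ev: "even (f K v) \<longleftrightarrow> p v \<in> K" if "v \<in> pos" for v unfolding fv[OF that] by simp
    have "f K \<bar>act g v\<bar> = f K v \<longleftrightarrow> p \<bar>act g v\<bar> = p v" if v: "v \<in> pos" for v
    proof
      assume "f K \<bar>act g v\<bar> = f K v"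
      then show "p \<bar>act g v\<bar> = p v" using d[OF act_pos_abs[OF g v]] d[OF v] by simp
    next
      assume "p \<bar>act g v\<bar> = p v"
      then show "f K \<bar>act g v\<bar> = f K v" unfolding fv[OF act_pos_abs[OF g v]] fv[OF v] by simp
    qed
    then have 1: "(\<forall>v\<in>pos. f K \<bar>act g v\<bar> = f K v) \<longleftrightarrow> (\<forall>v\<in>pos. p \<bar>act g v\<bar> = p v)" by blast
    have "(\<Prod>v\<in>pos. if even (f K v) then sgn (act g v) else 1) = (\<Prod>v\<in>pos. if p v \<in> K then sgn (act g v) else 1)"
      by (rule prod.cong[OF HOL.refl]) (simp only: ev)
    also have "\<dots> = (\<Prod>v\<in>{v \<in> pos. p v \<in> K}. sgn (act g v))"
      by (rule prod.inter_filter[symmetric]) simp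
    also have "\<dots> = (\<Prod>j\<in>K. \<Prod>v | v \<in> {v \<in> pos. p v \<in> K} \<and> p v = j. sgn (act g v))"
    proof (rule prod.group[symmetric])
      show "finite {v \<in> pos. p v \<in> K}" by (rule finite_pos_Collect)
      show "finite K" using finite_subset[OF K] by simp
    qed blast
    also have "\<dots> = (\<Prod>j\<in>K. e j g)"
      unfolding e_def by (intro prod.cong HOL.refl) auto
    finally have 2: "(\<Prod>v\<in>pos. if even (f K v) then sgn (act g v) else 1) = (\<Prod>j\<in>K. e j g)" .
    show ?thesis unfolding m_def 1 2 ..
  qed
  have S0: "(\<Sum>g\<in>carrier G. \<chi> g * of_int (m (f K) g)) = 0" if K: "K \<subseteq> ?J" for K
  proof -
    have "f K v < 2 * n + 2" if "v \<in> pos" for v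
      using pn[OF that] that by (simp add: f_def del: atLeastAtMost_iff)
    then have "f K \<in> PiE pos (%_. {..<2 * n + 2})" by (auto simp: f_def simp del: atLeastAtMost_iff)
    from z[OF this] have "of_nat (card (rcl (f K))) * (\<Sum>g\<in>carrier G. \<chi> g * of_int (m (f K) g)) = 0"
      by (simp only: sum_class_function_M[OF \<chi>])
    moreover have "f K \<in> rcl (f K)" by (rule rcl_refl) (simp add: f_def)
    then have "card (rcl (f K)) ~= 0" using finite_rcl[of "f K"] by (metis card_0_eq empty_iff)
    ultimately show ?thesis by simp
  qed
  let ?A = "{g \<in> carrier G. (\<forall>v\<in>pos. p \<bar>act g v\<bar> = p v) \<and> (\<forall>j\<in>?J. e j g = e j g0)}"
  have "0 = (\<Sum>K\<in>Pow ?J. of_int (\<Prod>j\<in>K. e j g0) * (\<Sum>g\<in>carrier G. \<chi> g * of_int (m (f K) g)))"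
    using S0 by simp
  also have "\<dots> = (\<Sum>K\<in>Pow ?J. \<Sum>g\<in>carrier G. \<chi> g * of_int ((\<Prod>j\<in>K. e j g0) * m (f K) g))"
    by (simp add: sum_distrib_left mult_ac)
  also have "\<dots> = (\<Sum>g\<in>carrier G. \<Sum>K\<in>Pow ?J. \<chi> g * of_int ((\<Prod>j\<in>K. e j g0) * m (f K) g))"
    by (rule sum.swap)
  also have "\<dots> = (\<Sum>g\<in>carrier G. \<chi> g * of_int (\<Sum>K\<in>Pow ?J. (\<Prod>j\<in>K. e j g0) * m (f K) g))"
    by (simp add: sum_distrib_left)
  also have "\<dots> = (\<Sum>g\<in>carrier G. if g \<in> ?A then \<chi> g * 2 ^ card ?J else 0)"
  proof (rule sum.cong[OF HOL.refl])
    fix g assume g: "g \<in> carrier G"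
    show "\<chi> g * of_int (\<Sum>K\<in>Pow ?J. (\<Prod>j\<in>K. e j g0) * m (f K) g) = (if g \<in> ?A then \<chi> g * 2 ^ card ?J else 0)"
    proof (cases "\<forall>v\<in>pos. p \<bar>act g v\<bar> = p v")
      case False
      then have "(\<Sum>K\<in>Pow ?J. (\<Prod>j\<in>K. e j g0) * m (f K) g) = 0" using mf[OF g] by (intro sum.neutral) auto
      then show ?thesis using False by auto
    next
      case True
      have "(\<Sum>K\<in>Pow ?J. (\<Prod>j\<in>K. e j g0) * m (f K) g) = (\<Sum>K\<in>Pow ?J. \<Prod>j\<in>K. e j g0 * e j g)"
        by (rule sum.cong[OF HOL.refl]) (use mf[OF g] True in \<open>simp add: prod.distrib del: atLeastAtMost_iff\<close>)
      also have "\<dots> = (\<Prod>j\<in>?J. 1 + e j g0 * e j g)" by (rule prod_one_plus[symmetric]) simp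
      also have "\<dots> = (if \<forall>j\<in>?J. e j g0 * e j g = 1 then 2 ^ card ?J else 0)"
        by (rule prod_one_plus_signs) (use e1[OF g0] e1[OF g] in \<open>simp, metis mult_cancel_left1 mult_minus1 minus_mult_minus mult.right_neutral\<close>)
      also have "(\<forall>j\<in>?J. e j g0 * e j g = 1) \<longleftrightarrow> (\<forall>j\<in>?J. e j g = e j g0)"
      proof (intro ball_cong HOL.refl)
        fix j show "e j g0 * e j g = 1 \<longleftrightarrow> e j g = e j g0" using e1[OF g0, of j] e1[OF g, of j] by auto
      qed
      finally have "(\<Sum>K\<in>Pow ?J. (\<Prod>j\<in>K. e j g0) * m (f K) g) = (if \<forall>j\<in>?J. e j g = e j g0 then 2 ^ card ?J else 0)" .
      moreover have "g \<in> ?A \<longleftrightarrow> (\<forall>j\<in>?J. e j g = e j g0)" using g True by blast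
      ultimately show ?thesis by simp
    qed
  qed
  also have "\<dots> = (\<Sum>g\<in>?A. \<chi> g * 2 ^ card ?J)"
    by (rule sum.mono_neutral_cong_right) (auto simp: finite_carrier simp del: atLeastAtMost_iff)
  also have "\<dots> = (\<Sum>g\<in>?A. \<chi> g) * 2 ^ card ?J" by (simp add: sum_distrib_right)
  finally have sum0: "(\<Sum>g\<in>?A. \<chi> g) = 0" by simp
  have g0A: "g0 \<in> ?A"
  proof -
    have "p \<bar>act g0 v\<bar> = p v" if v: "v \<in> pos" for v
    proof -
      have "\<bar>act g0 v\<bar> = ap g0 v" using v by (simp add: ap_def)
      then show ?thesis by (simp add: p_def orb_ap[OF g0])
    qed
    then show ?thesis using g0 by blast
  qed
  have sub: "orb g v \<subseteq> orb g0 v" if g: "g \<in> ?A" and v: "v \<in> pos" for g v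
  proof
    have gc: "g \<in> carrier G" using g by blast
    fix u assume "u \<in> orb g v"
    then have "u \<in> orbit (ap g) v" by (simp add: orb_def)
    then have "u \<in> pos \<and> p u = p v"
    proof induction
      case base
      have "p (ap g v) = p v" using g v by (simp add: ap_def)
      then show ?case using ap_pos[OF gc v] by blast
    next
      case (step y)
      then have "y \<in> pos" by blast
      have "p (ap g y) = p y" using g \<open>y \<in> pos\<close> by (simp add: ap_def)
      then show ?case using ap_pos[OF gc \<open>y \<in> pos\<close>] step by simp
    qed
    then show "u \<in> orb g0 v" using p_iff[of u v] v by blast
  qed
  have val: "\<chi> g = (if \<forall>v\<in>pos. orb g v = orb g0 v then \<chi> g0 else 0)" if g: "g \<in> ?A" for g
  proof (cases "\<forall>v\<in>pos. orb g v = orb g0 v")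
    case True
    have gc: "g \<in> carrier G" using g by blast
    have Bo: "?B (p v) = orb g0 v" if "v \<in> pos" for v
      using p_iff[OF _ that] orb_pos[OF g0 that] by blast
    have "csign g0 v = csign g v" if v: "v \<in> pos" for v
    proof -
      have "e (p v) g = e (p v) g0" using g v by blast
      then show ?thesis unfolding e_def Bo[OF v] csign_def using True v by simp
    qed
    then obtain x where "x \<in> carrier G" "g = x \<otimes> g0 \<otimes> inv x"
      using same_signed_cycles_conjugate[OF g0 gc] True by metis
    then have "\<chi> g = \<chi> g0" using \<chi> g0 by (simp add: class_function_def)
    then show ?thesis using True by simp
  next
    case False
    have gc: "g \<in> carrier G" using g by blast
    obtain w where w: "w \<in> pos" "orb g w ~= orb g0 w" using False by blast
    have "(\<Sum>v\<in>pos. card (orb g v)) < (\<Sum>v\<in>pos. card (orb g0 v))"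
    proof (rule sum_strict_mono_ex1)
      show "\<forall>v\<in>pos. card (orb g v) \<le> card (orb g0 v)" using card_mono[OF fo[OF g0] sub[OF g]] by blast
      have "orb g w \<subset> orb g0 w" using sub[OF g w(1)] w(2) by blast
      then show "\<exists>v\<in>pos. card (orb g v) < card (orb g0 v)" using psubset_card_mono[OF fo[OF g0 w(1)]] w(1) by blast
    qed simp
    then have "\<chi> g = 0" by (rule less.hyps) (rule gc)
    then show ?thesis unfolding if_not_P[OF False] .
  qed
  let ?C = "{g \<in> ?A. \<forall>v\<in>pos. orb g v = orb g0 v}"
  have fA: "finite ?A" by (rule finite_subset[OF _ finite_carrier]) blast
  have "(\<Sum>g\<in>?A. \<chi> g) = (\<Sum>g\<in>?A. if \<forall>v\<in>pos. orb g v = orb g0 v then \<chi> g0 else 0)"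
    by (rule sum.cong[OF HOL.refl]) (rule val)
  also have "\<dots> = (\<Sum>g\<in>?C. \<chi> g0)" by (rule sum.inter_filter[OF fA, symmetric])
  also have "\<dots> = of_nat (card ?C) * \<chi> g0" by simp
  finally have e: "of_nat (card ?C) * \<chi> g0 = 0" using sum0 by simp
  have "g0 \<in> ?C" using g0A by blast
  moreover have "finite ?C" by (rule finite_subset[OF _ fA]) blast
  ultimately have "card ?C ~= 0" unfolding card_eq_0_iff by blast
  then have "(of_nat (card ?C) :: complex) ~= 0" unfolding of_nat_eq_0_iff .
  then show ?case using e unfolding mult_eq_0_iff by blast
qed

section \<open>Surjectivity\<close>

lemma conj_eps: "g \<in> carrier G ==> x \<in> carrier G ==> eps (x \<otimes> g \<otimes> inv x) = eps g"
proof -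
  assume g: "g \<in> carrier G" and x: "x \<in> carrier G"
  have "eps x * eps (inv x) = 1" using eps_mult[OF x, of "inv x"] x eps_one by simp
  then show ?thesis using g x by (simp add: eps_mult mult.assoc mult.left_commute)
qed

lemma induced_character:
  "J \<in> P0 G n s ==> \<exists>d \<rho>. representation G d \<rho> \<and> rep_character G d \<rho> = induced G (generate G J) (%_. 1)"
proof -
  assume "J \<in> P0 G n s"
  then have "J \<subseteq> carrier G" by (auto simp: P0_def S_ext_def)
  then show ?thesis by (rule induced_trivial_is_character[OF is_group finite_carrier generate_is_subgroup])
qed

lemma character_class_function: "representation G d \<rho> ==> class_function (rep_character G d \<rho>)"
  unfolding class_function_def using rep_character_class_function[OF is_group] by (auto simp: rep_character_def)

lemma class_function_sum:
  "(\<And>i. i \<in> A ==> class_function (\<phi> i)) ==> class_function (%g. \<Sum>i\<in>A. k i * \<phi> i g)"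
  unfolding class_function_def by (auto intro!: sum.neutral sum.cong)

lemma class_function_Th: "class_function (Th c)"
proof -
  have "class_function (%g. \<Sum>I\<in>P0 G n s. of_int (c I) * induced G (generate G I) (%_. 1) g)"
  proof (rule class_function_sum)
    fix I assume "I \<in> P0 G n s"
    then obtain d \<rho> where r: "representation G d \<rho>" "rep_character G d \<rho> = induced G (generate G I) (%_. 1)"
      using induced_character by blast
    show "class_function (induced G (generate G I) (%_. 1))" unfolding r(2)[symmetric] by (rule character_class_function[OF r(1)])
  qed
  then show ?thesis by (simp add: Th_def[abs_def])
qed

lemma class_function_eps: "class_function \<chi> ==> class_function (%g. of_int (eps g) * \<chi> g)"
  unfolding class_function_def using conj_eps by simp

lemma class_function_diff: "class_function \<chi> ==> class_function \<psi> ==> class_function (%g. \<chi> g - \<psi> g)"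
  unfolding class_function_def by simp

lemma Th_out: "g \<notin> carrier G ==> Th c g = 0"
  by (simp add: Th_def induced_out)

text \<open>No complex conjugation: one of the arguments will always be real-valued.\<close>

definition scalar :: "('a => complex) => ('a => complex) => complex" where
  "scalar \<chi> \<psi> = (\<Sum>g\<in>carrier G. \<chi> g * \<psi> g) / of_nat (card (carrier G))"

lemma card_carrier_nz: "(of_nat (card (carrier G)) :: complex) ~= 0"
  using finite_carrier one_closed by (metis card_0_eq empty_iff of_nat_eq_0_iff)

lemma scalar_sum_right: "scalar \<chi> (%g. \<Sum>i\<in>A. k i * \<phi> i g) = (\<Sum>i\<in>A. k i * scalar \<chi> (\<phi> i))"
proof -
  have "(\<Sum>g\<in>carrier G. \<chi> g * (\<Sum>i\<in>A. k i * \<phi> i g)) = (\<Sum>g\<in>carrier G. \<Sum>i\<in>A. k i * (\<chi> g * \<phi> i g))"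
    by (simp add: sum_distrib_left mult_ac)
  also have "\<dots> = (\<Sum>i\<in>A. k i * (\<Sum>g\<in>carrier G. \<chi> g * \<phi> i g))"
    unfolding sum_distrib_left by (rule sum.swap)
  finally have e: "(\<Sum>g\<in>carrier G. \<chi> g * (\<Sum>i\<in>A. k i * \<phi> i g)) = (\<Sum>i\<in>A. k i * (\<Sum>g\<in>carrier G. \<chi> g * \<phi> i g))" .
  show ?thesis unfolding scalar_def e by (simp only: sum_divide_distrib[of _ A] times_divide_eq_right)
qed

lemma scalar_character_Th:
  assumes "representation G d \<rho>" shows "scalar (rep_character G d \<rho>) (Th c) \<in> \<int>"
proof -
  have "scalar (rep_character G d \<rho>) (induced G (generate G I) (%_. 1)) \<in> \<int>" if I: "I \<in> P0 G n s" for I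
  proof -
    have "I \<subseteq> carrier G" using I by (auto simp: P0_def S_ext_def)
    then interpret H: subgroup "generate G I" G by (rule generate_is_subgroup)
    have "scalar (rep_character G d \<rho>) (induced G (generate G I) (%_. 1)) =
      (\<Sum>h\<in>generate G I. rep_character G d \<rho> h) / of_nat (card (generate G I))"
      unfolding scalar_def
      by (subst frobenius_trivial[OF is_group finite_carrier H.is_subgroup])
        (use rep_character_class_function[OF is_group assms] card_carrier_nz in simp_all)
    also have "\<dots> \<in> \<nat>"
      by (rule average_character_Nats[OF is_group assms H.is_subgroup finite_subset[OF H.subset finite_carrier]])
    finally show ?thesis using Nats_subset_Ints by blast
  qed
  then have "(\<Sum>I\<in>P0 G n s. of_int (c I) * scalar (rep_character G d \<rho>) (induced G (generate G I) (%_. 1))) \<in> \<int>"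
    by (intro Ints_sum Ints_mult) auto
  then show ?thesis by (simp add: scalar_sum_right[symmetric] Th_def[abs_def])
qed

lemma twist_character:
  assumes "representation G d \<rho>"
  obtains \<rho>' where "representation G d \<rho>'" "rep_character G d \<rho>' = (%g. of_int (eps g) * rep_character G d \<rho> g)"
  using twist_representation[OF is_group assms, of "%g. of_int (eps g)"] eps_one eps_mult by auto

lemma scalar_commute: "scalar \<chi> \<psi> = scalar \<psi> \<chi>" by (simp add: scalar_def mult.commute)

text \<open>Twisting by \<open>eps\<close> makes a character from an induced one, so the scalar product is a
  combination of multiplicities of trivial characters in restrictions.\<close>

lemma scalar_eps_Th: "scalar (%g. of_int (eps g) * Th c g) (Th d) \<in> \<int>"
proof -
  have "scalar (Th d) (%g. of_int (eps g) * induced G (generate G I) (%_. 1) g) \<in> \<int>" if I: "I \<in> P0 G n s" for I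
  proof -
    obtain e \<rho> where r: "representation G e \<rho>" "rep_character G e \<rho> = induced G (generate G I) (%_. 1)"
      using induced_character[OF I] by blast
    obtain \<rho>' where r': "representation G e \<rho>'" "rep_character G e \<rho>' = (%g. of_int (eps g) * rep_character G e \<rho> g)"
      using twist_character[OF r(1)] by blast
    show ?thesis using scalar_character_Th[OF r'(1), of d] unfolding r'(2) r(2) scalar_commute[of "Th d"] .
  qed
  then have "(\<Sum>I\<in>P0 G n s. of_int (c I) * scalar (Th d) (%g. of_int (eps g) * induced G (generate G I) (%_. 1) g)) \<in> \<int>"
    by (intro Ints_sum Ints_mult) auto
  moreover have "(%g. of_int (eps g) * Th c g) =
      (%g. \<Sum>I\<in>P0 G n s. of_int (c I) * (of_int (eps g) * induced G (generate G I) (%_. 1) g))"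
    by (simp add: Th_def fun_eq_iff sum_distrib_left mult_ac)
  ultimately show ?thesis unfolding scalar_commute[of _ "Th d"] by (simp add: scalar_sum_right)
qed

lemma class_Th:
  obtains cc where "\<And>f g. g \<in> carrier G ==> Th (cc f) g = of_int (M (rcl f) g)"
proof -
  have "\<forall>f. \<exists>c. \<forall>g\<in>carrier G. Th c g = of_int (M (rcl f) g)" using class_in_span by blast
  from choice[OF this] show thesis using that by blast
qed

text \<open>Peeling off the coefficients in decreasing order of \<open>Q\<close>: the pairing of \<open>M (rcl f)\<close> with
  \<open>eps \<cdot> M (rcl (hc b))\<close> is unitriangular.\<close>

lemma class_function_in_span:
  assumes "class_function \<psi>" "\<And>c. scalar \<psi> (Th c) \<in> \<int>"
    and "\<And>f. f \<in> PiE pos (%_. {..<2 * n + 2}) ==> q \<le> Q f ==> (\<Sum>g\<in>carrier G. \<psi> g * of_int (M (rcl f) g)) = 0"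
  shows "\<exists>c. \<psi> = (%g. of_int (eps g) * Th c g)"
  using assms
proof (induction q arbitrary: \<psi>)
  case 0
  have "\<psi> g = 0" for g
  proof (cases "g \<in> carrier G")
    case True show ?thesis by (rule class_function_eq_zero[OF 0(1) _ True]) (rule 0(3), simp_all)
  next
    case False then show ?thesis using 0(1) by (simp add: class_function_def)
  qed
  then have "\<psi> = (%g. of_int (eps g) * Th (%_. 0) g)" by (simp add: Th_def fun_eq_iff)
  then show ?case by blast
next
  case (Suc q)
  let ?F = "PiE pos (%_. {..<2 * n + 2})"
  let ?W = "card (carrier G)"
  obtain cc where cc: "\<And>f g. g \<in> carrier G ==> Th (cc f) g = of_int (M (rcl f) g)" by (rule class_Th) blast
  define a where "a f = scalar \<psi> (Th (cc f))" for f
  have a: "(\<Sum>g\<in>carrier G. \<psi> g * of_int (M (rcl f) g)) = of_nat ?W * a f" for f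
    using cc card_carrier_nz by (simp add: a_def scalar_def)
  have "\<forall>f. \<exists>k. a f = of_int k" using Suc.prems(2) by (auto simp: a_def elim: Ints_cases)
  from choice[OF this] obtain k where k: "\<And>f. a f = of_int (k f)" by blast
  let ?T = "ctype ` {f \<in> ?F. Q f = q}"
  define \<beta> where "\<beta> t = (SOME f. f \<in> ?F \<and> Q f = q \<and> ctype f = t)" for t
  have b: "\<beta> t \<in> ?F \<and> Q (\<beta> t) = q \<and> ctype (\<beta> t) = t" if "t \<in> ?T" for t
    unfolding \<beta>_def by (rule someI_ex[of "%f. f \<in> ?F \<and> Q f = q \<and> ctype f = t"]) (use that in blast)
  have fF: "finite ?F" by (rule finite_PiE) simp_all
  have fT: "finite ?T" by (rule finite_imageI, rule finite_subset[OF _ fF]) blast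
  define c0 where "c0 = (%I. \<Sum>t\<in>?T. k (\<beta> t) * cc (hc (\<beta> t)) I)"
  have c0: "Th c0 g = (\<Sum>t\<in>?T. of_int (k (\<beta> t)) * of_int (M (rcl (hc (\<beta> t))) g))" if "g \<in> carrier G" for g
    unfolding c0_def Th_sum using cc[OF that] by simp
  let ?\<psi> = "%g. \<psi> g - of_int (eps g) * Th c0 g"
  have s: "(\<Sum>g\<in>carrier G. ?\<psi> g * of_int (M (rcl f) g)) = of_nat ?W * a f - (\<Sum>t\<in>?T. of_int (k (\<beta> t)) * of_int (D f (\<beta> t)))" for f
  proof -
    have "(\<Sum>g\<in>carrier G. of_int (eps g) * Th c0 g * of_int (M (rcl f) g)) =
        (\<Sum>g\<in>carrier G. \<Sum>t\<in>?T. of_int (k (\<beta> t)) * of_int (M (rcl f) g * eps g * M (rcl (hc (\<beta> t))) g))"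
      by (rule sum.cong[OF HOL.refl]) (simp add: c0 sum_distrib_left sum_distrib_right mult_ac)
    also have "\<dots> = (\<Sum>t\<in>?T. \<Sum>g\<in>carrier G. of_int (k (\<beta> t)) * of_int (M (rcl f) g * eps g * M (rcl (hc (\<beta> t))) g))"
      by (rule sum.swap)
    also have "\<dots> = (\<Sum>t\<in>?T. of_int (k (\<beta> t)) * of_int (D f (\<beta> t)))"
      unfolding D_def of_int_sum sum_distrib_left ..
    finally show ?thesis using a[of f] by (simp add: left_diff_distrib sum_subtractf)
  qed
  have "\<exists>c. ?\<psi> = (%g. of_int (eps g) * Th c g)"
  proof (rule Suc.IH)
    show "class_function ?\<psi>" by (rule class_function_diff[OF Suc.prems(1) class_function_eps[OF class_function_Th]])
    show "scalar ?\<psi> (Th c) \<in> \<int>" for c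
    proof -
      have "scalar ?\<psi> (Th c) = scalar \<psi> (Th c) - scalar (%g. of_int (eps g) * Th c0 g) (Th c)"
        by (simp add: scalar_def left_diff_distrib sum_subtractf diff_divide_distrib)
      then show ?thesis using Ints_diff[OF Suc.prems(2) scalar_eps_Th] by simp
    qed
    fix f assume f: "f \<in> ?F" "q \<le> Q f"
    have dz: "D f (\<beta> t) = 0" if t: "t \<in> ?T" "Q f ~= q \<or> t ~= ctype f" for t
      using D_nonzero[of f "\<beta> t"] b[OF t(1)] t(2) f(2) by (metis le_antisym)
    show "(\<Sum>g\<in>carrier G. ?\<psi> g * of_int (M (rcl f) g)) = 0"
    proof (cases "Q f = q")
      case False
      then have "(\<Sum>g\<in>carrier G. \<psi> g * of_int (M (rcl f) g)) = 0" using Suc.prems(3)[OF f(1)] f(2) by simp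
      then have "a f = 0" using a[of f] card_carrier_nz by simp
      moreover have "(\<Sum>t\<in>?T. of_int (k (\<beta> t)) * (of_int (D f (\<beta> t)) :: complex)) = 0"
        by (rule sum.neutral) (use dz False in simp)
      ultimately show ?thesis unfolding s by simp
    next
      case True
      then have t: "ctype f \<in> ?T" using f(1) by blast
      have "(\<Sum>t\<in>?T. of_int (k (\<beta> t)) * (of_int (D f (\<beta> t)) :: complex)) = (\<Sum>t\<in>{ctype f}. of_int (k (\<beta> t)) * of_int (D f (\<beta> t)))"
        by (rule sum.mono_neutral_right[OF fT]) (use t dz in auto)
      also have "\<dots> = of_int (k (\<beta> (ctype f))) * of_nat ?W" using D_ctype[of f "\<beta> (ctype f)"] b[OF t] by simp
      also have "of_int (k (\<beta> (ctype f))) = a f"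
      proof -
        have "scalar \<psi> (Th (cc (\<beta> (ctype f)))) = scalar \<psi> (Th (cc f))"
          unfolding scalar_def using cc M_ctype[of "\<beta> (ctype f)" f] b[OF t] by simp
        then show ?thesis unfolding k[symmetric] a_def .
      qed
      finally show ?thesis unfolding s by simp
    qed
  qed
  then obtain c where c: "?\<psi> = (%g. of_int (eps g) * Th c g)" by blast
  have "\<psi> = (%g. of_int (eps g) * Th (%I. c0 I + c I) g)"
  proof
    fix g show "\<psi> g = of_int (eps g) * Th (%I. c0 I + c I) g"
      using fun_cong[OF c, of g] unfolding Th_add by (simp add: distrib_left algebra_simps)
  qed
  then show ?case by blast
qed

lemma character_in_image:
  assumes "representation G d \<rho>" obtains c where "rep_character G d \<rho> = Th c"
proof -
  let ?\<chi> = "rep_character G d \<rho>"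
  obtain \<rho>' where r: "representation G d \<rho>'" "rep_character G d \<rho>' = (%g. of_int (eps g) * ?\<chi> g)"
    using twist_character[OF assms] by blast
  let ?q = "Suc (Max (Q ` PiE pos (%_. {..<2 * n + 2})))"
  have "\<exists>c. rep_character G d \<rho>' = (%g. of_int (eps g) * Th c g)"
  proof (rule class_function_in_span[of _ ?q])
    fix f assume f: "f \<in> PiE pos (%_. {..<2 * n + 2})" "?q \<le> Q f"
    have "Q f \<le> Max (Q ` PiE pos (%_. {..<2 * n + 2}))"
      by (rule Max_ge) (use f(1) finite_PiE[of pos "%_. {..<2 * n + 2}"] in auto)
    then show "(\<Sum>g\<in>carrier G. rep_character G d \<rho>' g * of_int (M (rcl f) g)) = 0" using f(2) by simp
  qed (rule character_class_function[OF r(1)], rule scalar_character_Th[OF r(1)])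
  then obtain c where c: "\<And>g. of_int (eps g) * ?\<chi> g = of_int (eps g) * Th c g" unfolding r(2) by metis
  have "?\<chi> g = Th c g" for g
  proof -
    have "eps g ~= 0" using eps_square[of g] by auto
    then show ?thesis using c[of g] by simp
  qed
  then show thesis using that by blast
qed

section \<open>The kernel\<close>

lemma ctype_relabel:
  assumes "inj \<phi>" "\<And>k. even (\<phi> k) \<longleftrightarrow> even k"
  shows "ctype (%v. \<phi> (f v)) = ctype f" "Q (%v. \<phi> (f v)) = Q f"
proof -
  have c: "cnt (%v. \<phi> (f v)) (\<phi> i) = cnt f i" for i using assms(1) by (simp add: cnt_def inj_eq)
  have im: "(%v. \<phi> (f v)) ` pos = \<phi> ` (f ` pos)" by blast
  have inj: "inj_on \<phi> A" for A using assms(1) by (rule inj_on_subset) simp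
  show "Q (%v. \<phi> (f v)) = Q f" unfolding Q_def im by (simp add: sum.reindex[OF inj] c)
  have "{i \<in> \<phi> ` f ` pos. odd i = o' \<and> j < cnt (%v. \<phi> (f v)) i} = \<phi> ` {i \<in> f ` pos. odd i = o' \<and> j < cnt f i}" for o' j
  proof (intro equalityI subsetI)
    fix x assume x: "x \<in> {i \<in> \<phi> ` f ` pos. odd i = o' \<and> j < cnt (%v. \<phi> (f v)) i}"
    then obtain i where i: "i \<in> f ` pos" "x = \<phi> i" by blast
    then have "i \<in> {i \<in> f ` pos. odd i = o' \<and> j < cnt f i}" using x c[of i] assms(2) by (simp del: image_iff)
    then show "x \<in> \<phi> ` {i \<in> f ` pos. odd i = o' \<and> j < cnt f i}" using i(2) by blast
  next
    fix x assume "x \<in> \<phi> ` {i \<in> f ` pos. odd i = o' \<and> j < cnt f i}"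
    then obtain i where i: "i \<in> f ` pos" "odd i = o'" "j < cnt f i" "x = \<phi> i" by blast
    have "odd x = o'" "j < cnt (%v. \<phi> (f v)) x" using c[of i] assms(2) i by simp_all
    then show "x \<in> {i \<in> \<phi> ` f ` pos. odd i = o' \<and> j < cnt (%v. \<phi> (f v)) i}" using i by blast
  qed
  then show "ctype (%v. \<phi> (f v)) = ctype f"
    unfolding ctype_def[abs_def] im by (simp add: card_image[OF inj])
qed

lemma ctype_cnt: "cnt f = cnt f' ==> ctype f = ctype f'"
  using image_pos_cnt[of f f'] by (simp add: ctype_def fun_eq_iff)

text \<open>Letters of \<open>b\<close> as letters of \<open>spl b\<close>, with the even ones kept negative.\<close>

definition split_letter :: "nat => nat" where "split_letter k = 2 * k + k mod 2"

lemma split_letter: "inj split_letter" "even (split_letter k) \<longleftrightarrow> even k" "split_letter k div 2 = k"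
proof -
  show d: "split_letter k div 2 = k" for k by (simp add: split_letter_def)
  show "inj split_letter" by (rule inj_on_inverseI[of _ "%k. k div 2"]) (rule d)
  show "even (split_letter k) \<longleftrightarrow> even k" by (simp add: split_letter_def)
qed

text \<open>Splitting an even letter can only turn negative positions into positive ones, and the content
  is unchanged when it does not.\<close>

lemma nsize_spl:
  assumes F: "F \<in> spl b"
  shows "nsize F \<le> nsize b" "nsize F = nsize b ==> ctype F = ctype b \<and> Q F = Q b"
proof -
  have c: "cnt (%v. F v div 2) = cnt b" and o: "\<And>v. v \<in> pos ==> even (F v) ==> even (F v div 2)"
    using F by (auto simp: spl_def simp del: atLeastAtMost_iff)
  have nb: "nsize b = card {v \<in> pos. even (F v div 2)}" using nsize_cnt[OF c] by (simp add: nsize_def)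
  have sub: "{v \<in> pos. even (F v)} \<subseteq> {v \<in> pos. even (F v div 2)}" using o by blast
  show "nsize F \<le> nsize b" unfolding nb unfolding nsize_def by (rule card_mono[OF finite_pos_Collect sub])
  assume "nsize F = nsize b"
  then have eq: "{v \<in> pos. even (F v)} = {v \<in> pos. even (F v div 2)}"
    unfolding nb unfolding nsize_def by (intro card_subset_eq[OF finite_pos_Collect sub])
  have "F v = split_letter (F v div 2)" if "v \<in> pos" for v
  proof -
    have "even (F v) \<longleftrightarrow> even (F v div 2)" using eq that by blast
    then have "F v mod 2 = F v div 2 mod 2" by (simp add: mod2_eq_if)
    then show ?thesis unfolding split_letter_def by (metis div_mult_mod_eq mult.commute)
  qed
  then have "cnt F = cnt (%v. split_letter (F v div 2))" by (rule cnt_cong)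
  then show "ctype F = ctype b \<and> Q F = Q b"
    using ctype_cnt Q_cnt ctype_relabel[OF split_letter(1,2), of "%v. F v div 2"] ctype_cnt[OF c] Q_cnt[OF c] by metis
qed

lemma split_letter_spl:
  assumes b: "mono_word b" shows "restrict (%v. split_letter (b v)) pos \<in> spl b"
proof -
  have "cnt (%v. restrict (%v. split_letter (b v)) pos v div 2) = cnt b" by (rule cnt_cong) (simp add: split_letter)
  then show ?thesis by (auto simp: spl_def split_letter simp del: atLeastAtMost_iff)
qed

definition spl_pairing :: "(int => nat) => (int => nat) => int" where
  "spl_pairing b b' = (\<Sum>g\<in>carrier G. M (spl b) g * eps g * M (rcl (hc b')) g)"

text \<open>A transversal pair has the same number of even letters in both words.\<close>

lemma spl_pairing_nonzero:
  assumes "spl_pairing b b' ~= 0"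
  shows "nsize b' \<le> nsize b" "nsize b = nsize b' ==> Q b \<le> Q b'" "nsize b = nsize b' ==> Q b = Q b' ==> ctype b = ctype b'"
proof -
  have "\<exists>F\<in>spl b. \<exists>h\<in>rcl (hc b'). pairing F h ~= 0"
    using assms unfolding spl_pairing_def sum_M_pairing by (metis (mono_tags, lifting) sum.neutral)
  then obtain F h where F: "F \<in> spl b" and h: "cnt h = cnt (hc b')" and t: "transversal F h"
    unfolding pairing_eq by (auto simp: rcl_def split: if_splits)
  have "nsize F = nsize h" using t unfolding nsize_def transversal_def by (metis (mono_tags, lifting))
  also have "\<dots> = nsize (hc b')" by (rule nsize_cnt[OF h])
  also have "\<dots> = nsize b'" by (simp add: nsize_def)
  finally have nF: "nsize F = nsize b'" .
  show "nsize b' \<le> nsize b" using nsize_spl(1)[OF F] nF by simp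
  show "nsize b = nsize b' ==> Q b \<le> Q b'" using nsize_spl(2)[OF F] nF transversal_Q(1)[OF t h] by simp
  show "nsize b = nsize b' ==> Q b = Q b' ==> ctype b = ctype b'"
    using nsize_spl(2)[OF F] nF transversal_Q(2)[OF t h] by simp
qed

lemma spl_pairing_self: assumes b: "mono_word b" shows "spl_pairing b b ~= 0"
proof -
  let ?F = "restrict (%v. split_letter (b v)) pos" and ?h = "restrict (hc b) pos"
  have F: "?F \<in> spl b" by (rule split_letter_spl[OF b])
  have h: "?h \<in> rcl (hc b)" by (simp add: rcl_def)
  have "transversal ?F ?h"
    using hc_transversal[of b] injD[OF split_letter(1)] split_letter(2) by (auto simp: transversal_def inj_on_def simp del: atLeastAtMost_iff)
  then have p: "0 < pairing ?F ?h" by (simp add: pairing_eq)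
  have nn: "0 \<le> pairing F h" for F h by (simp add: pairing_eq)
  have f: "finite (spl b)" using closed_spl by (simp add: closed_family_def)
  have "pairing ?F ?h \<le> (\<Sum>h\<in>rcl (hc b). pairing ?F h)"
    by (rule member_le_sum[OF h]) (simp_all add: nn finite_rcl)
  also have "\<dots> \<le> (\<Sum>F\<in>spl b. \<Sum>h\<in>rcl (hc b). pairing F h)"
    by (rule member_le_sum[OF F, of "%F. \<Sum>h\<in>rcl (hc b). pairing F h"]) (simp_all add: nn f sum_nonneg)
  finally show ?thesis using p unfolding spl_pairing_def sum_M_pairing by simp
qed

text \<open>The permutation characters of representatives of the types are independent: pair with the class of greatest
  negative part and, among these, least \<open>Q\<close>.\<close>

lemma Th_types_independent:
  assumes b: "\<And>I. I \<in> P0 G n s ==> mono_word (b I) \<and> I = gens (b I)"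
    and inj: "\<And>I J. I \<in> P0 G n s ==> J \<in> P0 G n s ==> c I ~= 0 ==> c J ~= 0 ==> ctype (b I) = ctype (b J) ==> I = J"
    and z: "\<And>g. g \<in> carrier G ==> Th c g = 0" and I: "I \<in> P0 G n s"
  shows "c I = 0"
proof (rule ccontr)
  assume cI: "c I ~= 0"
  let ?P = "P0 G n s"
  let ?C = "{I \<in> ?P. c I ~= 0}"
  define N where "N = Max ((%I. nsize (b I)) ` ?C)"
  have fC: "finite ?C" by (rule finite_subset[OF _ finite_P0]) blast
  have nN: "nsize (b J) \<le> N" if "J \<in> ?C" for J unfolding N_def by (rule Max_ge) (use fC that in auto)
  have "N \<in> (%I. nsize (b I)) ` ?C" unfolding N_def by (rule Max_in) (use fC I cI in auto)
  then obtain J0 where J0: "J0 \<in> ?C \<and> nsize (b J0) = N" by blast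
  define J where "J = (ARG_MIN (%I. Q (b I)) I. I \<in> ?C \<and> nsize (b I) = N)"
  have J: "J \<in> ?C \<and> nsize (b J) = N" unfolding J_def by (rule arg_min_natI[of "%I. I \<in> ?C \<and> nsize (b I) = N"]) (rule J0)
  have Jm: "Q (b J) \<le> Q (b K)" if "K \<in> ?C \<and> nsize (b K) = N" for K
    unfolding J_def by (rule arg_min_nat_le[of "%I. I \<in> ?C \<and> nsize (b I) = N", OF that])
  have p0: "c K * spl_pairing (b K) (b J) = 0" if K: "K \<in> ?P" "K ~= J" for K
  proof (rule ccontr)
    assume "c K * spl_pairing (b K) (b J) ~= 0"
    then have k: "K \<in> ?C" "spl_pairing (b K) (b J) ~= 0" using K by auto
    have ns: "nsize (b K) = nsize (b J)" using spl_pairing_nonzero(1)[OF k(2)] nN[OF k(1)] J by simp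
    have "Q (b K) = Q (b J)" using spl_pairing_nonzero(2)[OF k(2) ns] Jm[of K] k(1) ns J by simp
    then have "ctype (b K) = ctype (b J)" using spl_pairing_nonzero(3)[OF k(2) ns] by simp
    then show False using inj[of K J] K k(1) J by simp
  qed
  have "(of_int (\<Sum>K\<in>?P. c K * spl_pairing (b K) (b J)) :: complex) =
      (\<Sum>K\<in>?P. \<Sum>g\<in>carrier G. of_int (c K) * of_int (M (spl (b K)) g) * of_int (eps g * M (rcl (hc (b J))) g))"
    by (simp add: spl_pairing_def sum_distrib_left mult_ac)
  also have "\<dots> = (\<Sum>g\<in>carrier G. \<Sum>K\<in>?P. of_int (c K) * of_int (M (spl (b K)) g) * of_int (eps g * M (rcl (hc (b J))) g))"
    by (rule sum.swap)
  also have "\<dots> = (\<Sum>g\<in>carrier G. Th c g * of_int (eps g * M (rcl (hc (b J))) g))"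
  proof (rule sum.cong[OF HOL.refl])
    fix g assume g: "g \<in> carrier G"
    have "induced G (generate G K) (%_. 1) g = of_int (M (spl (b K)) g)" if "K \<in> ?P" for K
      using induced_eq_M[of "b K", OF _ g] b[OF that] by metis
    then show "(\<Sum>K\<in>?P. of_int (c K) * of_int (M (spl (b K)) g) * of_int (eps g * M (rcl (hc (b J))) g)) =
        Th c g * of_int (eps g * M (rcl (hc (b J))) g)"
      by (simp add: Th_def sum_distrib_right)
  qed
  also have "\<dots> = 0" using z by simp
  finally have "(\<Sum>K\<in>?P. c K * spl_pairing (b K) (b J)) = 0" by (simp only: of_int_eq_0_iff)
  moreover have "(\<Sum>K\<in>?P. c K * spl_pairing (b K) (b J)) = (\<Sum>K\<in>{J}. c K * spl_pairing (b K) (b J))"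
    by (rule sum.mono_neutral_right[OF finite_P0]) (use J p0 in auto)
  ultimately have "c J * spl_pairing (b J) (b J) = 0" by simp
  then show False using J spl_pairing_self b[of J] by auto
qed

text \<open>Replace every \<open>x\<^sub>I\<close> by the \<open>x\<^sub>J\<close> of a representative \<open>J\<close> of its type; by independence what
  remains is zero.\<close>

lemma kernel_as_differences:
  assumes z: "Th c = (%_. 0)"
  obtains r where "\<And>I. I \<in> P0 G n s ==> r I \<in> P0 G n s \<and> conj_sets G I (r I)"
    "comb c = (%w. \<Sum>I\<in>P0 G n s. c I * (x_elem G n s I w - x_elem G n s (r I) w))"
proof -
  let ?P = "P0 G n s"
  obtain b where b: "\<And>I. I \<in> ?P ==> mono_word (b I) \<and> I = gens (b I)"
  proof -
    have "\<forall>I\<in>?P. \<exists>b. mono_word b \<and> I = gens b"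
    proof
      fix I assume "I \<in> ?P"
      then show "\<exists>b. mono_word b \<and> I = gens b" by (rule P0_gens) blast
    qed
    from bchoice[OF this] show thesis using that by blast
  qed
  define r where "r I = (SOME J. J \<in> ?P \<and> ctype (b J) = ctype (b I))" for I
  have r: "r I \<in> ?P" "ctype (b (r I)) = ctype (b I)" if "I \<in> ?P" for I
  proof -
    have "r I \<in> ?P \<and> ctype (b (r I)) = ctype (b I)" unfolding r_def by (rule someI[of _ I]) (use that in simp)
    then show "r I \<in> ?P" "ctype (b (r I)) = ctype (b I)" by auto
  qed
  have req: "r I = r J" if "ctype (b I) = ctype (b J)" for I J using that by (simp add: r_def)
  have cj: "conj_sets G I (r I)" if I: "I \<in> ?P" for I
    using ctype_conj_sets[of "b I" "b (r I)"] b[OF I] b[OF r(1)[OF I]] r(2)[OF I] by metis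
  define c' where "c' = (%K. \<Sum>I\<in>?P. c I * dlt (r I) K)"
  have C': "comb c' = (%w. \<Sum>I\<in>?P. c I * x_elem G n s (r I) w)"
    unfolding c'_def comb_sum using r(1) by (simp add: comb_dlt)
  have "Th c' g = 0" for g
  proof -
    have "Th c' g = (\<Sum>I\<in>?P. of_int (c I) * induced G (generate G (r I)) (%_. 1) g)"
      unfolding c'_def Th_sum using r(1) by (simp add: Th_dlt)
    also have "\<dots> = Th c g" unfolding Th_def
    proof (rule sum.cong[OF HOL.refl])
      fix I assume I: "I \<in> ?P"
      then have "I \<subseteq> carrier G" by (auto simp: P0_def S_ext_def)
      from conj_sets_induced[OF this cj[OF I]]
      show "of_int (c I) * induced G (generate G (r I)) (%_. 1) g = of_int (c I) * induced G (generate G I) (%_. 1) g" by simp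
    qed
    finally show ?thesis using z by simp
  qed
  have "c' K = 0" if K: "K \<in> ?P" for K
  proof (rule Th_types_independent[OF b _ _ K])
    fix I J assume IJ: "I \<in> ?P" "J \<in> ?P" "c' I ~= 0" "c' J ~= 0" "ctype (b I) = ctype (b J)"
    have "I \<in> r ` ?P" if "c' I ~= 0" for I
    proof (rule ccontr)
      assume "I \<notin> r ` ?P"
      then have "c' I = 0" unfolding c'_def by (intro sum.neutral) (auto simp: dlt_def)
      then show False using that by simp
    qed
    then obtain I' J' where "I = r I'" "J = r J'" "I' \<in> ?P" "J' \<in> ?P" using IJ(3,4) by blast
    then show "I = J" using IJ(5) r(2) req by metis
  qed (use \<open>\<And>g. Th c' g = 0\<close> in auto)
  then have "comb c' = (%w. 0)" by (simp add: comb_def fun_eq_iff)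
  then have "comb c w = (\<Sum>I\<in>?P. c I * (x_elem G n s I w - x_elem G n s (r I) w))" for w
    using fun_cong[OF C', of w] by (simp add: comb_def right_diff_distrib sum_subtractf)
  then show thesis using that[of r] r(1) cj by blast
qed

end

section \<open>Nilpotence and the Jacobson radical\<close>

context ring begin

lemma nilpotent_unit:
  assumes z: "z \<in> carrier R" "z [^] (N::nat) = \<zero>"
  obtains u where "u \<in> carrier R" "u \<otimes> (\<one> \<ominus> z) = \<one>"
proof -
  have "\<exists>u\<in>carrier R. u \<otimes> (\<one> \<ominus> z) = \<one> \<ominus> z [^] (k::nat)" for k
  proof (induction k)
    case 0
    then show ?case using z(1) by (intro bexI[of _ \<zero>]) (simp_all add: a_minus_def r_neg)
  next
    case (Suc k)
    then obtain u where u: "u \<in> carrier R" "u \<otimes> (\<one> \<ominus> z) = \<one> \<ominus> z [^] k" by blast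
    let ?p = "z [^] k"
    have p: "?p \<in> carrier R" using z(1) by simp
    have "(u \<oplus> ?p) \<otimes> (\<one> \<ominus> z) = (\<one> \<ominus> ?p) \<oplus> (?p \<ominus> ?p \<otimes> z)"
    proof -
      have "(u \<oplus> ?p) \<otimes> (\<one> \<ominus> z) = u \<otimes> (\<one> \<ominus> z) \<oplus> ?p \<otimes> (\<one> \<ominus> z)" using u(1) p z(1) by (simp add: l_distr)
      moreover have "?p \<otimes> (\<one> \<ominus> z) = ?p \<ominus> ?p \<otimes> z" using p z(1) by (simp add: r_distr a_minus_def r_minus)
      ultimately show ?thesis using u(2) by simp
    qed
    also have "\<dots> = \<one> \<ominus> ?p \<otimes> z" using p z(1) by algebra
    finally show ?case using u(1) p by (intro bexI[of _ "u \<oplus> ?p"]) simp_all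
  qed
  then obtain u where "u \<in> carrier R" "u \<otimes> (\<one> \<ominus> z) = \<one> \<ominus> \<zero>" using z(2) by metis
  then show thesis using that by (simp add: a_minus_def)
qed

lemma left_ideal_one: "left_ideal L R ==> \<one> \<in> L ==> L = carrier R"
proof -
  assume L: "left_ideal L R" and o: "\<one> \<in> L"
  have "L \<subseteq> carrier R" using L subgroup.subset[of L "add_monoid R"] by (simp add: left_ideal_def)
  moreover have "a \<in> L" if "a \<in> carrier R" for a
    using L o that r_one[of a] unfolding left_ideal_def by metis
  ultimately show ?thesis by blast
qed

text \<open>If \<open>a\<close> lies outside the maximal left ideal \<open>L\<close>, then \<open>1 = l + b a\<close> with \<open>l \<in> L\<close>; but \<open>1 - b a\<close> is a
  unit when \<open>b a\<close> is nilpotent.\<close>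

lemma nil_in_jacobson_radical:
  assumes a: "a \<in> carrier R" and nil: "\<And>b. b \<in> carrier R ==> \<exists>N::nat. (b \<otimes> a) [^] N = \<zero>"
  shows "a \<in> jacobson_radical R"
  unfolding jacobson_radical_def
proof (intro CollectI conjI allI impI a, rule ccontr)
  fix L assume L: "maximal_left_ideal L R" and aL: "a \<notin> L"
  have li: "left_ideal L R" using L by (simp add: maximal_left_ideal_def)
  interpret S: subgroup L "add_monoid R" using li by (simp add: left_ideal_def)
  have Lc: "x \<in> carrier R" if "x \<in> L" for x using S.mem_carrier[OF that] by simp
  have Ladd: "x \<oplus> y \<in> L" if "x \<in> L" "y \<in> L" for x y using S.m_closed[OF that] by simp
  have Lneg: "\<ominus> x \<in> L" if "x \<in> L" for x using S.m_inv_closed[OF that] by (simp add: a_inv_def)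
  have L0: "\<zero> \<in> L" using S.one_closed by simp
  have Lm: "b \<otimes> x \<in> L" if "b \<in> carrier R" "x \<in> L" for b x using li that by (simp add: left_ideal_def)
  define L' where "L' = {l \<oplus> b \<otimes> a | l b. l \<in> L \<and> b \<in> carrier R}"
  have "left_ideal L' R"
    unfolding left_ideal_def
  proof (intro conjI ballI)
    show "subgroup L' (add_monoid R)"
    proof (rule add.subgroupI)
      show "L' \<subseteq> carrier R" using Lc a by (auto simp: L'_def)
      show "L' ~= {}" using L0 by (auto simp: L'_def)
      show "\<ominus> x \<in> L'" if x: "x \<in> L'" for x
      proof -
        obtain l b where l: "l \<in> L" "b \<in> carrier R" "x = l \<oplus> b \<otimes> a" using x by (auto simp: L'_def)
        have "\<ominus> x = \<ominus> l \<oplus> (\<ominus> b) \<otimes> a" using l Lc[OF l(1)] a by (simp add: minus_add l_minus)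
        then show ?thesis using Lneg[OF l(1)] l(2) unfolding L'_def by blast
      qed
      show "x \<oplus> y \<in> L'" if "x \<in> L'" "y \<in> L'" for x y
      proof -
        obtain l b where l: "l \<in> L" "b \<in> carrier R" "x = l \<oplus> b \<otimes> a" using \<open>x \<in> L'\<close> by (auto simp: L'_def)
        obtain l' b' where l': "l' \<in> L" "b' \<in> carrier R" "y = l' \<oplus> b' \<otimes> a" using \<open>y \<in> L'\<close> by (auto simp: L'_def)
        have "x \<oplus> y = (l \<oplus> l') \<oplus> (b \<oplus> b') \<otimes> a" using l l' Lc[OF l(1)] Lc[OF l'(1)] a by (simp add: l_distr a_ac)
        then show ?thesis using Ladd[OF l(1) l'(1)] l(2) l'(2) unfolding L'_def by blast
      qed
    qed
    fix d x assume d: "d \<in> carrier R" and "x \<in> L'"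
    then obtain l b where l: "l \<in> L" "b \<in> carrier R" "x = l \<oplus> b \<otimes> a" by (auto simp: L'_def)
    have "d \<otimes> x = d \<otimes> l \<oplus> (d \<otimes> b) \<otimes> a" using d l Lc[OF l(1)] a by (simp add: r_distr m_assoc)
    then show "d \<otimes> x \<in> L'" using Lm[OF d l(1)] d l(2) unfolding L'_def by blast
  qed
  moreover have "L \<subseteq> L'"
  proof
    fix l assume l: "l \<in> L"
    have "l = l \<oplus> \<zero> \<otimes> a" using Lc[OF l] a by simp
    then show "l \<in> L'" using l unfolding L'_def by blast
  qed
  moreover have "a \<in> L'"
  proof -
    have "a = \<zero> \<oplus> \<one> \<otimes> a" using a by simp
    then show ?thesis using L0 unfolding L'_def by blast
  qed
  ultimately have "L' = carrier R" using L aL unfolding maximal_left_ideal_def by blast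
  then obtain l b where l: "l \<in> L" "b \<in> carrier R" "\<one> = l \<oplus> b \<otimes> a" using one_closed unfolding L'_def by blast
  have bc: "b \<otimes> a \<in> carrier R" using l a by simp
  obtain N where "(b \<otimes> a) [^] (N::nat) = \<zero>" using nil[OF l(2)] by blast
  then obtain u where u: "u \<in> carrier R" "u \<otimes> (\<one> \<ominus> b \<otimes> a) = \<one>" by (rule nilpotent_unit[OF bc])
  have "\<one> \<ominus> b \<otimes> a = l" using l Lc[OF l(1)] bc by (simp add: a_minus_def a_assoc r_neg)
  then have "\<one> \<in> L" using u Lm[OF u(1) l(1)] by simp
  then have "L = carrier R" by (rule left_ideal_one[OF li])
  then show False using aL a by blast
qed

text \<open>A left ideal that contains an element outside the kernel contains a preimage of the inverse of
  its value times this element, which differs from \<open>1\<close> by an element of the kernel.\<close>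

lemma hom_to_field_kernel_maximal:
  fixes \<phi> :: "'a => 'k::field"
  assumes add: "\<And>a b. a \<in> carrier R ==> b \<in> carrier R ==> \<phi> (a \<oplus> b) = \<phi> a + \<phi> b"
    and mult: "\<And>a b. a \<in> carrier R ==> b \<in> carrier R ==> \<phi> (a \<otimes> b) = \<phi> a * \<phi> b"
    and one: "\<phi> \<one> = 1" and surj: "\<And>t. \<exists>e\<in>carrier R. \<phi> e = t"
  shows "maximal_left_ideal {a \<in> carrier R. \<phi> a = 0} R" (is "maximal_left_ideal ?L R")
proof -
  have zero: "\<phi> \<zero> = 0"
    using add[OF zero_closed zero_closed] by (simp only: r_zero zero_closed add_cancel_right_right)
  have neg: "\<phi> (\<ominus> a) = - \<phi> a" if "a \<in> carrier R" for a
    using add[OF that a_inv_closed[OF that]] zero that by (simp add: r_neg eq_neg_iff_add_eq_0 add.commute)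
  have li: "left_ideal ?L R"
    unfolding left_ideal_def
  proof (intro conjI ballI)
    show "subgroup ?L (add_monoid R)"
      by (rule add.subgroupI) (use zero neg add in auto)
  qed (use mult in auto)
  have mx: "L' = ?L \<or> L' = carrier R" if L': "left_ideal L' R" "?L \<subseteq> L'" for L'
  proof (cases "L' \<subseteq> ?L")
    case True then show ?thesis using L'(2) by blast
  next
    case False
    interpret S: subgroup L' "add_monoid R" using L'(1) by (simp add: left_ideal_def)
    obtain a where a: "a \<in> L'" "a \<notin> ?L" using False by blast
    have ac: "a \<in> carrier R" using S.mem_carrier[OF a(1)] by simp
    then have t: "\<phi> a ~= 0" using a(2) by simp
    obtain e where e: "e \<in> carrier R" "\<phi> e = inverse (\<phi> a)" using surj by blast
    have ea: "e \<otimes> a \<in> L'" using L'(1) e(1) a(1) by (simp add: left_ideal_def)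
    have eac: "e \<otimes> a \<in> carrier R" using e(1) ac by simp
    have "\<phi> (\<one> \<ominus> e \<otimes> a) = \<phi> \<one> + \<phi> (\<ominus> (e \<otimes> a))"
      unfolding a_minus_def by (rule add[OF one_closed a_inv_closed[OF eac]])
    also have "\<dots> = 1 - \<phi> e * \<phi> a" by (simp only: one neg[OF eac] mult[OF e(1) ac]) simp
    finally have "\<phi> (\<one> \<ominus> e \<otimes> a) = 0" using e(2) t by simp
    then have "\<one> \<ominus> e \<otimes> a \<in> ?L" using eac by simp
    then have "\<one> \<ominus> e \<otimes> a \<in> L'" by (rule set_mp[OF L'(2)])
    then have "(\<one> \<ominus> e \<otimes> a) \<oplus> e \<otimes> a \<in> L'" using S.m_closed[OF _ ea] by simp
    also have "(\<one> \<ominus> e \<otimes> a) \<oplus> e \<otimes> a = \<one>" using e(1) ac by (simp add: a_minus_def a_assoc l_neg)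
    finally show ?thesis using left_ideal_one[OF L'(1)] by blast
  qed
  have "\<one> \<notin> ?L" using one by simp
  then have "?L ~= carrier R" using one_closed by blast
  then show ?thesis unfolding maximal_left_ideal_def using li mx by blast
qed

end

context finite_group begin

primrec cpow :: "('a => 'r::comm_ring_1) => nat => 'a => 'r" where
  "cpow y 0 = (%w. if w = \<one> then 1 else 0)"
| "cpow y (Suc k) = conv (cpow y k) y"

lemma cpow_carrier: "cpow y k \<in> carrier (group_ring G)"
proof (cases k)
  case 0 then show ?thesis by (auto simp: group_ring_carrier)
next
  case (Suc j) then show ?thesis by (simp add: conv_closed)
qed

text \<open>The trace of left multiplication by \<open>y\<close> on the group algebra is \<open>|G|\<close> times the coefficient of the
  identity in \<open>y\<close>.\<close>

lemma conv_nilpotent: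
  fixes y :: "'a => complex"
  assumes y: "y \<in> carrier (group_ring G)" and z: "\<And>k. k \<ge> 1 ==> cpow y k \<one> = 0"
  shows "cpow y (card (carrier G)) = (%w. 0)"
proof -
  let ?N = "card (carrier G)"
  obtain e where e: "bij_betw e {0..<?N} (carrier G)" using ex_bij_betw_nat_finite[OF fin] by blast
  have ec: "e i \<in> carrier G" if "i < ?N" for i using e that by (auto simp: bij_betw_def)
  define A where "A y = mat ?N ?N (%(i, j). y (e i \<otimes> inv (e j)))" for y :: "'a => complex"
  have A[simp]: "A y \<in> carrier_mat ?N ?N" for y by (simp add: A_def)
  have cn: "x \<otimes> (inv x \<otimes> b) = b" "inv x \<otimes> (x \<otimes> b) = b" if "x \<in> carrier G" "b \<in> carrier G" for x b
    using that by (simp_all add: m_assoc[symmetric])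
  have Am: "A (conv y z) = A y * A z" for y z
  proof (rule eq_matI)
    fix i j assume "i < dim_row (A y * A z)" "j < dim_col (A y * A z)"
    then have ij: "i < ?N" "j < ?N" by (simp_all add: A_def)
    have "(A y * A z) $$ (i, j) = (\<Sum>l = 0..<?N. y (e i \<otimes> inv (e l)) * z (e l \<otimes> inv (e j)))"
      using ij by (simp add: A_def scalar_prod_def)
    also have "\<dots> = (\<Sum>x\<in>carrier G. y (e i \<otimes> inv x) * z (x \<otimes> inv (e j)))"
      by (rule sum.reindex_bij_betw[OF e])
    also have "\<dots> = (\<Sum>x\<in>carrier G. y x * z (inv x \<otimes> (e i \<otimes> inv (e j))))"
      by (rule sum.reindex_bij_witness[of _ "%x. inv x \<otimes> e i" "%x. e i \<otimes> inv x"])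
        (use ec ij in \<open>auto simp: m_assoc inv_mult_group cn\<close>)
    also have "\<dots> = conv y z (e i \<otimes> inv (e j))" using ec ij by (simp add: conv_eq)
    finally show "A (conv y z) $$ (i, j) = (A y * A z) $$ (i, j)" using ij by (simp add: A_def)
  qed (simp_all add: A_def)
  have A1: "A (%w. if w = \<one> then 1 else 0) = 1\<^sub>m ?N"
  proof (rule eq_matI)
    fix i j assume ij: "i < dim_row (1\<^sub>m ?N)" "j < dim_col (1\<^sub>m ?N)"
    have "e i \<otimes> inv (e j) = \<one> \<longleftrightarrow> i = j"
    proof
      assume "e i \<otimes> inv (e j) = \<one>"
      then have "e i = e j" using ec ij by (simp add: inv_solve_right')
      then show "i = j" using e ij by (auto simp: bij_betw_def inj_on_def)
    qed (use ec ij in simp)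
    then show "A (%w. if w = \<one> then 1 else 0) $$ (i, j) = 1\<^sub>m ?N $$ (i, j)" using ij by (simp add: A_def)
  qed (simp_all add: A_def)
  have Ap: "A (cpow y k) = A y ^\<^sub>m k" for k
  proof (induction k)
    case 0
    have "dim_row (A y) = ?N" by (simp add: A_def)
    then show ?case using A1 by simp
  next
    case (Suc k) then show ?case by (simp add: Am)
  qed
  have "A y ^\<^sub>m ?N = 0\<^sub>m ?N ?N"
  proof (rule nilpotent_if_traces_zero[OF A])
    fix k :: nat assume k: "k \<ge> 1"
    have "mtrace (A (cpow y k)) = (\<Sum>i<?N. cpow y k \<one>)"
      unfolding mtrace_def using ec by (simp add: A_def)
    then show "mtrace (A y ^\<^sub>m k) = 0" using z[OF k] by (simp add: Ap)
  qed
  then have A0: "A (cpow y ?N) = 0\<^sub>m ?N ?N" by (simp add: Ap)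
  show ?thesis
  proof
    fix w
    show "cpow y ?N w = 0"
    proof (cases "w \<in> carrier G")
      case False then show ?thesis using cpow_carrier[of y ?N] by (simp add: group_ring_carrier)
    next
      case True
      have "w \<in> e ` {0..<?N}" "\<one> \<in> e ` {0..<?N}" using e True one_closed by (simp_all add: bij_betw_def)
      then obtain i j where ij: "i < ?N" "w = e i" "j < ?N" "\<one> = e j" by auto
      have "A (cpow y ?N) $$ (i, j) = cpow y ?N (e i \<otimes> inv (e j))" using ij(1,3) by (simp add: A_def)
      also have "e i \<otimes> inv (e j) = w" using ij(2) True unfolding ij(4)[symmetric] by simp
      finally show ?thesis using A0 ij by simp
    qed
  qed
qed

lemma conv_of_rat: "conv (%w. of_rat (f w)) (%w. of_rat (g w)) = (%w. (of_rat (conv f g w) :: complex))"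
  by (rule ext) (auto simp: conv_def of_rat_sum of_rat_mult intro!: sum.cong)

lemma cpow_of_rat: "cpow (%w. (of_rat (y w) :: complex)) k = (%w. of_rat (cpow y k w))"
  by (induction k) (auto simp: conv_of_rat)

lemma conv_nilpotent_rat:
  fixes y :: "'a => rat"
  assumes y: "y \<in> carrier (group_ring G)" and z: "\<And>k. k \<ge> 1 ==> cpow y k \<one> = 0"
  shows "cpow y (card (carrier G)) = (%w. 0)"
proof -
  have "cpow (%w. (of_rat (y w) :: complex)) (card (carrier G)) = (%w. 0)"
    by (rule conv_nilpotent) (use y z in \<open>auto simp: group_ring_carrier cpow_of_rat\<close>)
  then show ?thesis by (simp add: cpow_of_rat fun_eq_iff)
qed

end

context coxeter_C begin

section \<open>Rational combinations\<close>

text \<open>The value of the induced character as an integer, for transport to the rationals.\<close>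

definition icoef :: "'a set => 'a => int" where
  "icoef I g = (SOME k. induced G (generate G I) (%_. 1) g = of_int k)"

lemma icoef: "I \<in> P0 G n s ==> induced G (generate G I) (%_. 1) g = of_int (icoef I g)"
  unfolding icoef_def
proof (rule someI_ex)
  assume "I \<in> P0 G n s"
  then obtain b where b: "mono_word b" "I = gens b" by (rule P0_gens) blast
  show "\<exists>k. induced G (generate G I) (%_. 1) g = of_int k"
  proof (cases "g \<in> carrier G")
    case True then show ?thesis using induced_eq_M[OF b(1)] b(2) by blast
  next
    case False then show ?thesis by (intro exI[of _ 0]) (simp add: induced_out)
  qed
qed

definition ratcomb :: "('a set => rat) => 'a => rat" where
  "ratcomb q w = (\<Sum>I\<in>P0 G n s. q I * of_int (x_elem G n s I w))"

text \<open>The rational extension of \<open>Th\<close>; its values are rational because the induced characters are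
  integral.\<close>

definition RTh :: "('a set => rat) => 'a => rat" where
  "RTh q g = (\<Sum>I\<in>P0 G n s. q I * of_int (icoef I g))"

lemma Th_icoef: "Th c g = of_int (\<Sum>I\<in>P0 G n s. c I * icoef I g)"
  unfolding Th_def of_int_sum of_int_mult by (rule sum.cong[OF HOL.refl]) (simp add: icoef)

lemma RTh_of_int: "of_rat (RTh (%I. of_int (c I)) g) = Th c g"
  unfolding Th_icoef by (simp add: RTh_def of_rat_sum of_rat_mult)

lemma ratcomb_of_int: "ratcomb (%I. of_int (c I)) w = of_int (comb c w)"
  by (simp add: ratcomb_def comb_def)

lemma clear_denominators:
  fixes q :: "'k => rat"
  assumes "finite P" shows "\<exists>N c. N ~= 0 \<and> (\<forall>I\<in>P. of_int (c I) = of_int N * q I)"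
  using assms
proof (induction P)
  case empty then show ?case by (intro exI[of _ 1]) auto
next
  case (insert J P)
    then obtain N c where N: "N ~= 0" "\<forall>I\<in>P. of_int (c I) = of_int N * q I" by blast
    obtain a b where ab: "q J = Rat.Fract a b" "b > 0" by (metis Rat_cases)
    have qb: "of_int b * q J = of_int a" using ab by (simp add: Fract_of_int_quotient)
    let ?c = "%I. if I = J then N * a else b * c I"
    have "N * b ~= 0 \<and> (\<forall>I\<in>insert J P. of_int (?c I) = of_int (N * b) * q I)"
  proof (intro conjI ballI)
    show "N * b ~= 0" using N ab(2) by simp
    fix I assume I: "I \<in> insert J P"
    show "of_int (?c I) = of_int (N * b) * q I"
    proof (cases "I = J")
      case True then show ?thesis using qb by (simp add: mult.assoc)
    next
      case False
      then have "of_int (c I) = of_int N * q I" using I N by blast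
      then show ?thesis using False by simp
    qed
  qed
  then show ?case by (rule exI[of _ "N * b", OF exI[of _ ?c]])
qed

text \<open>Statements about rational combinations are reduced to integral ones by clearing denominators.\<close>

lemma ratcomb_scale:
  "\<exists>N c. N ~= 0 \<and> (\<forall>w. of_int N * ratcomb q w = of_int (comb c w)) \<and>
    (\<forall>g. of_int N * RTh q g = RTh (%I. of_int (c I)) g) \<and> (\<forall>I\<in>P0 G n s. of_int (c I) = of_int N * q I)"
proof -
  obtain N :: int and c where N: "N ~= 0" "\<And>I. I \<in> P0 G n s ==> of_int (c I) = of_int N * q I"
    using clear_denominators[OF finite_P0, of q] by blast
  have "of_int N * ratcomb q w = of_int (comb c w)" for w
    unfolding ratcomb_def comb_def of_int_sum of_int_mult sum_distrib_left
    by (rule sum.cong[OF HOL.refl]) (simp add: N(2))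
  moreover have "of_int N * RTh q g = RTh (%I. of_int (c I)) g" for g
    unfolding RTh_def sum_distrib_left by (rule sum.cong[OF HOL.refl]) (simp add: N(2))
  ultimately show ?thesis using N by blast
qed

lemma x_independentD:
  assumes "\<And>w. (\<Sum>I\<in>P0 G n s. c I * x_elem G n s I w) = 0" "I \<in> P0 G n s" shows "c I = 0"
proof -
  have "(\<forall>w. (\<Sum>I\<in>P0 G n s. c I * x_elem G n s I w) = 0) --> (\<forall>I\<in>P0 G n s. c I = 0)"
    using x_independent unfolding int_independent_def by (rule spec)
  then show ?thesis using assms by blast
qed

lemma ratcomb_unique:
  assumes "ratcomb q = ratcomb q'" shows "RTh q = RTh q'"
proof -
  obtain N c where N: "N ~= 0" "\<And>w. of_int N * ratcomb (%I. q I - q' I) w = of_int (comb c w)"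
    "\<And>I. I \<in> P0 G n s ==> of_int (c I) = of_int N * (q I - q' I)"
    using ratcomb_scale[of "%I. q I - q' I"] by blast
  have "ratcomb (%I. q I - q' I) w = 0" for w
    using fun_cong[OF assms, of w] by (simp add: ratcomb_def left_diff_distrib sum_subtractf)
  then have "(\<Sum>I\<in>P0 G n s. c I * x_elem G n s I w) = 0" for w
  proof -
    have "comb c w = 0" using N(2)[of w] \<open>\<And>w. ratcomb (%I. q I - q' I) w = 0\<close> by simp
    then show ?thesis by (simp add: comb_def)
  qed
  then have "c I = 0" if "I \<in> P0 G n s" for I using x_independentD[of c I] that by blast
  then have "q I = q' I" if "I \<in> P0 G n s" for I using N(3)[OF that] N(1) that by simp
  then show ?thesis by (simp add: RTh_def fun_eq_iff)
qed

lemma x_inj: "inj_on (x_elem G n s) (P0 G n s)"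
proof (rule inj_onI, rule ccontr)
  fix I J assume IJ: "I \<in> P0 G n s" "J \<in> P0 G n s" "x_elem G n s I = x_elem G n s J" "I ~= J"
  have "(\<Sum>K\<in>P0 G n s. (dlt I K - dlt J K) * x_elem G n s K w) = 0" for w
    using fun_cong[OF comb_dlt[OF IJ(1)], of w] fun_cong[OF comb_dlt[OF IJ(2)], of w] IJ(3)
    by (simp add: comb_def left_diff_distrib sum_subtractf)
  then have "dlt I I - dlt J I = 0" by (rule x_independentD[of "%K. dlt I K - dlt J K"]) (rule IJ(1))
  then show False using IJ(4) by (simp add: dlt_def)
qed

lemma x_carrier: "x_elem G n s I \<in> carrier (group_ring G)"
  by (auto simp: x_elem_def X_set_def group_ring_carrier)

lemma comb_carrier: "comb c \<in> carrier (group_ring G)"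
  using x_carrier by (auto simp: comb_def group_ring_carrier intro!: sum.neutral)

lemma ratcomb_carrier: "ratcomb q \<in> carrier (group_ring G)"
  using x_carrier by (auto simp: ratcomb_def group_ring_carrier intro!: sum.neutral)

lemma Sigma_eq: "Sigma_ext G n s = range comb"
proof -
  have "Sigma_ext G n s = {(%w. \<Sum>i\<in>P0 G n s. of_int (c i) * x_elem G n s i w) | c. True}"
    unfolding Sigma_ext_def
    by (rule int_span_eq[OF ring.is_abelian_group[OF ring_group_ring]]) (simp_all add: finite_P0 x_carrier)
  then show ?thesis by (auto simp: comb_def[abs_def])
qed

lemma rat_extI: "finite F ==> F \<subseteq> K ==> (%w. \<Sum>m\<in>F. q m * of_int (m w)) \<in> rat_ext K"
  unfolding rat_ext_def mem_Collect_eq by (rule exI[of _ q], rule exI[of _ F]) simp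

lemma rat_ext_comb:
  assumes "K = {comb c | c. Z c}"
  shows "rat_ext K \<subseteq> {ratcomb q | q. True}"
    "a \<in> rat_ext K ==> \<exists>q (F :: ('a => int) set) cc. finite F \<and> (\<forall>m\<in>F. Z (cc m)) \<and> a = ratcomb (%I. \<Sum>m\<in>F. q m * of_int (cc m I))"
proof -
  show 2: "\<exists>q (F :: ('a => int) set) cc. finite F \<and> (\<forall>m\<in>F. Z (cc m)) \<and> a = ratcomb (%I. \<Sum>m\<in>F. q m * of_int (cc m I))" if a: "a \<in> rat_ext K" for a
  proof -
    obtain q F where F: "a = (%w. \<Sum>m\<in>F. q m * of_int (m w))" "finite F" "F \<subseteq> K"
      using a unfolding rat_ext_def by blast
    have "\<forall>m\<in>F. \<exists>c. m = comb c \<and> Z c" using F(3) assms by blast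
    from bchoice[OF this] obtain cc where cc: "\<And>m. m \<in> F ==> m = comb (cc m) \<and> Z (cc m)" by blast
    have "ratcomb (%I. \<Sum>m\<in>F. q m * of_int (cc m I)) w = (\<Sum>m\<in>F. q m * of_int (m w))" for w
    proof -
      have "ratcomb (%I. \<Sum>m\<in>F. q m * of_int (cc m I)) w =
          (\<Sum>I\<in>P0 G n s. \<Sum>m\<in>F. q m * (of_int (cc m I) * of_int (x_elem G n s I w)))"
        by (simp add: ratcomb_def sum_distrib_right mult.assoc)
      also have "\<dots> = (\<Sum>m\<in>F. \<Sum>I\<in>P0 G n s. q m * (of_int (cc m I) * of_int (x_elem G n s I w)))" by (rule sum.swap)
      also have "\<dots> = (\<Sum>m\<in>F. q m * of_int (comb (cc m) w))"
        unfolding sum_distrib_left[symmetric] comb_def by simp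
      also have "\<dots> = (\<Sum>m\<in>F. q m * of_int (m w))" using cc by (intro sum.cong HOL.refl) metis
      finally show ?thesis .
    qed
    then have e: "a = ratcomb (%I. \<Sum>m\<in>F. q m * of_int (cc m I))" using F(1) by (simp add: fun_eq_iff)
    show ?thesis by (intro exI[of _ q] exI[of _ F] exI[of _ cc] conjI ballI F(2) e) (use cc in blast)
  qed
  show "rat_ext K \<subseteq> {ratcomb q | q. True}" using 2 by blast
qed

lemma rat_ext_Sigma: "rat_ext (Sigma_ext G n s) = range ratcomb"
proof
  show "rat_ext (Sigma_ext G n s) \<subseteq> range ratcomb"
    using rat_ext_comb(1)[of "Sigma_ext G n s" "%_. True"] unfolding Sigma_eq by blast
  show "range ratcomb \<subseteq> rat_ext (Sigma_ext G n s)"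
  proof (rule image_subsetI)
    fix q
    let ?x = "x_elem G n s"
    have e: "ratcomb q = (%w. \<Sum>m\<in>?x ` P0 G n s. q (inv_into (P0 G n s) ?x m) * of_int (m w))"
      by (simp add: ratcomb_def fun_eq_iff sum.reindex[OF x_inj] inv_into_f_f[OF x_inj])
    have "?x ` P0 G n s \<subseteq> Sigma_ext G n s" unfolding Sigma_ext_def by (auto intro: generate.incl)
    then show "ratcomb q \<in> rat_ext (Sigma_ext G n s)"
      unfolding e by (rule rat_extI[OF finite_imageI[OF finite_P0]])
  qed
qed

lemma rat_ext_kernel: "rat_ext {comb c | c. Th c = (%_. 0)} = {ratcomb q | q. RTh q = (%_. 0)}" (is "rat_ext ?K = _")
proof (intro equalityI subsetI)
  fix a assume a: "a \<in> rat_ext ?K"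
  have "\<exists>q (F :: ('a => int) set) cc. finite F \<and> (\<forall>m\<in>F. Th (cc m) = (%_. 0)) \<and> a = ratcomb (%I. \<Sum>m\<in>F. q m * of_int (cc m I))"
    by (rule rat_ext_comb(2)[of ?K "%c. Th c = (%_. 0)", OF HOL.refl a])
  then obtain q F cc where F: "finite (F :: ('a => int) set)" "\<forall>m\<in>F. Th (cc m) = (%_. 0)" "a = ratcomb (%I. \<Sum>m\<in>F. q m * of_int (cc m I))"
    by (elim exE conjE) (rule that)
  have "RTh (%I. \<Sum>m\<in>F. q m * of_int (cc m I)) g = 0" for g
  proof -
    have "RTh (%I. \<Sum>m\<in>F. q m * of_int (cc m I)) g = (\<Sum>I\<in>P0 G n s. \<Sum>m\<in>F. q m * (of_int (cc m I) * of_int (icoef I g)))"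
      by (simp add: RTh_def sum_distrib_right mult.assoc)
    also have "\<dots> = (\<Sum>m\<in>F. \<Sum>I\<in>P0 G n s. q m * (of_int (cc m I) * of_int (icoef I g)))" by (rule sum.swap)
    also have "\<dots> = (\<Sum>m\<in>F. q m * RTh (%I. of_int (cc m I)) g)" by (simp add: sum_distrib_left RTh_def)
    also have "\<dots> = 0"
    proof (intro sum.neutral ballI)
      fix m assume "m \<in> F"
      then have "Th (cc m) g = 0" using F(2) by simp
      then have "RTh (%I. of_int (cc m I)) g = 0" unfolding RTh_of_int[symmetric] by simp
      then show "q m * RTh (%I. of_int (cc m I)) g = 0" by simp
    qed
    finally show ?thesis .
  qed
  then show "a \<in> {ratcomb q | q. RTh q = (%_. 0)}" using F(3) by blast
next
  fix a assume "a \<in> {ratcomb q | q. RTh q = (%_. 0)}"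
  then obtain q where q: "a = ratcomb q" "RTh q = (%_. 0)" by blast
  obtain N c where N: "N ~= 0" "\<And>w. of_int N * ratcomb q w = of_int (comb c w)"
    "\<And>g. of_int N * RTh q g = RTh (%I. of_int (c I)) g" using ratcomb_scale[of q] by blast
  have "Th c g = 0" for g using N(3)[of g] q(2) unfolding RTh_of_int[symmetric] by simp
  then have K: "{comb c} \<subseteq> ?K" by blast
  have e: "a = (%w. \<Sum>m\<in>{comb c}. (1 / of_int N) * of_int (m w))"
    unfolding q(1) using N(1) N(2)[symmetric] by (simp add: fun_eq_iff)
  show "a \<in> rat_ext ?K" unfolding e by (rule rat_extI[OF _ K]) simp
qed

lemma ratcomb_mult: "\<exists>e. conv (ratcomb q) (ratcomb q') = ratcomb e \<and> RTh e = (%g. RTh q g * RTh q' g)"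
proof -
  obtain N c where N: "N ~= 0" "\<And>w. of_int N * ratcomb q w = of_int (comb c w)"
    "\<And>g. of_int N * RTh q g = RTh (%I. of_int (c I)) g" using ratcomb_scale[of q] by blast
  obtain N' c' where N': "N' ~= 0" "\<And>w. of_int N' * ratcomb q' w = of_int (comb c' w)"
    "\<And>g. of_int N' * RTh q' g = RTh (%I. of_int (c' I)) g" using ratcomb_scale[of q'] by blast
  obtain e where e: "conv (comb c) (comb c') = comb e" "Th e = (%g. Th c g * Th c' g)" using comb_mult by blast
  let ?r = "1 / of_int (N * N') :: rat"
  let ?e = "%I. ?r * of_int (e I)"
  have q: "ratcomb q = (%w. \<Sum>i\<in>{()}. (1 / of_int N) * of_int (comb c w))"
    using N(1) N(2)[symmetric] by (simp add: fun_eq_iff)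
  have q': "ratcomb q' = (%w. \<Sum>i\<in>{()}. (1 / of_int N') * of_int (comb c' w))"
    using N'(1) N'(2)[symmetric] by (simp add: fun_eq_iff)
  have "conv (ratcomb q) (ratcomb q') = (%w. ?r * of_int (comb e w))"
    unfolding q q' conv_sum_left conv_sum_right conv_of_int e(1) by (simp add: fun_eq_iff)
  also have "\<dots> = ratcomb ?e"
    unfolding ratcomb_of_int[symmetric] by (simp add: ratcomb_def fun_eq_iff sum_distrib_left mult_ac)
  finally have 1: "conv (ratcomb q) (ratcomb q') = ratcomb ?e" .
  have "RTh ?e g = RTh q g * RTh q' g" for g
  proof -
    have "(of_rat (RTh (%I. of_int (e I)) g) :: complex) = of_rat (RTh (%I. of_int (c I)) g * RTh (%I. of_int (c' I)) g)"
      unfolding of_rat_mult RTh_of_int e(2) ..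
    then have m: "RTh (%I. of_int (e I)) g = (of_int N * RTh q g) * (of_int N' * RTh q' g)"
      unfolding N(3) N'(3) by (simp only: of_rat_eq_iff)
    have "RTh ?e g = ?r * RTh (%I. of_int (e I)) g" by (simp add: RTh_def sum_distrib_left mult_ac)
    then show ?thesis unfolding m using N(1) N'(1) by simp
  qed
  then show ?thesis using 1 by blast
qed

lemma one_ratcomb: obtains q where "ratcomb q = (%w. if w = \<one> then 1 else 0)" "\<And>g. g \<in> carrier G ==> RTh q g = 1"
proof -
  obtain c where c: "comb c = (%w. if w = \<one> then 1 else 0)" "Th c = (%g. if g \<in> carrier G then 1 else 0)"
    using one_comb by blast
  have "(of_rat (RTh (%I. of_int (c I)) g) :: complex) = of_rat 1" if "g \<in> carrier G" for g
    unfolding RTh_of_int c(2) using that by simp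
  then have "RTh (%I. of_int (c I)) g = 1" if "g \<in> carrier G" for g using that by (simp only: of_rat_eq_iff)
  moreover have "ratcomb (%I. of_int (c I)) = (%w. if w = \<one> then 1 else 0)"
    by (simp add: fun_eq_iff ratcomb_of_int c(1))
  ultimately show thesis using that by blast
qed

text \<open>The coefficient of the identity in an element of \<open>\<Sigma>'\<close> is the scalar product of its image with the trivial
  character; it vanishes on the kernel.\<close>

lemma ratcomb_at_one: assumes "RTh q = (%_. 0)" shows "ratcomb q \<one> = 0"
proof -
  have one: "x_elem G n s I \<one> = 1" if I: "I \<in> P0 G n s" for I
  proof -
    obtain b where b: "mono_word b" "I = gens b" using I by (rule P0_gens) blast
    have "\<one> \<in> Xb b" by (simp add: Xb_def)
    then show ?thesis by (simp add: x_elem_def b(2) X_set_gens)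
  qed
  have av: "(\<Sum>g\<in>carrier G. icoef I g) = int (card (carrier G))" if I: "I \<in> P0 G n s" for I
  proof -
    have Ic: "I \<subseteq> carrier G" using I by (auto simp: P0_def S_ext_def)
    interpret H: subgroup "generate G I" G by (rule generate_is_subgroup[OF Ic])
    have fH: "finite (generate G I)" by (rule finite_subset[OF H.subset finite_carrier])
    have cH: "card (generate G I) ~= 0" using fH H.one_closed by (metis card_0_eq empty_iff)
    have "(\<Sum>g\<in>carrier G. 1 * induced G (generate G I) (%_. 1) g) =
        of_nat (card (carrier G)) * ((\<Sum>h\<in>generate G I. 1) / of_nat (card (generate G I)))"
      by (rule frobenius_trivial[OF is_group finite_carrier H.is_subgroup]) simp
    then have "(of_int (\<Sum>g\<in>carrier G. icoef I g) :: complex) = of_int (int (card (carrier G)))"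
      using cH by (simp add: icoef[OF I])
    then show ?thesis by (simp only: of_int_eq_iff)
  qed
  have "of_nat (card (carrier G)) * ratcomb q \<one> = (\<Sum>I\<in>P0 G n s. q I * of_int (int (card (carrier G))))"
    by (simp add: ratcomb_def one sum_distrib_left mult_ac)
  also have "\<dots> = (\<Sum>I\<in>P0 G n s. \<Sum>g\<in>carrier G. q I * of_int (icoef I g))"
    by (rule sum.cong[OF HOL.refl]) (simp only: av[symmetric] of_int_sum sum_distrib_left)
  also have "\<dots> = (\<Sum>g\<in>carrier G. RTh q g)" unfolding RTh_def by (rule sum.swap)
  also have "\<dots> = 0" using assms by simp
  finally have "of_nat (card (carrier G)) * ratcomb q \<one> = 0" .
  moreover have "card (carrier G) ~= 0" using finite_carrier one_closed by (metis card_0_eq empty_iff)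
  ultimately show ?thesis by simp
qed

lemma kernel_nilpotent:
  assumes "RTh q = (%_. 0)" shows "cpow (ratcomb q) (card (carrier G)) = (%w. 0)"
proof (rule conv_nilpotent_rat[OF ratcomb_carrier])
  have pw: "\<exists>e. cpow (ratcomb q) (Suc j) = ratcomb e \<and> RTh e = (%_. 0)" for j
  proof (induction j)
    case 0
    have "cpow (ratcomb q) (Suc 0) = ratcomb q" by (simp add: conv_one_left[OF ratcomb_carrier])
    then show ?case using assms by blast
  next
    case (Suc j)
    then obtain e where e: "cpow (ratcomb q) (Suc j) = ratcomb e" "RTh e = (%_. 0)" by blast
    obtain d where d: "conv (ratcomb e) (ratcomb q) = ratcomb d" "RTh d = (%g. RTh e g * RTh q g)"
      using ratcomb_mult by blast
    have "cpow (ratcomb q) (Suc (Suc j)) = ratcomb d" using e(1) d(1) by (simp only: cpow.simps)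
    then show ?case using d(2) e(2) by auto
  qed
  fix k :: nat assume "1 \<le> k"
  then obtain j where "k = Suc j" by (cases k) auto
  then show "cpow (ratcomb q) k \<one> = 0" using pw[of j] ratcomb_at_one by metis
qed

section \<open>The morphism\<close>

lemma function_ring_simps [simp]:
  "zero (function_ring G) = (%w. 0)" "add (function_ring G) f g = (%w. f w + g w)"
  "f \<otimes>\<^bsub>function_ring G\<^esub> g = (%w. f w * g w)"
  "one (function_ring G) = (%x. if x \<in> carrier G then 1 else 0)"
  "carrier (function_ring G) = {f. \<forall>x. x \<notin> carrier G --> f x = 0}"
  by (simp_all add: function_ring_def)

lemma function_ring_abelian: "abelian_group (function_ring G)"
proof (rule abelian_groupI)
  fix f assume "f \<in> carrier (function_ring G)"
  then show "\<exists>g\<in>carrier (function_ring G). g \<oplus>\<^bsub>function_ring G\<^esub> f = \<zero>\<^bsub>function_ring G\<^esub>"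
    by (intro bexI[of _ "%w. - f w"]) auto
qed (auto simp: add_ac)

lemma virtual_characters_eq: "carrier (virtual_character_ring G) = range Th"
proof -
  let ?F = "function_ring G"
  let ?ind = "%I. induced G (generate G I) (%_. 1)"
  interpret F: abelian_group ?F by (rule function_ring_abelian)
  have indc: "?ind I \<in> carrier ?F" for I by (simp add: induced_out)
  have img: "generate (add_monoid ?F) (?ind ` P0 G n s) = range Th"
  proof -
    have "generate (add_monoid ?F) (?ind ` P0 G n s) = {(%w. \<Sum>i\<in>P0 G n s. of_int (c i) * ?ind i w) | c. True}"
      by (rule int_span_eq[OF function_ring_abelian]) (use finite_P0 indc in simp_all)
    then show ?thesis by (auto simp: Th_def[abs_def])
  qed
  have Irr: "Irr G \<subseteq> range Th"
  proof
    fix \<chi> assume "\<chi> \<in> Irr G"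
    then obtain d \<rho> where "representation G d \<rho>" "\<chi> = rep_character G d \<rho>"
      unfolding Irr_def irreducible_representation_def by blast
    then show "\<chi> \<in> range Th" using character_in_image by blast
  qed
  have "range Th \<subseteq> carrier ?F" using Th_out by auto
  then have IrrF: "Irr G \<subseteq> carrier ?F" using Irr by blast
  have sub: "subgroup (range Th) (add_monoid ?F)"
    unfolding img[symmetric] by (rule F.add.generate_is_subgroup) (use indc in auto)
  have "generate (add_monoid ?F) (Irr G) \<subseteq> range Th"
    by (rule F.add.generate_subgroup_incl[OF Irr sub])
  moreover have "range Th \<subseteq> generate (add_monoid ?F) (Irr G)"
    unfolding img[symmetric]
  proof (rule F.add.generate_subgroup_incl)
    show "?ind ` P0 G n s \<subseteq> generate (add_monoid ?F) (Irr G)"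
    proof (rule image_subsetI)
      fix I assume "I \<in> P0 G n s"
      then obtain d \<rho> where "representation G d \<rho>" "rep_character G d \<rho> = ?ind I" using induced_character by blast
      then show "?ind I \<in> generate (add_monoid ?F) (Irr G)" using character_in_Irr_span[OF is_group] by metis
    qed
    show "subgroup (generate (add_monoid ?F) (Irr G)) (add_monoid ?F)"
      by (rule F.add.generate_is_subgroup) (use IrrF in simp)
  qed
  ultimately show ?thesis by (simp add: virtual_character_ring_def)
qed

lemma Th_unique: assumes "comb c = comb d" shows "Th c = Th d"
proof -
  have "(\<Sum>I\<in>P0 G n s. (c I - d I) * x_elem G n s I w) = 0" for w
    using fun_cong[OF assms, of w] by (simp add: comb_def left_diff_distrib sum_subtractf)
  then have "c I - d I = 0" if "I \<in> P0 G n s" for I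
    by (rule x_independentD[of "%I. c I - d I"]) (rule that)
  then have "c I = d I" if "I \<in> P0 G n s" for I using that by simp
  then show ?thesis by (simp add: Th_def fun_eq_iff)
qed

lemma comb_zero: "comb (%_. 0) = (%_. 0)" and Th_zero: "Th (%_. 0) = (%_. 0)"
  by (simp_all add: comb_def Th_def fun_eq_iff)

lemma comb_uminus: "comb (%I. - c I) = (%w. - comb c w)" and Th_uminus: "Th (%I. - c I) = (%w. - Th c w)"
  by (simp_all add: comb_def Th_def fun_eq_iff sum_negf)

lemma Sigma_subring: "subring (Sigma_ext G n s) (int_group_ring G)"
proof -
  interpret R: ring "int_group_ring G" by (rule ring_group_ring)
  show ?thesis
    unfolding Sigma_eq
  proof (rule R.subringI)
    show "range comb \<subseteq> carrier (int_group_ring G)" using comb_carrier by blast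
    obtain c where c: "comb c = (%w. if w = \<one> then 1 else 0)" using one_comb by blast
    show "\<one>\<^bsub>int_group_ring G\<^esub> \<in> range comb" unfolding group_ring_simps(3) c[symmetric] by (rule rangeI)
    fix h assume "h \<in> range comb"
    then obtain c where c: "h = comb c" by blast
    have "\<ominus>\<^bsub>int_group_ring G\<^esub> h = comb (%I. - c I)" unfolding c by (simp only: group_ring_minus[OF comb_carrier] comb_uminus)
    then show "\<ominus>\<^bsub>int_group_ring G\<^esub> h \<in> range comb" by blast
    fix h' assume "h' \<in> range comb"
    then obtain d where d: "h' = comb d" by blast
    have "h \<oplus>\<^bsub>int_group_ring G\<^esub> h' = comb (%I. c I + d I)" unfolding c d by (simp add: comb_add)
    then show "h \<oplus>\<^bsub>int_group_ring G\<^esub> h' \<in> range comb" by blast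
    obtain e where "conv (comb c) (comb d) = comb e" using comb_mult by blast
    then show "h \<otimes>\<^bsub>int_group_ring G\<^esub> h' \<in> range comb"
      unfolding c d group_ring_mult[OF comb_carrier comb_carrier] by blast
  qed
qed

abbreviation sends_x_to_induced :: "(('a => int) => 'a => complex) => bool" where
  "sends_x_to_induced \<theta> \<equiv> \<theta> \<in> hom (add_monoid (Sigma_ring G n s)) (add_monoid (virtual_character_ring G)) \<and>
     (\<forall>I\<in>P0 G n s. \<theta> (x_elem G n s I) = induced G (generate G I) (%_. 1))"

lemma virtual_character_ring_simps:
  "zero (virtual_character_ring G) = (%w. 0)" "add (virtual_character_ring G) f g = (%w. f w + g w)"
  "f \<otimes>\<^bsub>virtual_character_ring G\<^esub> g = (%w. f w * g w)"
  "one (virtual_character_ring G) = (%x. if x \<in> carrier G then 1 else 0)"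
  by (simp_all add: virtual_character_ring_def)

lemma morphism_exists: "\<exists>\<theta>. sends_x_to_induced \<theta>"
proof -
  define \<theta> where "\<theta> u = Th (SOME c. u = comb c)" for u
  have t: "\<theta> (comb c) = Th c" for c
  proof -
    have "comb c = comb (SOME d. comb c = comb d)" by (rule someI[of _ c]) (rule HOL.refl)
    then show ?thesis unfolding \<theta>_def by (rule Th_unique[symmetric])
  qed
  have "\<theta> \<in> hom (add_monoid (Sigma_ring G n s)) (add_monoid (virtual_character_ring G))"
  proof (rule homI)
    fix u assume "u \<in> carrier (add_monoid (Sigma_ring G n s))"
    then obtain c where c: "u = comb c" by (auto simp: Sigma_eq)
    show "\<theta> u \<in> carrier (add_monoid (virtual_character_ring G))" by (simp add: virtual_characters_eq c t)
    fix v assume "v \<in> carrier (add_monoid (Sigma_ring G n s))"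
    then obtain d where d: "v = comb d" by (auto simp: Sigma_eq)
    have "u \<otimes>\<^bsub>add_monoid (Sigma_ring G n s)\<^esub> v = comb (%I. c I + d I)" by (simp add: c d comb_add)
    then show "\<theta> (u \<otimes>\<^bsub>add_monoid (Sigma_ring G n s)\<^esub> v) = \<theta> u \<otimes>\<^bsub>add_monoid (virtual_character_ring G)\<^esub> \<theta> v"
      by (simp add: t c d Th_add virtual_character_ring_simps)
  qed
  moreover have "\<theta> (x_elem G n s I) = induced G (generate G I) (%_. 1)" if "I \<in> P0 G n s" for I
    using t[of "dlt I"] comb_dlt[OF that] Th_dlt[OF that] by simp
  ultimately show ?thesis by blast
qed

text \<open>A homomorphism of additive groups is determined by its values on the \<open>x\<^sub>I\<close>.\<close>

lemma morphism_comb: assumes t: "sends_x_to_induced \<theta>" shows "\<theta> (comb c) = Th c"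
proof -
  interpret R: ring "int_group_ring G" by (rule ring_group_ring)
  let ?A = "add_monoid (int_group_ring G)"
  have Sc: "Sigma_ext G n s \<subseteq> carrier (int_group_ring G)" using comb_carrier by (auto simp: Sigma_eq)
  have add: "\<theta> (comb a \<oplus>\<^bsub>int_group_ring G\<^esub> comb b) = (%w. \<theta> (comb a) w + \<theta> (comb b) w)" for a b
    using hom_mult[of \<theta> "add_monoid (Sigma_ring G n s)" "add_monoid (virtual_character_ring G)" "comb a" "comb b"] t
    by (simp add: Sigma_eq virtual_character_ring_simps)
  have addc: "comb a \<oplus>\<^bsub>int_group_ring G\<^esub> comb b = comb (%I. a I + b I)" for a b by (simp add: comb_add)
  have zero: "\<theta> (comb (%_. 0)) = (%w. 0)" using add[of "%_. 0" "%_. 0", unfolded addc] by (auto simp: fun_eq_iff)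
  have "\<exists>a. u = comb a \<and> \<theta> u = Th a" if "u \<in> generate ?A (x_elem G n s ` P0 G n s)" for u
    using that
  proof induction
    case one
    have "\<one>\<^bsub>?A\<^esub> = comb (%_. 0)" by (simp add: comb_zero)
    then show ?case using zero Th_zero by metis
  next
    case (incl h)
    then obtain I where I: "I \<in> P0 G n s" "h = x_elem G n s I" by blast
    then show ?case using t comb_dlt[OF I(1)] Th_dlt[OF I(1)] by metis
  next
    case (inv h)
    then obtain I where I: "I \<in> P0 G n s" "h = x_elem G n s I" by blast
    let ?c = "%J. - dlt I J"
    have "inv\<^bsub>?A\<^esub> h = comb ?c"
      using group_ring_minus[OF comb_carrier, of "dlt I"] unfolding I(2) comb_dlt[OF I(1)] comb_uminus a_inv_def .
    moreover have "\<theta> (comb ?c) = Th ?c"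
    proof
      fix w
      have "(%J. dlt I J + ?c J) = (%_. 0)" by simp
      then have "\<theta> (comb (dlt I)) w + \<theta> (comb ?c) w = 0"
        using fun_cong[OF add[of "dlt I" ?c, unfolded addc], of w] zero by simp
      moreover have "\<theta> (comb (dlt I)) = Th (dlt I)" using t I(1) comb_dlt[OF I(1)] Th_dlt[OF I(1)] by simp
      ultimately show "\<theta> (comb ?c) w = Th ?c w" by (simp add: Th_uminus eq_neg_iff_add_eq_0 add.commute)
    qed
    ultimately show ?case by metis
  next
    case (eng h1 h2)
    then obtain a b where ab: "h1 = comb a" "\<theta> h1 = Th a" "h2 = comb b" "\<theta> h2 = Th b" by blast
    have e: "h1 \<otimes>\<^bsub>?A\<^esub> h2 = comb (%I. a I + b I)" by (simp add: ab comb_add)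
    have "\<theta> (comb (%I. a I + b I)) = Th (%I. a I + b I)"
      using add[of a b, unfolded addc] ab by (simp add: Th_add)
    then show ?case using e by metis
  qed
  moreover have "comb c \<in> generate ?A (x_elem G n s ` P0 G n s)"
    using Sigma_eq unfolding Sigma_ext_def by blast
  ultimately obtain a where "comb c = comb a" "\<theta> (comb c) = Th a" by blast
  then show ?thesis using Th_unique by metis
qed

lemma morphism_ring_hom:
  assumes t: "sends_x_to_induced \<theta>"
  shows "\<theta> \<in> Ring.ring_hom (Sigma_ring G n s) (virtual_character_ring G)"
proof (rule ring_hom_memI)
  fix u assume "u \<in> carrier (Sigma_ring G n s)"
  then obtain c where c: "u = comb c" by (auto simp: Sigma_eq)
  show "\<theta> u \<in> carrier (virtual_character_ring G)" by (simp add: virtual_characters_eq c morphism_comb[OF t])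
  fix v assume "v \<in> carrier (Sigma_ring G n s)"
  then obtain d where d: "v = comb d" by (auto simp: Sigma_eq)
  obtain e where e: "conv (comb c) (comb d) = comb e" "Th e = (%g. Th c g * Th d g)" using comb_mult by blast
  have "u \<otimes>\<^bsub>Sigma_ring G n s\<^esub> v = comb e"
    unfolding c d e(1)[symmetric] using group_ring_mult[OF comb_carrier comb_carrier] by simp
  then show "\<theta> (u \<otimes>\<^bsub>Sigma_ring G n s\<^esub> v) = \<theta> u \<otimes>\<^bsub>virtual_character_ring G\<^esub> \<theta> v"
    by (simp add: morphism_comb[OF t] c d e(2) virtual_character_ring_simps)
  have "u \<oplus>\<^bsub>Sigma_ring G n s\<^esub> v = comb (%I. c I + d I)" by (simp add: c d comb_add)
  then show "\<theta> (u \<oplus>\<^bsub>Sigma_ring G n s\<^esub> v) = \<theta> u \<oplus>\<^bsub>virtual_character_ring G\<^esub> \<theta> v"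
    by (simp add: morphism_comb[OF t] c d Th_add virtual_character_ring_simps)
next
  obtain c where c: "comb c = (%w. if w = \<one> then 1 else 0)" "Th c = (%g. if g \<in> carrier G then 1 else 0)"
    using one_comb by blast
  have "\<one>\<^bsub>Sigma_ring G n s\<^esub> = comb c" by (simp add: c)
  then show "\<theta> \<one>\<^bsub>Sigma_ring G n s\<^esub> = \<one>\<^bsub>virtual_character_ring G\<^esub>"
    by (simp add: morphism_comb[OF t] c(2) virtual_character_ring_simps)
qed

lemma morphism_surjective:
  assumes t: "sends_x_to_induced \<theta>" shows "\<theta> ` Sigma_ext G n s = carrier (virtual_character_ring G)"
  unfolding Sigma_eq virtual_characters_eq image_image by (simp add: morphism_comb[OF t])

lemma morphism_kernel:
  assumes t: "sends_x_to_induced \<theta>"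
  shows "a_kernel (Sigma_ring G n s) (virtual_character_ring G) \<theta> = {comb c | c. Th c = (%_. 0)}"
  by (auto simp: a_kernel_def kernel_def Sigma_eq virtual_character_ring_simps morphism_comb[OF t])

lemma kernel_span:
  "{comb c | c. Th c = (%_. 0)} = int_span (int_group_ring G)
     {x_elem G n s I \<ominus>\<^bsub>int_group_ring G\<^esub> x_elem G n s I' | I I'.
        I \<in> P0 G n s \<and> I' \<in> P0 G n s \<and> conj_sets G I I'}" (is "?K = generate ?A ?D")
proof -
  interpret R: ring "int_group_ring G" by (rule ring_group_ring)
  let ?x = "x_elem G n s"
  have df: "?x I \<ominus>\<^bsub>int_group_ring G\<^esub> ?x J = (%w. ?x I w - ?x J w)" for I J
    by (simp add: a_minus_def group_ring_minus[OF x_carrier])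
  have Dc: "?D \<subseteq> carrier ?A" using x_carrier by auto
  have "generate ?A ?D \<subseteq> ?K"
  proof (rule R.add.generate_subgroup_incl)
    show "?D \<subseteq> ?K"
    proof
      fix u assume "u \<in> ?D"
      then obtain I J where IJ: "I \<in> P0 G n s" "J \<in> P0 G n s" "conj_sets G I J" "u = (%w. ?x I w - ?x J w)"
        unfolding df by blast
      have "I \<subseteq> carrier G" using IJ(1) by (auto simp: P0_def S_ext_def)
      then have "Th (%K. dlt I K - dlt J K) = (%_. 0)"
        using conj_sets_induced[OF _ IJ(3)] by (simp add: Th_diff Th_dlt IJ(1,2))
      moreover have "u = comb (%K. dlt I K - dlt J K)" by (simp add: comb_diff comb_dlt IJ)
      ultimately show "u \<in> ?K" by blast
    qed
    show "subgroup ?K ?A"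
    proof (rule R.add.subgroupI)
      show "?K \<subseteq> carrier (int_group_ring G)" using comb_carrier by blast
      show "?K ~= {}" using Th_zero by blast
      show "\<ominus>\<^bsub>int_group_ring G\<^esub> u \<in> ?K" if u: "u \<in> ?K" for u
      proof -
        obtain c where c: "u = comb c" "Th c = (%_. 0)" using u by blast
        have "\<ominus>\<^bsub>int_group_ring G\<^esub> u = comb (%I. - c I)" unfolding c by (simp only: group_ring_minus[OF comb_carrier] comb_uminus)
        moreover have "Th (%I. - c I) = (%_. 0)" by (simp add: Th_uminus c(2))
        ultimately show ?thesis by blast
      qed
      show "u \<oplus>\<^bsub>int_group_ring G\<^esub> v \<in> ?K" if u: "u \<in> ?K" and v: "v \<in> ?K" for u v
      proof -
        obtain c where c: "u = comb c" "Th c = (%_. 0)" using u by blast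
        obtain d where d: "v = comb d" "Th d = (%_. 0)" using v by blast
        have "u \<oplus>\<^bsub>int_group_ring G\<^esub> v = comb (%I. c I + d I)" by (simp add: c d comb_add)
        moreover have "Th (%I. c I + d I) = (%_. 0)" by (simp add: Th_add c(2) d(2))
        ultimately show ?thesis by blast
      qed
    qed
  qed
  moreover have "?K \<subseteq> generate ?A ?D"
  proof
    fix u assume "u \<in> ?K"
    then obtain c where c: "u = comb c" "Th c = (%_. 0)" by blast
    obtain r where r: "\<And>I. I \<in> P0 G n s ==> r I \<in> P0 G n s \<and> conj_sets G I (r I)"
      "comb c = (%w. \<Sum>I\<in>P0 G n s. c I * (?x I w - ?x (r I) w))"
      using kernel_as_differences[OF c(2)] by blast
    let ?y = "%I w. ?x I w - ?x (r I) w"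
    have "generate ?A (?y ` P0 G n s) = {(%w. \<Sum>I\<in>P0 G n s. of_int (k I) * ?y I w) | k. True}"
      by (rule int_span_eq[OF R.is_abelian_group]) (use x_carrier finite_P0 in \<open>auto simp: group_ring_carrier\<close>)
    then have "u \<in> generate ?A (?y ` P0 G n s)" unfolding c(1) r(2) by auto
    moreover have "?y ` P0 G n s \<subseteq> ?D" unfolding df using r(1) by blast
    then have "generate ?A (?y ` P0 G n s) \<subseteq> generate ?A ?D" by (rule R.add.mono_generate)
    ultimately show "u \<in> generate ?A ?D" by blast
  qed
  ultimately show ?thesis by blast
qed

section \<open>The radical\<close>

lemma RTh_add: "RTh (%I. q I + q' I) g = RTh q g + RTh q' g"
  by (simp add: RTh_def distrib_right sum.distrib)

lemma ratcomb_add: "ratcomb (%I. q I + q' I) = (%w. ratcomb q w + ratcomb q' w)"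
  by (simp add: ratcomb_def fun_eq_iff distrib_right sum.distrib)

lemma RTh_mult: "RTh (%I. t * q I) g = t * RTh q g"
  by (simp add: RTh_def sum_distrib_left mult.assoc)

lemma ratcomb_uminus: "ratcomb (%I. - q I) = (%w. - ratcomb q w)"
  by (simp add: ratcomb_def fun_eq_iff sum_negf)

lemma rat_Sigma_subring: "subring (range ratcomb) (rat_group_ring G)"
proof -
  interpret R: ring "rat_group_ring G" by (rule ring_group_ring)
  show ?thesis
  proof (rule R.subringI)
    show "range ratcomb \<subseteq> carrier (rat_group_ring G)" using ratcomb_carrier by blast
    obtain c where c: "ratcomb c = (%w. if w = \<one> then 1 else 0)" using one_ratcomb by blast
    show "\<one>\<^bsub>rat_group_ring G\<^esub> \<in> range ratcomb" unfolding group_ring_simps(3) c[symmetric] by (rule rangeI)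
    fix h assume "h \<in> range ratcomb"
    then obtain c where c: "h = ratcomb c" by blast
    have "\<ominus>\<^bsub>rat_group_ring G\<^esub> h = ratcomb (%I. - c I)"
      unfolding c by (simp only: group_ring_minus[OF ratcomb_carrier] ratcomb_uminus)
    then show "\<ominus>\<^bsub>rat_group_ring G\<^esub> h \<in> range ratcomb" by blast
    fix h' assume "h' \<in> range ratcomb"
    then obtain d where d: "h' = ratcomb d" by blast
    have "h \<oplus>\<^bsub>rat_group_ring G\<^esub> h' = ratcomb (%I. c I + d I)" unfolding c d by (simp add: ratcomb_add)
    then show "h \<oplus>\<^bsub>rat_group_ring G\<^esub> h' \<in> range ratcomb" by blast
    obtain e where "conv (ratcomb c) (ratcomb d) = ratcomb e" using ratcomb_mult by blast
    then show "h \<otimes>\<^bsub>rat_group_ring G\<^esub> h' \<in> range ratcomb"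
      unfolding c d group_ring_mult[OF ratcomb_carrier ratcomb_carrier] by blast
  qed
qed

lemma radical_eq: "jacobson_radical (rat_Sigma_ring G n s) = {ratcomb q | q. RTh q = (%_. 0)}"
proof -
  let ?B = "(rat_group_ring G)\<lparr>carrier := range ratcomb\<rparr>"
  interpret R: ring "rat_group_ring G" by (rule ring_group_ring)
  interpret B: ring ?B by (rule R.subring_is_ring[OF rat_Sigma_subring])
  have mult: "ratcomb q \<otimes>\<^bsub>?B\<^esub> ratcomb q' = conv (ratcomb q) (ratcomb q')" for q q'
    using group_ring_mult[OF ratcomb_carrier ratcomb_carrier] by simp
  have pow: "ratcomb q [^]\<^bsub>?B\<^esub> (k::nat) = cpow (ratcomb q) k" for q k
  proof (induction k)
    case 0 show ?case by simp
  next
    case (Suc k)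
    then have "ratcomb q [^]\<^bsub>?B\<^esub> Suc k = cpow (ratcomb q) k \<otimes>\<^bsub>rat_group_ring G\<^esub> ratcomb q" by simp
    then show ?case using group_ring_mult[OF cpow_carrier ratcomb_carrier] by simp
  qed
  have "jacobson_radical ?B = {ratcomb q | q. RTh q = (%_. 0)}"
  proof (intro equalityI subsetI)
    fix a assume "a \<in> {ratcomb q | q. RTh q = (%_. 0)}"
    then obtain q where q: "a = ratcomb q" "RTh q = (%_. 0)" by blast
    show "a \<in> jacobson_radical ?B"
    proof (rule B.nil_in_jacobson_radical)
      show "a \<in> carrier ?B" by (simp add: q(1))
      fix b assume "b \<in> carrier ?B"
      then obtain p where p: "b = ratcomb p" by auto
      obtain e where e: "conv (ratcomb p) (ratcomb q) = ratcomb e" "RTh e = (%g. RTh p g * RTh q g)"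
        using ratcomb_mult by blast
      have ba: "b \<otimes>\<^bsub>?B\<^esub> a = ratcomb e" unfolding p q(1) mult e(1) ..
      have "RTh e = (%_. 0)" using e(2) q(2) by simp
      then have "(b \<otimes>\<^bsub>?B\<^esub> a) [^]\<^bsub>?B\<^esub> card (carrier G) = \<zero>\<^bsub>?B\<^esub>"
        unfolding ba pow using kernel_nilpotent by simp
      then show "\<exists>N::nat. (b \<otimes>\<^bsub>?B\<^esub> a) [^]\<^bsub>?B\<^esub> N = \<zero>\<^bsub>?B\<^esub>" by blast
    qed
  next
    fix a assume a: "a \<in> jacobson_radical ?B"
    then obtain q where q: "a = ratcomb q" by (auto simp: jacobson_radical_def)
    have "RTh q g = 0" for g
    proof (cases "g \<in> carrier G")
      case False
      have "icoef I g = 0" if "I \<in> P0 G n s" for I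
        using icoef[OF that, of g] induced_out[OF False, of "generate G I"] by simp
      then show ?thesis by (simp add: RTh_def)
    next
      case True
      define \<phi> where "\<phi> u = RTh (SOME q. u = ratcomb q) g" for u
      have \<phi>: "\<phi> (ratcomb q) = RTh q g" for q
      proof -
        have "ratcomb q = ratcomb (SOME p. ratcomb q = ratcomb p)" by (rule someI[of _ q]) (rule HOL.refl)
        from fun_cong[OF ratcomb_unique[OF this], of g] show ?thesis by (simp add: \<phi>_def)
      qed
      obtain o1 where o1: "ratcomb o1 = (%w. if w = \<one> then 1 else 0)" "RTh o1 g = 1"
        using one_ratcomb True by metis
      have "maximal_left_ideal {u \<in> carrier ?B. \<phi> u = 0} ?B"
      proof (rule B.hom_to_field_kernel_maximal)
        fix u v assume "u \<in> carrier ?B" "v \<in> carrier ?B"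
        then obtain p p' where p: "u = ratcomb p" "v = ratcomb p'" by auto
        have "u \<oplus>\<^bsub>?B\<^esub> v = ratcomb (%I. p I + p' I)" by (simp add: p ratcomb_add)
        then show "\<phi> (u \<oplus>\<^bsub>?B\<^esub> v) = \<phi> u + \<phi> v" by (simp only: \<phi> p RTh_add)
        obtain e where e: "conv (ratcomb p) (ratcomb p') = ratcomb e" "RTh e = (%g. RTh p g * RTh p' g)"
          using ratcomb_mult by blast
        show "\<phi> (u \<otimes>\<^bsub>?B\<^esub> v) = \<phi> u * \<phi> v" unfolding p mult e(1) \<phi> e(2) ..
      next
        have "\<one>\<^bsub>?B\<^esub> = ratcomb o1" by (simp add: o1)
        then show "\<phi> \<one>\<^bsub>?B\<^esub> = 1" by (simp only: \<phi> o1(2))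
        fix t :: rat
        have "\<phi> (ratcomb (%I. t * o1 I)) = t" by (simp add: \<phi> RTh_mult o1(2))
        then show "\<exists>e\<in>carrier ?B. \<phi> e = t" by (intro bexI[of _ "ratcomb (%I. t * o1 I)"]) simp_all
      qed
      then have "\<phi> a = 0" using a unfolding jacobson_radical_def by blast
      then show ?thesis by (simp add: q \<phi>)
    qed
    then show "a \<in> {ratcomb q | q. RTh q = (%_. 0)}" using q by blast
  qed
  then show ?thesis by (simp only: rat_ext_Sigma)
qed

end

theorem mainTheorem1:
  fixes G :: "('a, 'm) monoid_scheme" and n :: nat and s :: "nat \<Rightarrow> 'a"
  assumes "n \<ge> 1"
    and "coxeter_system G {..<n} type_C s"
  shows "int_independent (x_elem G n s) (P0 G n s) \<and>
    subring (Sigma_ext G n s) (int_group_ring G) \<and>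
    (\<exists>\<theta> \<in> hom (add_monoid (Sigma_ring G n s)) (add_monoid (virtual_character_ring G)).
       \<forall>I \<in> P0 G n s. \<theta> (x_elem G n s I) = induced G (generate G I) (\<lambda>_. 1)) \<and>
    (\<forall>\<theta> \<in> hom (add_monoid (Sigma_ring G n s)) (add_monoid (virtual_character_ring G)).
       (\<forall>I \<in> P0 G n s. \<theta> (x_elem G n s I) = induced G (generate G I) (\<lambda>_. 1)) \<longrightarrow>
       \<theta> \<in> Ring.ring_hom (Sigma_ring G n s) (virtual_character_ring G) \<and>
       \<theta> ` Sigma_ext G n s = carrier (virtual_character_ring G) \<and>
       a_kernel (Sigma_ring G n s) (virtual_character_ring G) \<theta> =
         int_span (int_group_ring G)
           {x_elem G n s I \<ominus>\<^bsub>int_group_ring G\<^esub> x_elem G n s I' | I I'.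
              I \<in> P0 G n s \<and> I' \<in> P0 G n s \<and> conj_sets G I I'} \<and>
       rat_ext (a_kernel (Sigma_ring G n s) (virtual_character_ring G) \<theta>) =
         jacobson_radical (rat_Sigma_ring G n s))"
proof -
  interpret group G using assms(2) by (simp add: coxeter_system_def)
  interpret coxeter_C G n s by unfold_locales (rule assms(2))
  show ?thesis
  proof (intro conjI ballI impI)
    show "int_independent (x_elem G n s) (P0 G n s)" by (rule x_independent)
    show "subring (Sigma_ext G n s) (int_group_ring G)" by (rule Sigma_subring)
    show "\<exists>\<theta> \<in> hom (add_monoid (Sigma_ring G n s)) (add_monoid (virtual_character_ring G)).
       \<forall>I \<in> P0 G n s. \<theta> (x_elem G n s I) = induced G (generate G I) (\<lambda>_. 1)"
      using morphism_exists by blast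
    fix \<theta> assume "\<theta> \<in> hom (add_monoid (Sigma_ring G n s)) (add_monoid (virtual_character_ring G))"
      and "\<forall>I \<in> P0 G n s. \<theta> (x_elem G n s I) = induced G (generate G I) (\<lambda>_. 1)"
    then have t: "sends_x_to_induced \<theta>" by blast
    show "\<theta> \<in> Ring.ring_hom (Sigma_ring G n s) (virtual_character_ring G)" by (rule morphism_ring_hom[OF t])
    show "\<theta> ` Sigma_ext G n s = carrier (virtual_character_ring G)" by (rule morphism_surjective[OF t])
    show "a_kernel (Sigma_ring G n s) (virtual_character_ring G) \<theta> =
         int_span (int_group_ring G)
           {x_elem G n s I \<ominus>\<^bsub>int_group_ring G\<^esub> x_elem G n s I' | I I'.
              I \<in> P0 G n s \<and> I' \<in> P0 G n s \<and> conj_sets G I I'}"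
      unfolding morphism_kernel[OF t] by (rule kernel_span)
    show "rat_ext (a_kernel (Sigma_ring G n s) (virtual_character_ring G) \<theta>) = jacobson_radical (rat_Sigma_ring G n s)"
      unfolding morphism_kernel[OF t] radical_eq by (rule rat_ext_kernel)
  qed
qed

end
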